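(* Let $n\in\mathbb N$ and let $\tilde{H\Gamma}_n$ be the hypergraph with vertices $\{v_1,\dots,v_n\}$, a single edge $e_1$, and $r(e_1)=s(e_1)=\{v_1,\dots,v_n\}$. Then $C^*(\tilde{H\Gamma}_n)\cong C(S^1)*_{\mathbb C}\mathbb C^n$. In particular, $C^*(\tilde{H\Gamma}_n)$ is not nuclear, i.e. $\tilde{H\Gamma}_n$ is non-amenable, as soon as $n\ge 2$.
   Context: A (finite directed) hypergraph $H\Gamma=(V,E,r,s)$ consists of finite sets $V$ (vertices) and $E$ (edges) and maps $r,s:E\to\mathcal P(V)\setminus\{\emptyset\}$ (range and source), where $\mathcal P(V)$ is the power set. A vertex $v$ is a sink if $v\notin s(e)$ for all $e\in E$. The hypergraph $C^*$-algebra $C^*(H\Gamma)$ is the universal $C^*$-algebra generated by mutually orthogonal projections $p_v$ ($v\in V$) and partial isometries $s_e$ ($e\in E$) such that: (HR1) $s_e^*s_f=\delta_{ef}\sum_{v\in r(e)}p_v$ for all $e,f\in E$; (HR2a) $s_es_e^*\le\sum_{v\in s(e)}p_v$ for all $e\in E$; (HR2b) $p_v\le\sum_{e\in E,\,v\in s(e)}s_es_e^*$ for all $v\in V$ that are not sinks. A hypergraph is called amenable if its hypergraph $C^*$-algebra is nuclear. $C(S^1)*_{\mathbb C}\mathbb C^n$ denotes the unital full free product, i.e. the universal unital $C^*$-algebra generated by a unitary $u$ and $n$ projections $p_1,\dots,p_n$ with $\sum_{i=1}^np_i=1$. *)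

theory Defs
  imports Complex_Main "HOL-Algebra.Module"
begin

section \<open>Complex star-algebras and C*-algebras\<close>

text \<open>
  Algebras are built on the module records of HOL-Algebra, with scalars in the complex numbers.
  Algebras need not have a unit: the inherited record field \<open>one\<close> is subject to no axiom and
  carries information only for those algebras that are unital.
\<close>

definition complex_ring :: "complex ring" where
  "complex_ring = \<lparr>carrier = UNIV, mult = (*), one = 1, zero = 0, add = (+)\<rparr>"

record 'a star_alg = "(complex, 'a) module" +
  star :: "'a \<Rightarrow> 'a" ("(_\<^sup>\<star>\<index>)" [1000] 999)

record 'a normed_star_alg = "'a star_alg" +
  anorm :: "'a \<Rightarrow> real"

locale star_algebra = module complex_ring A for A (structure) +
  assumes mult_closed: "\<lbrakk>x \<in> carrier A; y \<in> carrier A\<rbrakk> \<Longrightarrow> x \<otimes>\<^bsub>A\<^esub> y \<in> carrier A"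
    and mult_assoc: "\<lbrakk>x \<in> carrier A; y \<in> carrier A; z \<in> carrier A\<rbrakk>
      \<Longrightarrow> (x \<otimes>\<^bsub>A\<^esub> y) \<otimes>\<^bsub>A\<^esub> z = x \<otimes>\<^bsub>A\<^esub> (y \<otimes>\<^bsub>A\<^esub> z)"
    and distrib_left: "\<lbrakk>x \<in> carrier A; y \<in> carrier A; z \<in> carrier A\<rbrakk>
      \<Longrightarrow> x \<otimes>\<^bsub>A\<^esub> (y \<oplus>\<^bsub>A\<^esub> z) = x \<otimes>\<^bsub>A\<^esub> y \<oplus>\<^bsub>A\<^esub> x \<otimes>\<^bsub>A\<^esub> z"
    and distrib_right: "\<lbrakk>x \<in> carrier A; y \<in> carrier A; z \<in> carrier A\<rbrakk>
      \<Longrightarrow> (x \<oplus>\<^bsub>A\<^esub> y) \<otimes>\<^bsub>A\<^esub> z = x \<otimes>\<^bsub>A\<^esub> z \<oplus>\<^bsub>A\<^esub> y \<otimes>\<^bsub>A\<^esub> z"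
    and smult_mult_left: "\<lbrakk>x \<in> carrier A; y \<in> carrier A\<rbrakk>
      \<Longrightarrow> (c \<odot>\<^bsub>A\<^esub> x) \<otimes>\<^bsub>A\<^esub> y = c \<odot>\<^bsub>A\<^esub> (x \<otimes>\<^bsub>A\<^esub> y)"
    and smult_mult_right: "\<lbrakk>x \<in> carrier A; y \<in> carrier A\<rbrakk>
      \<Longrightarrow> x \<otimes>\<^bsub>A\<^esub> (c \<odot>\<^bsub>A\<^esub> y) = c \<odot>\<^bsub>A\<^esub> (x \<otimes>\<^bsub>A\<^esub> y)"
    and star_closed: "x \<in> carrier A \<Longrightarrow> x\<^sup>\<star>\<^bsub>A\<^esub> \<in> carrier A"
    and star_star: "x \<in> carrier A \<Longrightarrow> (x\<^sup>\<star>\<^bsub>A\<^esub>)\<^sup>\<star>\<^bsub>A\<^esub> = x"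
    and star_add: "\<lbrakk>x \<in> carrier A; y \<in> carrier A\<rbrakk>
      \<Longrightarrow> (x \<oplus>\<^bsub>A\<^esub> y)\<^sup>\<star>\<^bsub>A\<^esub> = x\<^sup>\<star>\<^bsub>A\<^esub> \<oplus>\<^bsub>A\<^esub> y\<^sup>\<star>\<^bsub>A\<^esub>"
    and star_smult: "x \<in> carrier A \<Longrightarrow> (c \<odot>\<^bsub>A\<^esub> x)\<^sup>\<star>\<^bsub>A\<^esub> = cnj c \<odot>\<^bsub>A\<^esub> x\<^sup>\<star>\<^bsub>A\<^esub>"
    and star_mult: "\<lbrakk>x \<in> carrier A; y \<in> carrier A\<rbrakk>
      \<Longrightarrow> (x \<otimes>\<^bsub>A\<^esub> y)\<^sup>\<star>\<^bsub>A\<^esub> = y\<^sup>\<star>\<^bsub>A\<^esub> \<otimes>\<^bsub>A\<^esub> x\<^sup>\<star>\<^bsub>A\<^esub>"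

definition cstar_seminorm :: "('a, 'm) star_alg_scheme \<Rightarrow> ('a \<Rightarrow> real) \<Rightarrow> bool" where
  "cstar_seminorm A p \<longleftrightarrow>
     (\<forall>x\<in>carrier A. 0 \<le> p x) \<and>
     (\<forall>x\<in>carrier A. \<forall>c. p (c \<odot>\<^bsub>A\<^esub> x) = cmod c * p x) \<and>
     (\<forall>x\<in>carrier A. \<forall>y\<in>carrier A. p (x \<oplus>\<^bsub>A\<^esub> y) \<le> p x + p y) \<and>
     (\<forall>x\<in>carrier A. \<forall>y\<in>carrier A. p (x \<otimes>\<^bsub>A\<^esub> y) \<le> p x * p y) \<and>
     (\<forall>x\<in>carrier A. p (x\<^sup>\<star>\<^bsub>A\<^esub> \<otimes>\<^bsub>A\<^esub> x) = (p x)\<^sup>2)"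

definition cstar_norm :: "('a, 'm) star_alg_scheme \<Rightarrow> ('a \<Rightarrow> real) \<Rightarrow> bool" where
  "cstar_norm A p \<longleftrightarrow> cstar_seminorm A p \<and> (\<forall>x\<in>carrier A. p x = 0 \<longrightarrow> x = \<zero>\<^bsub>A\<^esub>)"

definition cauchy_seqs :: "('a, 'm) star_alg_scheme \<Rightarrow> ('a \<Rightarrow> real) \<Rightarrow> (nat \<Rightarrow> 'a) set" where
  "cauchy_seqs A p =
     {\<sigma>. (\<forall>n. \<sigma> n \<in> carrier A) \<and> (\<forall>\<epsilon>>0. \<exists>N. \<forall>m\<ge>N. \<forall>n\<ge>N. p (\<sigma> m \<ominus>\<^bsub>A\<^esub> \<sigma> n) < \<epsilon>)}"

definition cstar_algebra :: "'a normed_star_alg \<Rightarrow> bool" where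
  "cstar_algebra A \<longleftrightarrow> star_algebra A \<and> cstar_norm A (anorm A) \<and>
     (\<forall>\<sigma>\<in>cauchy_seqs A (anorm A). \<exists>x\<in>carrier A. (\<lambda>n. anorm A (\<sigma> n \<ominus>\<^bsub>A\<^esub> x)) \<longlonglongrightarrow> 0)"

definition star_isomorphic ::
    "('a, 'm) star_alg_scheme \<Rightarrow> ('b, 'k) star_alg_scheme \<Rightarrow> bool" (infix "\<cong>\<^sup>\<star>" 50) where
  "A \<cong>\<^sup>\<star> B \<longleftrightarrow> (\<exists>\<phi>. bij_betw \<phi> (carrier A) (carrier B) \<and>
     (\<forall>x\<in>carrier A. \<forall>y\<in>carrier A. \<phi> (x \<oplus>\<^bsub>A\<^esub> y) = \<phi> x \<oplus>\<^bsub>B\<^esub> \<phi> y) \<and>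
     (\<forall>x\<in>carrier A. \<forall>c. \<phi> (c \<odot>\<^bsub>A\<^esub> x) = c \<odot>\<^bsub>B\<^esub> \<phi> x) \<and>
     (\<forall>x\<in>carrier A. \<forall>y\<in>carrier A. \<phi> (x \<otimes>\<^bsub>A\<^esub> y) = \<phi> x \<otimes>\<^bsub>B\<^esub> \<phi> y) \<and>
     (\<forall>x\<in>carrier A. \<phi> (x\<^sup>\<star>\<^bsub>A\<^esub>) = (\<phi> x)\<^sup>\<star>\<^bsub>B\<^esub>))"

definition projection :: "('a, 'm) star_alg_scheme \<Rightarrow> 'a \<Rightarrow> bool" where
  "projection A p \<longleftrightarrow> p \<in> carrier A \<and> p\<^sup>\<star>\<^bsub>A\<^esub> = p \<and> p \<otimes>\<^bsub>A\<^esub> p = p"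

definition partial_isometry :: "('a, 'm) star_alg_scheme \<Rightarrow> 'a \<Rightarrow> bool" where
  "partial_isometry A s \<longleftrightarrow> s \<in> carrier A \<and> s \<otimes>\<^bsub>A\<^esub> s\<^sup>\<star>\<^bsub>A\<^esub> \<otimes>\<^bsub>A\<^esub> s = s"

text \<open>Only meaningful for unital algebras, with unit \<open>\<one>\<^bsub>A\<^esub>\<close>.\<close>

definition unitary :: "('a, 'm) star_alg_scheme \<Rightarrow> 'a \<Rightarrow> bool" where
  "unitary A u \<longleftrightarrow> u \<in> carrier A \<and> u\<^sup>\<star>\<^bsub>A\<^esub> \<otimes>\<^bsub>A\<^esub> u = \<one>\<^bsub>A\<^esub> \<and> u \<otimes>\<^bsub>A\<^esub> u\<^sup>\<star>\<^bsub>A\<^esub> = \<one>\<^bsub>A\<^esub>"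

text \<open>The order of a C*-algebra: the positive elements are those of the form \<open>c\<^sup>\<star> c\<close>.\<close>

definition cstar_le :: "('a, 'm) star_alg_scheme \<Rightarrow> 'a \<Rightarrow> 'a \<Rightarrow> bool" where
  "cstar_le A a b \<longleftrightarrow> (\<exists>c\<in>carrier A. b \<ominus>\<^bsub>A\<^esub> a = c\<^sup>\<star>\<^bsub>A\<^esub> \<otimes>\<^bsub>A\<^esub> c)"


section \<open>Constructions\<close>

text \<open>
  The quotient of a star-algebra by a congruence relation \<open>r\<close> on its carrier.  The operations are
  lifted in the style of \<^theory>\<open>HOL.Equiv_Relations\<close>.
\<close>

definition quotient_star_alg :: "('a, 'm) star_alg_scheme \<Rightarrow> ('a \<times> 'a) set \<Rightarrow> 'a set star_alg" where
  "quotient_star_alg A r =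
     \<lparr>carrier = carrier A // r,
      mult = (\<lambda>X Y. \<Union>x\<in>X. \<Union>y\<in>Y. r `` {x \<otimes>\<^bsub>A\<^esub> y}),
      one = r `` {\<one>\<^bsub>A\<^esub>},
      zero = r `` {\<zero>\<^bsub>A\<^esub>},
      add = (\<lambda>X Y. \<Union>x\<in>X. \<Union>y\<in>Y. r `` {x \<oplus>\<^bsub>A\<^esub> y}),
      smult = (\<lambda>c X. \<Union>x\<in>X. r `` {c \<odot>\<^bsub>A\<^esub> x}),
      star = (\<lambda>X. \<Union>x\<in>X. r `` {x\<^sup>\<star>\<^bsub>A\<^esub>})\<rparr>"

text \<open>
  The Hausdorff completion of a star-algebra \<open>A\<close> with respect to a C*-seminorm \<open>p\<close>: Cauchy
  sequences modulo null sequences.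
\<close>

definition cauchy_alg :: "('a, 'm) star_alg_scheme \<Rightarrow> ('a \<Rightarrow> real) \<Rightarrow> (nat \<Rightarrow> 'a) star_alg" where
  "cauchy_alg A p =
     \<lparr>carrier = cauchy_seqs A p,
      mult = (\<lambda>\<sigma> \<tau> n. \<sigma> n \<otimes>\<^bsub>A\<^esub> \<tau> n),
      one = (\<lambda>n. \<one>\<^bsub>A\<^esub>),
      zero = (\<lambda>n. \<zero>\<^bsub>A\<^esub>),
      add = (\<lambda>\<sigma> \<tau> n. \<sigma> n \<oplus>\<^bsub>A\<^esub> \<tau> n),
      smult = (\<lambda>c \<sigma> n. c \<odot>\<^bsub>A\<^esub> \<sigma> n),
      star = (\<lambda>\<sigma> n. (\<sigma> n)\<^sup>\<star>\<^bsub>A\<^esub>)\<rparr>"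

definition null_rel ::
    "('a, 'm) star_alg_scheme \<Rightarrow> ('a \<Rightarrow> real) \<Rightarrow> ((nat \<Rightarrow> 'a) \<times> (nat \<Rightarrow> 'a)) set" where
  "null_rel A p = {(\<sigma>, \<tau>). \<sigma> \<in> cauchy_seqs A p \<and> \<tau> \<in> cauchy_seqs A p \<and>
     (\<lambda>n. p (\<sigma> n \<ominus>\<^bsub>A\<^esub> \<tau> n)) \<longlonglongrightarrow> 0}"

definition completion ::
    "('a, 'm) star_alg_scheme \<Rightarrow> ('a \<Rightarrow> real) \<Rightarrow> (nat \<Rightarrow> 'a) set normed_star_alg" where
  "completion A p = star_alg.extend (quotient_star_alg (cauchy_alg A p) (null_rel A p))
     (normed_star_alg.fields (\<lambda>X. THE l. \<forall>\<sigma>\<in>X. (\<lambda>n. p (\<sigma> n)) \<longlonglongrightarrow> l))"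

definition to_completion ::
    "('a, 'm) star_alg_scheme \<Rightarrow> ('a \<Rightarrow> real) \<Rightarrow> 'a \<Rightarrow> (nat \<Rightarrow> 'a) set" where
  "to_completion A p x = null_rel A p `` {\<lambda>n. x}"

text \<open>
  The star-algebra of a semigroup \<open>S\<close> with involution \<open>i\<close>: finitely supported functions on \<open>S\<close>
  with convolution, and \<open>(\<Sum> f s \<cdot> s)\<^sup>\<star> = \<Sum> cnj (f s) \<cdot> i s\<close>.
\<close>

definition single :: "'s \<Rightarrow> 's \<Rightarrow> complex" where
  "single s = (\<lambda>t. if t = s then 1 else 0)"

definition semigroup_star_alg ::
    "('s, 'm) monoid_scheme \<Rightarrow> ('s \<Rightarrow> 's) \<Rightarrow> ('s \<Rightarrow> complex) star_alg" where
  "semigroup_star_alg S i =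
     \<lparr>carrier = {f. finite {s. f s \<noteq> 0} \<and> {s. f s \<noteq> 0} \<subseteq> carrier S},
      mult = (\<lambda>f g z. \<Sum>(s, t) | f s \<noteq> 0 \<and> g t \<noteq> 0 \<and> s \<otimes>\<^bsub>S\<^esub> t = z. f s * g t),
      one = single \<one>\<^bsub>S\<^esub>,
      zero = (\<lambda>s. 0),
      add = (\<lambda>f g s. f s + g s),
      smult = (\<lambda>c f s. c * f s),
      star = (\<lambda>f t. \<Sum>s | f s \<noteq> 0 \<and> i s = t. cnj (f s))\<rparr>"


section \<open>Universal C*-algebras\<close>

text \<open>
  A word is a list of letters \<open>(g, b)\<close>, which stand for \<open>g\<close> if \<open>b = False\<close> and for \<open>g\<^sup>\<star>\<close> if
  \<open>b = True\<close>.  Non-unital star-polynomials have no constant term, that is, the empty word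
  does not occur in them.
\<close>

type_synonym 'g word = "('g \<times> bool) list"

definition word_star :: "'g word \<Rightarrow> 'g word" where
  "word_star w = rev (map (\<lambda>(g, b). (g, \<not> b)) w)"

definition free_star_alg :: "'g set \<Rightarrow> ('g word \<Rightarrow> complex) star_alg" where
  "free_star_alg G =
     semigroup_star_alg \<lparr>carrier = lists (G \<times> UNIV) - {[]}, mult = (@), one = []\<rparr> word_star"

definition free_unital_star_alg :: "'g set \<Rightarrow> ('g word \<Rightarrow> complex) star_alg" where
  "free_unital_star_alg G =
     semigroup_star_alg \<lparr>carrier = lists (G \<times> UNIV), mult = (@), one = []\<rparr> word_star"

definition gen :: "'g \<Rightarrow> 'g word \<Rightarrow> complex" where
  "gen g = single [(g, False)]"

text \<open>
  Relations are given as a predicate \<open>R\<close> on a C*-algebra and a family of elements in it, so that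
  they may involve the order.  A C*-seminorm on the free star-algebra is admissible if the
  canonical generators of the C*-algebra obtained by completion satisfy the relations.  The
  universal C*-algebra is the completion in the supremum of all admissible C*-seminorms.  As
  always, this presupposes that the supremum is finite.
\<close>

type_synonym 'g presented_cstar_alg = "(nat \<Rightarrow> 'g word \<Rightarrow> complex) set normed_star_alg"

type_synonym 'g relations =
  "'g presented_cstar_alg \<Rightarrow> ('g \<Rightarrow> (nat \<Rightarrow> 'g word \<Rightarrow> complex) set) \<Rightarrow> bool"

definition admissible_seminorms ::
    "('g word \<Rightarrow> complex) star_alg \<Rightarrow> 'g relations \<Rightarrow> (('g word \<Rightarrow> complex) \<Rightarrow> real) set" where
  "admissible_seminorms F R =
     {p. cstar_seminorm F p \<and> R (completion F p) (\<lambda>g. to_completion F p (gen g))}"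

definition universal_completion ::
    "('g word \<Rightarrow> complex) star_alg \<Rightarrow> 'g relations \<Rightarrow> 'g presented_cstar_alg" where
  "universal_completion F R = completion F (\<lambda>f. SUP p\<in>admissible_seminorms F R. p f)"

definition universal_cstar_alg :: "'g set \<Rightarrow> 'g relations \<Rightarrow> 'g presented_cstar_alg" where
  "universal_cstar_alg G R = universal_completion (free_star_alg G) R"

definition universal_unital_cstar_alg :: "'g set \<Rightarrow> 'g relations \<Rightarrow> 'g presented_cstar_alg" where
  "universal_unital_cstar_alg G R = universal_completion (free_unital_star_alg G) R"


section \<open>Nuclearity\<close>

text \<open>
  The algebraic tensor product of \<open>A\<close> and \<open>B\<close> is the free vector space on pairs, with
  multiplication and involution acting componentwise on pairs, modulo the bilinearity relations.
\<close>

definition free_tensor_alg ::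
    "('a, 'm) star_alg_scheme \<Rightarrow> ('b, 'k) star_alg_scheme \<Rightarrow> ('a \<times> 'b \<Rightarrow> complex) star_alg" where
  "free_tensor_alg A B = semigroup_star_alg (A \<times>\<times> B) (map_prod (star A) (star B))"

inductive_set bilinear_relators ::
    "('a, 'm) star_alg_scheme \<Rightarrow> ('b, 'k) star_alg_scheme \<Rightarrow> ('a \<times> 'b \<Rightarrow> complex) set"
  for A :: "('a, 'm) star_alg_scheme" and B :: "('b, 'k) star_alg_scheme" where
  zero: "(\<lambda>t. 0) \<in> bilinear_relators A B"
| add: "\<lbrakk>f \<in> bilinear_relators A B; g \<in> bilinear_relators A B\<rbrakk>
    \<Longrightarrow> (\<lambda>t. f t + g t) \<in> bilinear_relators A B"
| smult: "f \<in> bilinear_relators A B \<Longrightarrow> (\<lambda>t. c * f t) \<in> bilinear_relators A B"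
| add_left: "\<lbrakk>a \<in> carrier A; a' \<in> carrier A; b \<in> carrier B\<rbrakk>
    \<Longrightarrow> (\<lambda>t. single (a \<oplus>\<^bsub>A\<^esub> a', b) t - (single (a, b) t + single (a', b) t))
      \<in> bilinear_relators A B"
| add_right: "\<lbrakk>a \<in> carrier A; b \<in> carrier B; b' \<in> carrier B\<rbrakk>
    \<Longrightarrow> (\<lambda>t. single (a, b \<oplus>\<^bsub>B\<^esub> b') t - (single (a, b) t + single (a, b') t))
      \<in> bilinear_relators A B"
| smult_left: "\<lbrakk>a \<in> carrier A; b \<in> carrier B\<rbrakk>
    \<Longrightarrow> (\<lambda>t. single (c \<odot>\<^bsub>A\<^esub> a, b) t - c * single (a, b) t) \<in> bilinear_relators A B"
| smult_right: "\<lbrakk>a \<in> carrier A; b \<in> carrier B\<rbrakk>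
    \<Longrightarrow> (\<lambda>t. single (a, c \<odot>\<^bsub>B\<^esub> b) t - c * single (a, b) t) \<in> bilinear_relators A B"

definition algebraic_tensor ::
    "('a, 'm) star_alg_scheme \<Rightarrow> ('b, 'k) star_alg_scheme \<Rightarrow> ('a \<times> 'b \<Rightarrow> complex) set star_alg" where
  "algebraic_tensor A B = quotient_star_alg (free_tensor_alg A B)
     {(f, g). f \<in> carrier (free_tensor_alg A B) \<and> g \<in> carrier (free_tensor_alg A B) \<and>
        (\<lambda>t. f t - g t) \<in> bilinear_relators A B}"

text \<open>
  A C*-algebra \<open>A\<close> is nuclear if for every C*-algebra \<open>B\<close> the algebraic tensor product of \<open>A\<close> and
  \<open>B\<close> has exactly one C*-norm.  Existence is automatic (the spatial norm).  For uniqueness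
  one may restrict to separable \<open>B\<close>, because two C*-norms that differ at an element
  \<open>\<Sum> a\<^sub>i \<otimes> b\<^sub>i\<close> already differ on the tensor product of \<open>A\<close> with the C*-subalgebra generated by
  the finitely many \<open>b\<^sub>i\<close>.  A separable C*-algebra has at most the cardinality of the continuum
  and so is isomorphic to one with carrier in the type \<open>nat \<Rightarrow> complex\<close>; hence
  it suffices to let \<open>B\<close> range over the C*-algebras in this type.
\<close>

definition nuclear :: "'a normed_star_alg \<Rightarrow> bool" where
  "nuclear A \<longleftrightarrow> (\<forall>B :: (nat \<Rightarrow> complex) normed_star_alg. cstar_algebra B \<longrightarrow>
     (\<forall>\<gamma> \<gamma>'. cstar_norm (algebraic_tensor A B) \<gamma> \<and> cstar_norm (algebraic_tensor A B) \<gamma>' \<longrightarrow>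
        (\<forall>t\<in>carrier (algebraic_tensor A B). \<gamma> t = \<gamma>' t)))"


section \<open>Hypergraph C*-algebras\<close>

record ('v, 'e) hypergraph =
  verts :: "'v set"
  edges :: "'e set"
  rng :: "'e \<Rightarrow> 'v set"
  src :: "'e \<Rightarrow> 'v set"

definition finite_hypergraph :: "('v, 'e) hypergraph \<Rightarrow> bool" where
  "finite_hypergraph H \<longleftrightarrow> finite (verts H) \<and> finite (edges H) \<and>
     (\<forall>e\<in>edges H. rng H e \<subseteq> verts H \<and> rng H e \<noteq> {} \<and> src H e \<subseteq> verts H \<and> src H e \<noteq> {})"

definition sink :: "('v, 'e) hypergraph \<Rightarrow> 'v \<Rightarrow> bool" where
  "sink H v \<longleftrightarrow> v \<in> verts H \<and> (\<forall>e\<in>edges H. v \<notin> src H e)"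

datatype ('v, 'e) hypergraph_gen = Vertex 'v | Edge 'e

definition hypergraph_gens :: "('v, 'e) hypergraph \<Rightarrow> ('v, 'e) hypergraph_gen set" where
  "hypergraph_gens H = Vertex ` verts H \<union> Edge ` edges H"

definition hypergraph_family ::
    "('v, 'e) hypergraph \<Rightarrow> 'a normed_star_alg \<Rightarrow> (('v, 'e) hypergraph_gen \<Rightarrow> 'a) \<Rightarrow> bool" where
  "hypergraph_family H A x \<longleftrightarrow> (let p = (\<lambda>v. x (Vertex v)); s = (\<lambda>e. x (Edge e)) in
     (\<forall>v\<in>verts H. projection A (p v)) \<and>
     (\<forall>v\<in>verts H. \<forall>w\<in>verts H. v \<noteq> w \<longrightarrow> p v \<otimes>\<^bsub>A\<^esub> p w = \<zero>\<^bsub>A\<^esub>) \<and>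
     (\<forall>e\<in>edges H. partial_isometry A (s e)) \<and>
     (\<forall>e\<in>edges H. \<forall>f\<in>edges H.
        (s e)\<^sup>\<star>\<^bsub>A\<^esub> \<otimes>\<^bsub>A\<^esub> s f = (if e = f then \<Oplus>\<^bsub>A\<^esub>v\<in>rng H e. p v else \<zero>\<^bsub>A\<^esub>)) \<and>
     (\<forall>e\<in>edges H. cstar_le A (s e \<otimes>\<^bsub>A\<^esub> (s e)\<^sup>\<star>\<^bsub>A\<^esub>) (\<Oplus>\<^bsub>A\<^esub>v\<in>src H e. p v)) \<and>
     (\<forall>v\<in>verts H. \<not> sink H v \<longrightarrow>
        cstar_le A (p v) (\<Oplus>\<^bsub>A\<^esub>e\<in>{e \<in> edges H. v \<in> src H e}. s e \<otimes>\<^bsub>A\<^esub> (s e)\<^sup>\<star>\<^bsub>A\<^esub>)))"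

definition hypergraph_cstar_alg ::
    "('v, 'e) hypergraph \<Rightarrow> ('v, 'e) hypergraph_gen presented_cstar_alg" where
  "hypergraph_cstar_alg H = universal_cstar_alg (hypergraph_gens H) (hypergraph_family H)"

definition amenable_hypergraph :: "('v, 'e) hypergraph \<Rightarrow> bool" where
  "amenable_hypergraph H \<longleftrightarrow> nuclear (hypergraph_cstar_alg H)"

definition full_loop_hypergraph :: "nat \<Rightarrow> (nat, nat) hypergraph" where
  "full_loop_hypergraph n =
     \<lparr>verts = {1..n}, edges = {1}, rng = (\<lambda>e. {1..n}), src = (\<lambda>e. {1..n})\<rparr>"

lemma finite_hypergraph_full_loop: "1 \<le> n \<Longrightarrow> finite_hypergraph (full_loop_hypergraph n)"
  by (simp add: finite_hypergraph_def full_loop_hypergraph_def)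


section \<open>The unital full free product of \<open>C(S\<^sup>1)\<close> and \<open>\<complex>\<^sup>n\<close>\<close>

datatype circle_gen = U | P nat

definition circle_family :: "nat \<Rightarrow> 'a normed_star_alg \<Rightarrow> (circle_gen \<Rightarrow> 'a) \<Rightarrow> bool" where
  "circle_family n A x \<longleftrightarrow>
     unitary A (x U) \<and> (\<forall>i\<in>{1..n}. projection A (x (P i))) \<and>
     (\<Oplus>\<^bsub>A\<^esub>i\<in>{1..n}. x (P i)) = \<one>\<^bsub>A\<^esub>"

definition circle_free_product :: "nat \<Rightarrow> circle_gen presented_cstar_alg" where
  "circle_free_product n =
     universal_unital_cstar_alg (insert U (P ` {1..n})) (circle_family n)"

end

theory Submission
  imports Defs "HOL-Library.Poly_Mapping" "HOL-Library.Countable"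
begin

text \<open>
  Put \<open>q = \<Sum> p\<^sub>v\<close>.  The relations of the hypergraph say that \<open>s\<close> is a unitary relative to \<open>q\<close>:
  (HR1) gives \<open>s\<^sup>* s = q\<close>, and (HR2a), (HR2b) give \<open>s s\<^sup>* \<le> q\<close> and \<open>p\<^sub>v \<le> s s\<^sup>*\<close>, hence \<open>s s\<^sup>* = q\<close>.  So
  \<open>q\<close> is a unit, and admissible C*-seminorms on the two free algebras correspond to each other.

  For \<open>n \<ge> 2\<close> the algebra contains the unitary \<open>s\<close> and the self-adjoint unitary \<open>v = 2 p\<^sub>1 - q\<close>.  Choose
  involutions \<open>t\<^sub>i\<close> of a set \<open>X\<close> and subsets \<open>X\<^sub>i\<close>, pairwise disjoint, such that \<open>t\<^sub>i\<close> exchanges \<open>X\<^sub>i\<close>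
  with its complement, and a permutation that conjugates \<open>t\<^sub>i\<close> to \<open>t\<^bsub>i+1\<^esub>\<close>.  Let \<open>B\<close> be the
  reduced C*-algebra generated by the \<open>t\<^sub>i\<close>, and \<open>x = \<Sum>\<^bsub>i<5\<^esub> s\<^sup>i v s\<^sup>*\<^sup>i \<otimes> t\<^sub>i\<close>.  Sending \<open>s\<^sup>i v s\<^sup>*\<^sup>i\<close> to \<open>t\<^sub>i\<close> and
  letting the two factors act on the group of permutations of \<open>X\<close> from the two sides gives a C*-seminorm
  equal to 5 at \<open>x\<close>.  In the product of any state with the regular trace on \<open>B\<close>, however, splitting
  the sum according to the \<open>X\<^sub>i\<close> bounds \<open>x\<close> by \<open>sqrt 20 < 5\<close>, as in Haagerup's inequality for free groups; the
  supremum of these seminorms is a C*-norm on the algebraic tensor product.  States are constructed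
  from the Hahn--Banach theorem applied to the one-sided derivative of the norm at the unit.
\<close>

section \<open>Hahn--Banach for sublinear functionals\<close>

text \<open>With N terms in place of five, the product seminorms of the test element are at most
  sqrt (4 N), whereas the two-sided action always gives N; five is the least N with sqrt (4 N) < N.
  The value N is reached because each involution, acting from the left and from the right at once,
  fixes the point mass at the identity permutation. The indices are integers, so that the
  conjugating permutation can be the translation of all list entries; it is the image of the edge
  generator. Two obstacles shape the rest. Nuclearity is tested on algebras with carrier in
  \<open>nat => complex\<close>; hence B is the completion of a free algebra with countably many
  words, embedded by countably many matrix coefficients. And the order relations, like the
  orthogonality of projections with sum one, call for positivity of \<open>c* c\<close> in an
  abstract C*-algebra, which is obtained from states defined by the norm alone. Hilbert spaces are
  never formed: a positive functional acts through its seminorm on the algebra itself, and forms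
  pass to completions as limits of finite Gram sums.\<close>

definition sublinear :: "('a::real_vector => real) => bool" where
  "sublinear p \<longleftrightarrow> (\<forall>x y. p (x + y) <= p x + p y) \<and> (\<forall>r\<ge>0. \<forall>x. p (r *\<^sub>R x) = r * p x)"

lemma sublinearD:
  assumes "sublinear p"
  shows "p (x + y) <= p x + p y" and "0 <= r ==> p (r *\<^sub>R x) = r * p x"
    and "p 0 = 0" and "- p (- x) <= p x"
proof -
  show a: "p (x + y) <= p x + p y" for x y using assms by (simp add: sublinear_def)
  show "0 <= r ==> p (r *\<^sub>R x) = r * p x" for r x using assms by (simp add: sublinear_def)
  from this[of 0 0] show z: "p 0 = 0" by simp
  show "- p (- x) <= p x" using a[of x "- x"] z by simp
qed

text \<open>By homogeneity, with s = 1 / t, this is the one-sided derivative of a sublinear p at y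
  in the direction x: the expression decreases in t, so infimum and limit agree.\<close>

definition directional :: "('a::real_vector => real) => 'a => 'a => real" where
  "directional p y x = (INF t\<in>{0..}. p (x + t *\<^sub>R y) - t * p y)"

text \<open>Parameters t1 for x1 and t2 for x2 add up to an admissible parameter for x1 + x2, whence
  subadditivity. The second conclusion at t = 1 gives \<open>q (- y) <= - p y\<close>, so that a
  linear functional below q must agree with p at y.\<close>

lemma sublinear_directional:
  fixes p :: "'a::real_vector => real"
  assumes p: "sublinear p" and q_eq: "q = directional p y"
  shows "sublinear q" and "!!x t. 0 <= t ==> q x <= p (x + t *\<^sub>R y) - t * p y" and "q <= p"
proof -
  note q_def = fun_cong[OF q_eq, unfolded directional_def]
  have lb: "- p (- x) <= p (x + t *\<^sub>R y) - t * p y" if "0 <= t" for x t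
  proof -
    have "t * p y = p ((x + t *\<^sub>R y) + (- x))" using that sublinearD(2)[OF p] by simp
    also have "... <= p (x + t *\<^sub>R y) + p (- x)" by (rule sublinearD(1)[OF p])
    finally show ?thesis by simp
  qed
  have bdd: "bdd_below ((%t. p (x + t *\<^sub>R y) - t * p y) ` {0..})" for x
    by (rule bdd_belowI2[of _ "- p (- x)"]) (use lb in auto)
  show le: "q x <= p (x + t *\<^sub>R y) - t * p y" if "0 <= t" for x t
    unfolding q_def by (rule cINF_lower[OF bdd]) (use that in auto)
  show "q <= p" using le[of 0] by (auto simp: le_fun_def)
  have ne: "{0::real..} ~= {}" by auto
  have great: "c <= q x" if "!!t. 0 <= t ==> c <= p (x + t *\<^sub>R y) - t * p y" for c x
    unfolding q_def by (rule cINF_greatest[OF ne]) (use that in auto)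
  have add: "q (x1 + x2) <= q x1 + q x2" for x1 x2
  proof -
    have "q (x1 + x2) - (p (x2 + t2 *\<^sub>R y) - t2 * p y) <= p (x1 + t1 *\<^sub>R y) - t1 * p y"
      if "0 <= t1" "0 <= t2" for t1 t2
    proof -
      have "q (x1 + x2) <= p ((x1 + x2) + (t1 + t2) *\<^sub>R y) - (t1 + t2) * p y"
        using le that by simp
      also have "(x1 + x2) + (t1 + t2) *\<^sub>R y = (x1 + t1 *\<^sub>R y) + (x2 + t2 *\<^sub>R y)"
        by (simp add: algebra_simps)
      also have "p ... <= p (x1 + t1 *\<^sub>R y) + p (x2 + t2 *\<^sub>R y)" by (rule sublinearD(1)[OF p])
      finally show ?thesis by (simp add: algebra_simps)
    qed
    then have "q (x1 + x2) - (p (x2 + t2 *\<^sub>R y) - t2 * p y) <= q x1" if "0 <= t2" for t2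
      using that by (intro great) auto
    then have "q (x1 + x2) - q x1 <= p (x2 + t2 *\<^sub>R y) - t2 * p y" if "0 <= t2" for t2
      using that by (smt (verit))
    then have "q (x1 + x2) - q x1 <= q x2"
      by (rule great)
    then show ?thesis by simp
  qed
  have scl: "q (r *\<^sub>R x) <= r * q x" if r: "0 < r" for r x
  proof -
    have "q (r *\<^sub>R x) / r <= p (x + t *\<^sub>R y) - t * p y" if "0 <= t" for t
    proof -
      have "q (r *\<^sub>R x) <= p (r *\<^sub>R x + (r * t) *\<^sub>R y) - (r * t) * p y"
        using le that r by simp
      also have "r *\<^sub>R x + (r * t) *\<^sub>R y = r *\<^sub>R (x + t *\<^sub>R y)" by (simp add: algebra_simps)
      also have "p ... = r * p (x + t *\<^sub>R y)" using r by (intro sublinearD(2)[OF p]) simp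
      finally show ?thesis using r by (simp add: field_simps)
    qed
    then have "q (r *\<^sub>R x) / r <= q x"
      by (rule great)
    then show ?thesis using r by (simp add: field_simps)
  qed
  have q0: "q 0 = 0"
  proof (rule antisym)
    show "q 0 <= 0" using le[of 0 0] sublinearD(3)[OF p] by simp
    show "0 <= q 0" unfolding q_def
      by (intro cINF_greatest[OF ne]) (use sublinearD(2)[OF p] in auto)
  qed
  have "q (r *\<^sub>R x) = r * q x" if "0 <= r" for r x
  proof (cases "r = 0")
    case True then show ?thesis by (simp add: q0)
  next
    case False
    with that have r: "0 < r" by simp
    have "q x <= inverse r * q (r *\<^sub>R x)" using scl[of "inverse r" "r *\<^sub>R x"] r by simp
    then show ?thesis using scl[OF r, of x] r by (simp add: field_simps)
  qed
  with add show "sublinear q" by (simp add: sublinear_def)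
qed

text \<open>A minimal sublinear functional is additive, because it equals its own directional
  regularisation; minimal ones exist by Zorn's lemma.\<close>

lemma sublinear_dominates_linear:
  assumes p: "sublinear (p :: 'a::real_vector => real)"
  shows "\<exists>f. linear f \<and> f <= p"
proof -
  define A where "A = {q. sublinear q \<and> q <= p}"
  have po: "partial_order_on A (relation_of (%q r. r <= q) A)"
    by (rule partial_order_on_relation_ofI) auto
  have "\<exists>m\<in>A. \<forall>a\<in>A. a <= m --> a = m"
  proof (rule predicate_Zorn[OF po])
    fix C assume C: "C : Chains (relation_of (%q r. r <= q) A)"
    then have CA: "C \<subseteq> A" and tot: "!!a b. a : C ==> b : C ==> a <= b \<or> b <= a"
      by (auto simp: Chains_def relation_of_def)
    show "\<exists>u\<in>A. \<forall>a\<in>C. u <= a"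
    proof (cases "C = {}")
      case True then show ?thesis using p by (auto simp: A_def)
    next
      case False
      define u where "u x = (INF q\<in>C. q x)" for x
      have sub: "sublinear q" and qp: "q x <= p x" if "q : C" for q x
        using that CA by (auto simp: A_def le_fun_def)
      have bdd: "bdd_below ((%q. q x) ` C)" for x
      proof (rule bdd_belowI2)
        fix q assume q: "q : C"
        show "- p (- x) <= q x"
          using sublinearD(4)[OF sub[OF q], of x] qp[OF q, of "- x"] by simp
      qed
      have low: "u x <= q x" if "q : C" for q x
        unfolding u_def by (rule cINF_lower[OF bdd that])
      have great: "c <= u x" if "!!q. q : C ==> c <= q x" for c x
        unfolding u_def by (rule cINF_greatest[OF False that])
      have "u (x + y) <= u x + u y" for x y
      proof -
        have "u (x + y) - q2 y <= q1 x" if q1: "q1 : C" and q2: "q2 : C" for q1 q2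
        proof -
          obtain q where q: "q : C" "q <= q1" "q <= q2" using tot[OF q1 q2] q1 q2 by auto
          have "u (x + y) <= q (x + y)" by (rule low[OF q(1)])
          also have "... <= q x + q y" by (rule sublinearD(1)[OF sub[OF q(1)]])
          also have "... <= q1 x + q2 y" using q by (auto simp: le_fun_def intro: add_mono)
          finally show ?thesis by simp
        qed
        then have "u (x + y) - q2 y <= u x" if "q2 : C" for q2 using great that by blast
        then have "u (x + y) - u x <= q2 y" if "q2 : C" for q2 using that by (smt (verit))
        then have "u (x + y) - u x <= u y" by (rule great)
        then show ?thesis by simp
      qed
      moreover have "u (r *\<^sub>R x) = r * u x" if r: "0 <= r" for r x
      proof (cases "r = 0")
        case True
        have "u 0 = (INF q\<in>C. 0)" unfolding u_def
          by (intro INF_cong) (auto intro: sublinearD(3)[OF sub])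
        then have "u 0 = 0" using False by simp
        then show ?thesis using True by simp
      next
        case False
        with r have r: "0 < r" by simp
        have sc: "q (r *\<^sub>R x) = r * q x" if "q : C" for q
          using sublinearD(2)[OF sub[OF that]] r by simp
        have "u (r *\<^sub>R x) / r <= u x"
        proof (rule great)
          fix q assume q: "q : C"
          show "u (r *\<^sub>R x) / r <= q x" using low[OF q, of "r *\<^sub>R x"] sc[OF q] r by (simp add: field_simps)
        qed
        moreover have "r * u x <= u (r *\<^sub>R x)"
        proof (rule great)
          fix q assume q: "q : C"
          show "r * u x <= q (r *\<^sub>R x)" using low[OF q, of x] sc[OF q] r by simp
        qed
        ultimately show ?thesis using r by (simp add: field_simps)
      qed
      ultimately have "sublinear u" by (simp add: sublinear_def)
      moreover have "u <= p"
      proof (rule le_funI)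
        fix x
        obtain q where "q : C" using False by blast
        then show "u x <= p x" using low[of q x] qp[of q x] by simp
      qed
      ultimately show ?thesis using low by (intro bexI[of _ u]) (auto simp: A_def le_fun_def)
    qed
  qed
  then obtain m where m: "sublinear m" "m <= p" and min: "!!a. sublinear a ==> a <= p ==> a <= m ==> a = m"
    by (auto simp: A_def)
  have add: "m (x + y) = m x + m y" for x y
  proof (rule antisym)
    show "m (x + y) <= m x + m y" by (rule sublinearD(1)[OF m(1)])
    define q where "q = directional m y"
    note q = sublinear_directional[OF m(1) q_def]
    have "q = m" by (rule min) (use q(1,3) m(2) in auto)
    then show "m x + m y <= m (x + y)" using q(2)[of 1 x] by simp
  qed
  have neg: "m (- x) = - m x" for x using add[of x "- x"] sublinearD(3)[OF m(1)] by simp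
  have "m (r *\<^sub>R x) = r * m x" for r x
  proof (cases "0 <= r")
    case True then show ?thesis by (rule sublinearD(2)[OF m(1)])
  next
    case False
    then have "m ((- r) *\<^sub>R x) = (- r) * m x" by (intro sublinearD(2)[OF m(1)]) simp
    then show ?thesis using neg[of "r *\<^sub>R x"] by simp
  qed
  with add have "linear m" by (intro linearI) auto
  with m(2) show ?thesis by blast
qed

text \<open>A linear functional below the directional regularisation at x0 is forced to take the
  value \<open>p x0\<close> there, and it stays below p.\<close>

lemma sublinear_attained_by_linear:
  assumes p: "sublinear (p :: 'a::real_vector => real)"
  shows "\<exists>f. linear f \<and> (\<forall>x. f x <= p x) \<and> f x0 = p x0"
proof -
  define q where "q = directional p x0"
  note q = sublinear_directional[OF p q_def]
  obtain f where f: "linear f" "f <= q" using sublinear_dominates_linear[OF q(1)] by blast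
  have fp: "f x <= p x" for x using f(2) q(3) by (meson le_funD order_trans)
  have "f (- x0) <= - p x0"
    using le_funD[OF f(2), of "- x0"] q(2)[of 1 "- x0"] sublinearD(3)[OF p] by simp
  then have "f x0 = p x0" using fp[of x0] linear_neg[OF f(1), of x0] by simp
  with f fp show ?thesis by blast
qed

section \<open>States of C*-seminormed algebras\<close>

text \<open>The degenerate case c = 0 is included, so that Cauchy--Schwarz follows for forms that
  are only semidefinite.\<close>

lemma quadratic_nonneg_discrim:
  fixes a b c :: real
  assumes "!!t. 0 <= a + 2 * b * t + c * t^2"
  shows "b^2 <= a * c"
proof (cases "c = 0")
  case True
  have "b = 0"
  proof (rule ccontr)
    assume b: "b ~= 0"
    \<comment> \<open>At this t the affine function takes the value - 1.\<close>
    have "0 <= a + 2 * b * (- (a + 1) / (2 * b)) + c * (- (a + 1) / (2 * b))^2" by (rule assms)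
    then show False using b True by simp
  qed
  then show ?thesis using True by simp
next
  case False
  have "0 <= c"
  proof (rule ccontr)
    assume "\<not> 0 <= c"
    then have c: "c < 0" by simp
    \<comment> \<open>Here - c t exceeds 2 b by at least \<bar>a\<bar> + 1, which pulls the
      quadratic below zero.\<close>
    define t where "t = (\<bar>a\<bar> + 2 * \<bar>b\<bar> + 1) / (- c) + 1"
    have t1: "1 <= t" using c by (simp add: t_def field_simps)
    have ct: "- c * t = \<bar>a\<bar> + 2 * \<bar>b\<bar> + 1 - c" using c by (simp add: t_def field_simps)
    have "a + 2 * b * t + c * t^2 = a + t * (2 * b - (- c * t))"
      by (simp add: power2_eq_square algebra_simps)
    also have "... = a + t * (2 * b - (\<bar>a\<bar> + 2 * \<bar>b\<bar> + 1 - c))" using ct by simp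
    also have "... <= a + t * (- (\<bar>a\<bar> + 1))" using t1 c by (intro add_left_mono mult_left_mono) auto
    also have "... <= a + 1 * (- (\<bar>a\<bar> + 1))" using t1 by (intro add_left_mono mult_right_mono_neg) auto
    also have "... < 0" by simp
    finally show False using assms[of t] by simp
  qed
  with False have c: "0 < c" by simp
  have "0 <= a + 2 * b * (- b / c) + c * (- b / c)^2" by (rule assms)
  also have "... = (a * c - b^2) / c" using c by (simp add: field_simps power2_eq_square)
  finally show ?thesis using c by (simp add: field_simps)
qed

text \<open>Roots of order 2^k make the constant K disappear, as in the spectral radius formula.
  Crude bounds on iterated squares thereby become sharp, first for states and later for GNS
  seminorms.\<close>

lemma power_le_imp_base_le:
  fixes a b K :: real
  assumes "0 <= a" "0 <= b" and "!!k. a ^ (2 ^ k) <= K * b ^ (2 ^ k)"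
  shows "a <= b"
proof (rule ccontr)
  assume "\<not> a <= b"
  then have ab: "b < a" by simp
  show False
  proof (cases "b = 0")
    case True
    then show False using assms(3)[of 0] ab by simp
  next
    case False
    with assms have b: "0 < b" by simp
    define q where "q = a / b"
    have q: "1 < q" using ab b by (simp add: q_def)
    obtain n where n: "K < q ^ n" using real_arch_pow[OF q] by blast
    have "n <= 2 ^ n" by (rule less_imp_le) (rule less_exp)
    then have "q ^ n <= q ^ (2 ^ n)" using q by (intro power_increasing) auto
    also have "... <= K" using assms(3)[of n] b by (simp add: q_def power_divide field_simps)
    finally show False using n by simp
  qed
qed

text \<open>The bound exp x <= 1 + x + x^2 is used at x = 1/8 and raised to the eighth power. The
  value 2.87 is good enough for sinh 1 < 1.265.\<close>

lemma exp_one_le: "exp (1::real) <= 287 / 100"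
proof -
  have "exp (1/8::real) <= 1 + 1/8 + (1/8)^2" by (rule exp_bound) auto
  then have "exp (1/8::real) ^ 8 <= (1 + 1/8 + (1/8)^2) ^ 8" by (rule power_mono) simp
  also have "exp (1/8::real) ^ 8 = exp 1" by (simp flip: exp_of_nat_mult)
  finally show ?thesis by (simp add: power2_eq_square eval_nat_numeral)
qed

text \<open>A replacement for a square root: from \<open>(P w)^2 <= 1 + x\<close> it yields
  \<open>P w <= 1 + x / 2\<close>.\<close>

lemma one_plus_le_square: "1 + x <= (1 + x / 2)^2" for x :: real
  by (simp add: power2_eq_square algebra_simps)

text \<open>The type class provides real scalars only. Multiplication by the imaginary unit is
  therefore multiplication by a central element \<open>I\<close> with square - 1 that the involution
  sends to its negative; states become real-valued, namely real parts of complex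
  functionals.\<close>

locale cstar_seminormed =
  fixes st :: "'a::real_algebra_1 => 'a" and I :: 'a and P :: "'a => real"
  assumes st_add: "st (x + y) = st x + st y"
    and st_mult: "st (x * y) = st y * st x"
    and st_st: "st (st x) = x"
    and st_scaleR: "st (r *\<^sub>R x) = r *\<^sub>R st x"
    and st_I: "st I = - I"
    and I_central: "x * I = I * x"
    and I_square: "I * I = - 1"
    and P_nonneg: "0 <= P x"
    and P_scaleR: "P (r *\<^sub>R x) = \<bar>r\<bar> * P x"
    and P_triangle: "P (x + y) <= P x + P y"
    and P_mult: "P (x * y) <= P x * P y"
    and P_star: "P (st x * x) = (P x)^2"
    and P_one: "P 1 = 1"
begin

section \<open>Calculus of the involution and of the seminorm\<close>

lemma st_minus: "st (- x) = - st x"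
  using st_scaleR[of "-1" x] by simp

lemma st_diff: "st (x - y) = st x - st y"
  using st_add[of x "- y"] by (simp add: st_minus)

lemma st_one: "st 1 = 1"
  using st_mult[of "st 1" 1] by (simp add: st_st)

lemma st_power: "st (x ^ k) = st x ^ k"
  by (induction k) (simp_all add: st_one st_mult power_commutes)

lemmas st_simps = st_add st_mult st_st st_scaleR st_I st_minus st_diff st_one st_power

lemma I_I: "I * (I * x) = - x"
  by (simp add: I_square flip: mult.assoc)

lemma P_minus: "P (- x) = P x"
  using P_scaleR[of "-1" x] by simp

lemma P_diff: "P (x - y) <= P x + P y"
  using P_triangle[of x "- y"] by (simp add: P_minus)

lemma P_zero: "P 0 = 0"
  using P_scaleR[of 0 0] by simp

lemma P_st: "P (st x) = P x"
proof -
  have le: "P x <= P (st x)" for x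
  proof (cases "P x = 0")
    case False
    then have "0 < P x" using P_nonneg[of x] by simp
    moreover have "P x * P x <= P (st x) * P x"
      using P_star[of x] P_mult[of "st x" x] by (simp add: power2_eq_square)
    ultimately show ?thesis by (simp add: mult_le_cancel_right)
  qed (simp add: P_nonneg)
  show ?thesis using le[of x] le[of "st x"] by (simp add: st_st)
qed

text \<open>The element \<open>I\<close> is unitary, so \<open>x\<close> and \<open>I * x\<close>
  have the same \<open>st x * x\<close>.\<close>

lemma P_I: "P (I * x) = P x"
proof -
  have "st (I * x) * (I * x) = st x * x"
  proof -
    have "st (I * x) * (I * x) = - (st x * (I * (I * x)))"
      by (simp add: st_simps mult.assoc)
    then show ?thesis by (simp add: I_I)
  qed
  then have "(P (I * x))^2 = (P x)^2" using P_star[of "I * x"] P_star[of x] by simp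
  then show ?thesis using P_nonneg by (simp add: power2_eq_iff_nonneg)
qed

lemma P_square: "st a = a ==> P (a * a) = (P a)^2"
  using P_star[of a] by simp

lemma P_power: "P (x ^ k) <= P x ^ k"
proof (induction k)
  case (Suc k)
  have "P (x ^ Suc k) <= P x * P (x ^ k)" by (simp add: P_mult)
  also have "... <= P x * P x ^ k" using Suc by (intro mult_left_mono) (auto simp: P_nonneg)
  finally show ?case by simp
qed (simp add: P_one)

text \<open>The one-sided derivative of the norm at the unit; its subgradients are the states.\<close>

definition numrange :: "'a => real" where
  "numrange h = (INF e\<in>{0<..}. (P (1 + e *\<^sub>R h) - 1) / e)"

lemma numrange_lower: "- P h <= (P (1 + e *\<^sub>R h) - 1) / e" if "0 < e"
proof -
  have "1 <= P (1 + e *\<^sub>R h) + P (e *\<^sub>R h)"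
    using P_diff[of "1 + e *\<^sub>R h" "e *\<^sub>R h"] P_one by simp
  then show ?thesis using that by (simp add: P_scaleR field_simps)
qed

lemma numrange_le: "numrange h <= (P (1 + e *\<^sub>R h) - 1) / e" if "0 < e"
  unfolding numrange_def
  by (rule cINF_lower) (use that numrange_lower in \<open>auto intro!: bdd_belowI2[of _ "- P h"]\<close>)

lemma numrange_greatest: "c <= numrange h" if "!!e. 0 < e ==> c <= (P (1 + e *\<^sub>R h) - 1) / e"
  unfolding numrange_def by (rule cINF_greatest) (use that in auto)

lemma numrange_le_P: "numrange h <= P h"
  using numrange_le[of 1 h] P_triangle[of 1 h] P_one by simp

lemma sublinear_numrange: "sublinear numrange"
proof -
  have add: "numrange (h + k) <= numrange h + numrange k" for h k
  proof -
    have key: "numrange (h + k) <= (P (1 + a *\<^sub>R h) - 1) / a + (P (1 + b *\<^sub>R k) - 1) / b"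
      if a: "0 < a" and b: "0 < b" for a b
    proof -
      \<comment> \<open>With this e, the element 1 + e (h + k) is the convex combination of 1 + a h
        and 1 + b k with weights e / a = b / (a + b) and e / b = a / (a + b).\<close>
      define e where "e = a * b / (a + b)"
      have e: "0 < e" using a b by (simp add: e_def)
      have "e / a = b / (a + b)" "e / b = a / (a + b)" using a b by (simp_all add: e_def)
      then have ab: "e / a + e / b = 1" using a b by (simp flip: add_divide_distrib)
      have "1 + e *\<^sub>R (h + k) = (e / a) *\<^sub>R (1 + a *\<^sub>R h) + (e / b) *\<^sub>R (1 + b *\<^sub>R k)"
      proof -
        have "(e / a) *\<^sub>R (1 + a *\<^sub>R h) + (e / b) *\<^sub>R (1 + b *\<^sub>R k)
            = (e / a + e / b) *\<^sub>R 1 + e *\<^sub>R (h + k)"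
          using a b by (simp only: scaleR_add_right scaleR_scaleR scaleR_add_left) simp
        then show ?thesis using ab by simp
      qed
      then have "P (1 + e *\<^sub>R (h + k)) <= (e / a) * P (1 + a *\<^sub>R h) + (e / b) * P (1 + b *\<^sub>R k)"
        using P_triangle[of "(e / a) *\<^sub>R (1 + a *\<^sub>R h)" "(e / b) *\<^sub>R (1 + b *\<^sub>R k)"] a b e
        by (simp add: P_scaleR del: scaleR_add_right)
      then have "P (1 + e *\<^sub>R (h + k)) - 1
          <= (e / a) * (P (1 + a *\<^sub>R h) - 1) + (e / b) * (P (1 + b *\<^sub>R k) - 1)"
        using ab by (simp add: algebra_simps)
      then have "(P (1 + e *\<^sub>R (h + k)) - 1) / e
          <= ((e / a) * (P (1 + a *\<^sub>R h) - 1) + (e / b) * (P (1 + b *\<^sub>R k) - 1)) / e"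
        using e by (intro divide_right_mono) auto
      also have "... = (P (1 + a *\<^sub>R h) - 1) / a + (P (1 + b *\<^sub>R k) - 1) / b"
        using e by (simp add: add_divide_distrib)
      finally show ?thesis using numrange_le[OF e, of "h + k"] by simp
    qed
    have "numrange (h + k) - (P (1 + b *\<^sub>R k) - 1) / b <= numrange h" if "0 < b" for b
      by (rule numrange_greatest) (use key that in fastforce)
    then have "numrange (h + k) - numrange h <= numrange k"
      by (intro numrange_greatest) fastforce
    then show ?thesis by simp
  qed
  have scl: "numrange (r *\<^sub>R h) <= r * numrange h" if r: "0 < r" for r h
  proof -
    have "numrange (r *\<^sub>R h) / r <= numrange h"
    proof (rule numrange_greatest)
      fix e :: real assume e: "0 < e"
      show "numrange (r *\<^sub>R h) / r <= (P (1 + e *\<^sub>R h) - 1) / e"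
        using numrange_le[of "e / r" "r *\<^sub>R h"] e r by (simp add: field_simps)
    qed
    then show ?thesis using r by (simp add: field_simps)
  qed
  have z: "numrange 0 = 0"
    unfolding numrange_def using P_one by (simp add: cINF_const)
  have "numrange (r *\<^sub>R h) = r * numrange h" if "0 <= r" for r h
  proof (cases "r = 0")
    case False
    with that have r: "0 < r" by simp
    show ?thesis
      using scl[OF r, of h] scl[of "inverse r" "r *\<^sub>R h"] r by (simp add: field_simps)
  qed (simp add: z)
  with add show ?thesis by (simp add: sublinear_def)
qed

text \<open>The inequality encodes normalisation as well: \<open>numrange 1 = 1\<close> and
  \<open>numrange (- 1) = - 1\<close>, so f is 1 at the unit.\<close>

definition state :: "('a => real) => bool" where
  "state f \<longleftrightarrow> linear f \<and> (\<forall>x. f x <= numrange x)"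

lemma state_linear: "state f ==> linear f"
  by (simp add: state_def)

lemma state_abs_le: assumes "state f" shows "\<bar>f x\<bar> <= P x"
proof -
  have le: "f y <= P y" for y
    using assms numrange_le_P[of y] order_trans unfolding state_def by blast
  show ?thesis
    using le[of x] le[of "- x"] linear_neg[OF state_linear[OF assms], of x] by (simp add: P_minus)
qed

lemma state_le: "state f ==> 0 < e ==> f h <= (P (1 + e *\<^sub>R h) - 1) / e"
  using numrange_le order_trans unfolding state_def by blast

text \<open>Near the unit, \<open>1 - t\<^sup>2 a\<^sup>2 / 2\<close> is the real part of the approximately unitary element
  \<open>1 + i t a - t\<^sup>2 a\<^sup>2 / 2\<close>.\<close>

lemma state_square_nonneg:
  assumes f: "state f" and a: "st a = a"
  shows "0 <= f (a * a)"
proof -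
  define M where "M = (P (a * a))^2"
  have M: "0 <= M" by (simp add: M_def)
  have key: "f (- (a * a)) <= s * M / 2" if s: "0 < s" for s
  proof -
    define b where "b = a * a"
    define j where "j = I * a"
    \<comment> \<open>With t^2 = 2 s the terms in b cancel in \<open>st w * w\<close>, which leaves
      an error of order s^2.\<close>
    define t where "t = sqrt (2 * s)"
    have tt: "t * t = 2 * s" using s by (simp add: t_def)
    define w where "w = 1 + t *\<^sub>R j - s *\<^sub>R b"
    have aI: "a * I = I * a" by (rule I_central)
    have stj: "st j = - j" using a by (simp add: j_def st_simps aI)
    have stb: "st b = b" using a by (simp add: b_def st_simps)
    have jj: "j * j = - b"
    proof -
      have "j * j = I * (a * I) * a" by (simp add: j_def mult.assoc)
      also have "... = (I * I) * (a * a)" by (simp only: aI mult.assoc)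
      finally show ?thesis by (simp add: I_square b_def)
    qed
    have jb: "j * b = b * j"
    proof -
      have "a * (I * x) = I * (a * x)" for x by (metis aI mult.assoc)
      then show ?thesis by (simp add: j_def b_def mult.assoc)
    qed
    have stw: "st w = 1 - t *\<^sub>R j - s *\<^sub>R b" by (simp add: w_def st_simps stj stb)
    have "st w * w = 1 + (s * s) *\<^sub>R (b * b)"
    proof -
      have "st w * w = 1 - (2 * s) *\<^sub>R b - (t * t) *\<^sub>R (j * j) + (s * s) *\<^sub>R (b * b)"
        unfolding stw unfolding w_def
        by (simp add: algebra_simps jb) (simp add: scaleR_2[symmetric] scaleR_add_left[symmetric])
      then show ?thesis by (simp add: jj tt)
    qed
    then have "(P w)^2 = P (1 + (s * s) *\<^sub>R (b * b))" using P_star[of w] by simp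
    also have "... <= 1 + s * s * P (b * b)"
      using P_triangle[of 1 "(s * s) *\<^sub>R (b * b)"] P_one by (simp add: P_scaleR)
    also have "P (b * b) = M" using P_square[OF stb] by (simp add: M_def b_def)
    also have "1 + s * s * M <= (1 + s * s * M / 2)^2"
      using one_plus_le_square[of "s * s * M"] by simp
    finally have Pw: "P w <= 1 + s * s * M / 2"
      by (rule power2_le_imp_le) (use M in simp)
    have "1 - s *\<^sub>R b = (1/2) *\<^sub>R (w + st w)"
      unfolding stw unfolding w_def by (simp add: algebra_simps flip: scaleR_2)
    then have "P (1 - s *\<^sub>R b) <= P w"
      using P_triangle[of w "st w"] by (simp add: P_scaleR P_st)
    with Pw have "P (1 + s *\<^sub>R (- b)) - 1 <= s * s * M / 2" by simp
    then have "(P (1 + s *\<^sub>R (- b)) - 1) / s <= s * M / 2" using s by (simp add: field_simps)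
    then show ?thesis
      using state_le[OF f s, of "- b"] unfolding b_def by linarith
  qed
  have "f (- (a * a)) <= 0"
  proof (rule field_le_epsilon)
    fix e :: real assume e: "0 < e"
    define s where "s = 2 * e / (M + 1)"
    have "s * M / 2 <= e" using e M by (simp add: s_def field_simps)
    moreover have "0 < s" using e M by (simp add: s_def)
    ultimately show "f (- (a * a)) <= 0 + e" using key[of s] by simp
  qed
  then show ?thesis using linear_neg[OF state_linear[OF f], of "a * a"] by simp
qed

text \<open>For self-adjoint h the squared norm of 1 + s I h is the norm of 1 + s^2 h^2, hence
  exceeds 1 only in second order. So the derivative of the norm at the unit in direction I h is at
  most 0, and the same holds for - h.\<close>

lemma state_I_zero:
  assumes f: "state f" and h: "st h = h"
  shows "f (I * h) = 0"
proof -
  have le: "f (I * h) <= 0" if h: "st h = h" for h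
  proof (rule field_le_epsilon)
    fix e :: real assume e: "0 < e"
    define M where "M = P (h * h)"
    have M: "0 <= M" by (simp add: M_def P_nonneg)
    define s where "s = 2 * e / (M + 1)"
    have s: "0 < s" using e M by (simp add: s_def)
    have hI: "h * I = I * h" by (rule I_central)
    have "st (1 + s *\<^sub>R (I * h)) * (1 + s *\<^sub>R (I * h)) = 1 - (s * s) *\<^sub>R ((I * h) * (I * h))"
      by (simp add: st_simps h hI algebra_simps)
    also have "(I * h) * (I * h) = I * (h * I) * h" by (simp add: mult.assoc)
    also have "... = - (h * h)" by (simp only: hI mult.assoc) (simp add: I_I)
    finally have "(P (1 + s *\<^sub>R (I * h)))^2 = P (1 + (s * s) *\<^sub>R (h * h))"
      using P_star[of "1 + s *\<^sub>R (I * h)"] by simp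
    also have "... <= 1 + s * s * M"
      using P_triangle[of 1 "(s * s) *\<^sub>R (h * h)"] P_one by (simp add: P_scaleR M_def)
    also have "... <= (1 + s * s * M / 2)^2" using one_plus_le_square[of "s * s * M"] by simp
    finally have "P (1 + s *\<^sub>R (I * h)) <= 1 + s * s * M / 2"
      by (rule power2_le_imp_le) (use M in simp)
    then have "(P (1 + s *\<^sub>R (I * h)) - 1) / s <= s * M / 2" using s by (simp add: field_simps)
    also have "... <= e" using e M by (simp add: s_def field_simps)
    finally show "f (I * h) <= 0 + e"
      using state_le[OF f s, of "I * h"] by simp
  qed
  have "- f (I * h) <= 0"
    using le[of "- h"] h linear_neg[OF state_linear[OF f], of "I * h"] by (simp add: st_simps)
  with le[OF h] show ?thesis by simp
qed

text \<open>On elements commuting with s the functional \<open>f (s * s * x)\<close> is nonnegative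
  at squares and satisfies Cauchy--Schwarz. Applying this to z, z^2, z^4 and so on, and bounding the
  last term crudely by the norm, gives the sharp bound after taking roots.\<close>

lemma state_weighted_square:
  assumes f: "state f" and s: "st s = s" and z: "st z = z" and c: "s * z = z * s"
  shows "0 <= f (s * s)" and "\<bar>f (s * s * z)\<bar> <= f (s * s) * P z"
proof -
  note lin = state_linear[OF f]
  define phi where "phi x = f (s * s * x)" for x
  have phi1: "0 <= phi 1" using state_square_nonneg[OF f s] by (simp add: phi_def)
  then show "0 <= f (s * s)" by (simp add: phi_def)
  have cs: "(phi x)^2 <= phi 1 * phi (x * x)" if x: "st x = x" and sx: "s * x = x * s" for x
  proof (rule quadratic_nonneg_discrim)
    fix t :: real
    define y where "y = s + t *\<^sub>R (s * x)"
    have "st y = y" by (simp add: y_def st_simps s x sx)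
    then have "0 <= f (y * y)" by (rule state_square_nonneg[OF f])
    also have "y * y = s * s + (2 * t) *\<^sub>R (s * s * x) + (t^2) *\<^sub>R (s * s * (x * x))"
    proof -
      have "s * x * s = s * s * x" by (metis sx mult.assoc)
      moreover have "s * x * (s * x) = s * s * (x * x)" by (metis sx mult.assoc)
      ultimately show ?thesis
        by (simp add: y_def algebra_simps power2_eq_square) (simp add: scaleR_2[symmetric] mult.assoc)
    qed
    also have "f ... = phi 1 + 2 * phi x * t + phi (x * x) * t^2"
      using lin by (simp add: phi_def linear_add linear_cmul)
    finally show "0 <= phi 1 + 2 * phi x * t + phi (x * x) * t^2" .
  qed
  \<comment> \<open>The inequality is kept free of division by \<open>phi 1\<close>, which may
    vanish.\<close>
  have iter: "\<bar>phi z\<bar> ^ (2 ^ k) * phi 1 <= phi 1 ^ (2 ^ k) * \<bar>phi (z ^ (2 ^ k))\<bar>" for k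
  proof (induction k)
    case (Suc k)
    define zk where "zk = z ^ (2 ^ k)"
    have st_zk: "st zk = zk" by (simp add: zk_def st_power z)
    have c_zk: "s * zk = zk * s" using c by (simp add: zk_def power_commuting_commutes)
    show ?case
    proof (cases "phi 1 = 0")
      case True
      then show ?thesis by simp
    next
      case False
      with phi1 have p: "0 < phi 1" by simp
      have "(\<bar>phi z\<bar> ^ (2 ^ k) * phi 1)^2 <= (phi 1 ^ (2 ^ k) * \<bar>phi zk\<bar>)^2"
        using Suc phi1 by (intro power_mono) (auto simp: zk_def)
      also have "... = (phi 1 ^ (2 ^ k))^2 * (phi zk)^2" by (simp add: power_mult_distrib)
      also have "... <= (phi 1 ^ (2 ^ k))^2 * (phi 1 * phi (zk * zk))"
        by (intro mult_left_mono cs st_zk c_zk) simp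
      finally have "phi 1 * (\<bar>phi z\<bar> ^ (2 ^ Suc k) * phi 1) <= phi 1 * (phi 1 ^ (2 ^ Suc k) * phi (zk * zk))"
        by (simp add: power_mult_distrib power2_eq_square mult_2 power_add algebra_simps)
      then have "\<bar>phi z\<bar> ^ (2 ^ Suc k) * phi 1 <= phi 1 ^ (2 ^ Suc k) * phi (zk * zk)"
        using p by (simp only: mult_le_cancel_left_pos)
      also have "... <= phi 1 ^ (2 ^ Suc k) * \<bar>phi (zk * zk)\<bar>" using phi1 by (intro mult_left_mono) auto
      also have "zk * zk = z ^ (2 ^ Suc k)" by (simp add: zk_def mult_2 flip: power_add)
      finally show ?thesis .
    qed
  qed simp
  show "\<bar>f (s * s * z)\<bar> <= f (s * s) * P z"
  proof (cases "phi 1 = 0")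
    case True
    then have "(phi z)^2 <= 0" using cs[OF z c] by simp
    then show ?thesis using True by (simp add: phi_def)
  next
    case False
    with phi1 have p: "0 < phi 1" by simp
    have "\<bar>phi z\<bar> <= phi 1 * P z"
    proof (rule power_le_imp_base_le)
      show "0 <= phi 1 * P z" using p P_nonneg by simp
      fix k
      have "\<bar>phi (z ^ (2 ^ k))\<bar> <= P (s * s * z ^ (2 ^ k))" by (simp add: phi_def state_abs_le[OF f])
      also have "... <= P (s * s) * P z ^ (2 ^ k)"
        by (rule order_trans[OF P_mult]) (simp add: mult_left_mono P_power P_nonneg)
      finally have "phi 1 ^ (2 ^ k) * \<bar>phi (z ^ (2 ^ k))\<bar> <= phi 1 ^ (2 ^ k) * (P (s * s) * P z ^ (2 ^ k))"
        using p by (intro mult_left_mono) auto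
      with iter[of k] have "\<bar>phi z\<bar> ^ (2 ^ k) * phi 1 <= phi 1 ^ (2 ^ k) * (P (s * s) * P z ^ (2 ^ k))"
        by linarith
      then show "\<bar>phi z\<bar> ^ (2 ^ k) <= P (s * s) / phi 1 * (phi 1 * P z) ^ (2 ^ k)"
        using p by (simp add: field_simps power_mult_distrib)
    qed simp
    then show ?thesis by (simp add: phi_def)
  qed
qed

text \<open>Put v = 1 - z, where z is self-adjoint of norm at most 1. Two consecutive values
  \<open>f (z * v ^ j)\<close> differ by \<open>f (z * z * v ^ j)\<close>, which is nonnegative, so
  these values decrease in j. Their first m terms add up to \<open>f (1 - v ^ m)\<close>, so the
  last one is at most the m-th part of it.\<close>

lemma state_geometric:
  assumes f: "state f" and z: "st z = z" "P z <= 1"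
  shows "f (z * (1 - z) ^ (2 * k)) <= f z" and "real (2 * k + 1) * f (z * (1 - z) ^ (2 * k)) <= 1"
proof -
  note lin = state_linear[OF f]
  define v where "v = 1 - z"
  have v: "st v = v" by (simp add: v_def st_simps z)
  have vz: "v * z = z * v" by (simp add: v_def algebra_simps)
  have wpos: "0 <= f (s * s * v)" if s: "st s = s" "s * z = z * s" for s
  proof -
    have "f (s * s * v) = f (s * s) - f (s * s * z)"
      using lin by (simp add: v_def algebra_simps linear_diff)
    moreover have "f (s * s) * P z <= f (s * s) * 1"
      using state_weighted_square(1)[OF f s(1) z(1) s(2)] z(2) by (intro mult_left_mono) auto
    ultimately show ?thesis using state_weighted_square(2)[OF f s(1) z(1) s(2)] by linarith
  qed
  have vpz: "v ^ j * z = z * v ^ j" for j using vz by (simp add: power_commuting_commutes)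
  have step: "f (z * v ^ Suc j) <= f (z * v ^ j)" for j
  proof -
    have eq: "z * v ^ j - z * v ^ Suc j = z * z * v ^ j"
      by (simp add: v_def algebra_simps power_commutes flip: mult.assoc)
    have "0 <= f (z * z * v ^ j)"
    proof -
      \<comment> \<open>Half of the power goes into s; then z z v^j is the square of s for even j,
        and this square times v for odd j. Both are nonnegative under f, the latter because the
        previous lemma bounds f (s s z) by f (s s).\<close>
      define s where "s = z * v ^ (j div 2)"
      have s: "st s = s" "s * z = z * s"
        by (simp_all add: s_def st_simps z v vpz mult.assoc)
      have ss: "s * s = z * z * v ^ (2 * (j div 2))"
        unfolding s_def mult_2 power_add by (metis mult.assoc vpz)
      show ?thesis
      proof (cases "even j")
        case True
        then have "z * z * v ^ j = s * s" by (simp add: ss)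
        then show ?thesis using state_square_nonneg[OF f s(1)] by simp
      next
        case False
        then have "v ^ j = v ^ (2 * (j div 2)) * v" by (metis odd_two_times_div_two_succ power_Suc2 Suc_eq_plus1)
        then have "z * z * v ^ j = s * s * v" by (simp add: ss mult.assoc)
        then show ?thesis using wpos[OF s] by simp
      qed
    qed
    then show ?thesis
      using linear_diff[OF lin, of "z * v ^ j" "z * v ^ Suc j"] unfolding eq by linarith
  qed
  have mono: "f (z * v ^ j) <= f (z * v ^ i)" if "i <= j" for i j
    using that by (induction rule: dec_induct) (use step in "auto intro: order_trans")
  show "f (z * (1 - z) ^ (2 * k)) <= f z" using mono[of 0 "2 * k"] by (simp add: v_def)
  have tel: "(\<Sum>j<m. z * v ^ j) = 1 - v ^ m" for m
    by (induction m) (simp_all add: v_def algebra_simps)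
  have "real (2 * k + 1) * f (z * v ^ (2 * k)) = (\<Sum>j<2 * k + 1. f (z * v ^ (2 * k)))" by simp
  also have "... <= (\<Sum>j<2 * k + 1. f (z * v ^ j))" by (intro sum_mono mono) simp
  also have "... = f (1 - v ^ (2 * k + 1))" by (simp only: linear_sum[OF lin, symmetric] tel)
  also have "... = f 1 - f (v ^ k * v ^ k * v)"
    by (simp only: linear_diff[OF lin] mult_2 power_add power_one_right)
  also have "... <= 1"
  proof -
    have "0 <= f (v ^ k * v ^ k * v)" by (rule wpos) (simp_all add: st_simps v vpz)
    moreover have "f 1 <= 1" using state_abs_le[OF f, of 1] P_one by simp
    ultimately show ?thesis by simp
  qed
  finally show "real (2 * k + 1) * f (z * (1 - z) ^ (2 * k)) <= 1" by (simp add: v_def)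
qed

text \<open>Kaplansky's trick: \<open>d\<^sup>* d + d d\<^sup>*\<close> is a sum of squares of self-adjoint elements.  Taking
  \<open>d = c (1 - \<epsilon> c\<^sup>* c)\<^sup>k\<close> makes \<open>d d\<^sup>*\<close> small where it is positive, which forces
  \<open>d\<^sup>* d\<close>, and then \<open>c\<^sup>* c\<close>, to be almost positive.\<close>

lemma state_positive:
  assumes f: "state f"
  shows "0 <= f (st c * c)"
proof -
  note lin = state_linear[OF f]
  define x where "x = st c * c"
  define y where "y = c * st c"
  \<comment> \<open>The scaling makes e x and e y contractions, as \<open>state_geometric\<close>
    demands.\<close>
  define e where "e = 1 / ((P c)^2 + 1)"
  have e: "0 < e" by (simp add: e_def add_nonneg_pos)
  have stx: "st x = x" and sty: "st y = y" by (simp_all add: x_def y_def st_simps)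
  have Px: "P x = (P c)^2" by (simp add: x_def P_star)
  have Py: "P y = (P c)^2" using P_star[of "st c"] by (simp add: y_def st_st P_st)
  have "0 < (P c)^2 + 1" by (simp add: add_nonneg_pos)
  then have small: "e * (P c)^2 <= 1" by (simp add: e_def field_simps)
  define u where "u = 1 - e *\<^sub>R x"
  define v where "v = 1 - e *\<^sub>R y"
  have stu: "st u = u" by (simp add: u_def st_simps stx)
  \<comment> \<open>Moving c across turns \<open>st c * c\<close> into \<open>c * st c\<close>, so
    every power of u on the right of c becomes a power of v on the left.\<close>
  have cu: "c * u = v * c" by (simp add: u_def v_def x_def y_def algebra_simps)
  have cuk: "c * u ^ j = v ^ j * c" for j
    by (induction j) (simp_all add: cu mult.assoc, metis cu mult.assoc)
  have ux: "u * x = x * u" by (simp add: u_def algebra_simps)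
  have vy: "v * y = y * v" by (simp add: v_def algebra_simps)
  have lower: "- 1 / real (2 * k + 1) <= f (e *\<^sub>R x)" for k
  proof -
    define d where "d = c * u ^ k"
    have dd: "st d * d = x * u ^ (2 * k)"
    proof -
      have "st d * d = u ^ k * x * u ^ k" by (simp add: d_def st_simps stu x_def mult.assoc)
      also have "u ^ k * x = x * u ^ k" using ux by (simp add: power_commuting_commutes)
      finally show ?thesis by (simp add: mult.assoc mult_2 power_add)
    qed
    have dd': "d * st d = y * v ^ (2 * k)"
    proof -
      have "d * st d = c * u ^ (2 * k) * st c"
        by (simp add: d_def st_simps stu mult.assoc mult_2 power_add)
      also have "... = v ^ (2 * k) * y" by (simp add: cuk y_def mult.assoc)
      also have "... = y * v ^ (2 * k)" using vy by (rule power_commuting_commutes)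
      finally show ?thesis .
    qed
    define a where "a = (1/2) *\<^sub>R (d + st d)"
    define b where "b = (1/2) *\<^sub>R (I * (st d - d))"
    have "st a = a" "st b = b" 
    by (simp_all add: a_def b_def st_simps I_central[of d] I_central[of "st d"] algebra_simps)
    then have pos: "0 <= f (a * a)" "0 <= f (b * b)" using state_square_nonneg[OF f] by auto
    have bb: "b * b = - ((1/4) *\<^sub>R ((st d - d) * (st d - d)))"
    proof -
      have "(I * (st d - d)) * (I * (st d - d)) = I * ((st d - d) * I) * (st d - d)"
        by (simp only: mult.assoc)
      also have "... = I * (I * ((st d - d) * (st d - d)))"
        by (simp only: I_central[of "st d - d"] mult.assoc)
      finally show ?thesis by (simp add: b_def I_I)
    qed
    have sum: "st d * d + d * st d = 2 *\<^sub>R (a * a + b * b)"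
    proof -
      have "4 *\<^sub>R (a * a) = (d + st d) * (d + st d)" by (simp add: a_def)
      moreover have "4 *\<^sub>R (b * b) = - ((st d - d) * (st d - d))" by (simp add: bb)
      ultimately have "4 *\<^sub>R (a * a + b * b) = 2 *\<^sub>R (st d * d + d * st d)"
        by (simp add: scaleR_add_right algebra_simps scaleR_2)
      then have "(1/2) *\<^sub>R (4 *\<^sub>R (a * a + b * b)) = st d * d + d * st d" by simp
      then show ?thesis by simp
    qed
    \<comment> \<open>After scaling by e, the summand with x is at most
      \<open>f (e *\<^sub>R x)\<close> and the one with y at most 1 / (2 k + 1).\<close>
    have "0 <= f (2 *\<^sub>R (a * a + b * b))" using pos lin by (simp add: linear_add linear_cmul)
    then have "0 <= f (x * u ^ (2 * k)) + f (y * v ^ (2 * k))"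
      using lin by (simp add: dd dd' linear_add flip: sum)
    moreover have "f (e *\<^sub>R x * u ^ (2 * k)) <= f (e *\<^sub>R x)"
      using state_geometric(1)[OF f, of "e *\<^sub>R x" k] small e
      by (simp add: u_def st_simps stx P_scaleR Px)
    moreover have "real (2 * k + 1) * f (e *\<^sub>R y * v ^ (2 * k)) <= 1"
      using state_geometric(2)[OF f, of "e *\<^sub>R y" k] small e
      by (simp add: v_def st_simps sty P_scaleR Py)
    then have "f (e *\<^sub>R y * v ^ (2 * k)) <= 1 / real (2 * k + 1)" by (simp add: field_simps)
    ultimately show ?thesis
      using lin e by (simp add: linear_cmul) (smt (verit) distrib_left mult_nonneg_nonneg)
  qed
  have "0 <= f (e *\<^sub>R x)"
  proof (rule ccontr)
    assume "\<not> 0 <= f (e *\<^sub>R x)"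
    then have n: "0 < - f (e *\<^sub>R x)" by simp
    obtain k where "1 / real (Suc k) < - f (e *\<^sub>R x)" using nat_approx_posE[OF n] by blast
    moreover have "1 / real (2 * k + 1) <= 1 / real (Suc k)" by (simp add: field_simps)
    ultimately show False using lower[of k] by simp
  qed
  then show ?thesis using e lin by (simp add: x_def linear_cmul zero_le_mult_iff)
qed

end

section \<open>Separation of elements by states\<close>

lemma commuting_power_mult:
  fixes a b :: "'a::monoid_mult"
  assumes "a * b = b * a"
  shows "a ^ n * b ^ n = (a * b) ^ n"
proof (induction n)
  case (Suc n)
  have ab: "a ^ n * b = b * a ^ n" using assms by (rule power_commuting_commutes)
  have "a ^ Suc n * b ^ Suc n = a * (a ^ n * b) * b ^ n" by (simp add: mult.assoc)
  also have "... = a * b * (a ^ n * b ^ n)" by (simp add: ab mult.assoc)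
  finally have "a ^ Suc n * b ^ Suc n = a * b * (a ^ n * b ^ n)" .
  with Suc show ?case by simp
qed simp

context cstar_seminormed
begin

text \<open>Up to signs, 1 - (1 - z)^N has the coefficients of (1 + z)^N - 1; the triangle
  inequality bounds its norm by the latter polynomial at \<open>P z\<close>.\<close>

lemma P_one_minus_power: "P (1 - (1 - z) ^ N) <= (1 + P z) ^ N - 1"
proof (induction N)
  case (Suc N)
  have pw: "P ((1 - z) ^ N) <= (1 + P z) ^ N"
  proof -
    have "P ((1 - z) ^ N) <= P (1 - z) ^ N" by (rule P_power)
    also have "... <= (1 + P z) ^ N"
      using P_diff[of 1 z] P_one P_nonneg by (intro power_mono) auto
    finally show ?thesis .
  qed
  have eq: "1 - (1 - z) ^ Suc N = (1 - (1 - z) ^ N) + z * (1 - z) ^ N" by (simp add: algebra_simps)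
  have "P (1 - (1 - z) ^ Suc N) <= P (1 - (1 - z) ^ N) + P z * P ((1 - z) ^ N)" unfolding eq
    using P_triangle[of "1 - (1 - z) ^ N" "z * (1 - z) ^ N"] P_mult[of z "(1 - z) ^ N"] by linarith
  also have "... <= ((1 + P z) ^ N - 1) + P z * (1 + P z) ^ N"
    using Suc pw P_nonneg by (intro add_mono mult_left_mono) auto
  finally show ?case by (simp add: algebra_simps)
qed (simp add: P_zero)

text \<open>\<open>S - real N *\<^sub>R y\<close> is the odd part of (1 + y)^N without its linear
  term. Its coefficients are nonnegative, so its norm is at most its value at \<open>P y\<close>. A
  joint recursion for odd and even parts takes the place of binomial coefficients.\<close>

lemma P_odd_part:
  fixes y :: 'a and N :: nat
  defines "S == (1/2) *\<^sub>R ((1 + y) ^ N - (1 - y) ^ N)"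
  shows "P (S - real N *\<^sub>R y) <= ((1 + P y) ^ N - (1 - P y) ^ N) / 2 - real N * P y"
proof -
  define odd where "odd n = (1/2) *\<^sub>R ((1 + y) ^ n - (1 - y) ^ n)" for n
  define even where "even n = (1/2) *\<^sub>R ((1 + y) ^ n + (1 - y) ^ n)" for n
  define od where "od n = ((1 + P y) ^ n - (1 - P y) ^ n) / 2" for n
  define ev where "ev n = ((1 + P y) ^ n + (1 - P y) ^ n) / 2" for n
  have odd_Suc: "odd (Suc n) = odd n + y * even n" and even_Suc: "even (Suc n) = even n + y * odd n"
    for n by (simp_all add: odd_def even_def algebra_simps flip: scaleR_add_left)
  have od_Suc: "od (Suc n) = od n + P y * ev n" and ev_Suc: "ev (Suc n) = ev n + P y * od n"
    for n by (simp_all add: od_def ev_def field_simps)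
  have "P (odd n - real n *\<^sub>R y) <= od n - real n * P y \<and> P (even n - 1) <= ev n - 1" for n
  proof (induction n)
    case 0
    have "(1/2::real) *\<^sub>R (2::'a) = 1" by (metis scaleR_half_double one_add_one)
    then show ?case by (simp add: odd_def even_def od_def ev_def P_zero)
  next
    case (Suc n)
    have "odd (Suc n) - real (Suc n) *\<^sub>R y = (odd n - real n *\<^sub>R y) + y * (even n - 1)"
      by (simp add: odd_Suc algebra_simps)
    then have "P (odd (Suc n) - real (Suc n) *\<^sub>R y) <= P (odd n - real n *\<^sub>R y) + P y * P (even n - 1)"
      using P_triangle[of "odd n - real n *\<^sub>R y" "y * (even n - 1)"] P_mult[of y "even n - 1"] by simp
    also have "... <= (od n - real n * P y) + P y * (ev n - 1)"
      using Suc by (intro add_mono mult_left_mono) (auto simp: P_nonneg)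
    finally have 1: "P (odd (Suc n) - real (Suc n) *\<^sub>R y) <= od (Suc n) - real (Suc n) * P y"
      by (simp add: od_Suc algebra_simps)
    have od: "P (odd n) <= od n"
      using Suc P_triangle[of "odd n - real n *\<^sub>R y" "real n *\<^sub>R y"] by (simp add: P_scaleR)
    have eq: "even (Suc n) - 1 = (even n - 1) + y * odd n" by (simp add: even_Suc)
    have "P (even (Suc n) - 1) <= P (even n - 1) + P y * P (odd n)" unfolding eq
      using P_triangle[of "even n - 1" "y * odd n"] P_mult[of y "odd n"] by linarith
    also have "... <= (ev n - 1) + P y * od n"
      using Suc od by (intro add_mono mult_left_mono) (auto simp: P_nonneg)
    finally have "P (even (Suc n) - 1) <= ev (Suc n) - 1" by (simp add: ev_Suc)
    with 1 show ?case by blast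
  qed
  then show ?thesis by (simp add: S_def odd_def od_def)
qed

text \<open>If \<open>\<parallel>1 \<plusminus> \<epsilon> k\<parallel> \<le> 1 + o(\<epsilon>)\<close>, then \<open>exp (\<plusminus> k)\<close> have norm one, so that
  \<open>\<parallel>1 + 2 sinh\<^sup>2 k\<parallel> = \<parallel>cosh (2 k)\<parallel> \<le> 1\<close> and \<open>\<parallel>sinh k\<parallel> \<le> 1 / sqrt 2 < 2 - sinh 1\<close>, while
  \<open>\<parallel>sinh k\<parallel> \<ge> 2 \<parallel>k\<parallel> - sinh \<parallel>k\<parallel>\<close>.  Here \<open>exp (\<plusminus> k)\<close> are replaced by
  \<open>(1 \<plusminus> k / N)\<^sup>N\<close>.\<close>

lemma numrange_zero_imp_P_zero:
  assumes h: "st h = h" and le: "numrange h <= 0" "numrange (- h) <= 0"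
  shows "P h = 0"
proof (rule ccontr)
  assume "P h ~= 0"
  then have r: "0 < P h" using P_nonneg[of h] by simp
  define k where "k = (1 / P h) *\<^sub>R h"
  have stk: "st k = k" by (simp add: k_def st_simps h)
  have Pk: "P k = 1" using r by (simp add: k_def P_scaleR)
  have nk: "numrange k <= 0" "numrange (- k) <= 0"
    using sublinearD(2)[OF sublinear_numrange, of "1 / P h" h]
      sublinearD(2)[OF sublinear_numrange, of "1 / P h" "- h"] r le
    by (auto simp: k_def divide_le_0_iff)
  \<comment> \<open>By convexity, a difference quotient below \<eta> at one parameter e stays below
    \<eta> at all smaller parameters, in particular at 1 / N for large N.\<close>
  have ex: "\<forall>\<^sub>F N in sequentially. P (1 + (1 / real N) *\<^sub>R x) <= 1 + \<eta> / real N"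
    if \<eta>: "0 < \<eta>" and x: "numrange x <= 0" for x \<eta>
  proof -
    have "\<exists>e>0. (P (1 + e *\<^sub>R x) - 1) / e < \<eta>"
    proof (rule ccontr)
      assume "\<not> ?thesis"
      then have "\<eta> <= (P (1 + e *\<^sub>R x) - 1) / e" if "0 < e" for e using that not_less by blast
      then have "\<eta> <= numrange x" by (rule numrange_greatest)
      with x \<eta> show False by simp
    qed
    then obtain e where e: "0 < e" "P (1 + e *\<^sub>R x) - 1 < \<eta> * e" by (auto simp: field_simps)
    obtain N0 where N0: "1 / e < real N0" using reals_Archimedean2 by blast
    show ?thesis unfolding eventually_sequentially
    proof (intro exI[of _ N0] allI impI)
      fix N assume "N0 <= N"
      with N0 have N: "1 / e < real N" by simp
      with e have Np: "0 < real N" by (meson divide_pos_pos less_trans zero_less_one)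
      define a where "a = 1 / (real N * e)"
      have a: "0 < a" "a <= 1" using N Np e by (auto simp: a_def field_simps)
      have ae: "a * e = 1 / real N" using e by (simp add: a_def)
      have "1 + (1 / real N) *\<^sub>R x = (1 - a) *\<^sub>R 1 + a *\<^sub>R (1 + e *\<^sub>R x)"
        by (simp add: algebra_simps ae)
      then have "P (1 + (1 / real N) *\<^sub>R x) <= (1 - a) + a * P (1 + e *\<^sub>R x)"
        using P_triangle[of "(1 - a) *\<^sub>R 1" "a *\<^sub>R (1 + e *\<^sub>R x)"] a P_one
        by (simp add: P_scaleR del: scaleR_add_right)
      also have "... = 1 + a * (P (1 + e *\<^sub>R x) - 1)" by (simp add: algebra_simps)
      also have "... <= 1 + a * (\<eta> * e)" using e a by (intro add_left_mono mult_left_mono) auto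
      also have "... = 1 + \<eta> / real N" using ae by (simp add: algebra_simps)
      finally show "P (1 + (1 / real N) *\<^sub>R x) <= 1 + \<eta> / real N" .
    qed
  qed
  \<comment> \<open>Chosen so that exp (2 \<eta>) = 1.05 bounds the norms of E E and F F.\<close>
  define \<eta> :: real where "\<eta> = ln (105 / 100) / 2"
  have \<eta>: "0 < \<eta>" by (simp add: \<eta>_def)
  have "(%N. (1 + 1 / real N) ^ N) \<longlonglongrightarrow> exp 1" "(%N. (1 + (- 1) / real N) ^ N) \<longlonglongrightarrow> exp (- 1)"
    by (rule tendsto_exp_limit_sequentially)+
  then have "(%N. ((1 + 1 / real N) ^ N - (1 + (- 1) / real N) ^ N) / 2) \<longlonglongrightarrow> (exp 1 - exp (- 1)) / 2"
    by (intro tendsto_intros) auto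
  moreover have "(exp 1 - exp (- 1)) / 2 < (1265 / 1000 :: real)"
  proof -
    have "inverse (287 / 100) <= inverse (exp (1::real))"
      by (rule le_imp_inverse_le[OF exp_one_le]) simp
    then show ?thesis using exp_one_le by (simp add: exp_minus)
  qed
  ultimately have s: "\<forall>\<^sub>F N in sequentially.
      ((1 + 1 / real N) ^ N - (1 + (- 1) / real N) ^ N) / 2 < 1265 / 1000"
    by (rule order_tendstoD)
  have "(%N. exp (1 / real N)) \<longlonglongrightarrow> exp 0"
    by (intro tendsto_intros lim_1_over_n)
  then have t: "\<forall>\<^sub>F N in sequentially. exp (1 / real N) < 101 / 100"
    by (rule order_tendstoD) simp
  have "\<forall>\<^sub>F N in sequentially. False"
    using ex[OF \<eta> nk(1)] ex[OF \<eta> nk(2)] s t eventually_gt_at_top[of 0]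
  proof eventually_elim
    case (elim N)
    define y where "y = (1 / real N) *\<^sub>R k"
    have Ny: "real N *\<^sub>R y = k" using elim by (simp add: y_def)
    have Py: "P y = 1 / real N" by (simp add: y_def P_scaleR Pk)
    have sty: "st y = y" by (simp add: y_def st_simps stk)
    define E where "E = (1 + y) ^ N"
    define F where "F = (1 - y) ^ N"
    define S where "S = (1/2) *\<^sub>R (E - F)"
    have stE: "st E = E" "st F = F" by (simp_all add: E_def F_def st_simps sty)
    then have stS: "st S = S" by (simp add: S_def st_simps)
    have pw: "P z ^ N <= exp \<eta>" if "P z <= 1 + \<eta> / real N" for z
    proof -
      have "P z ^ N <= (1 + \<eta> / real N) ^ N" using that by (intro power_mono) (auto simp: P_nonneg)
      also have "... <= exp (\<eta> / real N) ^ N"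
        using \<eta> by (intro power_mono exp_ge_add_one_self) (auto intro: add_nonneg_nonneg)
      also have "... = exp \<eta>" using elim by (simp flip: exp_of_nat_mult)
      finally show ?thesis .
    qed
    have PE: "P E <= exp \<eta>" unfolding E_def
      by (rule order_trans[OF P_power pw]) (use elim in "simp add: y_def")
    have PF: "P F <= exp \<eta>" unfolding F_def
      by (rule order_trans[OF P_power pw]) (use elim in "simp add: y_def")
    have sq: "P (z * z) <= 105 / 100" if "P z <= exp \<eta>" for z
    proof -
      have "P (z * z) <= exp \<eta> * exp \<eta>"
        by (rule order_trans[OF P_mult mult_mono]) (use that P_nonneg in auto)
      also have "... = 105 / 100" by (simp add: \<eta>_def flip: exp_add)
      finally show ?thesis .
    qed
    have comm: "(1 + y) * (1 - y) = (1 - y) * (1 + y)" by (simp add: algebra_simps)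
    have EF: "E * F = (1 - y * y) ^ N" and FE: "F * E = (1 - y * y) ^ N"
    proof -
      have p: "(1 + y) * (1 - y) = 1 - y * y" by (simp add: algebra_simps)
      show "E * F = (1 - y * y) ^ N"
        unfolding E_def F_def commuting_power_mult[OF comm] p ..
      show "F * E = (1 - y * y) ^ N"
        unfolding E_def F_def commuting_power_mult[OF comm[symmetric]] comm[symmetric] p ..
    qed
    have "P (1 - E * F) <= (1 + P (y * y)) ^ N - 1" unfolding EF by (rule P_one_minus_power)
    also have "... <= exp (1 / real N) - 1"
    proof -
      have "P (y * y) = (1 / real N)^2" using P_square[OF sty] Py by simp
      then have "(1 + P (y * y)) ^ N <= exp ((1 / real N)^2) ^ N"
        by (intro power_mono) (auto intro: exp_ge_add_one_self)
      also have "... = exp (1 / real N)" using elim by (simp add: power2_eq_square flip: exp_of_nat_mult)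
      finally show ?thesis by simp
    qed
    finally have PEF: "P (1 - E * F) <= 1 / 100" using elim by simp
    \<comment> \<open>The identity cosh (2 k) = 1 + 2 sinh^2 k, with the defect 1 - E F because E
      and F are only approximately inverse to each other.\<close>
    have eq: "1 + 2 *\<^sub>R (S * S) = (1 - E * F) + (1/2) *\<^sub>R (E * E) + (1/2) *\<^sub>R (F * F)"
      using EF FE by (simp add: S_def algebra_simps flip: scaleR_2)
    have "P (1 + 2 *\<^sub>R (S * S)) <= P (1 - E * F) + (1/2) * P (E * E) + (1/2) * P (F * F)"
      unfolding eq using P_triangle[of "(1 - E * F) + (1/2) *\<^sub>R (E * E)" "(1/2) *\<^sub>R (F * F)"]
        P_triangle[of "1 - E * F" "(1/2) *\<^sub>R (E * E)"] by (simp add: P_scaleR)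
    also have "... <= 106 / 100" using PEF sq[OF PE] sq[OF PF] by simp
    finally have up: "P (1 + 2 *\<^sub>R (S * S)) <= 106 / 100" .
    define g where "g = I * S"
    have SI: "S * I = I * S" by (rule I_central)
    have stg: "st g = - g" by (simp add: g_def st_simps stS SI)
    have gg: "g * g = - (S * S)"
    proof -
      have "g * g = I * (S * I) * S" by (simp add: g_def mult.assoc)
      then show ?thesis by (simp only: SI mult.assoc) (simp add: I_I)
    qed
    \<comment> \<open>Here \<open>st w * w\<close> is 1 + 2 S^2, while the skew-adjoint part of w is
      sqrt 2 I S; hence sqrt 2 \<open>P S\<close> is at most \<open>P w\<close>.\<close>
    define w where "w = 1 + sqrt 2 *\<^sub>R g"
    have stw: "st w = 1 - sqrt 2 *\<^sub>R g" by (simp add: w_def st_simps stg)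
    have "st w * w = 1 + 2 *\<^sub>R (S * S)" unfolding stw by (simp add: w_def algebra_simps gg)
    then have Pw: "(P w)^2 <= 106 / 100" using P_star[of w] up by simp
    have "(2 * sqrt 2) *\<^sub>R g = w - st w"
      unfolding stw by (simp add: w_def flip: scaleR_add_left)
    then have "2 * sqrt 2 * P S <= 2 * P w"
      using P_diff[of w "st w"] P_scaleR[of "2 * sqrt 2" g] by (simp add: P_st g_def P_I)
    then have "(sqrt 2 * P S)^2 <= (P w)^2" by (intro power_mono) (auto simp: P_nonneg)
    with Pw have PS: "2 * (P S)^2 <= 106 / 100" by (simp add: power_mult_distrib)
    have "P (S - real N *\<^sub>R y) <= ((1 + P y) ^ N - (1 - P y) ^ N) / 2 - real N * P y"
      unfolding S_def E_def F_def by (rule P_odd_part)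
    also have "... <= 1265 / 1000 - 1" using elim by (simp add: Py)
    finally have "P (S - k) <= 265 / 1000" by (simp add: Ny)
    then have "735 / 1000 <= P S"
      using P_diff[of S "S - k"] Pk by simp
    \<comment> \<open>The contradiction is numerical: 2 times 0.735^2 is 1.08045, which exceeds
      1.06.\<close>
    then have "(735 / 1000)^2 <= (P S)^2" by (intro power_mono) auto
    with PS show False by (simp add: power2_eq_square)
  qed
  then show False by simp
qed

text \<open>Every value of \<open>numrange\<close> is attained by a state. If no state were positive
  at h = \<open>st c * c\<close>, then \<open>numrange h\<close> would be at most 0;
  \<open>numrange (- h)\<close> is at most 0 because states are nonnegative at h. Vanishing in both
  directions forces the norm of h to be 0.\<close>

theorem state_exists:
  assumes "0 < P c"
  shows "\<exists>f. state f \<and> 0 < f (st c * c)"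
proof (rule ccontr)
  assume no: "\<not> ?thesis"
  define h where "h = st c * c"
  have att: "\<exists>f. state f \<and> f x = numrange x" for x
    using sublinear_attained_by_linear[OF sublinear_numrange, of x] unfolding state_def by blast
  have sth: "st h = h" by (simp add: h_def st_simps)
  obtain f where f: "state f" "f h = numrange h" using att by blast
  then have 1: "numrange h <= 0" using no unfolding h_def by (metis not_less)
  obtain g where g: "state g" "g (- h) = numrange (- h)" using att by blast
  then have 2: "numrange (- h) <= 0"
    using state_positive[OF g(1), of c] linear_neg[OF state_linear[OF g(1)], of h] by (simp add: h_def)
  have "P h = 0" by (rule numrange_zero_imp_P_zero[OF sth 1 2])
  then show False using assms by (simp add: h_def P_star)
qed

end

section \<open>Star-algebras given by records\<close>

lemma single_apply: "single s t = (if t = s then 1 else 0)"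
  by (simp add: Defs.single_def)

lemma complex_ring_simps [simp]:
  "carrier complex_ring = UNIV" "mult complex_ring = (*)" "one complex_ring = 1"
  "zero complex_ring = 0" "add complex_ring = (+)"
  by (simp_all add: complex_ring_def)

lemma cring_complex_ring: "cring complex_ring"
proof (rule cringI)
  show "abelian_group complex_ring"
    by (rule abelian_groupI) (auto intro: exI[of _ "- x" for x] simp: algebra_simps add_eq_0_iff)
  show "comm_monoid complex_ring" by (rule comm_monoidI) (auto simp: algebra_simps)
qed (auto simp: algebra_simps)

text \<open>Additive inverses are supplied by scalar multiplication with - 1.\<close>

lemma star_algebraI:
  fixes A (structure)
  assumes add: "!!x y. x : carrier A ==> y : carrier A ==> x \<oplus> y : carrier A"
      "\<zero> : carrier A"
      "!!x y z. x : carrier A ==> y : carrier A ==> z : carrier A ==> (x \<oplus> y) \<oplus> z = x \<oplus> (y \<oplus> z)"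
      "!!x y. x : carrier A ==> y : carrier A ==> x \<oplus> y = y \<oplus> x"
      "!!x. x : carrier A ==> \<zero> \<oplus> x = x"
    and smult: "!!c x. x : carrier A ==> c \<odot> x : carrier A"
      "!!a b x. x : carrier A ==> (a + b) \<odot> x = a \<odot> x \<oplus> b \<odot> x"
      "!!a x y. x : carrier A ==> y : carrier A ==> a \<odot> (x \<oplus> y) = a \<odot> x \<oplus> a \<odot> y"
      "!!a b x. x : carrier A ==> (a * b) \<odot> x = a \<odot> (b \<odot> x)"
      "!!x. x : carrier A ==> 1 \<odot> x = x"
      "!!x. x : carrier A ==> 0 \<odot> x = \<zero>"
    and ax: "star_algebra_axioms A"
  shows "star_algebra A"
proof -
  have "abelian_group A"
  proof (rule abelian_groupI)
    fix x assume x: "x : carrier A"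
    have "(- 1) \<odot> x \<oplus> x = (- 1 + 1) \<odot> x" using x smult(2)[OF x, of "- 1" 1] smult(5) by simp
    then show "\<exists>y\<in>carrier A. y \<oplus> x = \<zero>" using x smult by (intro bexI[of _ "(- 1) \<odot> x"]) auto
  qed (use add in auto)
  then have "module complex_ring A"
    by (intro moduleI cring_complex_ring) (use smult in auto)
  then show ?thesis using ax by (simp add: star_algebra_def)
qed

context star_algebra
begin

lemma s_closed [simp]: "x : carrier A ==> c \<odot> x : carrier A"
  using smult_closed[of c x] by simp

lemma s_add_left: "x : carrier A ==> (a + b) \<odot> x = a \<odot> x \<oplus> b \<odot> x"
  using smult_l_distr[of a b x] by simp

lemma s_add_right: "x : carrier A ==> y : carrier A ==> a \<odot> (x \<oplus> y) = a \<odot> x \<oplus> a \<odot> y"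
  using smult_r_distr[of a x y] by simp

lemma s_assoc: "x : carrier A ==> a \<odot> (b \<odot> x) = (a * b) \<odot> x"
  using smult_assoc1[of a b x] by simp

lemma s_one [simp]: "x : carrier A ==> 1 \<odot> x = x"
  using smult_one[of x] by simp

lemma s_zero_left [simp]: "x : carrier A ==> 0 \<odot> x = \<zero>"
  using smult_l_null[of x] by simp

lemma s_zero_right [simp]: "c \<odot> \<zero> = \<zero>"
  using smult_r_null[of c] by simp

lemma a_inv_eq: "x : carrier A ==> \<ominus> x = (- 1) \<odot> x"
proof -
  assume x: "x : carrier A"
  have "(- 1) \<odot> x \<oplus> x = \<zero>" using s_add_left[OF x, of "- 1" 1] x by simp
  then show ?thesis using x by (intro M.minus_equality) auto
qed

lemma minus_eq_s: "x : carrier A ==> y : carrier A ==> x \<ominus> y = x \<oplus> (- 1) \<odot> y"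
  by (simp add: a_minus_def a_inv_eq)

lemma minus_zero_iff: "x : carrier A ==> y : carrier A ==> x \<ominus> y = \<zero> \<longleftrightarrow> x = y"
  by (metis M.r_neg M.a_inv_closed M.add.inv_unique' M.minus_eq M.minus_minus M.add.inv_comm)

lemma minus_self [simp]: "x : carrier A ==> x \<ominus> x = \<zero>"
  by (simp add: minus_zero_iff)

lemma m_zero_left [simp]: "x : carrier A ==> \<zero> \<otimes> x = \<zero>"
  using smult_mult_left[of \<zero> x 0] mult_closed by simp

lemma m_zero_right [simp]: "x : carrier A ==> x \<otimes> \<zero> = \<zero>"
  using smult_mult_right[of x \<zero> 0] mult_closed by simp

lemma star_zero [simp]: "\<zero>\<^sup>\<star> = \<zero>"
  using star_smult[of \<zero> 0] star_closed by simp

lemmas closed [simp] = mult_closed star_closed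

lemma minus_mult_left: "x : carrier A ==> y : carrier A ==> z : carrier A ==>
    (x \<ominus> y) \<otimes> z = x \<otimes> z \<ominus> y \<otimes> z"
  by (simp add: minus_eq_s distrib_right smult_mult_left)

lemma minus_mult_right: "x : carrier A ==> y : carrier A ==> z : carrier A ==>
    z \<otimes> (x \<ominus> y) = z \<otimes> x \<ominus> z \<otimes> y"
  by (simp add: minus_eq_s distrib_left smult_mult_right)

lemma star_minus: "x : carrier A ==> y : carrier A ==> (x \<ominus> y)\<^sup>\<star> = x\<^sup>\<star> \<ominus> y\<^sup>\<star>"
  by (simp add: minus_eq_s star_add star_smult)

lemma s_minus: "x : carrier A ==> y : carrier A ==> c \<odot> (x \<ominus> y) = c \<odot> x \<ominus> c \<odot> y"
  by (simp add: minus_eq_s s_add_right s_assoc mult.commute)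

lemma add_minus_add: "x : carrier A ==> y : carrier A ==> z : carrier A ==> w : carrier A ==>
    (x \<oplus> y) \<ominus> (z \<oplus> w) = (x \<ominus> z) \<oplus> (y \<ominus> w)"
  by (simp add: minus_eq_s s_add_right M.a_ac)

lemma minus_minus_trans: "x : carrier A ==> y : carrier A ==> z : carrier A ==>
    x \<ominus> z = (x \<ominus> y) \<oplus> (y \<ominus> z)"
proof -
  assume c: "x : carrier A" "y : carrier A" "z : carrier A"
  have "(- 1) \<odot> y \<oplus> y = \<zero>" using s_add_left[of y "- 1" 1] c by simp
  then have "(- 1) \<odot> y \<oplus> (y \<oplus> (- 1) \<odot> z) = (- 1) \<odot> z" using c by (simp flip: M.a_assoc)
  then show ?thesis using c by (simp add: minus_eq_s M.a_assoc)
qed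

lemma minus_add_cancel: "x : carrier A ==> y : carrier A ==> (x \<ominus> y) \<oplus> y = x"
proof -
  assume c: "x : carrier A" "y : carrier A"
  have "(- 1) \<odot> y \<oplus> y = \<zero>" using s_add_left[of y "- 1" 1] c by simp
  then show ?thesis using c by (simp add: minus_eq_s M.a_assoc)
qed

lemma mult_minus_mult: "x : carrier A ==> y : carrier A ==> z : carrier A ==> w : carrier A ==>
    x \<otimes> y \<ominus> z \<otimes> w = (x \<ominus> z) \<otimes> y \<oplus> z \<otimes> (y \<ominus> w)"
  by (simp add: minus_mult_left minus_mult_right flip: minus_minus_trans)

lemma finsum_cl: "(!!i. i : T ==> m i : carrier A) ==> (\<Oplus>i\<in>T. m i) : carrier A"
  by (rule M.finsum_closed) auto

lemma finsum_ins: "finite T ==> j ~: T ==> (!!i. i : insert j T ==> m i : carrier A) ==>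
    (\<Oplus>i\<in>insert j T. m i) = m j \<oplus> (\<Oplus>i\<in>T. m i)"
  by (rule M.finsum_insert) auto

lemma finsum_mult_left: "finite T ==> (!!i. i : T ==> m i : carrier A) ==> x : carrier A ==>
    x \<otimes> (\<Oplus>i\<in>T. m i) = (\<Oplus>i\<in>T. x \<otimes> m i)"
  by (induction T rule: finite_induct) (simp_all add: finsum_ins finsum_cl distrib_left)

lemma finsum_mult_right: "finite T ==> (!!i. i : T ==> m i : carrier A) ==> x : carrier A ==>
    (\<Oplus>i\<in>T. m i) \<otimes> x = (\<Oplus>i\<in>T. m i \<otimes> x)"
  by (induction T rule: finite_induct) (simp_all add: finsum_ins finsum_cl distrib_right)

lemma finsum_star: "finite T ==> (!!i. i : T ==> m i : carrier A) ==>
    (\<Oplus>i\<in>T. m i)\<^sup>\<star> = (\<Oplus>i\<in>T. (m i)\<^sup>\<star>)"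
  by (induction T rule: finite_induct) (simp_all add: finsum_ins finsum_cl star_add)

lemma finsum_single: "finite T ==> j : T ==> m j : carrier A ==> (!!i. i : T ==> i ~= j ==> m i = \<zero>) ==>
    (\<Oplus>i\<in>T. m i) = m j"
proof -
  assume a: "finite T" "j : T" "m j : carrier A" "!!i. i : T ==> i ~= j ==> m i = \<zero>"
  have "(\<Oplus>i\<in>insert j (T - {j}). m i) = m j \<oplus> (\<Oplus>i\<in>T - {j}. m i)"
    by (rule finsum_ins) (use a in "auto, metis M.zero_closed")
  also have "(\<Oplus>i\<in>T - {j}. m i) = (\<Oplus>i\<in>T - {j}. \<zero>)"
    by (rule M.finsum_cong') (use a in auto)
  finally show ?thesis using a by (simp add: insert_absorb)
qed

text \<open>Linear extension of a map m on basis elements to formal finite combinations; the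
  homomorphisms out of free algebras are built in this way.\<close>

definition lin :: "('s => complex) => ('s => 'a) => 'a" where
  "lin f m = (\<Oplus>s\<in>{s. f s ~= 0}. f s \<odot> m s)"

lemma lin_superset:
  assumes "finite T" "!!s. s ~: T ==> f s = 0" "!!s. s : T ==> m s : carrier A"
  shows "lin f m = (\<Oplus>s\<in>T. f s \<odot> m s)"
  unfolding lin_def
  by (rule M.add.finprod_mono_neutral_cong_left) (use assms in auto)

lemma lin_closed [simp]: "(!!s. f s ~= 0 ==> m s : carrier A) ==> lin f m : carrier A"
  unfolding lin_def by (rule finsum_cl) auto

lemma lin_cong: "(!!s. f s ~= 0 ==> m s : carrier A) ==> (!!s. f s ~= 0 ==> m s = m' s) ==> lin f m = lin f m'"
  unfolding lin_def by (rule M.finsum_cong') auto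

lemma lin_zero [simp]: "lin (%s. 0) m = \<zero>"
  by (simp add: lin_def)

lemma lin_add:
  assumes "finite {s. f s ~= 0}" "finite {s. g s ~= 0}"
    and "!!s. f s ~= 0 ==> m s : carrier A" "!!s. g s ~= 0 ==> m s : carrier A"
  shows "lin (%s. f s + g s) m = lin f m \<oplus> lin g m"
proof -
  define T where "T = {s. f s ~= 0} \<union> {s. g s ~= 0}"
  have T: "finite T" "!!s. s : T ==> m s : carrier A" using assms by (auto simp: T_def)
  have "lin (%s. f s + g s) m = (\<Oplus>s\<in>T. (f s + g s) \<odot> m s)"
    by (rule lin_superset) (use T in "auto simp: T_def")
  also have "... = (\<Oplus>s\<in>T. f s \<odot> m s \<oplus> g s \<odot> m s)"
    by (rule M.finsum_cong') (use T in "auto simp: s_add_left")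
  also have "... = (\<Oplus>s\<in>T. f s \<odot> m s) \<oplus> (\<Oplus>s\<in>T. g s \<odot> m s)"
    by (rule M.finsum_addf) (use T in auto)
  also have "(\<Oplus>s\<in>T. f s \<odot> m s) = lin f m"
    by (rule lin_superset[symmetric]) (use T in "auto simp: T_def")
  also have "(\<Oplus>s\<in>T. g s \<odot> m s) = lin g m"
    by (rule lin_superset[symmetric]) (use T in "auto simp: T_def")
  finally show ?thesis .
qed

lemma lin_smult:
  assumes "finite {s. f s ~= 0}" "!!s. f s ~= 0 ==> m s : carrier A"
  shows "lin (%s. c * f s) m = c \<odot> lin f m"
proof -
  have "lin (%s. c * f s) m = (\<Oplus>s\<in>{s. f s ~= 0}. (c * f s) \<odot> m s)"
    by (rule lin_superset) (use assms in auto)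
  also have "... = (\<Oplus>s\<in>{s. f s ~= 0}. c \<odot> (f s \<odot> m s))"
    by (rule M.finsum_cong') (use assms in "auto simp: s_assoc")
  also have "... = c \<odot> lin f m" unfolding lin_def
    using finsum_smult_ldistr[of "{s. f s ~= 0}" c "%s. f s \<odot> m s"] assms by auto
  finally show ?thesis .
qed

lemma lin_single [simp]: "m s : carrier A ==> lin (single s) m = m s"
  using lin_superset[of "{s}" "single s" m] by (simp add: single_apply)

end

lemma finsupp_induct [consumes 2, case_names zero add]:
  assumes fin: "finite {s. f s ~= (0::complex)}" and sub: "{s. f s ~= 0} \<subseteq> C"
    and zero: "Q (%s. 0)"
    and step: "!!c s g. finite {s. g s ~= 0} ==> {s. g s ~= 0} \<subseteq> C ==> s : C ==> Q g ==>
      Q (%t. c * single s t + g t)"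
  shows "Q f"
proof -
  have "\<forall>f. {s. f s ~= 0} \<subseteq> T --> Q f" if "finite T" "T \<subseteq> C" for T
    using that
  proof (induction T rule: finite_induct)
    case empty
    show ?case
    proof (intro allI impI)
      fix f :: "'a => complex" assume "{s. f s ~= 0} \<subseteq> {}"
      then have "f = (%s. 0)" by auto
      then show "Q f" using zero by simp
    qed
  next
    case (insert s T)
    show ?case
    proof (intro allI impI)
      fix f :: "'a => complex" assume f: "{s. f s ~= 0} \<subseteq> insert s T"
      define g where "g = f(s := 0)"
      have g: "{s. g s ~= 0} \<subseteq> T" using f by (auto simp: g_def)
      have "Q (%t. f s * single s t + g t)"
      proof (rule step)
        show "finite {s. g s ~= 0}" using finite_subset[OF g insert.hyps(1)] .
      qed (use g insert in auto)
      moreover have "(%t. f s * single s t + g t) = f" by (auto simp: g_def single_apply)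
      ultimately show "Q f" by simp
    qed
  qed
  then show ?thesis using fin sub by blast
qed

section \<open>Semigroup algebras\<close>

text \<open>Finitely supported functions are compared by pairing them with arbitrary functions m.
  Convolution and involution become nested pairings, so that by \<open>pairing_ext\<close> the laws
  of the semigroup algebra reduce to laws of the semigroup.\<close>

definition pairing :: "('s => complex) => ('s => complex) => complex" where
  "pairing f m = (\<Sum>s | f s ~= 0. f s * m s)"

lemma pairing_superset:
  assumes "finite T" "!!s. s ~: T ==> f s = 0"
  shows "pairing f m = (\<Sum>s\<in>T. f s * m s)"
  unfolding pairing_def by (rule sum.mono_neutral_left) (use assms in auto)

lemma pairing_cong: "(!!s. f s ~= 0 ==> m s = m' s) ==> pairing f m = pairing f m'"
  unfolding pairing_def by (rule sum.cong) auto

lemma pairing_zero [simp]: "pairing (%s. 0) m = 0"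
  by (simp add: pairing_def)

lemma pairing_single [simp]: "pairing (single s) m = m s"
  using pairing_superset[of "{s}" "single s" m] by (simp add: single_apply)

lemma pairing_add:
  assumes "finite {s. f s ~= 0}" "finite {s. g s ~= 0}"
  shows "pairing (%s. f s + g s) m = pairing f m + pairing g m"
proof -
  define T where "T = {s. f s ~= 0} \<union> {s. g s ~= 0}"
  have T: "finite T" using assms by (simp add: T_def)
  show ?thesis
    by (subst (1 2 3) pairing_superset[OF T]) (auto simp: T_def algebra_simps sum.distrib)
qed

lemma pairing_smult: "pairing (%s. c * f s) m = c * pairing f m"
  by (cases "c = 0") (simp_all add: pairing_def sum_distrib_left mult.assoc)

lemma pairing_add_right: "pairing f (%s. m s + m' s) = pairing f m + pairing f m'"
  by (simp add: pairing_def algebra_simps sum.distrib)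

lemma pairing_smult_right: "pairing f (%s. c * m s) = c * pairing f m"
  by (simp add: pairing_def sum_distrib_left algebra_simps)

lemma pairing_swap: "pairing f (%s. pairing g (%t. m s t)) = pairing g (%t. pairing f (%s. m s t))"
  unfolding pairing_def sum_distrib_left by (subst sum.swap) (simp add: algebra_simps)

lemma pairing_indicator: "finite {s. f s ~= 0} ==> pairing f (%s. if s = z then 1 else 0) = f z"
  by (simp add: pairing_def if_distrib[of "(*) _"] sum.delta' cong: if_cong)

lemma pairing_ext:
  assumes "finite {s. f s ~= 0}" "finite {s. g s ~= 0}" "!!m. pairing f m = pairing g m"
  shows "f = g"
  using assms pairing_indicator by (metis ext)

locale involutive_semigroup =
  fixes S :: "('s, 'm) monoid_scheme" (structure) and i :: "'s => 's"
  assumes sg_closed: "s : carrier S ==> t : carrier S ==> s \<otimes> t : carrier S"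
    and sg_assoc: "s : carrier S ==> t : carrier S ==> r : carrier S ==> (s \<otimes> t) \<otimes> r = s \<otimes> (t \<otimes> r)"
    and inv_closed: "s : carrier S ==> i s : carrier S"
    and inv_inv: "s : carrier S ==> i (i s) = s"
    and inv_mult: "s : carrier S ==> t : carrier S ==> i (s \<otimes> t) = i t \<otimes> i s"
begin

abbreviation "\<A> == semigroup_star_alg S i"

lemma alg_simps:
  "zero \<A> = (%s. 0)" "one \<A> = single \<one>" "add \<A> = (%f g s. f s + g s)" "smult \<A> = (%c f s. c * f s)"
  by (simp_all add: semigroup_star_alg_def)

lemma alg_carrier: "f : carrier \<A> \<longleftrightarrow> finite {s. f s ~= 0} \<and> {s. f s ~= 0} \<subseteq> carrier S"
  by (simp add: semigroup_star_alg_def)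

lemma alg_finite: "f : carrier \<A> ==> finite {s. f s ~= 0}"
  by (simp add: alg_carrier)

lemma alg_support: "f : carrier \<A> ==> f s ~= 0 ==> s : carrier S"
  by (auto simp: alg_carrier)

lemma single_carrier: "s : carrier S ==> single s : carrier \<A>"
  by (simp add: alg_carrier single_apply)

lemma alg_add_closed:
  assumes f: "f : carrier \<A>" and g: "g : carrier \<A>"
  shows "(%s. f s + g s) : carrier \<A>"
proof -
  have sub: "{s. f s + g s ~= 0} \<subseteq> {s. f s ~= 0} \<union> {s. g s ~= 0}" by auto
  have "finite {s. f s + g s ~= 0}" by (rule finite_subset[OF sub]) (use f g in "simp add: alg_finite")
  with sub f g show ?thesis unfolding alg_carrier by blast
qed

lemma alg_smult_closed: "f : carrier \<A> ==> (%s. c * f s) : carrier \<A>"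
  unfolding alg_carrier by (auto intro: finite_subset[of _ "{s. f s ~= 0}"])

lemma mult_pairing:
  assumes "finite {s. f s ~= 0}" "finite {s. g s ~= 0}"
  shows "(f \<otimes>\<^bsub>\<A>\<^esub> g) z = pairing f (%s. pairing g (%t. if s \<otimes> t = z then 1 else 0))"
proof -
  have "(f \<otimes>\<^bsub>\<A>\<^esub> g) z = (\<Sum>(s, t)\<in>{(s, t). f s ~= 0 \<and> g t ~= 0 \<and> s \<otimes> t = z}. f s * g t)"
    by (simp add: semigroup_star_alg_def)
  also have "... = (\<Sum>(s, t)\<in>{s. f s ~= 0} \<times> {t. g t ~= 0}. f s * (g t * (if s \<otimes> t = z then 1 else 0)))"
    by (rule sum.mono_neutral_cong_left) (use assms in "auto split: if_splits")
  also have "... = pairing f (%s. pairing g (%t. if s \<otimes> t = z then 1 else 0))"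
    by (simp add: pairing_def sum_distrib_left sum.cartesian_product)
  finally show ?thesis .
qed

lemma mult_closed':
  assumes "f : carrier \<A>" "g : carrier \<A>"
  shows "f \<otimes>\<^bsub>\<A>\<^esub> g : carrier \<A>"
proof -
  have sub: "{z. (f \<otimes>\<^bsub>\<A>\<^esub> g) z ~= 0} \<subseteq> (%(s, t). s \<otimes> t) ` ({s. f s ~= 0} \<times> {t. g t ~= 0})"
  proof
    fix z assume z: "z : {z. (f \<otimes>\<^bsub>\<A>\<^esub> g) z ~= 0}"
    show "z : (%(s, t). s \<otimes> t) ` ({s. f s ~= 0} \<times> {t. g t ~= 0})"
    proof (rule ccontr)
      assume n: "\<not> ?thesis"
      have "{(s, t). f s ~= 0 \<and> g t ~= 0 \<and> s \<otimes> t = z} = {}" using n by force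
      then have "(f \<otimes>\<^bsub>\<A>\<^esub> g) z = (\<Sum>(s, t)\<in>{}. f s * g t)"
        unfolding semigroup_star_alg_def by (simp only: monoid.simps)
      then have "(f \<otimes>\<^bsub>\<A>\<^esub> g) z = 0" by simp
      with z show False by simp
    qed
  qed
  moreover have "finite ((%(s, t). s \<otimes> t) ` ({s. f s ~= 0} \<times> {t. g t ~= 0}))"
    using assms by (simp add: alg_finite)
  moreover have "(%(s, t). s \<otimes> t) ` ({s. f s ~= 0} \<times> {t. g t ~= 0}) \<subseteq> carrier S"
    using assms sg_closed by (auto dest: alg_support)
  ultimately show ?thesis unfolding alg_carrier by (meson finite_subset subset_trans)
qed

lemma pairing_mult:
  assumes "f : carrier \<A>" "g : carrier \<A>"
  shows "pairing (f \<otimes>\<^bsub>\<A>\<^esub> g) m = pairing f (%s. pairing g (%t. m (s \<otimes> t)))"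
proof -
  note fin = alg_finite[OF assms(1)] alg_finite[OF assms(2)]
  define T where "T = {z. (f \<otimes>\<^bsub>\<A>\<^esub> g) z ~= 0} \<union> (%(s, t). s \<otimes> t) ` ({s. f s ~= 0} \<times> {t. g t ~= 0})"
  have T: "finite T" using fin alg_finite[OF mult_closed'[OF assms]] by (simp add: T_def)
  have "pairing (f \<otimes>\<^bsub>\<A>\<^esub> g) m = (\<Sum>z\<in>T. pairing f (%s. pairing g (%t. if s \<otimes> t = z then 1 else 0)) * m z)"
    using pairing_superset[OF T, of "f \<otimes>\<^bsub>\<A>\<^esub> g" m] by (simp add: T_def mult_pairing[OF fin])
  also have "... = (\<Sum>z\<in>T. \<Sum>s | f s ~= 0. \<Sum>t | g t ~= 0.
      f s * (g t * (if s \<otimes> t = z then m z else 0)))"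
    unfolding pairing_def sum_distrib_left sum_distrib_right by (intro sum.cong refl) simp
  also have "... = (\<Sum>s | f s ~= 0. \<Sum>z\<in>T. \<Sum>t | g t ~= 0.
      f s * (g t * (if s \<otimes> t = z then m z else 0)))"
    by (rule sum.swap)
  also have "... = (\<Sum>s | f s ~= 0. \<Sum>t | g t ~= 0. \<Sum>z\<in>T.
      f s * (g t * (if s \<otimes> t = z then m z else 0)))"
    by (intro sum.cong refl sum.swap)
  also have "... = (\<Sum>s | f s ~= 0. \<Sum>t | g t ~= 0. f s * (g t * m (s \<otimes> t)))"
  proof (intro sum.cong refl)
    fix s t assume st: "s : {s. f s ~= 0}" "t : {t. g t ~= 0}"
    then have "s \<otimes> t : T" by (auto simp: T_def)
    then have "(\<Sum>z\<in>T. (if s \<otimes> t = z then m z else 0)) = m (s \<otimes> t)" using T by simp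
    then show "(\<Sum>z\<in>T. f s * (g t * (if s \<otimes> t = z then m z else 0))) = f s * (g t * m (s \<otimes> t))"
      by (simp flip: sum_distrib_left)
  qed
  finally show ?thesis by (simp add: pairing_def sum_distrib_left)
qed

lemma star_closed':
  assumes "f : carrier \<A>" shows "f\<^sup>\<star>\<^bsub>\<A>\<^esub> : carrier \<A>"
proof -
  have sub: "{t. (f\<^sup>\<star>\<^bsub>\<A>\<^esub>) t ~= 0} \<subseteq> i ` {s. f s ~= 0}"
  proof
    fix t assume t: "t : {t. (f\<^sup>\<star>\<^bsub>\<A>\<^esub>) t ~= 0}"
    show "t : i ` {s. f s ~= 0}"
    proof (rule ccontr)
      assume "\<not> ?thesis"
      then have "{s. f s ~= 0 \<and> i s = t} = {}" by blast
      then have "(f\<^sup>\<star>\<^bsub>\<A>\<^esub>) t = (\<Sum>s\<in>{}. cnj (f s))"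
        unfolding semigroup_star_alg_def by (simp only: star_alg.simps)
      then have "(f\<^sup>\<star>\<^bsub>\<A>\<^esub>) t = 0" by simp
      with t show False by simp
    qed
  qed
  moreover have "i ` {s. f s ~= 0} \<subseteq> carrier S" using assms inv_closed by (auto dest: alg_support)
  ultimately show ?thesis using assms unfolding alg_carrier
    by (meson finite_imageI finite_subset subset_trans)
qed

lemma pairing_star:
  assumes "f : carrier \<A>"
  shows "pairing (f\<^sup>\<star>\<^bsub>\<A>\<^esub>) m = cnj (pairing f (%s. cnj (m (i s))))"
proof -
  have inj: "inj_on i {s. f s ~= 0}"
    by (rule inj_on_inverseI[of _ i]) (use assms inv_inv in "auto dest: alg_support")
  have val: "(f\<^sup>\<star>\<^bsub>\<A>\<^esub>) (i s) = cnj (f s)" if "f s ~= 0" for s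
  proof -
    have "{s'. f s' ~= 0 \<and> i s' = i s} = {s}" using inj that by (auto dest: inj_onD)
    then show ?thesis by (simp add: semigroup_star_alg_def)
  qed
  have zero: "(f\<^sup>\<star>\<^bsub>\<A>\<^esub>) t = 0" if "t ~: i ` {s. f s ~= 0}" for t
  proof -
    have "{s. f s ~= 0 \<and> i s = t} = {}" using that by blast
    then have "(f\<^sup>\<star>\<^bsub>\<A>\<^esub>) t = (\<Sum>s\<in>{}. cnj (f s))"
      unfolding semigroup_star_alg_def by (simp only: star_alg.simps)
    then show ?thesis by simp
  qed
  have "pairing (f\<^sup>\<star>\<^bsub>\<A>\<^esub>) m = (\<Sum>t\<in>i ` {s. f s ~= 0}. (f\<^sup>\<star>\<^bsub>\<A>\<^esub>) t * m t)"
    by (rule pairing_superset) (use assms zero in "auto simp: alg_finite")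
  also have "... = (\<Sum>s | f s ~= 0. cnj (f s) * m (i s))"
    by (subst sum.reindex[OF inj]) (auto intro!: sum.cong simp: val)
  finally show ?thesis by (simp add: pairing_def)
qed

lemma star_algebra: "star_algebra \<A>"
proof (rule star_algebraI)
  note cl = mult_closed' star_closed' alg_add_closed alg_smult_closed
  show "star_algebra_axioms \<A>"
  proof
    fix f g h :: "'s => complex" and c
    show "f : carrier \<A> ==> g : carrier \<A> ==> f \<otimes>\<^bsub>\<A>\<^esub> g : carrier \<A>" by (rule mult_closed')
    show "f : carrier \<A> ==> f\<^sup>\<star>\<^bsub>\<A>\<^esub> : carrier \<A>" by (rule star_closed')
    assume f: "f : carrier \<A>"
    show "(f\<^sup>\<star>\<^bsub>\<A>\<^esub>)\<^sup>\<star>\<^bsub>\<A>\<^esub> = f"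
      \<comment> \<open>Against every m, the double star reduces to \<open>inv_inv\<close> on the
        support of f.\<close>
      by (rule pairing_ext)
        (auto simp: alg_finite cl f pairing_star inv_inv alg_support[OF f] cong: pairing_cong)
    show "(c \<odot>\<^bsub>\<A>\<^esub> f)\<^sup>\<star>\<^bsub>\<A>\<^esub> = cnj c \<odot>\<^bsub>\<A>\<^esub> f\<^sup>\<star>\<^bsub>\<A>\<^esub>"
      by (rule pairing_ext) (simp_all add: alg_finite cl f alg_simps pairing_star pairing_smult)
    assume g: "g : carrier \<A>"
    show "(c \<odot>\<^bsub>\<A>\<^esub> f) \<otimes>\<^bsub>\<A>\<^esub> g = c \<odot>\<^bsub>\<A>\<^esub> (f \<otimes>\<^bsub>\<A>\<^esub> g)"
      by (rule pairing_ext) (simp_all add: alg_finite cl f g alg_simps pairing_mult pairing_smult)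
    show "f \<otimes>\<^bsub>\<A>\<^esub> (c \<odot>\<^bsub>\<A>\<^esub> g) = c \<odot>\<^bsub>\<A>\<^esub> (f \<otimes>\<^bsub>\<A>\<^esub> g)"
      by (rule pairing_ext)
        (simp_all add: alg_finite cl f g alg_simps pairing_mult pairing_smult pairing_smult_right)
    show "(f \<oplus>\<^bsub>\<A>\<^esub> g)\<^sup>\<star>\<^bsub>\<A>\<^esub> = f\<^sup>\<star>\<^bsub>\<A>\<^esub> \<oplus>\<^bsub>\<A>\<^esub> g\<^sup>\<star>\<^bsub>\<A>\<^esub>"
      by (rule pairing_ext) (simp_all add: alg_finite cl f g alg_simps pairing_star pairing_add)
    show "(f \<otimes>\<^bsub>\<A>\<^esub> g)\<^sup>\<star>\<^bsub>\<A>\<^esub> = g\<^sup>\<star>\<^bsub>\<A>\<^esub> \<otimes>\<^bsub>\<A>\<^esub> f\<^sup>\<star>\<^bsub>\<A>\<^esub>"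
    proof (rule pairing_ext)
      fix m
      have "pairing ((f \<otimes>\<^bsub>\<A>\<^esub> g)\<^sup>\<star>\<^bsub>\<A>\<^esub>) m = cnj (pairing f (%s. pairing g (%t. cnj (m (i t \<otimes> i s)))))"
        by (simp add: pairing_star pairing_mult cl f g inv_mult alg_support[OF f] alg_support[OF g]
            cong: pairing_cong)
      also have "... = cnj (pairing g (%t. pairing f (%s. cnj (m (i t \<otimes> i s)))))"
        by (subst pairing_swap) simp
      also have "... = pairing (g\<^sup>\<star>\<^bsub>\<A>\<^esub> \<otimes>\<^bsub>\<A>\<^esub> f\<^sup>\<star>\<^bsub>\<A>\<^esub>) m"
        by (simp add: pairing_star pairing_mult cl f g)
      finally show "pairing ((f \<otimes>\<^bsub>\<A>\<^esub> g)\<^sup>\<star>\<^bsub>\<A>\<^esub>) m = pairing (g\<^sup>\<star>\<^bsub>\<A>\<^esub> \<otimes>\<^bsub>\<A>\<^esub> f\<^sup>\<star>\<^bsub>\<A>\<^esub>) m" .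
    qed (simp_all add: alg_finite cl f g)
    assume h: "h : carrier \<A>"
    show "(f \<otimes>\<^bsub>\<A>\<^esub> g) \<otimes>\<^bsub>\<A>\<^esub> h = f \<otimes>\<^bsub>\<A>\<^esub> (g \<otimes>\<^bsub>\<A>\<^esub> h)"
      by (rule pairing_ext) (simp_all add: alg_finite cl f g h pairing_mult sg_assoc
          alg_support[OF f] alg_support[OF g] alg_support[OF h] cong: pairing_cong)
    show "f \<otimes>\<^bsub>\<A>\<^esub> (g \<oplus>\<^bsub>\<A>\<^esub> h) = f \<otimes>\<^bsub>\<A>\<^esub> g \<oplus>\<^bsub>\<A>\<^esub> f \<otimes>\<^bsub>\<A>\<^esub> h"
      by (rule pairing_ext)
        (simp_all add: alg_finite cl f g h alg_simps pairing_mult pairing_add pairing_add_right)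
    show "(f \<oplus>\<^bsub>\<A>\<^esub> g) \<otimes>\<^bsub>\<A>\<^esub> h = f \<otimes>\<^bsub>\<A>\<^esub> h \<oplus>\<^bsub>\<A>\<^esub> g \<otimes>\<^bsub>\<A>\<^esub> h"
      by (rule pairing_ext)
        (simp_all add: alg_finite cl f g h alg_simps pairing_mult pairing_add)
  qed
qed (simp_all add: alg_simps alg_add_closed alg_smult_closed alg_carrier[of "%s. 0"] algebra_simps)

lemma alg_induct [consumes 1, case_names zero add]:
  assumes f: "f : carrier \<A>" and z: "Q \<zero>\<^bsub>\<A>\<^esub>"
    and st: "!!a s g. g : carrier \<A> ==> s : carrier S ==> Q g ==> Q (a \<odot>\<^bsub>\<A>\<^esub> single s \<oplus>\<^bsub>\<A>\<^esub> g)"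
  shows "Q f"
  using f[unfolded alg_carrier, THEN conjunct1] f[unfolded alg_carrier, THEN conjunct2]
proof (induction f rule: finsupp_induct)
  case zero
  then show ?case using z by (simp add: alg_simps)
next
  case (add a s g)
  then show ?case using st[of g s a] by (simp add: alg_simps alg_carrier)
qed

lemma mult_single: "s : carrier S ==> t : carrier S ==> single s \<otimes>\<^bsub>\<A>\<^esub> single t = single (s \<otimes> t)"
  by (rule pairing_ext) (simp_all add: alg_finite mult_closed' single_carrier sg_closed pairing_mult)

lemma star_single: "s : carrier S ==> (single s)\<^sup>\<star>\<^bsub>\<A>\<^esub> = single (i s)"
  by (rule pairing_ext) (simp_all add: alg_finite star_closed' single_carrier inv_closed pairing_star)

end

hide_const (open) Poly_Mapping.single

section \<open>C*-seminorms on star-algebras\<close>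

locale seminormed_star_algebra = star_algebra A for A (structure) +
  fixes N :: "'a => real"
  assumes cstar_seminorm: "cstar_seminorm A N"
begin

lemma N_nonneg [simp]: "x : carrier A ==> 0 <= N x"
  using cstar_seminorm by (simp add: cstar_seminorm_def)

lemma N_smult: "x : carrier A ==> N (c \<odot> x) = cmod c * N x"
  using cstar_seminorm by (simp add: cstar_seminorm_def)

lemma N_triangle: "x : carrier A ==> y : carrier A ==> N (x \<oplus> y) <= N x + N y"
  using cstar_seminorm by (simp add: cstar_seminorm_def)

lemma N_mult: "x : carrier A ==> y : carrier A ==> N (x \<otimes> y) <= N x * N y"
  using cstar_seminorm by (simp add: cstar_seminorm_def)

lemma N_star_mult: "x : carrier A ==> N (x\<^sup>\<star> \<otimes> x) = (N x)^2"
  using cstar_seminorm by (simp add: cstar_seminorm_def)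

lemma N_zero [simp]: "N \<zero> = 0"
  using N_smult[of \<zero> 0] by simp

lemma N_star: "x : carrier A ==> N (x\<^sup>\<star>) = N x"
proof -
  have le: "N x <= N (x\<^sup>\<star>)" if x: "x : carrier A" for x
  proof (cases "N x = 0")
    case False
    then have "0 < N x" using N_nonneg[OF x] by simp
    moreover have "N x * N x <= N (x\<^sup>\<star>) * N x"
      using N_star_mult[OF x] N_mult[of "x\<^sup>\<star>" x] x by (simp add: power2_eq_square)
    ultimately show ?thesis by (simp add: mult_le_cancel_right)
  qed (simp add: x)
  assume x: "x : carrier A"
  show ?thesis using le[OF x] le[of "x\<^sup>\<star>"] x by (simp add: star_star)
qed

lemma N_minus: "x : carrier A ==> y : carrier A ==> N (x \<ominus> y) <= N x + N y"
  using N_triangle[of x "(- 1) \<odot> y"] by (simp add: minus_eq_s N_smult)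

lemma N_minus_commute: "x : carrier A ==> y : carrier A ==> N (x \<ominus> y) = N (y \<ominus> x)"
proof -
  assume c: "x : carrier A" "y : carrier A"
  have "y \<ominus> x = (- 1) \<odot> (x \<ominus> y)"
    using c by (simp add: minus_eq_s s_add_right s_assoc M.a_comm)
  then show ?thesis using c by (simp add: N_smult)
qed

lemma N_minus_triangle: "x : carrier A ==> y : carrier A ==> z : carrier A ==>
    N (x \<ominus> z) <= N (x \<ominus> y) + N (y \<ominus> z)"
  using N_triangle[of "x \<ominus> y" "y \<ominus> z"] minus_minus_trans[of x y z] by simp

lemma N_diff_le: "x : carrier A ==> y : carrier A ==> \<bar>N x - N y\<bar> <= N (x \<ominus> y)"
proof -
  have le: "N x <= N (x \<ominus> y) + N y" if "x : carrier A" "y : carrier A" for x y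
    using N_triangle[of "x \<ominus> y" y] that by (simp add: minus_add_cancel)
  assume c: "x : carrier A" "y : carrier A"
  show ?thesis using le[OF c] le[OF c(2,1)] N_minus_commute[OF c] by simp
qed

lemma N_mult_minus_mult:
  "x : carrier A ==> y : carrier A ==> z : carrier A ==> w : carrier A ==>
    N (x \<otimes> y \<ominus> z \<otimes> w) <= N (x \<ominus> z) * N y + N z * N (y \<ominus> w)"
  using N_triangle[of "(x \<ominus> z) \<otimes> y" "z \<otimes> (y \<ominus> w)"] N_mult[of "x \<ominus> z" y] N_mult[of z "y \<ominus> w"]
  by (simp add: mult_minus_mult)

end

text \<open>An infimum of bounds instead of a supremum over unit vectors, because n is merely a
  seminorm and unit vectors may be absent.\<close>

definition opnorm :: "'v set => ('v => real) => ('x => 'v => 'v) => 'x => real" where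
  "opnorm V n act x = Inf {C. 0 <= C \<and> (\<forall>v\<in>V. n (act x v) <= C * n v)}"

lemma opnorm_least:
  assumes "0 <= C" "!!v. v : V ==> n (act x v) <= C * n v"
  shows "opnorm V n act x <= C"
  unfolding opnorm_def by (rule cInf_lower) (use assms in "auto intro!: bdd_belowI[of _ 0]")

lemma opnorm_bound:
  assumes bdd: "\<exists>C\<ge>0. \<forall>v\<in>V. n (act x v) <= C * n v" and n: "!!v. v : V ==> 0 <= n v"
  shows "0 <= opnorm V n act x" and "!!v. v : V ==> n (act x v) <= opnorm V n act x * n v"
proof -
  let ?S = "{C. 0 <= C \<and> (\<forall>v\<in>V. n (act x v) <= C * n v)}"
  have ne: "?S ~= {}" using bdd by auto
  show "0 <= opnorm V n act x" unfolding opnorm_def by (rule cInf_greatest[OF ne]) auto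
  fix v assume v: "v : V"
  show "n (act x v) <= opnorm V n act x * n v"
  proof (cases "n v = 0")
    case True
    then show ?thesis using bdd v by fastforce
  next
    case False
    with n[OF v] have p: "0 < n v" by simp
    have "n (act x v) / n v <= opnorm V n act x"
      unfolding opnorm_def by (rule cInf_greatest[OF ne]) (use v p in "auto simp: divide_le_eq")
    then show ?thesis using p by (simp add: divide_le_eq)
  qed
qed

text \<open>The hypothesis \<open>cs\<close> is Cauchy--Schwarz for the pairing of v with x* x v. It
  gives N(x)^2 <= N(x* x) for the operator norm N; comparison with submultiplicativity shows that x
  and its star have equal norms, and then equality holds.\<close>

lemma opnorm_cstar_seminorm:
  fixes D (structure)
  assumes "star_algebra D"
    and act: "!!x v. x : carrier D ==> v : V ==> act x v : V"
    and n: "!!v. v : V ==> 0 <= n v"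
    and add: "!!x y v. x : carrier D ==> y : carrier D ==> v : V ==>
      n (act (x \<oplus> y) v) <= n (act x v) + n (act y v)"
    and smult: "!!x c v. x : carrier D ==> v : V ==> n (act (c \<odot> x) v) = cmod c * n (act x v)"
    and mult: "!!x y v. x : carrier D ==> y : carrier D ==> v : V ==>
      n (act (x \<otimes> y) v) = n (act x (act y v))"
    and cs: "!!x v. x : carrier D ==> v : V ==> (n (act x v))^2 <= n v * n (act (x\<^sup>\<star> \<otimes> x) v)"
    and bdd: "!!x. x : carrier D ==> \<exists>C\<ge>0. \<forall>v\<in>V. n (act x v) <= C * n v"
  shows "cstar_seminorm D (opnorm V n act)"
proof -
  interpret D: star_algebra D by fact
  let ?N = "opnorm V n act"
  have nonneg: "0 <= ?N x" if "x : carrier D" for x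
    by (rule opnorm_bound(1)) (use bdd[OF that] n in auto)
  have bound: "n (act x v) <= ?N x * n v" if "x : carrier D" "v : V" for x v
    by (rule opnorm_bound(2)) (use bdd[OF that(1)] n that in auto)
  have sm: "?N (c \<odot> x) <= cmod c * ?N x" if x: "x : carrier D" for c x
  proof (rule opnorm_least)
    show "0 <= cmod c * ?N x" using nonneg[OF x] by simp
    fix v assume v: "v : V"
    show "n (act (c \<odot> x) v) <= cmod c * ?N x * n v"
      using mult_left_mono[OF bound[OF x v], of "cmod c"] by (simp add: smult[OF x v])
  qed
  have mu: "?N (x \<otimes> y) <= ?N x * ?N y" if x: "x : carrier D" and y: "y : carrier D" for x y
  proof (rule opnorm_least)
    show "0 <= ?N x * ?N y" using nonneg x y by simp
    fix v assume v: "v : V"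
    have "n (act x (act y v)) <= ?N x * n (act y v)" using bound[OF x act[OF y v]] .
    also have "... <= ?N x * (?N y * n v)"
      by (rule mult_left_mono[OF bound[OF y v]]) (use n v nonneg[OF x] in auto)
    finally show "n (act (x \<otimes> y) v) <= ?N x * ?N y * n v" by (simp add: mult[OF x y v])
  qed
  have st: "(?N x)^2 <= ?N (x\<^sup>\<star> \<otimes> x)" if x: "x : carrier D" for x
  proof -
    have xx: "x\<^sup>\<star> \<otimes> x : carrier D" using x by simp
    have "?N x <= sqrt (?N (x\<^sup>\<star> \<otimes> x))"
    proof (rule opnorm_least)
      show "0 <= sqrt (?N (x\<^sup>\<star> \<otimes> x))" using nonneg[OF xx] by simp
      fix v assume v: "v : V"
      have "(n (act x v))^2 <= n v * n (act (x\<^sup>\<star> \<otimes> x) v)" by (rule cs[OF x v])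
      also have "... <= n v * (?N (x\<^sup>\<star> \<otimes> x) * n v)"
        using bound[OF xx v] n[OF v] by (intro mult_left_mono)
      also have "... = (sqrt (?N (x\<^sup>\<star> \<otimes> x)) * n v)^2"
        using nonneg[OF xx] by (simp add: power_mult_distrib power2_eq_square)
      finally show "n (act x v) <= sqrt (?N (x\<^sup>\<star> \<otimes> x)) * n v"
        by (rule power2_le_imp_le) (use nonneg[OF xx] n[OF v] in simp)
    qed
    then have "(?N x)^2 <= (sqrt (?N (x\<^sup>\<star> \<otimes> x)))^2" using nonneg[OF x] by (intro power_mono)
    then show ?thesis using nonneg[OF xx] by simp
  qed
  have le_star: "?N x <= ?N (x\<^sup>\<star>)" if x: "x : carrier D" for x
  proof (cases "?N x = 0")
    case False
    then have "0 < ?N x" using nonneg[OF x] by simp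
    moreover have "?N x * ?N x <= ?N (x\<^sup>\<star>) * ?N x"
      using st[OF x] mu[of "x\<^sup>\<star>" x] x by (simp add: power2_eq_square)
    ultimately show ?thesis by (simp add: mult_le_cancel_right)
  qed (use nonneg x in simp)
  show ?thesis unfolding cstar_seminorm_def
  proof (intro conjI ballI allI)
    fix x assume x: "x : carrier D"
    show "0 <= ?N x" by (rule nonneg[OF x])
    show "?N (c \<odot> x) = cmod c * ?N x" for c
    proof (cases "c = 0")
      case True
      then show ?thesis using sm[OF x, of 0] nonneg[of \<zero>] x by simp
    next
      case False
      have "x = inverse c \<odot> (c \<odot> x)" using False x by (simp add: D.s_assoc)
      then have "?N x <= cmod (inverse c) * ?N (c \<odot> x)" using sm[of "c \<odot> x" "inverse c"] x by simp
      then have "?N x <= inverse (cmod c) * ?N (c \<odot> x)" unfolding norm_inverse .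
      then show ?thesis using sm[OF x, of c] False by (simp add: field_simps)
    qed
    show "?N (x\<^sup>\<star> \<otimes> x) = (?N x)^2"
    proof (rule antisym[OF _ st[OF x]])
      have "?N (x\<^sup>\<star>) <= ?N x" using le_star[of "x\<^sup>\<star>"] x by (simp add: D.star_star)
      then have "?N (x\<^sup>\<star>) * ?N x <= ?N x * ?N x" by (rule mult_right_mono) (rule nonneg[OF x])
      then show "?N (x\<^sup>\<star> \<otimes> x) <= (?N x)^2" using mu[of "x\<^sup>\<star>" x] x by (simp add: power2_eq_square)
    qed
    fix y assume y: "y : carrier D"
    show "?N (x \<otimes> y) <= ?N x * ?N y" by (rule mu[OF x y])
    show "?N (x \<oplus> y) <= ?N x + ?N y"
    proof (rule opnorm_least)
      show "0 <= ?N x + ?N y" using nonneg x y by simp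
      fix v assume v: "v : V"
      show "n (act (x \<oplus> y) v) <= (?N x + ?N y) * n v"
        using add[OF x y v] bound[OF x v] bound[OF y v] by (simp add: distrib_right)
    qed
  qed
qed

section \<open>States of star-algebras\<close>

text \<open>Words are wrapped into an additive monoid, so that finitely supported functions on them
  form a ring under convolution. This places the free algebra in the type class that the theory of
  states requires.\<close>

datatype 'a free_mon = Word (letters: "'a list")

instantiation free_mon :: (type) monoid_add
begin
definition zero_free_mon :: "'a free_mon" where "zero_free_mon = Word []"
definition plus_free_mon :: "'a free_mon => 'a free_mon => 'a free_mon" where
  "plus_free_mon v w = Word (letters v @ letters w)"
instance by standard (auto simp: zero_free_mon_def plus_free_mon_def)
end

lemma pm_induct [case_names zero add]:
  assumes "Q 0" "!!w c x. Q x ==> Q (Poly_Mapping.single w c + x)"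
  shows "Q (x :: 'k \<Rightarrow>\<^sub>0 'b::monoid_add)"
proof (induction x rule: update_induct)
  case (update f a b)
  have "Poly_Mapping.update a b f = Poly_Mapping.single a b + f"
    using update by (intro poly_mapping_eqI) (auto simp: Poly_Mapping.lookup_update lookup_add lookup_single in_keys_iff when_def)
  then show ?case using assms(2) update by simp
qed (rule assms(1))

instantiation poly_mapping :: (monoid_add, real_algebra_1) real_algebra_1
begin
definition scaleR_poly_mapping :: "real => ('a \<Rightarrow>\<^sub>0 'b) => ('a \<Rightarrow>\<^sub>0 'b)" where
  "scaleR_poly_mapping r x = Poly_Mapping.single 0 (of_real r) * x"

lemma single_zero_central:
  assumes "!!b. c * b = b * c"
  shows "Poly_Mapping.single 0 c * (x :: 'a \<Rightarrow>\<^sub>0 'b) = x * Poly_Mapping.single 0 c"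
proof (induction x rule: pm_induct)
  case (add w d x)
  then show ?case using assms by (simp add: distrib_left distrib_right mult_single)
qed simp

instance
proof
  fix a b :: real and x y :: "'a \<Rightarrow>\<^sub>0 'b"
  have c: "Poly_Mapping.single 0 (of_real a) * z = z * Poly_Mapping.single 0 (of_real a)"
    for z :: "'a \<Rightarrow>\<^sub>0 'b"
    by (rule single_zero_central) (simp add: of_real_def)
  show "a *\<^sub>R (x + y) = a *\<^sub>R x + a *\<^sub>R y" by (simp add: scaleR_poly_mapping_def distrib_left)
  show "(a + b) *\<^sub>R x = a *\<^sub>R x + b *\<^sub>R x"
    by (simp add: scaleR_poly_mapping_def single_add distrib_right)
  show "a *\<^sub>R b *\<^sub>R x = (a * b) *\<^sub>R x"
    by (simp add: scaleR_poly_mapping_def mult_single flip: mult.assoc)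
  show "1 *\<^sub>R x = x" by (simp add: scaleR_poly_mapping_def)
  show "a *\<^sub>R x * y = a *\<^sub>R (x * y)" by (simp add: scaleR_poly_mapping_def mult.assoc)
  show "x * a *\<^sub>R y = a *\<^sub>R (x * y)"
    by (simp add: scaleR_poly_mapping_def c mult.assoc)
qed
end

type_synonym 'a free_alg = "'a free_mon \<Rightarrow>\<^sub>0 complex"

definition positive_functional :: "('a, 'm) star_alg_scheme => ('a => complex) => bool" where
  "positive_functional A F \<longleftrightarrow>
     (\<forall>x\<in>carrier A. \<forall>y\<in>carrier A. F (x \<oplus>\<^bsub>A\<^esub> y) = F x + F y) \<and>
     (\<forall>x\<in>carrier A. \<forall>c. F (c \<odot>\<^bsub>A\<^esub> x) = c * F x) \<and>
     (\<forall>x\<in>carrier A. Im (F (x\<^sup>\<star>\<^bsub>A\<^esub> \<otimes>\<^bsub>A\<^esub> x)) = 0 \<and> 0 <= Re (F (x\<^sup>\<star>\<^bsub>A\<^esub> \<otimes>\<^bsub>A\<^esub> x)))"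

text \<open>To apply the results on typed algebras to a star-algebra \<open>A\<close> whose carrier is a set, take the
  free unital algebra over the letters of \<open>A\<close> and let it act on \<open>A\<close> by left multiplication.  The
  operator norm restricts to \<open>N\<close> on the letters.\<close>

context seminormed_star_algebra
begin

text \<open>All elements of the type serve as letters. Outside the carrier the involution is
  continued by the identity, which makes it involutive on all words.\<close>

definition letter_star :: "'a => 'a" where
  "letter_star x = (if x : carrier A then x\<^sup>\<star> else x)"

lemma letter_star_twice [simp]: "letter_star (letter_star x) = x"
  by (simp add: letter_star_def star_star)

definition mon_star :: "'a free_mon => 'a free_mon" where
  "mon_star w = Word (rev (map letter_star (letters w)))"

lemma mon_star_twice [simp]: "mon_star (mon_star w) = w"
  by (simp add: mon_star_def rev_map comp_def)

lemma mon_star_plus: "mon_star (v + w) = mon_star w + mon_star v"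
  by (simp add: mon_star_def plus_free_mon_def)

definition free_star :: "'a free_alg => 'a free_alg" where
  "free_star x = Abs_poly_mapping (%w. cnj (poly_mapping.lookup x (mon_star w)))"

lemma lookup_free_star: "poly_mapping.lookup (free_star x) w = cnj (poly_mapping.lookup x (mon_star w))"
proof -
  have "{w. poly_mapping.lookup x (mon_star w) ~= 0} = mon_star ` {w. poly_mapping.lookup x w ~= 0}"
    by (auto simp: image_iff) (metis mon_star_twice)
  then have "finite {w. poly_mapping.lookup x (mon_star w) ~= 0}" by (metis finite_imageI finite_lookup)
  then show ?thesis by (simp add: free_star_def)
qed

lemma free_star_add: "free_star (x + y) = free_star x + free_star y"
  by (rule poly_mapping_eqI) (simp add: lookup_free_star lookup_add)

lemma free_star_zero: "free_star 0 = 0"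
  by (rule poly_mapping_eqI) (simp add: lookup_free_star)

lemma free_star_twice: "free_star (free_star x) = x"
  by (rule poly_mapping_eqI) (simp add: lookup_free_star)

lemma free_star_single: "free_star (Poly_Mapping.single w c) = Poly_Mapping.single (mon_star w) (cnj c)"
  by (rule poly_mapping_eqI) (auto simp: lookup_free_star lookup_single when_def)

lemma free_star_mult: "free_star (x * y) = free_star y * free_star x"
proof (induction x rule: pm_induct)
  case (add v c x)
  have "free_star (Poly_Mapping.single v c * y) = free_star y * free_star (Poly_Mapping.single v c)"
  proof (induction y rule: pm_induct)
    case (add w d y)
    then show ?case
      by (simp add: ring_distribs free_star_add free_star_single mult_single mon_star_plus mult.commute)
  qed (simp add: free_star_zero)
  with add show ?case by (simp add: ring_distribs free_star_add)
qed (simp add: free_star_zero)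

text \<open>Letters outside the carrier act as zero; since \<open>letter_star\<close> fixes them,
  the adjoint relation remains valid.\<close>

definition word_act :: "'a free_mon => 'a => 'a" where
  "word_act w y = foldr (%x z. if x : carrier A then x \<otimes> z else \<zero>) (letters w) y"

lemma word_act_closed [simp]: "y : carrier A ==> word_act w y : carrier A"
proof -
  assume y: "y : carrier A"
  have "foldr (%x z. if x : carrier A then x \<otimes> z else \<zero>) l y : carrier A" for l
    by (induction l) (auto simp: y)
  then show ?thesis by (simp add: word_act_def)
qed

lemma word_act_plus: "word_act (v + w) y = word_act v (word_act w y)"
  by (simp add: word_act_def plus_free_mon_def)

lemma word_act_zero: "word_act 0 y = y"
  by (simp add: word_act_def zero_free_mon_def)

lemma word_act_Cons: "word_act (Word (x # l)) y = (if x : carrier A then x \<otimes> word_act (Word l) y else \<zero>)"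
  by (simp add: word_act_def)

lemma word_act_linear:
  assumes "y : carrier A" "z : carrier A"
  shows "word_act w (y \<oplus> z) = word_act w y \<oplus> word_act w z" "word_act w (c \<odot> y) = c \<odot> word_act w y"
proof -
  have "word_act (Word l) (y \<oplus> z) = word_act (Word l) y \<oplus> word_act (Word l) z \<and>
      word_act (Word l) (c \<odot> y) = c \<odot> word_act (Word l) y" for l
  proof (induction l)
    case Nil
    then show ?case by (simp add: word_act_zero[unfolded zero_free_mon_def])
  next
    case (Cons x l)
    then show ?case using assms by (simp add: word_act_Cons distrib_left smult_mult_right)
  qed
  from this[of "letters w"] show "word_act w (y \<oplus> z) = word_act w y \<oplus> word_act w z"
    "word_act w (c \<odot> y) = c \<odot> word_act w y" by auto
qed

text \<open>The product of the star of y with z serves as an algebra-valued inner product, for which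
  a word and its reversed starred word are adjoint. This is what yields the C*-identity for the
  operator norm.\<close>

lemma word_act_adjoint:
  assumes "y : carrier A" "z : carrier A"
  shows "(word_act w y)\<^sup>\<star> \<otimes> z = y\<^sup>\<star> \<otimes> word_act (mon_star w) z"
proof -
  have "(word_act (Word l) y)\<^sup>\<star> \<otimes> z = y\<^sup>\<star> \<otimes> word_act (mon_star (Word l)) z" if "z : carrier A" for l z
    using that
  proof (induction l arbitrary: z)
    case Nil
    then show ?case by (simp add: mon_star_def word_act_zero[unfolded zero_free_mon_def])
  next
    case (Cons x l)
    have step: "mon_star (Word (x # l)) = mon_star (Word l) + Word [letter_star x]"
      by (simp add: mon_star_def plus_free_mon_def)
    have nil: "word_act (Word []) z = z" by (simp add: word_act_def)
    show ?case
    proof (cases "x : carrier A")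
      case True
      then have "(word_act (Word (x # l)) y)\<^sup>\<star> \<otimes> z = (word_act (Word l) y)\<^sup>\<star> \<otimes> (x\<^sup>\<star> \<otimes> z)"
        using assms Cons.prems by (simp add: word_act_Cons star_mult mult_assoc)
      also have "... = y\<^sup>\<star> \<otimes> word_act (mon_star (Word l)) (x\<^sup>\<star> \<otimes> z)"
        using True Cons by simp
      finally show ?thesis using True by (simp add: step word_act_plus word_act_Cons nil letter_star_def)
    next
      case False
      have "word_act (mon_star (Word l)) \<zero> = \<zero>"
        using word_act_linear(2)[of \<zero> \<zero> _ 0] by simp
      then show ?thesis using False assms Cons.prems
        by (simp add: step word_act_plus word_act_Cons nil letter_star_def)
    qed
  qed
  from this[OF assms(2), of "letters w"] show ?thesis by simp
qed

definition free_act :: "'a free_alg => 'a => 'a" where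
  "free_act x y = lin (poly_mapping.lookup x) (%w. word_act w y)"

lemma free_act_closed [simp]: "y : carrier A ==> free_act x y : carrier A"
  by (simp add: free_act_def)

lemma free_act_zero [simp]: "free_act 0 y = \<zero>"
  by (simp add: free_act_def lin_def)

lemma free_act_add: "y : carrier A ==> free_act (x + x') y = free_act x y \<oplus> free_act x' y"
proof -
  assume y: "y : carrier A"
  have "poly_mapping.lookup (x + x') = (%w. poly_mapping.lookup x w + poly_mapping.lookup x' w)" by (auto simp: lookup_add)
  then show ?thesis using y lin_add[of "poly_mapping.lookup x" "poly_mapping.lookup x'" "%w. word_act w y"]
    by (simp add: free_act_def)
qed

lemma free_act_single: "y : carrier A ==> free_act (Poly_Mapping.single w c) y = c \<odot> word_act w y"
proof -
  assume y: "y : carrier A"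
  have "poly_mapping.lookup (Poly_Mapping.single w c) = (%v. c * single w v)"
    by (auto simp: lookup_single single_apply when_def)
  then show ?thesis using y lin_smult[of "single w" "%w. word_act w y" c]
    by (simp add: free_act_def single_apply)
qed

lemma free_act_linear:
  assumes "y : carrier A" "z : carrier A"
  shows "free_act x (y \<oplus> z) = free_act x y \<oplus> free_act x z"
    and "free_act x (c \<odot> y) = c \<odot> free_act x y"
proof -
  have "free_act x (y \<oplus> z) = free_act x y \<oplus> free_act x z \<and> free_act x (c \<odot> y) = c \<odot> free_act x y"
  proof (induction x rule: pm_induct)
    case (add w d x)
    then show ?case using assms
      by (simp add: free_act_add free_act_single word_act_linear s_add_right s_assoc mult.commute M.a_ac)
  qed simp
  then show "free_act x (y \<oplus> z) = free_act x y \<oplus> free_act x z"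
    "free_act x (c \<odot> y) = c \<odot> free_act x y" by auto
qed

lemma free_act_mult: "y : carrier A ==> free_act (x * x') y = free_act x (free_act x' y)"
proof -
  assume y: "y : carrier A"
  show ?thesis
  proof (induction x rule: pm_induct)
    case (add v c x)
    have "free_act (Poly_Mapping.single v c * x') y = free_act (Poly_Mapping.single v c) (free_act x' y)"
    proof (induction x' rule: pm_induct)
      case (add w d x')
      then show ?case using y
        by (simp add: ring_distribs free_act_add free_act_single free_act_linear mult_single
            word_act_plus word_act_linear s_add_right s_assoc mult.commute)
    qed (use y free_act_linear(2)[of \<zero> \<zero> _ 0] in simp)
    with add show ?case using y by (simp add: ring_distribs free_act_add)
  qed (use y in simp)
qed

lemma free_act_adjoint:
  assumes "y : carrier A" "z : carrier A"
  shows "(free_act x y)\<^sup>\<star> \<otimes> z = y\<^sup>\<star> \<otimes> free_act (free_star x) z"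
proof (induction x rule: pm_induct)
  case (add w c x)
  then show ?case using assms
    by (simp add: free_act_add free_act_single free_star_add free_star_single star_add star_smult
        distrib_left distrib_right smult_mult_left smult_mult_right word_act_adjoint)
qed (use assms in "simp add: free_star_zero")

definition free_norm :: "'a free_alg => real" where
  "free_norm = opnorm (carrier A) N free_act"

lemma free_act_bounded: "\<exists>C\<ge>0. \<forall>y\<in>carrier A. N (free_act x y) <= C * N y"
proof (induction x rule: pm_induct)
  case (add w c x)
  then obtain C where C: "0 <= C" "\<forall>y\<in>carrier A. N (free_act x y) <= C * N y" by blast
  have "\<exists>C\<ge>0. \<forall>y\<in>carrier A. N (word_act (Word l) y) <= C * N y" for l
  proof (induction l)
    case Nil
    then show ?case by (intro exI[of _ 1]) (simp add: word_act_def)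
  next
    case (Cons x l)
    then obtain C where C: "0 <= C" "\<forall>y\<in>carrier A. N (word_act (Word l) y) <= C * N y" by blast
    show ?case
    proof (cases "x : carrier A")
      case True
      have "N (word_act (Word (x # l)) y) <= (N x * C) * N y" if y: "y : carrier A" for y
      proof -
        have "N (word_act (Word (x # l)) y) <= N x * N (word_act (Word l) y)"
          using True y N_mult by (simp add: word_act_Cons)
        also have "... <= N x * (C * N y)" using C y True by (intro mult_left_mono) auto
        finally show ?thesis by (simp add: mult.assoc)
      qed
      then show ?thesis using C True by (intro exI[of _ "N x * C"]) auto
    next
      case False
      then show ?thesis by (intro exI[of _ 0]) (simp add: word_act_Cons)
    qed
  qed
  from this[of "letters w"] obtain C' where
    C': "0 <= C'" "\<forall>y\<in>carrier A. N (word_act w y) <= C' * N y" by auto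
  have "N (free_act (Poly_Mapping.single w c + x) y) <= (cmod c * C' + C) * N y" if y: "y : carrier A" for y
  proof -
    have "N (free_act (Poly_Mapping.single w c + x) y) <= cmod c * N (word_act w y) + N (free_act x y)"
      using y N_triangle[of "c \<odot> word_act w y" "free_act x y"]
      by (simp add: free_act_add free_act_single N_smult)
    also have "... <= cmod c * (C' * N y) + C * N y"
      using C C' y by (intro add_mono mult_left_mono) auto
    finally show ?thesis by (simp add: algebra_simps)
  qed
  then show ?case using C C' by (intro exI[of _ "cmod c * C' + C"]) auto
qed (intro exI[of _ 0], simp)

lemma free_norm_bound:
  shows "0 <= free_norm x" and "v : carrier A ==> N (free_act x v) <= free_norm x * N v"
  using opnorm_bound[of "carrier A" N free_act x, OF free_act_bounded] by (auto simp: free_norm_def)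

lemma free_norm_least:
  "0 <= C ==> (!!v. v : carrier A ==> N (free_act x v) <= C * N v) ==> free_norm x <= C"
  unfolding free_norm_def by (rule opnorm_least)

definition letter :: "'a => 'a free_alg" where
  "letter x = Poly_Mapping.single (Word [x]) 1"

abbreviation imag_unit :: "'a free_alg" where
  "imag_unit == Poly_Mapping.single 0 \<i>"

lemma free_act_letter: "x : carrier A ==> y : carrier A ==> free_act (letter x) y = x \<otimes> y"
  by (simp add: letter_def free_act_single word_act_Cons) (simp add: word_act_def)

lemma free_act_scaleR: "y : carrier A ==> free_act (r *\<^sub>R x) y = complex_of_real r \<odot> free_act x y"
  by (simp add: scaleR_poly_mapping_def free_act_mult free_act_single word_act_zero)

lemma free_act_imag_unit: "y : carrier A ==> free_act (imag_unit * x) y = \<i> \<odot> free_act x y"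
  by (simp add: free_act_mult free_act_single word_act_zero)

lemma free_act_minus: "y : carrier A ==> free_act (x - x') y = free_act x y \<ominus> free_act x' y"
  using free_act_add[of y x "- x'"] free_act_scaleR[of y "- 1" x'] by (simp add: minus_eq_s)

lemma cstar_seminormed_free:
  assumes "c : carrier A" "0 < N c"
  shows "cstar_seminormed free_star imag_unit free_norm"
proof
  fix x y :: "'a free_alg" and r :: real
  have nn: "0 <= free_norm x" for x using free_norm_bound(1) .
  show "free_star (x + y) = free_star x + free_star y" by (rule free_star_add)
  show "free_star (x * y) = free_star y * free_star x" by (rule free_star_mult)
  show "free_star (free_star x) = x" by (rule free_star_twice)
  have ms0: "mon_star 0 = 0" by (simp add: mon_star_def zero_free_mon_def)
  show im: "x * imag_unit = imag_unit * x" by (rule single_zero_central[symmetric]) simp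
  have re: "x * Poly_Mapping.single 0 (of_real r) = Poly_Mapping.single 0 (of_real r) * x" for x :: "'a free_alg"
    by (rule single_zero_central[symmetric]) simp
  show "free_star (r *\<^sub>R x) = r *\<^sub>R free_star x"
    by (simp add: scaleR_poly_mapping_def free_star_mult free_star_single ms0 re)
  show "free_star imag_unit = - imag_unit" by (simp add: free_star_single ms0 single_uminus)
  show "imag_unit * imag_unit = - 1" by (simp add: mult_single single_uminus)
  show "0 <= free_norm x" by (rule nn)
  show mult: "free_norm (x * y) <= free_norm x * free_norm y" for x y
  proof (rule free_norm_least)
    fix v assume v: "v : carrier A"
    have "N (free_act x (free_act y v)) <= free_norm x * N (free_act y v)"
      using v by (intro free_norm_bound(2)) auto
    also have "... <= free_norm x * (free_norm y * N v)"
      using v nn by (intro mult_left_mono free_norm_bound(2)) auto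
    finally show "N (free_act (x * y) v) <= free_norm x * free_norm y * N v"
      using v by (simp add: free_act_mult)
  qed (simp add: nn)
  show "free_norm (x + y) <= free_norm x + free_norm y"
  proof (rule free_norm_least)
    fix v assume v: "v : carrier A"
    have "N (free_act (x + y) v) <= N (free_act x v) + N (free_act y v)"
      using v N_triangle by (simp add: free_act_add)
    also have "... <= free_norm x * N v + free_norm y * N v"
      using v by (intro add_mono free_norm_bound(2))
    finally show "N (free_act (x + y) v) <= (free_norm x + free_norm y) * N v"
      by (simp add: ring_distribs)
  qed (simp add: nn)
  have sc: "free_norm (r *\<^sub>R x) <= \<bar>r\<bar> * free_norm x" for r and x :: "'a free_alg"
  proof (rule free_norm_least)
    fix v assume v: "v : carrier A"
    show "N (free_act (r *\<^sub>R x) v) <= \<bar>r\<bar> * free_norm x * N v"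
      using v mult_left_mono[OF free_norm_bound(2)[OF v, of x], of "\<bar>r\<bar>"]
      by (simp add: free_act_scaleR N_smult mult.assoc)
  qed (simp add: nn)
  show "free_norm (r *\<^sub>R x) = \<bar>r\<bar> * free_norm x"
  proof (cases "r = 0")
    case True
    then show ?thesis using sc[of 0 x] nn[of 0] by simp
  next
    case False
    have "free_norm x <= \<bar>inverse r\<bar> * free_norm (r *\<^sub>R x)" using sc[of "inverse r" "r *\<^sub>R x"] False by simp
    then show ?thesis using sc[of r x] False by (simp add: abs_inverse field_simps)
  qed
  \<comment> \<open>By the adjoint relation, N(x v)^2 is the norm of the inner product of v with x*
    x v.\<close>
  have st: "(free_norm x)^2 <= free_norm (free_star x * x)" for x :: "'a free_alg"
  proof -
    let ?q = "free_norm (free_star x * x)"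
    have "free_norm x <= sqrt ?q"
    proof (rule free_norm_least)
      fix v assume v: "v : carrier A"
      have "(N (free_act x v))^2 = N (v\<^sup>\<star> \<otimes> free_act (free_star x * x) v)"
        using v N_star_mult[of "free_act x v"] by (simp add: free_act_adjoint free_act_mult)
      also have "... <= N v * (?q * N v)"
        using N_mult[of "v\<^sup>\<star>" "free_act (free_star x * x) v"] v
          mult_left_mono[OF free_norm_bound(2)[OF v, of "free_star x * x"], of "N v"]
        by (simp add: N_star)
      also have "... = (sqrt ?q * N v)^2"
        using nn by (simp add: power_mult_distrib power2_eq_square)
      finally show "N (free_act x v) <= sqrt ?q * N v"
        by (rule power2_le_imp_le) (use nn v in simp)
    qed (simp add: nn)
    then have "(free_norm x)^2 <= (sqrt ?q)^2" using nn by (intro power_mono)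
    then show ?thesis using nn by simp
  qed
  have le_star: "free_norm x <= free_norm (free_star x)" for x :: "'a free_alg"
  proof (cases "free_norm x = 0")
    case False
    then have "0 < free_norm x" using nn[of x] by simp
    moreover have "free_norm x * free_norm x <= free_norm (free_star x) * free_norm x"
      using st[of x] mult[of "free_star x" x] by (simp add: power2_eq_square)
    ultimately show ?thesis by (simp add: mult_le_cancel_right)
  qed (use nn in simp)
  show "free_norm (free_star x * x) = (free_norm x)^2"
  proof (rule antisym[OF _ st])
    have "free_norm (free_star x) <= free_norm x" using le_star[of "free_star x"] by (simp add: free_star_twice)
    then have "free_norm (free_star x) * free_norm x <= free_norm x * free_norm x"
      by (rule mult_right_mono) (rule nn)
    then show "free_norm (free_star x * x) <= (free_norm x)^2"
      using mult[of "free_star x" x] by (simp add: power2_eq_square)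
  qed
  have one: "free_act 1 v = v" if "v : carrier A" for v
    using free_act_single[OF that, of 0 1] that by (simp add: word_act_zero)
  show "free_norm 1 = 1"
  proof (rule antisym)
    show "free_norm 1 <= 1" by (rule free_norm_least) (simp_all add: one)
    \<comment> \<open>The identity has norm one because it fixes c, an element of positive
      norm.\<close>
    show "1 <= free_norm 1" using free_norm_bound(2)[OF assms(1), of 1] assms by (simp add: one)
  qed
qed

text \<open>A real-valued state f of the free algebra is complexified to G. As G is bounded by the
  operator norm, it depends only on how an element acts, so its restriction F to letters is linear
  on A. The factor 2 comes from estimating real and imaginary part separately.\<close>

theorem positive_functional_exists:
  assumes c: "c : carrier A" "0 < N c"
  shows "\<exists>F. positive_functional A F \<and> (\<forall>x\<in>carrier A. cmod (F x) <= 2 * N x) \<and>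
    0 < Re (F (c\<^sup>\<star> \<otimes> c))"
proof -
  interpret T: cstar_seminormed free_star imag_unit free_norm by (rule cstar_seminormed_free[OF c])
  have norm_zero: "free_norm x = 0" if "!!v. v : carrier A ==> free_act x v = \<zero>" for x
  proof -
    have "free_norm x <= 0" by (rule free_norm_least) (simp_all add: that)
    then show ?thesis using T.P_nonneg[of x] by simp
  qed
  have pc: "0 < free_norm (letter c)"
  proof -
    \<comment> \<open>Testing \<open>letter c\<close> at the star of c shows that its operator norm
      is positive.\<close>
    have "(N c)^2 = N (c \<otimes> c\<^sup>\<star>)" using N_star_mult[of "c\<^sup>\<star>"] c by (simp add: star_star N_star)
    also have "... <= free_norm (letter c) * N c"
      using free_norm_bound(2)[of "c\<^sup>\<star>" "letter c"] c by (simp add: free_act_letter N_star)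
    finally show ?thesis
      using c T.P_nonneg[of "letter c"] by (cases "free_norm (letter c) = 0") auto
  qed
  obtain f where f: "T.state f" and fc: "0 < f (free_star (letter c) * letter c)"
    using T.state_exists[OF pc] by blast
  note lin = T.state_linear[OF f]
  have fle: "\<bar>f x\<bar> <= free_norm x" for x by (rule T.state_abs_le[OF f])
  define G where "G x = Complex (f x) (- f (imag_unit * x))" for x
  have Gadd: "G (x + y) = G x + G y" for x y
    using lin by (simp add: G_def ring_distribs linear_add complex_eq_iff)
  have Gdiff: "G (x - y) = G x - G y" for x y
    using lin by (simp add: G_def right_diff_distrib linear_diff complex_eq_iff)
  have Gscale: "G (r *\<^sub>R x) = of_real r * G x" for r x
    using lin by (simp add: G_def linear_cmul complex_eq_iff)
  have Gimag_unit: "G (imag_unit * x) = \<i> * G x" for x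
    using lin by (simp add: G_def T.I_I linear_neg complex_eq_iff)
  have Gzero: "G x = G y" if "!!v. v : carrier A ==> free_act x v = free_act y v" for x y
  proof -
    have z: "free_norm (x - y) = 0" by (rule norm_zero) (simp add: free_act_minus that)
    then have "free_norm (imag_unit * (x - y)) = 0" by (simp add: T.P_I)
    then have "G (x - y) = 0" using fle[of "x - y"] fle[of "imag_unit * (x - y)"] z
      by (simp add: G_def complex_eq_iff)
    then show ?thesis by (simp add: Gdiff)
  qed
  have Gstar: "G (letter (x\<^sup>\<star> \<otimes> x)) = G (free_star (letter x) * letter x)" if x: "x : carrier A" for x
  proof (rule Gzero)
    fix v assume v: "v : carrier A"
    have "free_star (letter x) = letter (x\<^sup>\<star>)"
      using x by (simp add: letter_def free_star_single mon_star_def letter_star_def)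
    then show "free_act (letter (x\<^sup>\<star> \<otimes> x)) v = free_act (free_star (letter x) * letter x) v"
      using x v by (simp add: free_act_mult free_act_letter mult_assoc)
  qed
  \<comment> \<open>\<open>free_star z * z\<close> is self-adjoint, so f vanishes at its product
    with the imaginary unit and G is real there.\<close>
  have Gpos: "G (free_star z * z) = of_real (f (free_star z * z))" for z
    using T.state_I_zero[OF f, of "free_star z * z"]
    by (simp add: G_def free_star_mult free_star_twice complex_eq_iff)
  define F where "F x = G (letter x)" for x
  have "positive_functional A F"
    unfolding positive_functional_def
  proof (intro conjI ballI allI)
    fix x assume x: "x : carrier A"
    show "F (x \<oplus> y) = F x + F y" if y: "y : carrier A" for y
      unfolding F_def Gadd[symmetric]
      by (rule Gzero) (simp add: x y free_act_letter free_act_add distrib_right)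
    show "F (c \<odot> x) = c * F x" for c
    proof -
      have cc: "of_real (Re c) + \<i> * of_real (Im c) = c" by (rule complex_eq[symmetric])
      have "F (c \<odot> x) = G (Re c *\<^sub>R letter x + imag_unit * (Im c *\<^sub>R letter x))"
        unfolding F_def
      proof (rule Gzero)
        fix v assume v: "v : carrier A"
        have "c \<odot> (x \<otimes> v) = (of_real (Re c) + \<i> * of_real (Im c)) \<odot> (x \<otimes> v)"
          by (simp only: cc)
        also have "... = of_real (Re c) \<odot> (x \<otimes> v) \<oplus> \<i> \<odot> (of_real (Im c) \<odot> (x \<otimes> v))"
          using x v by (simp only: s_add_left s_assoc mult_closed)
        finally show "free_act (letter (c \<odot> x)) v = free_act (Re c *\<^sub>R letter x + imag_unit * (Im c *\<^sub>R letter x)) v"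
          using x v by (simp add: free_act_add free_act_imag_unit free_act_scaleR free_act_letter smult_mult_left
            s_assoc mult.commute)
      qed
      also have "... = (of_real (Re c) + \<i> * of_real (Im c)) * F x"
        by (simp only: Gadd Gimag_unit Gscale F_def) (simp add: algebra_simps)
      finally show ?thesis by (simp only: cc)
    qed
    have p: "F (x\<^sup>\<star> \<otimes> x) = of_real (f (free_star (letter x) * letter x))"
      by (simp add: F_def Gstar[OF x] Gpos)
    show "Im (F (x\<^sup>\<star> \<otimes> x)) = 0" by (simp add: p)
    show "0 <= Re (F (x\<^sup>\<star> \<otimes> x))" using T.state_positive[OF f] by (simp add: p)
  qed
  moreover have "cmod (F x) <= 2 * N x" if x: "x : carrier A" for x
  proof -
    have l: "free_norm (letter x) <= N x"
      by (rule free_norm_least) (use x N_mult in "auto simp: free_act_letter")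
    have "cmod (F x) <= \<bar>f (letter x)\<bar> + \<bar>f (imag_unit * letter x)\<bar>"
      using cmod_le[of "F x"] by (simp add: F_def G_def)
    also have "... <= free_norm (letter x) + free_norm (letter x)"
      using fle[of "letter x"] fle[of "imag_unit * letter x"] by (simp add: T.P_I)
    finally show ?thesis using l by simp
  qed
  moreover have "0 < Re (F (c\<^sup>\<star> \<otimes> c))" using fc by (simp add: F_def Gstar[OF c(1)] Gpos)
  ultimately show ?thesis by blast
qed

end

section \<open>Homomorphisms and completions\<close>

definition star_hom :: "('a, 'm) star_alg_scheme => ('b, 'k) star_alg_scheme => ('a => 'b) => bool" where
  "star_hom A B phi \<longleftrightarrow> (\<forall>x\<in>carrier A. phi x : carrier B) \<and>
     (\<forall>x\<in>carrier A. \<forall>y\<in>carrier A. phi (x \<oplus>\<^bsub>A\<^esub> y) = phi x \<oplus>\<^bsub>B\<^esub> phi y) \<and>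
     (\<forall>x\<in>carrier A. \<forall>c. phi (c \<odot>\<^bsub>A\<^esub> x) = c \<odot>\<^bsub>B\<^esub> phi x) \<and>
     (\<forall>x\<in>carrier A. \<forall>y\<in>carrier A. phi (x \<otimes>\<^bsub>A\<^esub> y) = phi x \<otimes>\<^bsub>B\<^esub> phi y) \<and>
     (\<forall>x\<in>carrier A. phi (x\<^sup>\<star>\<^bsub>A\<^esub>) = (phi x)\<^sup>\<star>\<^bsub>B\<^esub>)"

lemma star_homD:
  assumes "star_hom A B phi" and "x : carrier A"
  shows "phi x : carrier B" "y : carrier A ==> phi (x \<oplus>\<^bsub>A\<^esub> y) = phi x \<oplus>\<^bsub>B\<^esub> phi y"
    "phi (c \<odot>\<^bsub>A\<^esub> x) = c \<odot>\<^bsub>B\<^esub> phi x" "y : carrier A ==> phi (x \<otimes>\<^bsub>A\<^esub> y) = phi x \<otimes>\<^bsub>B\<^esub> phi y"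
    "phi (x\<^sup>\<star>\<^bsub>A\<^esub>) = (phi x)\<^sup>\<star>\<^bsub>B\<^esub>"
  using assms by (simp_all add: star_hom_def)

lemma star_hom_minus:
  assumes "star_algebra A" "star_algebra B" "star_hom A B phi" "x : carrier A" "y : carrier A"
  shows "phi (x \<ominus>\<^bsub>A\<^esub> y) = phi x \<ominus>\<^bsub>B\<^esub> phi y"
proof -
  interpret A: star_algebra A by fact
  interpret B: star_algebra B by fact
  show ?thesis using assms by (simp add: A.minus_eq_s B.minus_eq_s star_homD[OF assms(3)])
qed

lemma star_hom_zero:
  assumes "star_algebra A" "star_algebra B" "star_hom A B phi"
  shows "phi \<zero>\<^bsub>A\<^esub> = \<zero>\<^bsub>B\<^esub>"
proof -
  interpret A: star_algebra A by fact
  interpret B: star_algebra B by fact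
  show ?thesis using star_homD(3)[OF assms(3) A.M.zero_closed, of 0] star_homD(1)[OF assms(3) A.M.zero_closed]
    by simp
qed

lemma star_hom_finsum:
  assumes "star_algebra A" "star_algebra B" "star_hom A B phi"
    and "finite T" "!!i. i : T ==> m i : carrier A"
  shows "phi (\<Oplus>\<^bsub>A\<^esub>i\<in>T. m i) = (\<Oplus>\<^bsub>B\<^esub>i\<in>T. phi (m i))"
proof -
  interpret A: star_algebra A by fact
  interpret B: star_algebra B by fact
  show ?thesis using assms(4,5)
  proof (induction T rule: finite_induct)
    case empty
    show ?case using star_hom_zero[OF assms(1-3)] by simp
  next
    case (insert i T)
    then show ?case
      by (simp add: A.finsum_ins B.finsum_ins A.finsum_cl star_homD[OF assms(3)])
  qed
qed

text \<open>Covers quotients, change of record type, and transport of structure.\<close>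

lemma star_algebra_image:
  assumes "star_algebra A" and onto: "phi ` carrier A = carrier B"
    and hom: "star_hom A B phi" and zero: "phi \<zero>\<^bsub>A\<^esub> = \<zero>\<^bsub>B\<^esub>"
  shows "star_algebra B"
proof -
  interpret A: star_algebra A by fact
  note h = star_homD(2-)[OF hom, symmetric]
  have cl: "phi x : carrier B" if "x : carrier A" for x using hom that by (rule star_homD)
  have all: "(\<forall>b\<in>carrier B. Q b) \<longleftrightarrow> (\<forall>x\<in>carrier A. Q (phi x))" for Q
    unfolding onto[symmetric] by blast
  have "\<forall>x\<in>carrier B. \<forall>y\<in>carrier B. \<forall>z\<in>carrier B.
      (x \<oplus>\<^bsub>B\<^esub> y) \<oplus>\<^bsub>B\<^esub> z = x \<oplus>\<^bsub>B\<^esub> (y \<oplus>\<^bsub>B\<^esub> z) \<and> (x \<otimes>\<^bsub>B\<^esub> y) \<otimes>\<^bsub>B\<^esub> z = x \<otimes>\<^bsub>B\<^esub> (y \<otimes>\<^bsub>B\<^esub> z) \<and>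
      x \<otimes>\<^bsub>B\<^esub> (y \<oplus>\<^bsub>B\<^esub> z) = x \<otimes>\<^bsub>B\<^esub> y \<oplus>\<^bsub>B\<^esub> x \<otimes>\<^bsub>B\<^esub> z \<and> (x \<oplus>\<^bsub>B\<^esub> y) \<otimes>\<^bsub>B\<^esub> z = x \<otimes>\<^bsub>B\<^esub> z \<oplus>\<^bsub>B\<^esub> y \<otimes>\<^bsub>B\<^esub> z"
    by (simp add: all h A.M.a_assoc A.mult_assoc A.distrib_left A.distrib_right)
  moreover have "\<forall>x\<in>carrier B. \<forall>y\<in>carrier B. x \<oplus>\<^bsub>B\<^esub> y : carrier B \<and> x \<otimes>\<^bsub>B\<^esub> y : carrier B \<and>
      x \<oplus>\<^bsub>B\<^esub> y = y \<oplus>\<^bsub>B\<^esub> x \<and> (x \<oplus>\<^bsub>B\<^esub> y)\<^sup>\<star>\<^bsub>B\<^esub> = x\<^sup>\<star>\<^bsub>B\<^esub> \<oplus>\<^bsub>B\<^esub> y\<^sup>\<star>\<^bsub>B\<^esub> \<and> (x \<otimes>\<^bsub>B\<^esub> y)\<^sup>\<star>\<^bsub>B\<^esub> = y\<^sup>\<star>\<^bsub>B\<^esub> \<otimes>\<^bsub>B\<^esub> x\<^sup>\<star>\<^bsub>B\<^esub> \<and>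
      (\<forall>c. c \<odot>\<^bsub>B\<^esub> (x \<oplus>\<^bsub>B\<^esub> y) = c \<odot>\<^bsub>B\<^esub> x \<oplus>\<^bsub>B\<^esub> c \<odot>\<^bsub>B\<^esub> y \<and>
        (c \<odot>\<^bsub>B\<^esub> x) \<otimes>\<^bsub>B\<^esub> y = c \<odot>\<^bsub>B\<^esub> (x \<otimes>\<^bsub>B\<^esub> y) \<and> x \<otimes>\<^bsub>B\<^esub> (c \<odot>\<^bsub>B\<^esub> y) = c \<odot>\<^bsub>B\<^esub> (x \<otimes>\<^bsub>B\<^esub> y))"
    by (simp add: all h cl A.M.a_comm A.s_add_right A.smult_mult_left A.smult_mult_right A.star_add A.star_mult)
  moreover have "\<forall>x\<in>carrier B. \<zero>\<^bsub>B\<^esub> \<oplus>\<^bsub>B\<^esub> x = x \<and> x\<^sup>\<star>\<^bsub>B\<^esub> : carrier B \<and> (x\<^sup>\<star>\<^bsub>B\<^esub>)\<^sup>\<star>\<^bsub>B\<^esub> = x \<and>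
      1 \<odot>\<^bsub>B\<^esub> x = x \<and> 0 \<odot>\<^bsub>B\<^esub> x = \<zero>\<^bsub>B\<^esub> \<and>
      (\<forall>a. a \<odot>\<^bsub>B\<^esub> x : carrier B \<and> (a \<odot>\<^bsub>B\<^esub> x)\<^sup>\<star>\<^bsub>B\<^esub> = cnj a \<odot>\<^bsub>B\<^esub> x\<^sup>\<star>\<^bsub>B\<^esub> \<and>
        (\<forall>b. (a + b) \<odot>\<^bsub>B\<^esub> x = a \<odot>\<^bsub>B\<^esub> x \<oplus>\<^bsub>B\<^esub> b \<odot>\<^bsub>B\<^esub> x \<and> (a * b) \<odot>\<^bsub>B\<^esub> x = a \<odot>\<^bsub>B\<^esub> (b \<odot>\<^bsub>B\<^esub> x)))"
    by (simp add: all h cl A.star_star A.star_smult A.s_add_left A.s_assoc flip: zero)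
  moreover have "\<zero>\<^bsub>B\<^esub> : carrier B" using cl zero by (metis A.M.zero_closed)
  ultimately show ?thesis
    by (intro star_algebraI star_algebra_axioms.intro; blast)
qed

lemma quotient_star_alg_hom:
  fixes A (structure)
  assumes "star_algebra A" and eq: "equiv (carrier A) r"
    and add: "!!x x' y y'. (x, x') : r ==> (y, y') : r ==> (x \<oplus> y, x' \<oplus> y') : r"
    and mult: "!!x x' y y'. (x, x') : r ==> (y, y') : r ==> (x \<otimes> y, x' \<otimes> y') : r"
    and smult: "!!x x' c. (x, x') : r ==> (c \<odot> x, c \<odot> x') : r"
    and star: "!!x x'. (x, x') : r ==> (x\<^sup>\<star>, x'\<^sup>\<star>) : r"
  shows "star_hom A (quotient_star_alg A r) (%x. r `` {x})"
    and "(%x. r `` {x}) ` carrier A = carrier (quotient_star_alg A r)"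
    and "star_algebra (quotient_star_alg A r)"
proof -
  interpret A: star_algebra A by fact
  have c2: "congruent2 r r (%x y. r `` {x \<oplus> y})" "congruent2 r r (%x y. r `` {x \<otimes> y})"
    by (auto intro!: congruent2I' equiv_class_eq[OF eq] add mult)
  have c1: "(%x. r `` {c \<odot> x}) respects r" "(%x. r `` {x\<^sup>\<star>}) respects r" for c
    by (auto intro!: congruentI equiv_class_eq[OF eq] smult star)
  show hom: "star_hom A (quotient_star_alg A r) (%x. r `` {x})"
    unfolding star_hom_def quotient_star_alg_def
    by (simp add: UN_equiv_class2[OF eq eq c2(1)] UN_equiv_class2[OF eq eq c2(2)]
        UN_equiv_class[OF eq c1(1)] UN_equiv_class[OF eq c1(2)] quotientI)
  show onto: "(%x. r `` {x}) ` carrier A = carrier (quotient_star_alg A r)"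
    by (auto simp: quotient_star_alg_def quotient_def)
  show "star_algebra (quotient_star_alg A r)"
    by (rule star_algebra_image[OF assms(1) onto hom]) (simp add: quotient_star_alg_def)
qed

section \<open>Cauchy sequences modulo null sequences\<close>

context seminormed_star_algebra
begin

lemma cauchy_seqsI:
  assumes "!!n. sig n : carrier A"
    and "!!e. 0 < e ==> \<exists>M. \<forall>m\<ge>M. \<forall>n\<ge>M. N (sig m \<ominus> sig n) < e"
  shows "sig : cauchy_seqs A N"
  using assms by (simp add: cauchy_seqs_def)

lemma cauchy_closed: "sig : cauchy_seqs A N ==> sig n : carrier A"
  by (simp add: cauchy_seqs_def)

lemma cauchyD: "sig : cauchy_seqs A N ==> 0 < e ==> \<exists>M. \<forall>m\<ge>M. \<forall>n\<ge>M. N (sig m \<ominus> sig n) < e"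
  by (simp add: cauchy_seqs_def)

lemma cauchy_bounded: "sig : cauchy_seqs A N ==> \<exists>K>0. \<forall>n. N (sig n) <= K"
proof -
  assume s: "sig : cauchy_seqs A N"
  obtain M where M: "\<forall>m\<ge>M. \<forall>n\<ge>M. N (sig m \<ominus> sig n) < 1" using cauchyD[OF s, of 1] by auto
  define K where "K = (\<Sum>n\<le>M. N (sig n)) + 1"
  have nn: "0 <= N (sig n)" for n using cauchy_closed[OF s] by simp
  have le: "N (sig n) <= (\<Sum>n\<le>M. N (sig n))" if "n <= M" for n
    by (rule member_le_sum) (use that nn in auto)
  have "N (sig n) <= K" for n
  proof (cases "n <= M")
    case True
    then show ?thesis using le by (simp add: K_def add_increasing2)
  next
    case False
    then have "N (sig n \<ominus> sig M) < 1" using M by simp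
    then show ?thesis
      using le[of M] N_diff_le[of "sig n" "sig M"] cauchy_closed[OF s] by (simp add: K_def abs_le_iff)
  qed
  moreover have "0 < K" by (simp add: K_def add_nonneg_pos sum_nonneg nn)
  ultimately show ?thesis by blast
qed

lemma cauchy_add: "sig : cauchy_seqs A N ==> tau : cauchy_seqs A N ==> (%n. sig n \<oplus> tau n) : cauchy_seqs A N"
proof (rule cauchy_seqsI)
  assume s: "sig : cauchy_seqs A N" and t: "tau : cauchy_seqs A N"
  note cl = cauchy_closed[OF s] cauchy_closed[OF t]
  show "sig n \<oplus> tau n : carrier A" for n using cl by simp
  fix e :: real assume e: "0 < e"
  then obtain M1 M2 where M: "\<forall>m\<ge>M1. \<forall>n\<ge>M1. N (sig m \<ominus> sig n) < e/2" "\<forall>m\<ge>M2. \<forall>n\<ge>M2. N (tau m \<ominus> tau n) < e/2"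
    using cauchyD[OF s, of "e/2"] cauchyD[OF t, of "e/2"] by auto
  have "N ((sig m \<oplus> tau m) \<ominus> (sig n \<oplus> tau n)) < e" if "m >= max M1 M2" "n >= max M1 M2" for m n
  proof -
    have "N (sig m \<ominus> sig n) < e/2" "N (tau m \<ominus> tau n) < e/2" using M that by auto
    then show ?thesis using N_triangle[of "sig m \<ominus> sig n" "tau m \<ominus> tau n"] cl by (simp add: add_minus_add)
  qed
  then show "\<exists>M. \<forall>m\<ge>M. \<forall>n\<ge>M. N ((sig m \<oplus> tau m) \<ominus> (sig n \<oplus> tau n)) < e" by blast
qed

lemma cauchy_lipschitz:
  assumes s: "sig : cauchy_seqs A N" and cl: "!!n. tau n : carrier A"
    and le: "!!m n. N (tau m \<ominus> tau n) <= K * N (sig m \<ominus> sig n)" and K: "0 <= K"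
  shows "tau : cauchy_seqs A N"
proof (rule cauchy_seqsI[OF cl])
  fix e :: real assume e: "0 < e"
  then obtain M where M: "\<forall>m\<ge>M. \<forall>n\<ge>M. N (sig m \<ominus> sig n) < e / (K + 1)"
    using cauchyD[OF s, of "e / (K + 1)"] K by auto
  have "N (tau m \<ominus> tau n) < e" if "m >= M" "n >= M" for m n
  proof -
    have "K * N (sig m \<ominus> sig n) <= K * (e / (K + 1))" using M that K by (intro mult_left_mono) (auto intro: less_imp_le)
    also have "... < e" using e K by (simp add: field_simps)
    finally show ?thesis using le[of m n] by simp
  qed
  then show "\<exists>M. \<forall>m\<ge>M. \<forall>n\<ge>M. N (tau m \<ominus> tau n) < e" by blast
qed

lemma cauchy_smult: "sig : cauchy_seqs A N ==> (%n. c \<odot> sig n) : cauchy_seqs A N"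
  by (rule cauchy_lipschitz[of sig _ "cmod c"]) (simp_all add: cauchy_closed N_smult flip: s_minus)

lemma cauchy_star: "sig : cauchy_seqs A N ==> (%n. (sig n)\<^sup>\<star>) : cauchy_seqs A N"
  by (rule cauchy_lipschitz[of sig _ 1]) (simp_all add: cauchy_closed N_star flip: star_minus)

lemma cauchy_const: "x : carrier A ==> (%n. x) : cauchy_seqs A N"
  by (rule cauchy_seqsI) auto

lemma cauchy_mult: "sig : cauchy_seqs A N ==> tau : cauchy_seqs A N ==> (%n. sig n \<otimes> tau n) : cauchy_seqs A N"
proof (rule cauchy_seqsI)
  assume s: "sig : cauchy_seqs A N" and t: "tau : cauchy_seqs A N"
  note cl = cauchy_closed[OF s] cauchy_closed[OF t]
  show "sig n \<otimes> tau n : carrier A" for n using cl by simp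
  obtain K1 K2 where K: "0 < K1" "!!n. N (sig n) <= K1" "0 < K2" "!!n. N (tau n) <= K2"
    using cauchy_bounded[OF s] cauchy_bounded[OF t] by auto
  fix e :: real assume e: "0 < e"
  then obtain M1 M2 where M: "\<forall>m\<ge>M1. \<forall>n\<ge>M1. N (sig m \<ominus> sig n) < e / (2 * K2)"
      "\<forall>m\<ge>M2. \<forall>n\<ge>M2. N (tau m \<ominus> tau n) < e / (2 * K1)"
    using cauchyD[OF s, of "e / (2 * K2)"] cauchyD[OF t, of "e / (2 * K1)"] K by auto
  have "N ((sig m \<otimes> tau m) \<ominus> (sig n \<otimes> tau n)) < e" if "m >= max M1 M2" "n >= max M1 M2" for m n
  proof -
    have a: "N (sig m \<ominus> sig n) < e / (2 * K2)" "N (tau m \<ominus> tau n) < e / (2 * K1)" using M that by auto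
    have "N (sig m \<ominus> sig n) * N (tau m) <= N (sig m \<ominus> sig n) * K2" using K cl by (intro mult_left_mono) auto
    also have "... < e / (2 * K2) * K2" using a K by (intro mult_strict_right_mono) auto
    finally have 1: "N (sig m \<ominus> sig n) * N (tau m) < e / 2" using K by simp
    have "N (sig n) * N (tau m \<ominus> tau n) <= K1 * N (tau m \<ominus> tau n)" using K cl by (intro mult_right_mono) auto
    also have "... < K1 * (e / (2 * K1))" using a K by (intro mult_strict_left_mono) auto
    finally have 2: "N (sig n) * N (tau m \<ominus> tau n) < e / 2" using K by simp
    show ?thesis using N_mult_minus_mult[of "sig m" "tau m" "sig n" "tau n"] cl 1 2 by simp
  qed
  then show "\<exists>M. \<forall>m\<ge>M. \<forall>n\<ge>M. N ((sig m \<otimes> tau m) \<ominus> (sig n \<otimes> tau n)) < e" by blast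
qed

lemmas cauchy_intros = cauchy_add cauchy_smult cauchy_star cauchy_const cauchy_mult

abbreviation "\<C> == cauchy_alg A N"

lemma cauchy_alg_simps [simp]:
  "carrier \<C> = cauchy_seqs A N" "mult \<C> = (%sig tau n. sig n \<otimes> tau n)" "zero \<C> = (%n. \<zero>)"
  "one \<C> = (%n. \<one>)"
  "add \<C> = (%sig tau n. sig n \<oplus> tau n)" "smult \<C> = (%c sig n. c \<odot> sig n)" "star \<C> = (%sig n. (sig n)\<^sup>\<star>)"
  by (simp_all add: cauchy_alg_def)

lemma star_algebra_cauchy: "star_algebra \<C>"
proof (rule star_algebraI)
  show "star_algebra_axioms \<C>"
    by standard (simp_all add: cauchy_intros cauchy_closed fun_eq_iff mult_assoc distrib_left distrib_right
        smult_mult_left smult_mult_right star_star star_add star_smult star_mult)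
qed (simp_all add: cauchy_intros cauchy_closed fun_eq_iff M.a_ac s_add_left s_add_right s_assoc)

definition cls :: "(nat => 'a) => (nat => 'a) set" where
  "cls sig = null_rel A N `` {sig}"

lemma null_rel_iff: "(sig, tau) : null_rel A N \<longleftrightarrow> sig : cauchy_seqs A N \<and> tau : cauchy_seqs A N \<and>
    (%n. N (sig n \<ominus> tau n)) \<longlonglongrightarrow> 0"
  by (simp add: null_rel_def)

lemma null_seqI:
  assumes "!!n. tau n : carrier A" "!!n. N (tau n) <= f n" "f \<longlonglongrightarrow> 0"
  shows "(%n. N (tau n)) \<longlonglongrightarrow> 0"
  by (rule tendsto_sandwich[OF _ _ tendsto_const assms(3)]) (use assms in auto)

lemma equiv_null_rel: "equiv (cauchy_seqs A N) (null_rel A N)"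
proof (rule equivI)
  show "null_rel A N \<subseteq> cauchy_seqs A N \<times> cauchy_seqs A N" by (auto simp: null_rel_iff)
  show "refl_on (cauchy_seqs A N) (null_rel A N)"
    by (rule refl_onI) (auto simp: null_rel_iff cauchy_closed)
  show "sym (null_rel A N)"
    by (rule symI) (auto simp: null_rel_iff N_minus_commute[OF cauchy_closed cauchy_closed])
  show "trans (null_rel A N)"
  proof (rule transI)
    fix sig tau \<upsilon> assume a: "(sig, tau) : null_rel A N" "(tau, \<upsilon>) : null_rel A N"
    then have "(%n. N (sig n \<ominus> tau n) + N (tau n \<ominus> \<upsilon> n)) \<longlonglongrightarrow> 0 + 0"
      by (intro tendsto_add) (auto simp: null_rel_iff)
    then have "(%n. N (sig n \<ominus> \<upsilon> n)) \<longlonglongrightarrow> 0"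
      using a by (intro null_seqI[where f = "%n. N (sig n \<ominus> tau n) + N (tau n \<ominus> \<upsilon> n)"])
        (auto simp: null_rel_iff cauchy_closed N_minus_triangle)
    with a show "(sig, \<upsilon>) : null_rel A N" by (simp add: null_rel_iff)
  qed
qed

lemma null_rel_mult:
  assumes "(sig, sig') : null_rel A N" "(tau, tau') : null_rel A N"
  shows "(%n. sig n \<otimes> tau n, %n. sig' n \<otimes> tau' n) : null_rel A N"
proof -
  have c: "sig : cauchy_seqs A N" "sig' : cauchy_seqs A N" "tau : cauchy_seqs A N" "tau' : cauchy_seqs A N"
    using assms by (auto simp: null_rel_iff)
  note cl = c[THEN cauchy_closed]
  obtain K1 K2 where K: "!!n. N (sig' n) <= K1" "!!n. N (tau n) <= K2"
    using cauchy_bounded[OF c(2)] cauchy_bounded[OF c(3)] by auto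
  have "(%n. N (sig n \<ominus> sig' n) * K2 + K1 * N (tau n \<ominus> tau' n)) \<longlonglongrightarrow> 0 * K2 + K1 * 0"
    using assms by (intro tendsto_intros) (auto simp: null_rel_iff)
  then have "(%n. N (sig n \<otimes> tau n \<ominus> sig' n \<otimes> tau' n)) \<longlonglongrightarrow> 0"
  proof (intro null_seqI[where f = "%n. N (sig n \<ominus> sig' n) * K2 + K1 * N (tau n \<ominus> tau' n)"])
    fix n
    have "N (sig n \<ominus> sig' n) * N (tau n) <= N (sig n \<ominus> sig' n) * K2"
      "N (sig' n) * N (tau n \<ominus> tau' n) <= K1 * N (tau n \<ominus> tau' n)"
      using K cl by (auto intro: mult_left_mono mult_right_mono)
    then show "N (sig n \<otimes> tau n \<ominus> sig' n \<otimes> tau' n) <= N (sig n \<ominus> sig' n) * K2 + K1 * N (tau n \<ominus> tau' n)"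
      using N_mult_minus_mult[of "sig n" "tau n" "sig' n" "tau' n"] cl by simp
  qed (use cl in auto)
  then show ?thesis using c by (simp add: null_rel_iff cauchy_mult)
qed

lemma null_rel_add:
  assumes "(sig, sig') : null_rel A N" "(tau, tau') : null_rel A N"
  shows "(%n. sig n \<oplus> tau n, %n. sig' n \<oplus> tau' n) : null_rel A N"
proof -
  have c: "sig : cauchy_seqs A N" "sig' : cauchy_seqs A N" "tau : cauchy_seqs A N" "tau' : cauchy_seqs A N"
    using assms by (auto simp: null_rel_iff)
  note cl = c[THEN cauchy_closed]
  have "(%n. N (sig n \<ominus> sig' n) + N (tau n \<ominus> tau' n)) \<longlonglongrightarrow> 0 + 0"
    using assms by (intro tendsto_intros) (auto simp: null_rel_iff)
  then have "(%n. N ((sig n \<oplus> tau n) \<ominus> (sig' n \<oplus> tau' n))) \<longlonglongrightarrow> 0"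
    by (intro null_seqI[where f = "%n. N (sig n \<ominus> sig' n) + N (tau n \<ominus> tau' n)"])
      (use cl in "auto simp: add_minus_add N_triangle")
  then show ?thesis using c by (simp add: null_rel_iff cauchy_add)
qed

lemma null_rel_smult:
  assumes "(sig, sig') : null_rel A N" shows "(%n. c \<odot> sig n, %n. c \<odot> sig' n) : null_rel A N"
proof -
  have c: "sig : cauchy_seqs A N" "sig' : cauchy_seqs A N" using assms by (auto simp: null_rel_iff)
  have "(%n. cmod c * N (sig n \<ominus> sig' n)) \<longlonglongrightarrow> cmod c * 0"
    using assms by (intro tendsto_intros) (auto simp: null_rel_iff)
  then show ?thesis using c
    by (simp add: null_rel_iff cauchy_smult cauchy_closed N_smult flip: s_minus)
qed

lemma null_rel_star:
  assumes "(sig, sig') : null_rel A N" shows "(%n. (sig n)\<^sup>\<star>, %n. (sig' n)\<^sup>\<star>) : null_rel A N"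
  using assms by (simp add: null_rel_iff cauchy_star cauchy_closed N_star flip: star_minus)

abbreviation "\<K> == completion A N"

lemma completion_simps:
  "carrier \<K> = carrier (quotient_star_alg \<C> (null_rel A N))"
  "mult \<K> = mult (quotient_star_alg \<C> (null_rel A N))"
  "zero \<K> = zero (quotient_star_alg \<C> (null_rel A N))"
  "one \<K> = one (quotient_star_alg \<C> (null_rel A N))"
  "add \<K> = add (quotient_star_alg \<C> (null_rel A N))"
  "smult \<K> = smult (quotient_star_alg \<C> (null_rel A N))"
  "star \<K> = star (quotient_star_alg \<C> (null_rel A N))"
  "anorm \<K> = (%X. THE l. \<forall>sig\<in>X. (%n. N (sig n)) \<longlonglongrightarrow> l)"
  by (simp_all add: completion_def star_alg.extend_def normed_star_alg.fields_def)

lemma cls_hom: "star_hom \<C> \<K> cls" and cls_onto: "cls ` cauchy_seqs A N = carrier \<K>"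
  and star_algebra_completion: "star_algebra \<K>" and cls_zero: "cls (%n. \<zero>) = \<zero>\<^bsub>\<K>\<^esub>"
proof -
  have eq: "equiv (carrier \<C>) (null_rel A N)" using equiv_null_rel by simp
  have c: "cls = (%sig. null_rel A N `` {sig})" by (auto simp: cls_def)
  have comp: "(x, x') : null_rel A N ==> (y, y') : null_rel A N ==> (x \<oplus>\<^bsub>\<C>\<^esub> y, x' \<oplus>\<^bsub>\<C>\<^esub> y') : null_rel A N"
    "(x, x') : null_rel A N ==> (y, y') : null_rel A N ==> (x \<otimes>\<^bsub>\<C>\<^esub> y, x' \<otimes>\<^bsub>\<C>\<^esub> y') : null_rel A N"
    "(x, x') : null_rel A N ==> (c \<odot>\<^bsub>\<C>\<^esub> x, c \<odot>\<^bsub>\<C>\<^esub> x') : null_rel A N"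
    "(x, x') : null_rel A N ==> (x\<^sup>\<star>\<^bsub>\<C>\<^esub>, x'\<^sup>\<star>\<^bsub>\<C>\<^esub>) : null_rel A N" for x x' y y' c
    by (simp_all add: null_rel_add null_rel_mult null_rel_smult null_rel_star)
  note q = quotient_star_alg_hom[OF star_algebra_cauchy eq comp]
  show hom: "star_hom \<C> \<K> cls" using q(1) unfolding star_hom_def completion_simps c .
  show onto: "cls ` cauchy_seqs A N = carrier \<K>" using q(2) unfolding completion_simps c by simp
  show z: "cls (%n. \<zero>) = \<zero>\<^bsub>\<K>\<^esub>"
    by (simp add: completion_simps c quotient_star_alg_def)
  show "star_algebra \<K>"
    by (rule star_algebra_image[OF star_algebra_cauchy _ hom]) (use onto z in simp_all)
qed

lemma cls_eq_iff: "sig : cauchy_seqs A N ==> tau : cauchy_seqs A N ==>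
    cls sig = cls tau \<longleftrightarrow> (%n. N (sig n \<ominus> tau n)) \<longlonglongrightarrow> 0"
  unfolding cls_def using eq_equiv_class_iff[OF equiv_null_rel, of sig tau] by (simp add: null_rel_iff)

lemma cls_ops:
  assumes "sig : cauchy_seqs A N" "tau : cauchy_seqs A N"
  shows "cls sig \<oplus>\<^bsub>\<K>\<^esub> cls tau = cls (%n. sig n \<oplus> tau n)" "cls sig \<otimes>\<^bsub>\<K>\<^esub> cls tau = cls (%n. sig n \<otimes> tau n)"
    "c \<odot>\<^bsub>\<K>\<^esub> cls sig = cls (%n. c \<odot> sig n)" "(cls sig)\<^sup>\<star>\<^bsub>\<K>\<^esub> = cls (%n. (sig n)\<^sup>\<star>)"
    "cls sig \<ominus>\<^bsub>\<K>\<^esub> cls tau = cls (%n. sig n \<ominus> tau n)" "cls sig : carrier \<K>"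
proof -
  interpret K: star_algebra \<K> by (rule star_algebra_completion)
  show cl: "cls sig : carrier \<K>" using cls_onto assms by blast
  have cl': "cls tau : carrier \<K>" using cls_onto assms by blast
  note h = star_homD[OF cls_hom, unfolded cauchy_alg_simps, OF assms(1)]
  show a: "cls sig \<oplus>\<^bsub>\<K>\<^esub> cls tau = cls (%n. sig n \<oplus> tau n)" "cls sig \<otimes>\<^bsub>\<K>\<^esub> cls tau = cls (%n. sig n \<otimes> tau n)"
    "c \<odot>\<^bsub>\<K>\<^esub> cls sig = cls (%n. c \<odot> sig n)" "(cls sig)\<^sup>\<star>\<^bsub>\<K>\<^esub> = cls (%n. (sig n)\<^sup>\<star>)"
    using h(2-5) assms(2) by simp_all
  have "cls sig \<ominus>\<^bsub>\<K>\<^esub> cls tau = cls sig \<oplus>\<^bsub>\<K>\<^esub> cls (%n. (- 1) \<odot> tau n)"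
    using cl cl' star_homD(3)[OF cls_hom, unfolded cauchy_alg_simps, OF assms(2)] by (simp add: K.minus_eq_s)
  also have "... = cls (%n. sig n \<oplus> (- 1) \<odot> tau n)"
    using star_homD(2)[OF cls_hom, unfolded cauchy_alg_simps, OF assms(1)] assms(2) by (simp add: cauchy_smult)
  finally show "cls sig \<ominus>\<^bsub>\<K>\<^esub> cls tau = cls (%n. sig n \<ominus> tau n)"
    using assms by (simp add: minus_eq_s cauchy_closed)
qed

lemma cls_unary:
  assumes "sig : cauchy_seqs A N"
  shows "c \<odot>\<^bsub>\<K>\<^esub> cls sig = cls (%n. c \<odot> sig n)" "(cls sig)\<^sup>\<star>\<^bsub>\<K>\<^esub> = cls (%n. (sig n)\<^sup>\<star>)"
    "cls sig : carrier \<K>"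
  using cls_ops(3,4,6)[OF assms assms] by auto

lemma cauchy_minus: "sig : cauchy_seqs A N ==> tau : cauchy_seqs A N ==> (%n. sig n \<ominus> tau n) : cauchy_seqs A N"
  using cauchy_add[of sig "%n. (- 1) \<odot> tau n"] by (simp add: cauchy_smult minus_eq_s cauchy_closed)

text \<open>Norms converge along every representative of the class and to the same limit, so the
  definite description in \<open>completion\<close> is well defined.\<close>

lemma anorm_cls:
  assumes "sig : cauchy_seqs A N"
  shows "(%n. N (sig n)) \<longlonglongrightarrow> anorm \<K> (cls sig)"
proof -
  have "Cauchy (%n. N (sig n))"
  proof (rule CauchyI')
    fix e :: real assume "0 < e"
    then obtain M where M: "\<forall>m\<ge>M. \<forall>n\<ge>M. N (sig m \<ominus> sig n) < e" using cauchyD[OF assms] by blast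
    have "norm (N (sig m) - N (sig n)) < e" if "m >= M" "n > m" for m n
    proof -
      have "N (sig m \<ominus> sig n) < e" using M that by simp
      then show ?thesis using N_diff_le[OF cauchy_closed[OF assms] cauchy_closed[OF assms], of m n] by simp
    qed
    then show "\<exists>M. \<forall>m\<ge>M. \<forall>n>m. dist (N (sig m)) (N (sig n)) < e" by (auto simp: dist_norm)
  qed
  then obtain l where l: "(%n. N (sig n)) \<longlonglongrightarrow> l" by (auto simp: Cauchy_convergent_iff convergent_def)
  have l': "(%n. N (tau n)) \<longlonglongrightarrow> l" if "tau : cls sig" for tau
  proof -
    have t: "tau : cauchy_seqs A N" "(%n. N (sig n \<ominus> tau n)) \<longlonglongrightarrow> 0"
      using that by (auto simp: cls_def null_rel_iff)
    have "(%n. N (sig n) - N (tau n)) \<longlonglongrightarrow> 0"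
      by (rule tendsto_rabs_zero_cancel, rule tendsto_sandwich[OF _ _ tendsto_const t(2)])
        (auto intro!: always_eventually N_diff_le cauchy_closed[OF assms] cauchy_closed[OF t(1)])
    from tendsto_diff[OF l this] show ?thesis by simp
  qed
  have self: "sig : cls sig" using assms by (simp add: cls_def null_rel_iff cauchy_closed)
  have "(THE l. \<forall>sig\<in>cls sig. (%n. N (sig n)) \<longlonglongrightarrow> l) = l"
    by (rule the_equality) (use l' self LIMSEQ_unique in blast)+
  then show ?thesis using l by (simp add: completion_simps)
qed

lemma cstar_norm_completion: "cstar_norm \<K> (anorm \<K>)"
proof -
  interpret K: star_algebra \<K> by (rule star_algebra_completion)
  have all: "(\<forall>X\<in>carrier \<K>. Q X) \<longleftrightarrow> (\<forall>sig\<in>cauchy_seqs A N. Q (cls sig))" for Q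
    unfolding cls_onto[symmetric] by blast
  have U: "f = g" if "(h \<longlonglongrightarrow> f)" "h \<longlonglongrightarrow> g" for f g :: real and h
    using LIMSEQ_unique that by blast
  show ?thesis unfolding cstar_norm_def cstar_seminorm_def all
  proof (intro conjI ballI allI impI)
    fix sig assume s: "sig : cauchy_seqs A N"
    note ls = anorm_cls[OF s] and cl = cauchy_closed[OF s]
    show "0 <= anorm \<K> (cls sig)" by (rule LIMSEQ_le_const[OF ls]) (use cl in auto)
    show "anorm \<K> (c \<odot>\<^bsub>\<K>\<^esub> cls sig) = cmod c * anorm \<K> (cls sig)" for c
      unfolding cls_ops(3)[OF s s]
      by (rule U[OF anorm_cls[OF cauchy_smult[OF s]]]) (use tendsto_mult_left[OF ls] cl in "simp add: N_smult")
    show "anorm \<K> ((cls sig)\<^sup>\<star>\<^bsub>\<K>\<^esub> \<otimes>\<^bsub>\<K>\<^esub> cls sig) = (anorm \<K> (cls sig))^2"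
      unfolding cls_ops(4)[OF s s] cls_ops(2)[OF cauchy_star[OF s] s]
      by (rule U[OF anorm_cls[OF cauchy_mult[OF cauchy_star[OF s] s]]])
        (use tendsto_power[OF ls] cl in "simp add: N_star_mult")
    show "cls sig = \<zero>\<^bsub>\<K>\<^esub>" if "anorm \<K> (cls sig) = 0"
      using that ls cl by (simp add: cls_zero[symmetric] cls_eq_iff s cauchy_const minus_eq_s)
    fix tau assume t: "tau : cauchy_seqs A N"
    note lt = anorm_cls[OF t] and cl' = cauchy_closed[OF t]
    show "anorm \<K> (cls sig \<oplus>\<^bsub>\<K>\<^esub> cls tau) <= anorm \<K> (cls sig) + anorm \<K> (cls tau)"
      unfolding cls_ops(1)[OF s t]
      by (rule LIMSEQ_le[OF anorm_cls[OF cauchy_add[OF s t]] tendsto_add[OF ls lt]])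
        (use cl cl' N_triangle in auto)
    show "anorm \<K> (cls sig \<otimes>\<^bsub>\<K>\<^esub> cls tau) <= anorm \<K> (cls sig) * anorm \<K> (cls tau)"
      unfolding cls_ops(2)[OF s t]
      by (rule LIMSEQ_le[OF anorm_cls[OF cauchy_mult[OF s t]] tendsto_mult[OF ls lt]])
        (use cl cl' N_mult in auto)
  qed
qed

lemma to_completion_cls: "to_completion A N x = cls (%n. x)"
  by (simp add: to_completion_def cls_def)

lemma to_completion_hom: "star_hom A \<K> (to_completion A N)"
  unfolding star_hom_def to_completion_cls by (simp add: cls_unary cls_ops(1,2) cauchy_const)

lemma anorm_to_completion: "x : carrier A ==> anorm \<K> (to_completion A N x) = N x"
  unfolding to_completion_cls
  by (rule LIMSEQ_unique[OF anorm_cls[OF cauchy_const] tendsto_const])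

lemma to_completion_eq_iff: "x : carrier A ==> y : carrier A ==>
    to_completion A N x = to_completion A N y \<longleftrightarrow> N (x \<ominus> y) = 0"
  unfolding to_completion_cls by (simp add: cls_eq_iff cauchy_const LIMSEQ_const_iff)

lemma completion_approx:
  assumes s: "sig : cauchy_seqs A N"
  shows "(%n. anorm \<K> (to_completion A N (sig n) \<ominus>\<^bsub>\<K>\<^esub> cls sig)) \<longlonglongrightarrow> 0"
proof (rule LIMSEQ_I)
  interpret K: seminormed_star_algebra \<K> "anorm \<K>"
    using star_algebra_completion cstar_norm_completion
    by (simp add: seminormed_star_algebra_def seminormed_star_algebra_axioms_def cstar_norm_def)
  fix e :: real assume "0 < e"
  then obtain M where M: "\<forall>m\<ge>M. \<forall>n\<ge>M. N (sig m \<ominus> sig n) < e/2" using cauchyD[OF s, of "e/2"] by auto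
  note cl = cauchy_closed[OF s]
  have "norm (anorm \<K> (to_completion A N (sig n) \<ominus>\<^bsub>\<K>\<^esub> cls sig) - 0) < e" if n: "n >= M" for n
  proof -
    have "to_completion A N (sig n) \<ominus>\<^bsub>\<K>\<^esub> cls sig = cls (%m. sig n \<ominus> sig m)"
      by (simp add: to_completion_cls cls_ops(5) cauchy_const cl s)
    moreover have "anorm \<K> (cls (%m. sig n \<ominus> sig m)) <= e / 2"
    proof (rule LIMSEQ_le_const2[OF anorm_cls])
      show "(%m. sig n \<ominus> sig m) : cauchy_seqs A N" by (intro cauchy_minus cauchy_const s cl)
      show "\<exists>M. \<forall>m\<ge>M. N (sig n \<ominus> sig m) <= e / 2" using M n by (auto intro: less_imp_le)
    qed
    moreover have "to_completion A N (sig n) \<ominus>\<^bsub>\<K>\<^esub> cls sig : carrier \<K>"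
      using K.M.minus_closed[OF cls_unary(3) cls_unary(3), OF cauchy_const[OF cl[of n]] s]
      by (simp add: to_completion_cls)
    ultimately show ?thesis using \<open>0 < e\<close> K.N_nonneg by simp
  qed
  then show "\<exists>M. \<forall>n\<ge>M. norm (anorm \<K> (to_completion A N (sig n) \<ominus>\<^bsub>\<K>\<^esub> cls sig) - 0) < e" by blast
qed

text \<open>Each term of a Cauchy sequence in the completion is approximated by an element
  \<open>tau k\<close> of A within 1 / (k + 1). The sequence tau is itself Cauchy, and its class is
  the limit.\<close>

theorem cstar_algebra_completion: "cstar_algebra \<K>"
proof -
  interpret K: seminormed_star_algebra \<K> "anorm \<K>"
    using star_algebra_completion cstar_norm_completion
    by (simp add: seminormed_star_algebra_def seminormed_star_algebra_axioms_def cstar_norm_def)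
  let ?j = "to_completion A N"
  have jcl: "?j x : carrier \<K>" if "x : carrier A" for x
    using that by (rule star_homD[OF to_completion_hom])
  have jm: "?j x \<ominus>\<^bsub>\<K>\<^esub> ?j y = ?j (x \<ominus> y)" if "x : carrier A" "y : carrier A" for x y
    using star_hom_minus[OF star_algebra_axioms K.star_algebra_axioms to_completion_hom that] by simp
  have "\<exists>X\<in>carrier \<K>. (%n. anorm \<K> (\<Xi> n \<ominus>\<^bsub>\<K>\<^esub> X)) \<longlonglongrightarrow> 0" if X: "\<Xi> : cauchy_seqs \<K> (anorm \<K>)" for \<Xi>
  proof -
    have Xcl: "\<Xi> k : carrier \<K>" for k using X by (rule K.cauchy_closed)
    have "\<exists>x\<in>carrier A. anorm \<K> (?j x \<ominus>\<^bsub>\<K>\<^esub> \<Xi> k) < 1 / real (Suc k)" for k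
    proof -
      obtain sig where s: "sig : cauchy_seqs A N" "\<Xi> k = cls sig" using Xcl[of k] cls_onto by blast
      have "\<forall>\<^sub>F n in sequentially. anorm \<K> (?j (sig n) \<ominus>\<^bsub>\<K>\<^esub> \<Xi> k) < 1 / real (Suc k)"
        using order_tendstoD(2)[OF completion_approx[OF s(1)], of "1 / real (Suc k)"] by (simp add: s)
      then obtain n where "anorm \<K> (?j (sig n) \<ominus>\<^bsub>\<K>\<^esub> \<Xi> k) < 1 / real (Suc k)"
        using eventually_happens'[OF sequentially_bot] by blast
      then show ?thesis using cauchy_closed[OF s(1)] by blast
    qed
    then obtain tau where tcl: "!!k. tau k : carrier A" and
      tau: "!!k. anorm \<K> (?j (tau k) \<ominus>\<^bsub>\<K>\<^esub> \<Xi> k) < 1 / real (Suc k)" by metis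
    have "tau : cauchy_seqs A N"
    proof (rule cauchy_seqsI[OF tcl])
      fix e :: real assume e: "0 < e"
      then obtain M where M: "\<forall>m\<ge>M. \<forall>n\<ge>M. anorm \<K> (\<Xi> m \<ominus>\<^bsub>\<K>\<^esub> \<Xi> n) < e/3"
        using K.cauchyD[OF X, of "e/3"] by auto
      obtain L where L: "1 / real (Suc L) < e/3" using nat_approx_posE[of "e/3"] e by auto
      have "N (tau m \<ominus> tau n) < e" if mn: "m >= max M L" "n >= max M L" for m n
      proof -
        have small: "anorm \<K> (?j (tau k) \<ominus>\<^bsub>\<K>\<^esub> \<Xi> k) < e/3" if "k >= L" for k
        proof -
          have "1 / real (Suc k) <= 1 / real (Suc L)" using that by (simp add: field_simps)
          then show ?thesis using tau[of k] L by simp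
        qed
        have "N (tau m \<ominus> tau n) = anorm \<K> (?j (tau m) \<ominus>\<^bsub>\<K>\<^esub> ?j (tau n))"
          by (simp add: jm tcl anorm_to_completion)
        also have "... <= anorm \<K> (?j (tau m) \<ominus>\<^bsub>\<K>\<^esub> \<Xi> m) + (anorm \<K> (\<Xi> m \<ominus>\<^bsub>\<K>\<^esub> \<Xi> n) + anorm \<K> (\<Xi> n \<ominus>\<^bsub>\<K>\<^esub> ?j (tau n)))"
          using K.N_minus_triangle[of "?j (tau m)" "\<Xi> m" "?j (tau n)"]
            K.N_minus_triangle[of "\<Xi> m" "\<Xi> n" "?j (tau n)"] jcl[OF tcl] Xcl by (smt (verit))
        also have "... < e/3 + (e/3 + e/3)"
        proof (intro add_strict_mono)
          show "anorm \<K> (?j (tau m) \<ominus>\<^bsub>\<K>\<^esub> \<Xi> m) < e/3" using small mn by simp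
          show "anorm \<K> (\<Xi> m \<ominus>\<^bsub>\<K>\<^esub> \<Xi> n) < e/3" using M mn by simp
          show "anorm \<K> (\<Xi> n \<ominus>\<^bsub>\<K>\<^esub> ?j (tau n)) < e/3"
            using small[of n] mn K.N_minus_commute[OF Xcl jcl[OF tcl]] by simp
        qed
        finally show ?thesis by simp
      qed
      then show "\<exists>M. \<forall>m\<ge>M. \<forall>n\<ge>M. N (tau m \<ominus> tau n) < e" by blast
    qed
    note t = this
    have "(%n. anorm \<K> (\<Xi> n \<ominus>\<^bsub>\<K>\<^esub> cls tau)) \<longlonglongrightarrow> 0"
    proof (rule K.null_seqI)
      have "(%n. 1 / real (Suc n) + anorm \<K> (?j (tau n) \<ominus>\<^bsub>\<K>\<^esub> cls tau)) \<longlonglongrightarrow> 0 + 0"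
        by (intro tendsto_add completion_approx[OF t] LIMSEQ_Suc[OF lim_1_over_n])
      then show "(%n. 1 / real (Suc n) + anorm \<K> (?j (tau n) \<ominus>\<^bsub>\<K>\<^esub> cls tau)) \<longlonglongrightarrow> 0" by simp
      fix n
      show "\<Xi> n \<ominus>\<^bsub>\<K>\<^esub> cls tau : carrier \<K>" using Xcl cls_ops(6)[OF t t] by simp
      show "anorm \<K> (\<Xi> n \<ominus>\<^bsub>\<K>\<^esub> cls tau) <= 1 / real (Suc n) + anorm \<K> (?j (tau n) \<ominus>\<^bsub>\<K>\<^esub> cls tau)"
        using K.N_minus_triangle[OF Xcl[of n] jcl[OF tcl[of n]] cls_ops(6)[OF t t]] tau[of n]
          K.N_minus_commute[OF Xcl[of n] jcl[OF tcl[of n]]] by simp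
    qed
    then show ?thesis using cls_ops(6)[OF t t] by blast
  qed
  then show ?thesis unfolding cstar_algebra_def
    using star_algebra_completion cstar_norm_completion by blast
qed

end

section \<open>Free star-algebras and universal seminorms\<close>

declare One_nat_def [simp del]

text \<open>Universal property of the semigroup algebra. Multiplicativity is verified first for a
  basis element on the left and then extended by linearity.\<close>

lemma (in involutive_semigroup) star_hom_lin:
  assumes "star_algebra B"
    and cl: "!!s. s : carrier S ==> m s : carrier B"
    and mult: "!!s t. s : carrier S ==> t : carrier S ==> m (s \<otimes> t) = m s \<otimes>\<^bsub>B\<^esub> m t"
    and star: "!!s. s : carrier S ==> m (i s) = (m s)\<^sup>\<star>\<^bsub>B\<^esub>"
  shows "star_hom \<A> B (%f. star_algebra.lin B f m)"
proof -
  interpret B: star_algebra B by fact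
  interpret A: star_algebra \<A> by (rule star_algebra)
  let ?phi = "%f. B.lin f m"
  have c: "?phi f : carrier B" if "f : carrier \<A>" for f
    using that by (auto intro!: B.lin_closed cl dest: alg_support)
  have plus: "?phi (f \<oplus>\<^bsub>\<A>\<^esub> g) = ?phi f \<oplus>\<^bsub>B\<^esub> ?phi g" if "f : carrier \<A>" "g : carrier \<A>" for f g
    using that by (auto simp: alg_simps intro!: B.lin_add cl dest: alg_support alg_finite)
  have sm: "?phi (a \<odot>\<^bsub>\<A>\<^esub> f) = a \<odot>\<^bsub>B\<^esub> ?phi f" if "f : carrier \<A>" for a f
    using that by (auto simp: alg_simps intro!: B.lin_smult cl dest: alg_support alg_finite)
  have sg: "?phi (single s) = m s" if "s : carrier S" for s
    using that cl by simp
  have z: "?phi \<zero>\<^bsub>\<A>\<^esub> = \<zero>\<^bsub>B\<^esub>" by (simp add: alg_simps)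
  have single_left: "?phi (single s \<otimes>\<^bsub>\<A>\<^esub> g) = m s \<otimes>\<^bsub>B\<^esub> ?phi g" if s: "s : carrier S" and g: "g : carrier \<A>" for s g
    using g
  proof (induction rule: alg_induct)
    case (add a t g)
    then show ?case using s
      by (simp add: A.distrib_left A.smult_mult_right plus sm sg mult_single single_carrier mult c cl
          sg_closed B.distrib_left B.smult_mult_right)
  qed (use s z cl in "simp add: single_carrier")
  have mu: "?phi (f \<otimes>\<^bsub>\<A>\<^esub> g) = ?phi f \<otimes>\<^bsub>B\<^esub> ?phi g" if f: "f : carrier \<A>" and g: "g : carrier \<A>" for f g
    using f
  proof (induction rule: alg_induct)
    case (add a s f)
    then have f: "f : carrier \<A>" and s: "s : carrier S"
      and IH: "?phi (f \<otimes>\<^bsub>\<A>\<^esub> g) = ?phi f \<otimes>\<^bsub>B\<^esub> ?phi g" by auto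
    note s' = single_carrier[OF s]
    have "?phi ((a \<odot>\<^bsub>\<A>\<^esub> single s \<oplus>\<^bsub>\<A>\<^esub> f) \<otimes>\<^bsub>\<A>\<^esub> g) = a \<odot>\<^bsub>B\<^esub> (m s \<otimes>\<^bsub>B\<^esub> ?phi g) \<oplus>\<^bsub>B\<^esub> ?phi f \<otimes>\<^bsub>B\<^esub> ?phi g"
      using s' f g by (simp only: A.distrib_right A.smult_mult_left plus sm IH single_left[OF s g]
          A.s_closed A.mult_closed)
    also have "... = (a \<odot>\<^bsub>B\<^esub> m s \<oplus>\<^bsub>B\<^esub> ?phi f) \<otimes>\<^bsub>B\<^esub> ?phi g"
      using c[OF f] c[OF g] cl[OF s] by (simp only: B.distrib_right B.smult_mult_left B.s_closed)
    also have "... = ?phi (a \<odot>\<^bsub>\<A>\<^esub> single s \<oplus>\<^bsub>\<A>\<^esub> f) \<otimes>\<^bsub>B\<^esub> ?phi g"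
      using s' f by (simp only: plus sm sg[OF s] A.s_closed)
    finally show ?case .
  qed (use g z c in simp)
  have st: "?phi (f\<^sup>\<star>\<^bsub>\<A>\<^esub>) = (?phi f)\<^sup>\<star>\<^bsub>B\<^esub>" if f: "f : carrier \<A>" for f
    using f
  proof (induction rule: alg_induct)
    case (add a s f)
    then have f: "f : carrier \<A>" and s: "s : carrier S"
      and IH: "?phi (f\<^sup>\<star>\<^bsub>\<A>\<^esub>) = (?phi f)\<^sup>\<star>\<^bsub>B\<^esub>" by auto
    note s' = single_carrier[OF s] and is' = single_carrier[OF inv_closed[OF s]]
    have "?phi ((a \<odot>\<^bsub>\<A>\<^esub> single s \<oplus>\<^bsub>\<A>\<^esub> f)\<^sup>\<star>\<^bsub>\<A>\<^esub>) = cnj a \<odot>\<^bsub>B\<^esub> (m s)\<^sup>\<star>\<^bsub>B\<^esub> \<oplus>\<^bsub>B\<^esub> (?phi f)\<^sup>\<star>\<^bsub>B\<^esub>"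
      using s' is' f by (simp only: A.star_add A.star_smult star_single[OF s] plus sm IH A.s_closed
          A.star_closed sg[OF inv_closed[OF s]] star[OF s])
    also have "... = (a \<odot>\<^bsub>B\<^esub> m s \<oplus>\<^bsub>B\<^esub> ?phi f)\<^sup>\<star>\<^bsub>B\<^esub>"
      using c[OF f] cl[OF s] by (simp only: B.star_add B.star_smult B.s_closed)
    also have "... = (?phi (a \<odot>\<^bsub>\<A>\<^esub> single s \<oplus>\<^bsub>\<A>\<^esub> f))\<^sup>\<star>\<^bsub>B\<^esub>"
      using s' f by (simp only: plus sm sg[OF s] A.s_closed)
    finally show ?case .
  qed (use z in simp)
  show ?thesis unfolding star_hom_def by (intro conjI ballI allI c plus sm mu st)
qed

lemma word_star_simps [simp]:
  "word_star [] = []" "word_star (v @ w) = word_star w @ word_star v" "word_star (word_star w) = w"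
  "word_star w = [] \<longleftrightarrow> w = []" "word_star [(g, b)] = [(g, \<not> b)]"
  by (auto simp: word_star_def rev_map case_prod_beta comp_def)

lemma word_star_lists: "word_star w : lists (G \<times> UNIV) \<longleftrightarrow> w : lists (G \<times> UNIV)"
  by (force simp: word_star_def in_lists_conv_set)

abbreviation "words_ne G == \<lparr>carrier = lists (G \<times> UNIV) - {[]}, mult = (@), one = []\<rparr>"
abbreviation "words G == \<lparr>carrier = lists (G \<times> UNIV), mult = (@), one = []\<rparr>"

lemma involutive_words_ne: "involutive_semigroup (words_ne G :: 'g word monoid) word_star"
  by standard (auto simp: word_star_lists)

lemma involutive_words: "involutive_semigroup (words G :: 'g word monoid) word_star"
  by standard (auto simp: word_star_lists)

lemma free_star_alg_facts:
  fixes G :: "'g set"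
  defines "F == free_star_alg G"
  shows "star_algebra F"
    and "!!w. w : lists (G \<times> UNIV) ==> w ~= [] ==> single w : carrier F"
    and "!!v w. v : lists (G \<times> UNIV) ==> v ~= [] ==> w : lists (G \<times> UNIV) ==> w ~= [] ==>
      single v \<otimes>\<^bsub>F\<^esub> single w = single (v @ w)"
    and "!!w. w : lists (G \<times> UNIV) ==> w ~= [] ==> (single w)\<^sup>\<star>\<^bsub>F\<^esub> = single (word_star w)"
proof -
  interpret involutive_semigroup "words_ne G" word_star by (rule involutive_words_ne)
  show "star_algebra F" unfolding F_def free_star_alg_def by (rule star_algebra)
  show "!!w. w : lists (G \<times> UNIV) ==> w ~= [] ==> single w : carrier F"
    unfolding F_def free_star_alg_def by (rule single_carrier) simp
  show "!!v w. v : lists (G \<times> UNIV) ==> v ~= [] ==> w : lists (G \<times> UNIV) ==> w ~= [] ==>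
      single v \<otimes>\<^bsub>F\<^esub> single w = single (v @ w)"
    unfolding F_def free_star_alg_def by (subst mult_single) auto
  show "!!w. w : lists (G \<times> UNIV) ==> w ~= [] ==> (single w)\<^sup>\<star>\<^bsub>F\<^esub> = single (word_star w)"
    unfolding F_def free_star_alg_def by (rule star_single) simp
qed

lemma free_unital_star_alg_facts:
  fixes G :: "'g set"
  defines "F == free_unital_star_alg G"
  shows "star_algebra F"
    and "!!w. w : lists (G \<times> UNIV) ==> single w : carrier F"
    and "!!v w. v : lists (G \<times> UNIV) ==> w : lists (G \<times> UNIV) ==>
      single v \<otimes>\<^bsub>F\<^esub> single w = single (v @ w)"
    and "!!w. w : lists (G \<times> UNIV) ==> (single w)\<^sup>\<star>\<^bsub>F\<^esub> = single (word_star w)"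
proof -
  interpret involutive_semigroup "words G" word_star by (rule involutive_words)
  show "star_algebra F" unfolding F_def free_unital_star_alg_def by (rule star_algebra)
  show "!!w. w : lists (G \<times> UNIV) ==> single w : carrier F"
    unfolding F_def free_unital_star_alg_def by (rule single_carrier) simp
  show "!!v w. v : lists (G \<times> UNIV) ==> w : lists (G \<times> UNIV) ==>
      single v \<otimes>\<^bsub>F\<^esub> single w = single (v @ w)"
    unfolding F_def free_unital_star_alg_def by (subst mult_single) auto
  show "!!w. w : lists (G \<times> UNIV) ==> (single w)\<^sup>\<star>\<^bsub>F\<^esub> = single (word_star w)"
    unfolding F_def free_unital_star_alg_def by (rule star_single) simp
qed

lemma star_hom_free:
  assumes "star_algebra B"
    and "!!w. w : lists (G \<times> UNIV) ==> w ~= [] ==> m w : carrier B"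
    and "!!v w. v : lists (G \<times> UNIV) ==> v ~= [] ==> w : lists (G \<times> UNIV) ==> w ~= [] ==>
      m (v @ w) = m v \<otimes>\<^bsub>B\<^esub> m w"
    and "!!w. w : lists (G \<times> UNIV) ==> w ~= [] ==> m (word_star w) = (m w)\<^sup>\<star>\<^bsub>B\<^esub>"
  shows "star_hom (free_star_alg G) B (%f. star_algebra.lin B f m)"
  unfolding free_star_alg_def
  by (rule involutive_semigroup.star_hom_lin[OF involutive_words_ne assms(1)]) (use assms in auto)

lemma star_hom_free_unital:
  assumes "star_algebra B"
    and "!!w. w : lists (G \<times> UNIV) ==> m w : carrier B"
    and "!!v w. v : lists (G \<times> UNIV) ==> w : lists (G \<times> UNIV) ==> m (v @ w) = m v \<otimes>\<^bsub>B\<^esub> m w"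
    and "!!w. w : lists (G \<times> UNIV) ==> m (word_star w) = (m w)\<^sup>\<star>\<^bsub>B\<^esub>"
  shows "star_hom (free_unital_star_alg G) B (%f. star_algebra.lin B f m)"
  unfolding free_unital_star_alg_def
  by (rule involutive_semigroup.star_hom_lin[OF involutive_words assms(1)]) (use assms in auto)

lemma free_induct [consumes 1, case_names zero add]:
  assumes "f : carrier (free_star_alg G)" "Q \<zero>\<^bsub>free_star_alg G\<^esub>"
    and "!!c w g. g : carrier (free_star_alg G) ==> w : lists (G \<times> UNIV) ==> w ~= [] ==> Q g ==>
      Q (c \<odot>\<^bsub>free_star_alg G\<^esub> single w \<oplus>\<^bsub>free_star_alg G\<^esub> g)"
  shows "Q f"
  using assms(1)[unfolded free_star_alg_def]
  by (rule involutive_semigroup.alg_induct[OF involutive_words_ne]) (use assms(2,3) in "auto simp: free_star_alg_def")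

lemma free_unital_induct [consumes 1, case_names zero add]:
  assumes "f : carrier (free_unital_star_alg G)" "Q \<zero>\<^bsub>free_unital_star_alg G\<^esub>"
    and "!!c w g. g : carrier (free_unital_star_alg G) ==> w : lists (G \<times> UNIV) ==> Q g ==>
      Q (c \<odot>\<^bsub>free_unital_star_alg G\<^esub> single w \<oplus>\<^bsub>free_unital_star_alg G\<^esub> g)"
  shows "Q f"
  using assms(1)[unfolded free_unital_star_alg_def]
  by (rule involutive_semigroup.alg_induct[OF involutive_words]) (use assms(2,3) in "auto simp: free_unital_star_alg_def")

lemma seminormed_star_algebraI:
  "star_algebra A ==> cstar_seminorm A N ==> seminormed_star_algebra A N"
  by (simp add: seminormed_star_algebra_def seminormed_star_algebra_axioms_def)

section \<open>Pullbacks and suprema of C*-seminorms; isomorphic completions\<close>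

lemma cstar_seminorm_hom:
  assumes "star_algebra A" "star_algebra B" "cstar_seminorm B N" "star_hom A B phi"
  shows "cstar_seminorm A (%x. N (phi x))"
proof -
  interpret A: star_algebra A by fact
  interpret B: seminormed_star_algebra B N by (rule seminormed_star_algebraI) fact+
  show ?thesis unfolding cstar_seminorm_def
    using star_homD[OF assms(4)] B.N_triangle B.N_mult B.N_smult B.N_star_mult by simp
qed

text \<open>The C*-identity survives because squaring is increasing on nonnegative numbers and so
  commutes with suprema.\<close>

lemma cstar_seminorm_SUP:
  assumes "star_algebra A" and ne: "\<Q> ~= {}" and sn: "!!p. p : \<Q> ==> cstar_seminorm A p"
    and bdd: "!!x. x : carrier A ==> bdd_above ((%p. p x) ` \<Q>)"
  shows "cstar_seminorm A (%x. SUP p\<in>\<Q>. p x)"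
proof -
  interpret A: star_algebra A by fact
  let ?N = "%x. SUP p\<in>\<Q>. p x"
  have S: "seminormed_star_algebra A p" if "p : \<Q>" for p
    by (rule seminormed_star_algebraI[OF assms(1) sn[OF that]])
  have up: "p x <= ?N x" if "p : \<Q>" "x : carrier A" for p x
    by (rule cSUP_upper[OF that(1) bdd[OF that(2)]])
  have least: "?N x <= c" if "!!p. p : \<Q> ==> p x <= c" for x c
    by (rule cSUP_least[OF ne that])
  have nn: "0 <= ?N x" if x: "x : carrier A" for x
  proof -
    obtain p where p: "p : \<Q>" using ne by blast
    show ?thesis using seminormed_star_algebra.N_nonneg[OF S[OF p] x] up[OF p x] by simp
  qed
  have sm: "?N (c \<odot>\<^bsub>A\<^esub> x) <= cmod c * ?N x" if x: "x : carrier A" for c x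
    by (rule least) (use up x in "auto simp: seminormed_star_algebra.N_smult[OF S] intro!: mult_left_mono")
  show ?thesis unfolding cstar_seminorm_def
  proof (intro conjI ballI allI)
    fix x assume x: "x : carrier A"
    show "0 <= ?N x" by (rule nn[OF x])
    show "?N (c \<odot>\<^bsub>A\<^esub> x) = cmod c * ?N x" for c
    proof (cases "c = 0")
      case True
      then show ?thesis using sm[OF x, of 0] nn[of "\<zero>\<^bsub>A\<^esub>"] x by simp
    next
      case False
      have "x = inverse c \<odot>\<^bsub>A\<^esub> (c \<odot>\<^bsub>A\<^esub> x)" using False x by (simp add: A.s_assoc)
      then have "?N x <= cmod (inverse c) * ?N (c \<odot>\<^bsub>A\<^esub> x)" using sm[of "c \<odot>\<^bsub>A\<^esub> x" "inverse c"] x by simp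
      then have "?N x <= inverse (cmod c) * ?N (c \<odot>\<^bsub>A\<^esub> x)" unfolding norm_inverse .
      then show ?thesis using sm[OF x, of c] False by (simp add: field_simps)
    qed
    show "?N (x\<^sup>\<star>\<^bsub>A\<^esub> \<otimes>\<^bsub>A\<^esub> x) = (?N x)^2"
    proof (rule antisym)
      show "?N (x\<^sup>\<star>\<^bsub>A\<^esub> \<otimes>\<^bsub>A\<^esub> x) <= (?N x)^2"
        by (rule least) (use up x in "auto simp: seminormed_star_algebra.N_star_mult[OF S]
            seminormed_star_algebra.N_nonneg[OF S] intro!: power_mono")
      have q: "0 <= ?N (x\<^sup>\<star>\<^bsub>A\<^esub> \<otimes>\<^bsub>A\<^esub> x)" by (rule nn) (simp add: x)
      have "?N x <= sqrt (?N (x\<^sup>\<star>\<^bsub>A\<^esub> \<otimes>\<^bsub>A\<^esub> x))"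
      proof (rule least)
        fix p assume p: "p : \<Q>"
        have "(p x)^2 <= ?N (x\<^sup>\<star>\<^bsub>A\<^esub> \<otimes>\<^bsub>A\<^esub> x)"
          using up[OF p, of "x\<^sup>\<star>\<^bsub>A\<^esub> \<otimes>\<^bsub>A\<^esub> x"] x by (simp add: seminormed_star_algebra.N_star_mult[OF S[OF p]])
        then show "p x <= sqrt (?N (x\<^sup>\<star>\<^bsub>A\<^esub> \<otimes>\<^bsub>A\<^esub> x))" by (rule real_le_rsqrt)
      qed
      then have "(?N x)^2 <= (sqrt (?N (x\<^sup>\<star>\<^bsub>A\<^esub> \<otimes>\<^bsub>A\<^esub> x)))^2" using nn[OF x] by (intro power_mono)
      then show "(?N x)^2 <= ?N (x\<^sup>\<star>\<^bsub>A\<^esub> \<otimes>\<^bsub>A\<^esub> x)" using q by simp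
    qed
    fix y assume y: "y : carrier A"
    show "?N (x \<oplus>\<^bsub>A\<^esub> y) <= ?N x + ?N y"
      by (rule least) (use up x y seminormed_star_algebra.N_triangle[OF S] in "meson add_mono order_trans")
    show "?N (x \<otimes>\<^bsub>A\<^esub> y) <= ?N x * ?N y"
    proof (rule least)
      fix p assume p: "p : \<Q>"
      have "p (x \<otimes>\<^bsub>A\<^esub> y) <= p x * p y" by (rule seminormed_star_algebra.N_mult[OF S[OF p] x y])
      also have "... <= ?N x * ?N y"
        by (intro mult_mono up p x y nn seminormed_star_algebra.N_nonneg[OF S[OF p]])
      finally show "p (x \<otimes>\<^bsub>A\<^esub> y) <= ?N x * ?N y" .
    qed
  qed
qed

text \<open>Isometry transports Cauchy and null sequences in both directions. Density is demanded at
  distance exactly zero, so that a Cauchy sequence in the target is lifted term by term.\<close>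

lemma completion_isomorphic:
  fixes F :: "'a star_alg" and F' :: "'b star_alg"
  assumes "star_algebra F" "cstar_seminorm F p" "star_algebra F'" "cstar_seminorm F' p'"
    and hom: "star_hom F F' phi" and iso: "!!x. x : carrier F ==> p' (phi x) = p x"
    and dense: "!!y. y : carrier F' ==> \<exists>x\<in>carrier F. p' (phi x \<ominus>\<^bsub>F'\<^esub> y) = 0"
  shows "completion F p \<cong>\<^sup>\<star> completion F' p'"
proof -
  interpret F: seminormed_star_algebra F p by (rule seminormed_star_algebraI) fact+
  interpret F': seminormed_star_algebra F' p' by (rule seminormed_star_algebraI) fact+
  have hm: "phi (x \<ominus>\<^bsub>F\<^esub> y) = phi x \<ominus>\<^bsub>F'\<^esub> phi y" if "x : carrier F" "y : carrier F" for x y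
    by (rule star_hom_minus[OF assms(1,3) hom that])
  have cau: "(%n. phi (sig n)) : cauchy_seqs F' p'" if s: "sig : cauchy_seqs F p" for sig
  proof (rule F'.cauchy_seqsI)
    show "phi (sig n) : carrier F'" for n using star_homD(1)[OF hom] F.cauchy_closed[OF s] by blast
    fix e :: real assume "0 < e"
    then show "\<exists>M. \<forall>m\<ge>M. \<forall>n\<ge>M. p' (phi (sig m) \<ominus>\<^bsub>F'\<^esub> phi (sig n)) < e"
      using F.cauchyD[OF s] F.cauchy_closed[OF s] by (simp add: iso flip: hm)
  qed
  \<comment> \<open>The chosen representative is immaterial, since phi maps null differences to null
    differences.\<close>
  define \<Phi> where "\<Phi> X = F'.cls (%n. phi ((SOME sig. sig : cauchy_seqs F p \<and> X = F.cls sig) n))" for X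
  have \<Phi>: "\<Phi> (F.cls sig) = F'.cls (%n. phi (sig n))" if s: "sig : cauchy_seqs F p" for sig
  proof -
    define tau where "tau = (SOME tau. tau : cauchy_seqs F p \<and> F.cls sig = F.cls tau)"
    have t: "tau : cauchy_seqs F p \<and> F.cls sig = F.cls tau"
      unfolding tau_def by (rule someI[of _ sig]) (simp add: s)
    then have "(%n. p (sig n \<ominus>\<^bsub>F\<^esub> tau n)) \<longlonglongrightarrow> 0" using F.cls_eq_iff[OF s] by blast
    then have "F'.cls (%n. phi (sig n)) = F'.cls (%n. phi (tau n))"
      using s t by (simp add: F'.cls_eq_iff cau F.cauchy_closed iso flip: hm)
    then show ?thesis by (simp add: \<Phi>_def tau_def)
  qed
  have all: "(\<forall>X\<in>carrier (completion F p). Q X) \<longleftrightarrow> (\<forall>sig\<in>cauchy_seqs F p. Q (F.cls sig))" for Q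
    unfolding F.cls_onto[symmetric] by blast
  note ops = F.cls_ops(1,2) F.cls_unary F'.cls_ops(1,2) F'.cls_unary
  have "bij_betw \<Phi> (carrier (completion F p)) (carrier (completion F' p'))"
    unfolding bij_betw_def
  proof (intro conjI)
    have "\<forall>X\<in>carrier (completion F p). \<forall>Y\<in>carrier (completion F p). \<Phi> X = \<Phi> Y --> X = Y"
      unfolding all
      by (simp add: \<Phi> F.cls_eq_iff F'.cls_eq_iff cau F.cauchy_closed iso flip: hm)
    then show "inj_on \<Phi> (carrier (completion F p))" by (simp add: inj_on_def)
    show "\<Phi> ` carrier (completion F p) = carrier (completion F' p')"
    proof
      have "\<forall>X\<in>carrier (completion F p). \<Phi> X : carrier (completion F' p')"
        unfolding all by (simp add: \<Phi> F'.cls_unary(3) cau)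
      then show "\<Phi> ` carrier (completion F p) \<subseteq> carrier (completion F' p')" by blast
      show "carrier (completion F' p') \<subseteq> \<Phi> ` carrier (completion F p)"
      proof
        fix Y assume "Y : carrier (completion F' p')"
        then obtain tau where t: "tau : cauchy_seqs F' p'" "Y = F'.cls tau" using F'.cls_onto by blast
        obtain sig where s: "!!n. sig n : carrier F" "!!n. p' (phi (sig n) \<ominus>\<^bsub>F'\<^esub> tau n) = 0"
          using dense[OF F'.cauchy_closed[OF t(1)]] by metis
        have cl: "phi (sig n) : carrier F'" "tau n : carrier F'" for n
          using star_homD(1)[OF hom s(1)] F'.cauchy_closed[OF t(1)] by auto
        have eq: "p' (phi (sig m) \<ominus>\<^bsub>F'\<^esub> phi (sig n)) <= p' (tau m \<ominus>\<^bsub>F'\<^esub> tau n)" for m n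
          using F'.N_minus_triangle[OF cl(1)[of m] cl(2)[of m] cl(1)[of n]]
            F'.N_minus_triangle[OF cl(2)[of m] cl(2)[of n] cl(1)[of n]] s(2)[of m] s(2)[of n]
            F'.N_minus_commute[OF cl(1)[of n] cl(2)[of n]] by simp
        have "sig : cauchy_seqs F p"
        proof (rule F.cauchy_seqsI[OF s(1)])
          fix e :: real assume "0 < e"
          then obtain M where M: "\<forall>m\<ge>M. \<forall>n\<ge>M. p' (tau m \<ominus>\<^bsub>F'\<^esub> tau n) < e"
            using F'.cauchyD[OF t(1)] by blast
          show "\<exists>M. \<forall>m\<ge>M. \<forall>n\<ge>M. p (sig m \<ominus>\<^bsub>F\<^esub> sig n) < e"
          proof (intro exI[of _ M] allI impI)
            fix m n assume "M <= m" "M <= n"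
            then have "p' (phi (sig m) \<ominus>\<^bsub>F'\<^esub> phi (sig n)) < e" using M order.strict_trans1[OF eq] by blast
            then show "p (sig m \<ominus>\<^bsub>F\<^esub> sig n) < e" using s(1) by (simp add: hm flip: iso)
          qed
        qed
        note sc = this
        have "Y = \<Phi> (F.cls sig)"
          using t by (simp add: \<Phi>[OF sc] F'.cls_eq_iff cau[OF sc] F'.N_minus_commute[OF cl(2) cl(1)] s(2))
        then show "Y : \<Phi> ` carrier (completion F p)" using F.cls_unary(3)[OF sc] by blast
      qed
    qed
  qed
  moreover have "\<forall>X\<in>carrier (completion F p). \<forall>Y\<in>carrier (completion F p).
      \<Phi> (X \<oplus>\<^bsub>completion F p\<^esub> Y) = \<Phi> X \<oplus>\<^bsub>completion F' p'\<^esub> \<Phi> Y"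
    "\<forall>X\<in>carrier (completion F p). \<forall>c. \<Phi> (c \<odot>\<^bsub>completion F p\<^esub> X) = c \<odot>\<^bsub>completion F' p'\<^esub> \<Phi> X"
    "\<forall>X\<in>carrier (completion F p). \<forall>Y\<in>carrier (completion F p).
      \<Phi> (X \<otimes>\<^bsub>completion F p\<^esub> Y) = \<Phi> X \<otimes>\<^bsub>completion F' p'\<^esub> \<Phi> Y"
    "\<forall>X\<in>carrier (completion F p). \<Phi> (X\<^sup>\<star>\<^bsub>completion F p\<^esub>) = (\<Phi> X)\<^sup>\<star>\<^bsub>completion F' p'\<^esub>"
    unfolding all
    by (simp_all add: ops \<Phi> cau F.cauchy_add F.cauchy_mult F.cauchy_smult F.cauchy_star
        F.cauchy_closed star_homD[OF hom])
  ultimately show ?thesis unfolding star_isomorphic_def by blast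
qed

section \<open>Families of projections and a unitary\<close>

text \<open>Common normal form of the two presentations, in which the sum of the projections takes
  the role of the unit.\<close>

definition unit_family :: "nat => ('a, 'm) star_alg_scheme => (nat => 'a) => 'a => bool" where
  "unit_family n A p s \<longleftrightarrow> (\<forall>i\<in>{1..n}. projection A (p i)) \<and>
     (\<forall>i\<in>{1..n}. \<forall>j\<in>{1..n}. i ~= j --> p i \<otimes>\<^bsub>A\<^esub> p j = \<zero>\<^bsub>A\<^esub>) \<and> s : carrier A \<and>
     s\<^sup>\<star>\<^bsub>A\<^esub> \<otimes>\<^bsub>A\<^esub> s = (\<Oplus>\<^bsub>A\<^esub>i\<in>{1..n}. p i) \<and> s \<otimes>\<^bsub>A\<^esub> s\<^sup>\<star>\<^bsub>A\<^esub> = (\<Oplus>\<^bsub>A\<^esub>i\<in>{1..n}. p i)"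

locale normed_star_algebra = seminormed_star_algebra +
  assumes N_definite: "x : carrier A ==> N x = 0 ==> x = \<zero>"
begin

lemma star_mult_zero: "x : carrier A ==> x\<^sup>\<star> \<otimes> x = \<zero> ==> x = \<zero>"
  using N_star_mult[of x] by (intro N_definite) simp_all

text \<open>The only way in which positivity of \<open>c\<^sup>\<star> c\<close> enters the study of the relations.\<close>

lemma star_mult_zero_if_functionals_zero:
  assumes "x : carrier A" "!!F. positive_functional A F ==> Re (F (x\<^sup>\<star> \<otimes> x)) <= 0"
  shows "x = \<zero>"
proof (rule ccontr)
  assume "x ~= \<zero>"
  then have "0 < N x" using N_definite[OF assms(1)] N_nonneg[OF assms(1)] by fastforce
  from positive_functional_exists[OF assms(1) this] assms(2) show False by fastforce
qed

text \<open>Let q - p = c* c and w = p - q p. Then (c p)* (c p) equals - w* w, so that no positive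
  functional can be positive at w* w; hence w = 0.\<close>

lemma projection_le_imp_mult:
  assumes p: "projection A p" and q: "projection A q" and le: "cstar_le A p q"
  shows "p \<otimes> q = p" "q \<otimes> p = p"
proof -
  have [simp]: "p : carrier A" "q : carrier A" and ps: "p\<^sup>\<star> = p" "q\<^sup>\<star> = q"
    and pp: "p \<otimes> p = p" "q \<otimes> q = q"
    using p q by (auto simp: projection_def)
  obtain c where c [simp]: "c : carrier A" and qp: "q \<ominus> p = c\<^sup>\<star> \<otimes> c"
    using le by (auto simp: cstar_le_def)
  define w where "w = p \<ominus> q \<otimes> p"
  have w [simp]: "w : carrier A" by (simp add: w_def)
  have pqp: "p \<otimes> (q \<otimes> p) = (p \<otimes> q) \<otimes> p" by (simp add: mult_assoc)
  have ws: "w\<^sup>\<star> = p \<ominus> p \<otimes> q" by (simp add: w_def star_minus star_mult ps)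
  have "w\<^sup>\<star> \<otimes> w = w\<^sup>\<star> \<otimes> p \<ominus> w\<^sup>\<star> \<otimes> (q \<otimes> p)" unfolding w_def[of] by (simp add: minus_mult_right)
  also have "w\<^sup>\<star> \<otimes> p = p \<ominus> (p \<otimes> q) \<otimes> p" by (simp add: ws minus_mult_left pp)
  also have "w\<^sup>\<star> \<otimes> (q \<otimes> p) = \<zero>"
    by (simp add: ws minus_mult_left flip: mult_assoc) (simp add: mult_assoc[of p q q] pp)
  finally have ww: "w\<^sup>\<star> \<otimes> w = p \<ominus> (p \<otimes> q) \<otimes> p" by (simp add: minus_eq_s)
  have "(c \<otimes> p)\<^sup>\<star> \<otimes> (c \<otimes> p) = p \<otimes> (c\<^sup>\<star> \<otimes> c) \<otimes> p" by (simp add: star_mult ps mult_assoc)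
  also have "... = (p \<otimes> q) \<otimes> p \<ominus> p"
    by (simp add: minus_mult_left minus_mult_right pp flip: qp)
  also have "... = (- 1) \<odot> (w\<^sup>\<star> \<otimes> w)"
    by (simp add: ww minus_eq_s s_add_right s_assoc M.a_comm)
  finally have eq: "(c \<otimes> p)\<^sup>\<star> \<otimes> (c \<otimes> p) = (- 1) \<odot> (w\<^sup>\<star> \<otimes> w)" .
  have "w = \<zero>"
  proof (rule star_mult_zero_if_functionals_zero[OF w])
    fix F assume F: "positive_functional A F"
    have "0 <= Re (F ((c \<otimes> p)\<^sup>\<star> \<otimes> (c \<otimes> p)))" using F by (simp add: positive_functional_def)
    then show "Re (F (w\<^sup>\<star> \<otimes> w)) <= 0" using F by (simp add: eq positive_functional_def)
  qed
  then show qp': "q \<otimes> p = p" using minus_zero_iff[of p "q \<otimes> p"] by (simp add: w_def)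
  have "p\<^sup>\<star> = (q \<otimes> p)\<^sup>\<star>" using qp' by simp
  then show "p \<otimes> q = p" by (simp add: star_mult ps)
qed

text \<open>The unit property gives p_j as the sum over k of p_j p_k p_j. The term k = j is already
  p_j, so under a positive functional the other terms, which are star-squares of p_k p_j, add up to
  0 and vanish one by one. This recovers the orthogonality that the relations of the free product
  leave implicit.\<close>

lemma orthogonal_if_sum_unit:
  assumes fin: "finite T" and pr: "!!i. i : T ==> projection A (p i)"
    and unit: "!!i. i : T ==> (\<Oplus>k\<in>T. p k) \<otimes> p i = p i" and ij: "i : T" "j : T" "i ~= j"
  shows "p i \<otimes> p j = \<zero>"
proof -
  have cl [simp]: "p k : carrier A" and st: "(p k)\<^sup>\<star> = p k" and pp: "p k \<otimes> p k = p k" if "k : T" for k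
    using pr[OF that] by (auto simp: projection_def)
  have sq: "(p k \<otimes> p j)\<^sup>\<star> \<otimes> (p k \<otimes> p j) = p j \<otimes> (p k \<otimes> p j)" if k: "k : T" for k
  proof -
    have "(p k \<otimes> p j)\<^sup>\<star> \<otimes> (p k \<otimes> p j) = p j \<otimes> ((p k \<otimes> p k) \<otimes> p j)"
      using k ij by (simp add: star_mult st mult_assoc)
    then show ?thesis by (simp add: pp k)
  qed
  have pc: "p k \<otimes> p j : carrier A" if "k : T" for k using that ij by simp
  show ?thesis
  proof (rule star_mult_zero_if_functionals_zero[OF pc[OF ij(1)]])
    fix F assume F: "positive_functional A F"
    have Fadd: "F (x \<oplus> y) = F x + F y" if "x : carrier A" "y : carrier A" for x y
      using F that by (simp add: positive_functional_def)
    have F0: "F \<zero> = 0" using Fadd[of \<zero> \<zero>] by simp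
    have Fsum: "F (\<Oplus>k\<in>T'. m k) = (\<Sum>k\<in>T'. F (m k))" if "finite T'" "!!k. k : T' ==> m k : carrier A" for T' and m :: "'i => 'a"
      using that by (induction T' rule: finite_induct) (simp_all add: finsum_ins finsum_cl Fadd F0)
    have pos: "0 <= Re (F (p j \<otimes> (p k \<otimes> p j)))" if "k : T" for k
      using F pc[OF that] by (simp add: positive_functional_def flip: sq[OF that])
    have "p j = p j \<otimes> ((\<Oplus>k\<in>T. p k) \<otimes> p j)" using unit[OF ij(2)] pp[OF ij(2)] by simp
    also have "... = (\<Oplus>k\<in>T. p j \<otimes> (p k \<otimes> p j))"
      using fin ij by (simp add: finsum_mult_left finsum_mult_right)
    finally have "F (p j) = (\<Sum>k\<in>T. F (p j \<otimes> (p k \<otimes> p j)))"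
      using Fsum[OF fin, of "%k. p j \<otimes> (p k \<otimes> p j)"] ij by simp
    also have "... = F (p j) + (\<Sum>k\<in>T - {j}. F (p j \<otimes> (p k \<otimes> p j)))"
      using sum.remove[OF fin ij(2), of "%k. F (p j \<otimes> (p k \<otimes> p j))"] ij by (simp add: pp)
    finally have "(\<Sum>k\<in>T - {j}. Re (F (p j \<otimes> (p k \<otimes> p j)))) = 0" by (simp flip: Re_sum)
    then have "Re (F (p j \<otimes> (p i \<otimes> p j))) = 0"
      using fin ij pos by (subst (asm) sum_nonneg_eq_0_iff) auto
    then show "Re (F ((p i \<otimes> p j)\<^sup>\<star> \<otimes> (p i \<otimes> p j))) <= 0" by (simp add: sq[OF ij(1)])
  qed
qed

text \<open>Orthogonality makes the sum q a projection that is a unit for the summands. That q is a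
  unit for s follows from definiteness, as the star-square of s q - s is 0.\<close>

lemma unit_family_facts:
  assumes u: "unit_family n A p s"
  defines "q == \<Oplus>i\<in>{1..n}. p i"
  shows "projection A q" "i : {1..n} ==> q \<otimes> p i = p i" "i : {1..n} ==> p i \<otimes> q = p i"
    "s \<otimes> q = s" "q \<otimes> s = s" "q \<otimes> s\<^sup>\<star> = s\<^sup>\<star>" "s\<^sup>\<star> \<otimes> q = s\<^sup>\<star>"
proof -
  have pr: "projection A (p i)" if "i : {1..n}" for i using u that by (simp add: unit_family_def)
  have cl [simp]: "p i : carrier A" and st: "(p i)\<^sup>\<star> = p i" and pp: "p i \<otimes> p i = p i"
    if "i : {1..n}" for i using pr[OF that] by (auto simp: projection_def)
  have orth: "p i \<otimes> p j = \<zero>" if "i : {1..n}" "j : {1..n}" "i ~= j" for i j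
    using u that by (simp add: unit_family_def)
  have s [simp]: "s : carrier A" and ss: "s\<^sup>\<star> \<otimes> s = q" "s \<otimes> s\<^sup>\<star> = q"
    using u by (simp_all add: unit_family_def q_def)
  have q [simp]: "q : carrier A" unfolding q_def by (rule finsum_cl) simp
  have qs: "q\<^sup>\<star> = q" by (simp add: star_mult star_star flip: ss(1))
  show qp: "q \<otimes> p i = p i" if i: "i : {1..n}" for i
  proof -
    have "q \<otimes> p i = (\<Oplus>k\<in>{1..n}. p k \<otimes> p i)" unfolding q_def using i by (intro finsum_mult_right) auto
    also have "... = p i \<otimes> p i" by (rule finsum_single) (use i orth in auto)
    finally show ?thesis using i by (simp add: pp)
  qed
  show "p i \<otimes> q = p i" if i: "i : {1..n}" for i
  proof -
    have "(q \<otimes> p i)\<^sup>\<star> = (p i)\<^sup>\<star>" using qp[OF i] by simp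
    then show ?thesis using i by (simp add: star_mult qs st)
  qed
  have qq: "q \<otimes> q = q"
  proof -
    have "q \<otimes> q = (\<Oplus>k\<in>{1..n}. q \<otimes> p k)" unfolding q_def[of]
      by (rule finsum_mult_left) (use q in "auto simp: q_def")
    also have "... = q" unfolding q_def[of] by (rule M.finsum_cong') (use qp q_def in auto)
    finally show ?thesis .
  qed
  then show "projection A q" by (simp add: projection_def qs)
  have "s \<otimes> q \<ominus> s = \<zero>"
  proof (rule star_mult_zero)
    have "(s \<otimes> q \<ominus> s)\<^sup>\<star> \<otimes> (s \<otimes> q \<ominus> s) = q \<otimes> (s\<^sup>\<star> \<otimes> s) \<otimes> q \<ominus> s\<^sup>\<star> \<otimes> s \<otimes> q \<ominus> (q \<otimes> (s\<^sup>\<star> \<otimes> s) \<ominus> s\<^sup>\<star> \<otimes> s)"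
      by (simp add: star_minus star_mult qs minus_mult_left minus_mult_right mult_assoc)
    then show "(s \<otimes> q \<ominus> s)\<^sup>\<star> \<otimes> (s \<otimes> q \<ominus> s) = \<zero>" by (simp add: ss qq)
  qed simp
  then show sq: "s \<otimes> q = s" by (simp add: minus_zero_iff)
  have "q \<otimes> s = s \<otimes> (s\<^sup>\<star> \<otimes> s)" by (simp add: mult_assoc flip: ss(2))
  then show qs': "q \<otimes> s = s" by (simp add: ss sq)
  show "q \<otimes> s\<^sup>\<star> = s\<^sup>\<star>" using arg_cong[OF sq, of "star A"] by (simp add: star_mult qs)
  show "s\<^sup>\<star> \<otimes> q = s\<^sup>\<star>" using arg_cong[OF qs', of "star A"] by (simp add: star_mult qs)
qed

lemma projection_norm_le: "projection A p ==> N p <= 1"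
proof -
  assume p: "projection A p"
  then have "(N p)^2 = N p" using N_star_mult[of p] by (simp add: projection_def)
  then have "N p * (N p - 1) = 0" by (simp add: power2_eq_square algebra_simps)
  then show ?thesis by auto
qed

lemma unit_family_norm_le:
  assumes u: "unit_family n A p s"
  shows "i : {1..n} ==> N (p i) <= 1" "N s <= 1"
proof -
  show "i : {1..n} ==> N (p i) <= 1" using u by (auto simp: unit_family_def intro: projection_norm_le)
  have "(N s)^2 <= 1^2"
    using u projection_norm_le[OF unit_family_facts(1)[OF u]] N_star_mult[of s] by (simp add: unit_family_def)
  then show "N s <= 1" by (rule power2_le_imp_le) simp
qed

end

lemma normed_star_algebraI: "star_algebra A ==> cstar_norm A N ==> normed_star_algebra A N"
  by (simp add: normed_star_algebra_def normed_star_algebra_axioms_def seminormed_star_algebraI cstar_norm_def)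

text \<open>Let g = s s*. From (HR2a) one gets g q = g, and from (HR2b), as no vertex is a sink, g
  p_i = p_i for every i. Summing over i gives g q = q, so g = q.\<close>

lemma hypergraph_family_iff:
  fixes A :: "'a normed_star_alg"
  assumes "star_algebra A" "cstar_norm A (anorm A)"
  shows "hypergraph_family (full_loop_hypergraph n) A x \<longleftrightarrow> unit_family n A (%i. x (Vertex i)) (x (Edge 1))"
proof -
  interpret normed_star_algebra A "anorm A" by (rule normed_star_algebraI) fact+
  define p where "p = (%i. x (Vertex i))"
  define s where "s = x (Edge 1)"
  define q where "q = (\<Oplus>\<^bsub>A\<^esub>i\<in>{1..n}. p i)"
  have sink: "\<not> sink (full_loop_hypergraph n) v" if "v : {1..n}" for v
    using that by (simp add: sink_def full_loop_hypergraph_def)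
  have esum: "(\<Oplus>\<^bsub>A\<^esub>e\<in>{e : {1}. v : {1..n}}. x (Edge e) \<otimes>\<^bsub>A\<^esub> (x (Edge e))\<^sup>\<star>\<^bsub>A\<^esub>) = s \<otimes>\<^bsub>A\<^esub> s\<^sup>\<star>\<^bsub>A\<^esub>"
    if "v : {1..n}" "s : carrier A" for v
  proof -
    have "{e : {1}. v : {1..n}} = {1::nat}" using that by auto
    then show ?thesis using that by (simp add: finsum_single[of "{1}" 1] s_def)
  qed
  have fam: "hypergraph_family (full_loop_hypergraph n) A x \<longleftrightarrow>
    (\<forall>i\<in>{1..n}. projection A (p i)) \<and> (\<forall>i\<in>{1..n}. \<forall>j\<in>{1..n}. i ~= j --> p i \<otimes>\<^bsub>A\<^esub> p j = \<zero>\<^bsub>A\<^esub>) \<and>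
    partial_isometry A s \<and> s\<^sup>\<star>\<^bsub>A\<^esub> \<otimes>\<^bsub>A\<^esub> s = q \<and> cstar_le A (s \<otimes>\<^bsub>A\<^esub> s\<^sup>\<star>\<^bsub>A\<^esub>) q \<and>
    (\<forall>i\<in>{1..n}. cstar_le A (p i) (s \<otimes>\<^bsub>A\<^esub> s\<^sup>\<star>\<^bsub>A\<^esub>))"
  proof (cases "s : carrier A")
    case True
    then show ?thesis
      unfolding hypergraph_family_def Let_def q_def
      using sink esum by (auto simp: full_loop_hypergraph_def p_def s_def)
  next
    case False
    then show ?thesis
      unfolding hypergraph_family_def Let_def
      by (auto simp: full_loop_hypergraph_def p_def s_def partial_isometry_def)
  qed
  show ?thesis
  proof
    assume "hypergraph_family (full_loop_hypergraph n) A x"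
    note f = this[unfolded fam]
    have s [simp]: "s : carrier A" and sss: "s \<otimes>\<^bsub>A\<^esub> s\<^sup>\<star>\<^bsub>A\<^esub> \<otimes>\<^bsub>A\<^esub> s = s" using f by (auto simp: partial_isometry_def)
    have pcl [simp]: "p i : carrier A" if "i : {1..n}" for i using f that by (simp add: projection_def)
    have q [simp]: "q : carrier A" unfolding q_def by (rule finsum_cl) simp
    define g where "g = s \<otimes>\<^bsub>A\<^esub> s\<^sup>\<star>\<^bsub>A\<^esub>"
    have g: "projection A g"
      using sss by (simp add: projection_def g_def star_mult star_star) (simp flip: mult_assoc)
    have qs: "q\<^sup>\<star>\<^bsub>A\<^esub> = q" using f by (metis s star_closed star_mult star_star)
    have "q \<otimes>\<^bsub>A\<^esub> q = s\<^sup>\<star>\<^bsub>A\<^esub> \<otimes>\<^bsub>A\<^esub> (s \<otimes>\<^bsub>A\<^esub> s\<^sup>\<star>\<^bsub>A\<^esub> \<otimes>\<^bsub>A\<^esub> s)" using f by (metis mult_assoc mult_closed s star_closed)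
    then have pq: "projection A q" using f sss qs by (simp add: projection_def)
    have gq: "g \<otimes>\<^bsub>A\<^esub> q = g" using projection_le_imp_mult(1)[OF g pq] f by (simp add: g_def)
    have gp: "g \<otimes>\<^bsub>A\<^esub> p i = p i" if "i : {1..n}" for i
      using projection_le_imp_mult(2)[of "p i" g] g f that by (simp add: g_def)
    have "g \<otimes>\<^bsub>A\<^esub> q = (\<Oplus>\<^bsub>A\<^esub>i\<in>{1..n}. g \<otimes>\<^bsub>A\<^esub> p i)" unfolding q_def
      using g by (intro finsum_mult_left) (auto simp: projection_def)
    also have "... = q" unfolding q_def by (rule M.finsum_cong') (use gp in auto)
    finally have "g = q" using gq by simp
    then have "unit_family n A p s"
      using f unfolding unit_family_def by (simp add: g_def flip: q_def)
    then show "unit_family n A (%i. x (Vertex i)) (x (Edge 1))" by (simp only: p_def s_def)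
  next
    assume "unit_family n A (%i. x (Vertex i)) (x (Edge 1))"
    then have u: "unit_family n A p s" by (simp add: p_def s_def)
    note uf = unit_family_facts[OF u, folded q_def]
    have s [simp]: "s : carrier A" and ss: "s\<^sup>\<star>\<^bsub>A\<^esub> \<otimes>\<^bsub>A\<^esub> s = q" "s \<otimes>\<^bsub>A\<^esub> s\<^sup>\<star>\<^bsub>A\<^esub> = q"
      using u by (auto simp: unit_family_def q_def)
    have q [simp]: "q : carrier A" and qp: "q\<^sup>\<star>\<^bsub>A\<^esub> = q" "q \<otimes>\<^bsub>A\<^esub> q = q" using uf(1) by (auto simp: projection_def)
    have pr: "projection A (p i)" if "i : {1..n}" for i using u that by (simp add: unit_family_def)
    have "cstar_le A q q" unfolding cstar_le_def by (rule bexI[of _ "\<zero>\<^bsub>A\<^esub>"]) simp_all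
    moreover have "cstar_le A (p i) q" if i: "i : {1..n}" for i
    proof -
      have pi [simp]: "p i : carrier A" "(p i)\<^sup>\<star>\<^bsub>A\<^esub> = p i" "p i \<otimes>\<^bsub>A\<^esub> p i = p i"
        using pr[OF i] by (auto simp: projection_def)
      have "(q \<ominus>\<^bsub>A\<^esub> p i)\<^sup>\<star>\<^bsub>A\<^esub> \<otimes>\<^bsub>A\<^esub> (q \<ominus>\<^bsub>A\<^esub> p i) = q \<ominus>\<^bsub>A\<^esub> p i"
        by (simp add: star_minus qp minus_mult_left minus_mult_right uf(2)[OF i] uf(3)[OF i])
          (simp add: minus_eq_s)
      then show ?thesis unfolding cstar_le_def by (intro bexI[of _ "q \<ominus>\<^bsub>A\<^esub> p i"]) simp_all
    qed
    moreover have "partial_isometry A s" by (simp add: partial_isometry_def mult_assoc ss uf(4,5))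
    ultimately show "hypergraph_family (full_loop_hypergraph n) A x"
      unfolding fam using u ss by (simp add: unit_family_def)
  qed
qed

lemma circle_family_iff:
  fixes A :: "'a normed_star_alg"
  assumes "star_algebra A" "cstar_norm A (anorm A)"
    and one: "\<one>\<^bsub>A\<^esub> : carrier A" "!!x. x : carrier A ==> \<one>\<^bsub>A\<^esub> \<otimes>\<^bsub>A\<^esub> x = x"
  shows "circle_family n A x \<longleftrightarrow>
    unit_family n A (%i. x (P i)) (x U) \<and> (\<Oplus>\<^bsub>A\<^esub>i\<in>{1..n}. x (P i)) = \<one>\<^bsub>A\<^esub>"
proof -
  interpret normed_star_algebra A "anorm A" by (rule normed_star_algebraI) fact+
  have "x (P i) \<otimes>\<^bsub>A\<^esub> x (P j) = \<zero>\<^bsub>A\<^esub>"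
    if c: "circle_family n A x" and ij: "i : {1..n}" "j : {1..n}" "i ~= j" for i j
    by (rule orthogonal_if_sum_unit[of "{1..n}"])
      (use c ij one in "auto simp: circle_family_def projection_def")
  then show ?thesis unfolding circle_family_def unit_family_def unitary_def by auto
qed

text \<open>Admissibility can be read off in any normed algebra B to which F maps with the same
  seminorm: in the completion as in B, two elements of F become equal exactly when their difference
  has seminorm 0, and the relations are equations between such images.\<close>

lemma unit_family_completion_iff:
  assumes "star_algebra F" "cstar_seminorm F p" "star_algebra B" "cstar_norm B N"
    and hom: "star_hom F B \<theta>" and iso: "!!x. x : carrier F ==> p x = N (\<theta> x)"
    and cl: "!!i. i : {1..n} ==> x i : carrier F" "s : carrier F"
  shows "unit_family n (completion F p) (%i. to_completion F p (x i)) (to_completion F p s) \<longleftrightarrow>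
    unit_family n B (%i. \<theta> (x i)) (\<theta> s)"
proof -
  interpret F: seminormed_star_algebra F p by (rule seminormed_star_algebraI) fact+
  interpret B: normed_star_algebra B N by (rule normed_star_algebraI) fact+
  let ?j = "to_completion F p" and ?K = "completion F p"
  have eq: "?j y = ?j z \<longleftrightarrow> \<theta> y = \<theta> z" if "y : carrier F" "z : carrier F" for y z
  proof -
    have "N (\<theta> y \<ominus>\<^bsub>B\<^esub> \<theta> z) = 0 \<longleftrightarrow> \<theta> y = \<theta> z"
      using that star_homD(1)[OF hom] B.N_definite[of "\<theta> y \<ominus>\<^bsub>B\<^esub> \<theta> z"] by (auto simp: B.minus_zero_iff)
    then show ?thesis
      using that by (simp add: F.to_completion_eq_iff iso star_hom_minus[OF assms(1,3) hom])
  qed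
  note j = star_homD[OF F.to_completion_hom] and h = star_homD[OF hom]
  have z: "?j \<zero>\<^bsub>F\<^esub> = \<zero>\<^bsub>?K\<^esub>" "\<theta> \<zero>\<^bsub>F\<^esub> = \<zero>\<^bsub>B\<^esub>"
    using star_hom_zero[OF assms(1) F.star_algebra_completion F.to_completion_hom]
      star_hom_zero[OF assms(1,3) hom] by auto
  have sum: "?j (\<Oplus>\<^bsub>F\<^esub>i\<in>{1..n}. x i) = (\<Oplus>\<^bsub>?K\<^esub>i\<in>{1..n}. ?j (x i))"
    "\<theta> (\<Oplus>\<^bsub>F\<^esub>i\<in>{1..n}. x i) = (\<Oplus>\<^bsub>B\<^esub>i\<in>{1..n}. \<theta> (x i))"
    using star_hom_finsum[OF assms(1) F.star_algebra_completion F.to_completion_hom, of "{1..n}" x]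
      star_hom_finsum[OF assms(1,3) hom, of "{1..n}" x] cl by auto
  have fc: "(\<Oplus>\<^bsub>F\<^esub>i\<in>{1..n}. x i) : carrier F" by (rule F.finsum_cl) (use cl in auto)
  have pr: "projection ?K (?j (x i)) \<longleftrightarrow> projection B (\<theta> (x i))" if i: "i : {1..n}" for i
    using cl(1)[OF i] eq[of "(x i)\<^sup>\<star>\<^bsub>F\<^esub>" "x i"] eq[of "x i \<otimes>\<^bsub>F\<^esub> x i" "x i"]
    by (simp add: projection_def j h)
  have orth: "?j (x i) \<otimes>\<^bsub>?K\<^esub> ?j (x k) = \<zero>\<^bsub>?K\<^esub> \<longleftrightarrow> \<theta> (x i) \<otimes>\<^bsub>B\<^esub> \<theta> (x k) = \<zero>\<^bsub>B\<^esub>"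
    if "i : {1..n}" "k : {1..n}" for i k
    using cl(1)[OF that(1)] cl(1)[OF that(2)] eq[of "x i \<otimes>\<^bsub>F\<^esub> x k" "\<zero>\<^bsub>F\<^esub>"] by (simp add: j h z)
  have "(?j s)\<^sup>\<star>\<^bsub>?K\<^esub> \<otimes>\<^bsub>?K\<^esub> ?j s = (\<Oplus>\<^bsub>?K\<^esub>i\<in>{1..n}. ?j (x i)) \<longleftrightarrow>
      (\<theta> s)\<^sup>\<star>\<^bsub>B\<^esub> \<otimes>\<^bsub>B\<^esub> \<theta> s = (\<Oplus>\<^bsub>B\<^esub>i\<in>{1..n}. \<theta> (x i))"
    "?j s \<otimes>\<^bsub>?K\<^esub> (?j s)\<^sup>\<star>\<^bsub>?K\<^esub> = (\<Oplus>\<^bsub>?K\<^esub>i\<in>{1..n}. ?j (x i)) \<longleftrightarrow>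
      \<theta> s \<otimes>\<^bsub>B\<^esub> (\<theta> s)\<^sup>\<star>\<^bsub>B\<^esub> = (\<Oplus>\<^bsub>B\<^esub>i\<in>{1..n}. \<theta> (x i))"
    using cl(2) fc eq[of "s\<^sup>\<star>\<^bsub>F\<^esub> \<otimes>\<^bsub>F\<^esub> s" "\<Oplus>\<^bsub>F\<^esub>i\<in>{1..n}. x i"] eq[of "s \<otimes>\<^bsub>F\<^esub> s\<^sup>\<star>\<^bsub>F\<^esub>" "\<Oplus>\<^bsub>F\<^esub>i\<in>{1..n}. x i"]
    by (simp_all add: j h sum)
  moreover have "(\<forall>i\<in>{1..n}. projection ?K (?j (x i))) \<longleftrightarrow> (\<forall>i\<in>{1..n}. projection B (\<theta> (x i)))"
    by (rule ball_cong[OF refl pr])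
  moreover have "(\<forall>i\<in>{1..n}. \<forall>k\<in>{1..n}. i ~= k --> ?j (x i) \<otimes>\<^bsub>?K\<^esub> ?j (x k) = \<zero>\<^bsub>?K\<^esub>) \<longleftrightarrow>
      (\<forall>i\<in>{1..n}. \<forall>k\<in>{1..n}. i ~= k --> \<theta> (x i) \<otimes>\<^bsub>B\<^esub> \<theta> (x k) = \<zero>\<^bsub>B\<^esub>)"
    using orth by blast
  ultimately show ?thesis unfolding unit_family_def using cl(2) by (simp only: j(1) h(1))
qed

section \<open>The isomorphism with the free product\<close>

abbreviation "loop_gens n == hypergraph_gens (full_loop_hypergraph n)"
abbreviation "circle_gens n == insert U (P ` {1..n})"
abbreviation "loop_alg n == free_star_alg (loop_gens n)"
abbreviation "circle_alg n == free_unital_star_alg (circle_gens n)"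

section \<open>Admissible seminorms on the two free algebras\<close>

definition "loop_adm n = admissible_seminorms (loop_alg n) (hypergraph_family (full_loop_hypergraph n))"
definition "circle_adm n = admissible_seminorms (circle_alg n) (circle_family n)"
definition "loop_norm n f = (SUP p\<in>loop_adm n. p f)"
definition "circle_norm n f = (SUP p\<in>circle_adm n. p f)"

lemma hypergraph_cstar_alg_loop:
  "hypergraph_cstar_alg (full_loop_hypergraph n) = completion (loop_alg n) (loop_norm n)"
  by (simp add: hypergraph_cstar_alg_def universal_cstar_alg_def universal_completion_def
      loop_norm_def[abs_def] loop_adm_def)

lemma circle_free_product_eq: "circle_free_product n = completion (circle_alg n) (circle_norm n)"
  by (simp add: circle_free_product_def universal_unital_cstar_alg_def universal_completion_def
      circle_norm_def[abs_def] circle_adm_def)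

lemma loop_gens_eq: "loop_gens n = Vertex ` {1..n} \<union> {Edge 1}"
  by (simp add: hypergraph_gens_def full_loop_hypergraph_def)

lemmas loop_facts = free_star_alg_facts[where G = "loop_gens n" for n]
lemmas circle_facts = free_unital_star_alg_facts[where G = "circle_gens n" for n]

lemma gen_loop: "g : loop_gens n ==> gen g : carrier (loop_alg n)"
  unfolding gen_def by (rule loop_facts(2)) auto

lemma gen_circle: "g : circle_gens n ==> gen g : carrier (circle_alg n)"
  unfolding gen_def by (rule circle_facts(2)) auto

lemma completion_normed: "seminormed_star_algebra F p ==> normed_star_algebra (completion F p) (anorm (completion F p))"
  by (rule normed_star_algebraI[OF seminormed_star_algebra.star_algebra_completion
        seminormed_star_algebra.cstar_norm_completion])

lemma loop_adm_iff: "p : loop_adm n \<longleftrightarrow> cstar_seminorm (loop_alg n) p \<and>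
    unit_family n (completion (loop_alg n) p) (%i. to_completion (loop_alg n) p (gen (Vertex i)))
      (to_completion (loop_alg n) p (gen (Edge 1)))"
proof (cases "cstar_seminorm (loop_alg n) p")
  case True
  interpret seminormed_star_algebra "loop_alg n" p by (rule seminormed_star_algebraI[OF loop_facts(1) True])
  show ?thesis
    using hypergraph_family_iff[OF star_algebra_completion cstar_norm_completion] True
    by (simp add: loop_adm_def admissible_seminorms_def)
qed (simp add: loop_adm_def admissible_seminorms_def)

lemma completion_one:
  assumes "cstar_seminorm (circle_alg n) p"
  shows "\<one>\<^bsub>completion (circle_alg n) p\<^esub> = to_completion (circle_alg n) p (single [])"
    and "\<one>\<^bsub>completion (circle_alg n) p\<^esub> : carrier (completion (circle_alg n) p)"
    and "x : carrier (completion (circle_alg n) p) ==> \<one>\<^bsub>completion (circle_alg n) p\<^esub> \<otimes>\<^bsub>completion (circle_alg n) p\<^esub> x = x"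
proof -
  interpret seminormed_star_algebra "circle_alg n" p by (rule seminormed_star_algebraI[OF circle_facts(1) assms])
  have one: "\<one>\<^bsub>circle_alg n\<^esub> = single []" by (simp add: free_unital_star_alg_def semigroup_star_alg_def)
  have ocl: "single [] : carrier (circle_alg n)" by (rule circle_facts(2)) simp
  show e: "\<one>\<^bsub>completion (circle_alg n) p\<^esub> = to_completion (circle_alg n) p (single [])"
    by (simp add: completion_simps quotient_star_alg_def to_completion_def one)
  show "\<one>\<^bsub>completion (circle_alg n) p\<^esub> : carrier (completion (circle_alg n) p)"
    unfolding e by (rule star_homD(1)[OF to_completion_hom ocl])
  have unit: "single [] \<otimes>\<^bsub>circle_alg n\<^esub> f = f" if "f : carrier (circle_alg n)" for f
    using that
  proof (induction f rule: free_unital_induct)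
    case (add c w g)
    have "single [] \<otimes>\<^bsub>circle_alg n\<^esub> single w = single w" using circle_facts(3)[of "[]" n w] add by simp
    then show ?case using add ocl circle_facts(2)[of w n] by (simp add: distrib_left smult_mult_right)
  qed (use ocl in simp)
  assume "x : carrier (completion (circle_alg n) p)"
  then obtain sig where s: "sig : cauchy_seqs (circle_alg n) p" "x = cls sig" using cls_onto by blast
  show "\<one>\<^bsub>completion (circle_alg n) p\<^esub> \<otimes>\<^bsub>completion (circle_alg n) p\<^esub> x = x"
    unfolding e to_completion_cls s(2)
    by (simp add: cls_ops(2)[OF cauchy_const[OF ocl] s(1)] unit cauchy_closed[OF s(1)])
qed

lemma circle_adm_iff: "p : circle_adm n \<longleftrightarrow> cstar_seminorm (circle_alg n) p \<and>
    unit_family n (completion (circle_alg n) p) (%i. to_completion (circle_alg n) p (gen (P i)))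
      (to_completion (circle_alg n) p (gen U)) \<and>
    (\<Oplus>\<^bsub>completion (circle_alg n) p\<^esub>i\<in>{1..n}. to_completion (circle_alg n) p (gen (P i))) =
      to_completion (circle_alg n) p (single [])"
proof (cases "cstar_seminorm (circle_alg n) p")
  case True
  interpret seminormed_star_algebra "circle_alg n" p by (rule seminormed_star_algebraI[OF circle_facts(1) True])
  show ?thesis
    using circle_family_iff[OF star_algebra_completion cstar_norm_completion completion_one(2,3)[OF True]] True
    by (simp add: circle_adm_def admissible_seminorms_def completion_one(1)[OF True])
qed (simp add: circle_adm_def admissible_seminorms_def)

text \<open>Projections and s are contractions in the completion, hence so are all words. The bound
  is uniform in p and makes the supremum of the admissible seminorms finite.\<close>

lemma loop_word_norm:
  assumes p: "p : loop_adm n" and w: "w : lists (loop_gens n \<times> UNIV)" "w ~= []"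
  shows "p (single w) <= 1"
proof -
  have sn: "cstar_seminorm (loop_alg n) p" using p by (simp add: loop_adm_iff)
  interpret F: seminormed_star_algebra "loop_alg n" p by (rule seminormed_star_algebraI[OF loop_facts(1) sn])
  interpret K: normed_star_algebra "completion (loop_alg n) p" "anorm (completion (loop_alg n) p)"
    by (rule completion_normed) (rule F.seminormed_star_algebra_axioms)
  note u = p[unfolded loop_adm_iff, THEN conjunct2]
  have g: "p (gen g) <= 1" if "g : loop_gens n" for g
  proof -
    have "anorm (completion (loop_alg n) p) (to_completion (loop_alg n) p (gen g)) <= 1"
      using that K.unit_family_norm_le[OF u] unfolding loop_gens_eq by blast
    then show ?thesis using F.anorm_to_completion[OF gen_loop[OF that]] by simp
  qed
  have letter: "p (single [x]) <= 1" if x: "x : loop_gens n \<times> UNIV" for x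
  proof (cases x)
    case (Pair y b)
    have "single [(y, True)] = (gen y)\<^sup>\<star>\<^bsub>loop_alg n\<^esub>"
      unfolding gen_def by (subst loop_facts(4)) (use x Pair in auto)
    then have "p (single [(y, True)]) = p (gen y)" using x Pair by (simp add: F.N_star gen_loop)
    then show ?thesis using g[of y] x Pair by (cases b) (auto simp: gen_def)
  qed
  show ?thesis using w
  proof (induction w)
    case (Cons x w)
    show ?case
    proof (cases "w = []")
      case True
      then show ?thesis using letter Cons by simp
    next
      case False
      have "single (x # w) = single [x] \<otimes>\<^bsub>loop_alg n\<^esub> single w"
        by (subst loop_facts(3)) (use Cons False in auto)
      then have "p (single (x # w)) <= p (single [x]) * p (single w)"
        using F.N_mult[OF loop_facts(2) loop_facts(2)] Cons False by simp
      also have "... <= 1 * 1"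
        using Cons False letter[of x] F.N_nonneg[OF loop_facts(2), of w] by (intro mult_mono) auto
      finally show ?thesis by simp
    qed
  qed simp
qed

lemma loop_adm_bdd:
  assumes "f : carrier (loop_alg n)" shows "bdd_above ((%p. p f) ` loop_adm n)"
proof -
  have "\<exists>C. \<forall>p\<in>loop_adm n. p f <= C" using assms
  proof (induction f rule: free_induct)
    case zero
    have "p \<zero>\<^bsub>loop_alg n\<^esub> = 0" if "p : loop_adm n" for p
      using that seminormed_star_algebra.N_zero[OF seminormed_star_algebraI[OF loop_facts(1)]]
      by (simp add: loop_adm_iff)
    then show ?case by (intro exI[of _ 0] ballI eq_refl) blast
  next
    case (add c w g)
    then obtain C where C: "!!p. p : loop_adm n ==> p g <= C" by blast
    have "p (c \<odot>\<^bsub>loop_alg n\<^esub> single w \<oplus>\<^bsub>loop_alg n\<^esub> g) <= cmod c + C" if p: "p : loop_adm n" for p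
    proof -
      have sn: "cstar_seminorm (loop_alg n) p" using p by (simp add: loop_adm_iff)
      interpret F: seminormed_star_algebra "loop_alg n" p by (rule seminormed_star_algebraI[OF loop_facts(1) sn])
      have wc: "single w : carrier (loop_alg n)" using add by (intro loop_facts(2)) auto
      have "cmod c * p (single w) <= cmod c * 1"
        using loop_word_norm[OF p] add by (intro mult_left_mono) auto
      then show ?thesis
        using F.N_triangle[of "c \<odot>\<^bsub>loop_alg n\<^esub> single w" g] C[OF p] wc add by (simp add: F.N_smult)
    qed
    then show ?case by blast
  qed
  then show ?thesis by (auto simp: bdd_above_def)
qed

text \<open>The zero seminorm is admissible, for its completion has only one element and all
  relations hold there.\<close>

lemma loop_adm_nonempty: "loop_adm n ~= {}"
proof -
  define p :: "((nat, nat) hypergraph_gen word => complex) => real" where "p = (%f. 0)"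
  have sn: "cstar_seminorm (loop_alg n) p" by (simp add: cstar_seminorm_def p_def)
  interpret F: seminormed_star_algebra "loop_alg n" p by (rule seminormed_star_algebraI[OF loop_facts(1) sn])
  interpret K: star_algebra "completion (loop_alg n) p" by (rule F.star_algebra_completion)
  have triv: "X = Y" if XY: "X : carrier (completion (loop_alg n) p)" "Y : carrier (completion (loop_alg n) p)" for X Y
  proof -
    obtain sig tau where "sig : cauchy_seqs (loop_alg n) p" "X = F.cls sig" "tau : cauchy_seqs (loop_alg n) p" "Y = F.cls tau"
      using XY unfolding F.cls_onto[symmetric] by blast
    moreover have "(%k. p (sig k \<ominus>\<^bsub>loop_alg n\<^esub> tau k)) \<longlonglongrightarrow> 0" by (simp add: p_def)
    ultimately show ?thesis by (simp only: F.cls_eq_iff)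
  qed
  have cl: "to_completion (loop_alg n) p (gen g) : carrier (completion (loop_alg n) p)" if "g : loop_gens n" for g
    by (rule star_homD(1)[OF F.to_completion_hom gen_loop[OF that]])
  have v: "Vertex i : loop_gens n" if "i : {1..n}" for i using that by (simp add: loop_gens_eq)
  have e: "Edge 1 : loop_gens n" by (simp add: loop_gens_eq)
  have "p : loop_adm n" unfolding loop_adm_iff unit_family_def projection_def
    using sn by (intro conjI ballI impI triv cl v e K.mult_closed K.star_closed K.M.zero_closed K.finsum_cl) auto
  then show ?thesis by blast
qed

section \<open>Comparison of the two free algebras\<close>

primrec to_circle :: "(nat, nat) hypergraph_gen => circle_gen" where
  "to_circle (Vertex i) = P i" | "to_circle (Edge e) = U"

primrec to_loop :: "circle_gen => (nat, nat) hypergraph_gen" where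
  "to_loop U = Edge 1" | "to_loop (P i) = Vertex i"

definition "circle_word w = map (map_prod to_circle id) w"
definition "loop_word w = map (map_prod to_loop id) w"

lemma circle_word_lists: "w : lists (loop_gens n \<times> UNIV) ==> circle_word w : lists (circle_gens n \<times> UNIV)"
  by (induction w) (auto simp: circle_word_def loop_gens_eq)

lemma loop_word_lists: "w : lists (circle_gens n \<times> UNIV) ==> loop_word w : lists (loop_gens n \<times> UNIV)"
  by (induction w) (auto simp: loop_word_def loop_gens_eq)

lemma loop_circle_word: "w : lists (loop_gens n \<times> UNIV) ==> loop_word (circle_word w) = w"
  by (induction w) (auto simp: loop_word_def circle_word_def loop_gens_eq)

lemma circle_loop_word: "circle_word (loop_word w) = w"
proof -
  have "to_circle (to_loop g) = g" for g by (cases g) auto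
  then show ?thesis by (induction w) (auto simp: loop_word_def circle_word_def)
qed

lemma word_maps_simps [simp]:
  "circle_word (v @ w) = circle_word v @ circle_word w" "circle_word [] = []" "circle_word w = [] \<longleftrightarrow> w = []"
  "circle_word (word_star w) = word_star (circle_word w)"
  "loop_word (v' @ w') = loop_word v' @ loop_word w'" "loop_word [] = []" "loop_word w' = [] \<longleftrightarrow> w' = []"
  "loop_word (word_star w') = word_star (loop_word w')"
  by (auto simp: circle_word_def loop_word_def word_star_def rev_map)

definition to_circle_alg :: "nat => ((nat, nat) hypergraph_gen word => complex) => (circle_gen word => complex)" where
  "to_circle_alg n f = star_algebra.lin (circle_alg n) f (%w. single (circle_word w))"

lemma to_circle_alg_hom: "star_hom (loop_alg n) (circle_alg n) (to_circle_alg n)"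
  unfolding to_circle_alg_def[abs_def]
  by (rule star_hom_free) (simp_all add: circle_facts circle_word_lists)

lemma to_circle_alg_single:
  "w : lists (loop_gens n \<times> UNIV) ==> to_circle_alg n (single w) = single (circle_word w)"
  unfolding to_circle_alg_def
  by (rule star_algebra.lin_single[OF circle_facts(1)]) (simp add: circle_facts(2) circle_word_lists)

lemma to_circle_alg_gen: "g : loop_gens n ==> to_circle_alg n (gen g) = gen (to_circle g)"
  unfolding gen_def using to_circle_alg_single[of "[(g, False)]" n] by (simp add: circle_word_def)

text \<open>The pulled-back seminorm is the norm of the image in the completion of the circle
  algebra, where the generators already form a unit family.\<close>

lemma circle_adm_pullback:
  assumes p: "p : circle_adm n"
  shows "(%f. p (to_circle_alg n f)) : loop_adm n"
proof -
  have sn: "cstar_seminorm (circle_alg n) p" using p by (simp add: circle_adm_iff)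
  interpret F: seminormed_star_algebra "circle_alg n" p by (rule seminormed_star_algebraI[OF circle_facts(1) sn])
  let ?q = "%f. p (to_circle_alg n f)" and ?j = "to_completion (circle_alg n) p"
  have sq: "cstar_seminorm (loop_alg n) ?q"
    by (rule cstar_seminorm_hom[OF loop_facts(1) circle_facts(1) sn to_circle_alg_hom])
  have cl: "to_circle_alg n x : carrier (circle_alg n)" if "x : carrier (loop_alg n)" for x
    by (rule star_homD(1)[OF to_circle_alg_hom that])
  interpret L: star_algebra "loop_alg n" by (rule loop_facts(1))
  have hom: "star_hom (loop_alg n) (completion (circle_alg n) p) (%x. ?j (to_circle_alg n x))"
    unfolding star_hom_def by (simp add: star_homD[OF to_circle_alg_hom] star_homD[OF F.to_completion_hom])
  have "unit_family n (completion (loop_alg n) ?q) (%i. to_completion (loop_alg n) ?q (gen (Vertex i)))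
      (to_completion (loop_alg n) ?q (gen (Edge 1))) \<longleftrightarrow>
    unit_family n (completion (circle_alg n) p) (%i. ?j (to_circle_alg n (gen (Vertex i))))
      (?j (to_circle_alg n (gen (Edge 1))))"
    by (rule unit_family_completion_iff[OF loop_facts(1) sq F.star_algebra_completion F.cstar_norm_completion hom])
      (auto simp: F.anorm_to_completion cl loop_gens_eq[symmetric] intro!: gen_loop, auto simp: loop_gens_eq)
  also have "... \<longleftrightarrow> unit_family n (completion (circle_alg n) p) (%i. ?j (gen (P i))) (?j (gen U))"
  proof -
    interpret K: star_algebra "completion (circle_alg n) p" by (rule F.star_algebra_completion)
    have v: "?j (to_circle_alg n (gen (Vertex i))) = ?j (gen (P i))" if "i : {1..n}" for i
      using that by (simp add: to_circle_alg_gen loop_gens_eq)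
    have e: "?j (to_circle_alg n (gen (Edge 1))) = ?j (gen U)"
      by (simp add: to_circle_alg_gen loop_gens_eq)
    have "(\<Oplus>\<^bsub>completion (circle_alg n) p\<^esub>i\<in>{1..n}. ?j (to_circle_alg n (gen (Vertex i)))) =
        (\<Oplus>\<^bsub>completion (circle_alg n) p\<^esub>i\<in>{1..n}. ?j (gen (P i)))"
      by (rule K.M.finsum_cong') (auto simp: v intro!: star_homD(1)[OF F.to_completion_hom] gen_circle)
    then show ?thesis unfolding unit_family_def by (simp add: v e)
  qed
  finally show ?thesis using p sq unfolding loop_adm_iff circle_adm_iff by blast
qed

text \<open>Conversely, in a completion of the free algebra on the hypergraph generators the sum of the
  vertex projections is a unit, which is the image of the empty word.\<close>

lemma loop_adm_extend:
  assumes q: "q : loop_adm n"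
  shows "\<exists>p\<in>circle_adm n. \<forall>f\<in>carrier (loop_alg n). p (to_circle_alg n f) = q f"
proof -
  have sn: "cstar_seminorm (loop_alg n) q" using q by (simp add: loop_adm_iff)
  interpret F: seminormed_star_algebra "loop_alg n" q by (rule seminormed_star_algebraI[OF loop_facts(1) sn])
  let ?K = "completion (loop_alg n) q" and ?j = "to_completion (loop_alg n) q"
  interpret K: normed_star_algebra ?K "anorm ?K"
    by (rule completion_normed) (rule F.seminormed_star_algebra_axioms)
  note u = q[unfolded loop_adm_iff, THEN conjunct2]
  note uf = K.unit_family_facts[OF u]
  note j = star_homD[OF F.to_completion_hom]
  define e where "e = (\<Oplus>\<^bsub>?K\<^esub>i\<in>{1..n}. ?j (gen (Vertex i)))"
  have e [simp]: "e : carrier ?K" "e\<^sup>\<star>\<^bsub>?K\<^esub> = e" "e \<otimes>\<^bsub>?K\<^esub> e = e"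
    using uf(1) by (simp_all add: projection_def e_def)
  define js where "js w = ?j (single w)" for w :: "(nat, nat) hypergraph_gen word"
  have js: "js w : carrier ?K" if "w : lists (loop_gens n \<times> UNIV)" "w ~= []" for w
    unfolding js_def using that by (intro j(1) loop_facts(2))
  have js_app: "js (v @ w) = js v \<otimes>\<^bsub>?K\<^esub> js w"
    if "v : lists (loop_gens n \<times> UNIV)" "v ~= []" "w : lists (loop_gens n \<times> UNIV)" "w ~= []" for v w
    unfolding js_def using that by (simp add: loop_facts(2) flip: j(4) loop_facts(3))
  have js_star: "js (word_star w) = (js w)\<^sup>\<star>\<^bsub>?K\<^esub>" if "w : lists (loop_gens n \<times> UNIV)" "w ~= []" for w
    unfolding js_def using that by (simp add: loop_facts(2) flip: j(5) loop_facts(4))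
  \<comment> \<open>Letters may be starred, so the right unit law for generators is needed too: its
    star is the left unit law for their stars.\<close>
  have letter: "e \<otimes>\<^bsub>?K\<^esub> js [x] = js [x]" if x: "x : loop_gens n \<times> UNIV" for x
  proof (cases x)
    case (Pair g b)
    have gc: "?j (gen g) : carrier ?K" using x Pair by (intro j(1) gen_loop) auto
    have g1: "e \<otimes>\<^bsub>?K\<^esub> ?j (gen g) = ?j (gen g)" and g2: "?j (gen g) \<otimes>\<^bsub>?K\<^esub> e = ?j (gen g)"
      using x Pair uf(2-5) unfolding e_def by (auto simp: loop_gens_eq)
    have "js [(g, True)] = (js [(g, False)])\<^sup>\<star>\<^bsub>?K\<^esub>" using js_star[of "[(g, False)]"] x Pair by simp
    moreover have "js [(g, False)] = ?j (gen g)" by (simp add: js_def gen_def)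
    moreover have "e \<otimes>\<^bsub>?K\<^esub> (?j (gen g))\<^sup>\<star>\<^bsub>?K\<^esub> = (?j (gen g))\<^sup>\<star>\<^bsub>?K\<^esub>"
      using arg_cong[OF g2, of "star ?K"] gc by (simp add: K.star_mult)
    ultimately show ?thesis using Pair g1 by (cases b) auto
  qed
  have left: "e \<otimes>\<^bsub>?K\<^esub> js w = js w" if w: "w : lists (loop_gens n \<times> UNIV)" "w ~= []" for w
  proof (cases w)
    case (Cons x v)
    show ?thesis
    proof (cases "v = []")
      case True
      then show ?thesis using letter w Cons by simp
    next
      case False
      have "js w = js [x] \<otimes>\<^bsub>?K\<^esub> js v" using js_app[of "[x]" v] w Cons False by simp
      then show ?thesis using letter[of x] js[of v] js[of "[x]"] w Cons False
        by (simp flip: K.mult_assoc)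
    qed
  qed (use w in simp)
  have right: "js w \<otimes>\<^bsub>?K\<^esub> e = js w" if w: "w : lists (loop_gens n \<times> UNIV)" "w ~= []" for w
  proof -
    have w': "word_star w : lists (loop_gens n \<times> UNIV)" "word_star w ~= []" using w by (simp_all add: word_star_lists)
    have "(e \<otimes>\<^bsub>?K\<^esub> js (word_star w))\<^sup>\<star>\<^bsub>?K\<^esub> = (js (word_star w))\<^sup>\<star>\<^bsub>?K\<^esub>" using left[OF w'] by simp
    then show ?thesis using js[OF w'] js_star[OF w'] by (simp add: K.star_mult)
  qed
  define m where "m w = (if w = [] then e else js (loop_word w))" for w :: "circle_gen word"
  have mc: "m w : carrier ?K" if "w : lists (circle_gens n \<times> UNIV)" for w
    using that by (cases "w = []") (simp_all add: m_def js loop_word_lists)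
  define psi where "psi f = star_algebra.lin ?K f m" for f
  have hom: "star_hom (circle_alg n) ?K psi"
    unfolding psi_def[abs_def]
    by (rule star_hom_free_unital[OF F.star_algebra_completion mc])
      (auto simp: m_def left right js_app js_star loop_word_lists)
  have psi: "psi (single w) = m w" if "w : lists (circle_gens n \<times> UNIV)" for w
    unfolding psi_def by (rule K.lin_single) (rule mc[OF that])
  have agree: "psi (to_circle_alg n f) = ?j f" if "f : carrier (loop_alg n)" for f
    using that
  proof (induction f rule: free_induct)
    case zero
    show ?case using star_hom_zero[OF loop_facts(1) circle_facts(1) to_circle_alg_hom]
        star_hom_zero[OF circle_facts(1) F.star_algebra_completion hom]
        star_hom_zero[OF loop_facts(1) F.star_algebra_completion F.to_completion_hom] by simp
  next
    case (add c w g)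
    then have wc: "single w : carrier (loop_alg n)" by (intro loop_facts(2)) auto
    note tc = star_homD(1)[OF to_circle_alg_hom]
    interpret C: star_algebra "circle_alg n" by (rule circle_facts(1))
    have "psi (to_circle_alg n (single w)) = ?j (single w)"
      using add by (simp add: to_circle_alg_single psi circle_word_lists m_def loop_circle_word js_def)
    then show ?case using add wc
      by (simp add: star_homD(2,3)[OF to_circle_alg_hom] star_homD(2,3)[OF hom] j(2,3) tc[OF wc] tc)
  qed
  define p where "p f = anorm ?K (psi f)" for f
  have sp: "cstar_seminorm (circle_alg n) p"
    unfolding p_def[abs_def]
    by (rule cstar_seminorm_hom[OF circle_facts(1) F.star_algebra_completion _ hom]) (rule K.cstar_seminorm)
  interpret C: seminormed_star_algebra "circle_alg n" p by (rule seminormed_star_algebraI[OF circle_facts(1) sp])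
  have gens: "psi (gen (P i)) = ?j (gen (Vertex i))" if "i : {1..n}" for i
    unfolding gen_def using that by (subst psi) (auto simp: m_def js_def loop_word_def)
  have genU: "psi (gen U) = ?j (gen (Edge 1))"
    unfolding gen_def by (subst psi) (auto simp: m_def js_def loop_word_def)
  have Pc: "gen (P i) : carrier (circle_alg n)" if "i : {1..n}" for i using that by (intro gen_circle) auto
  have jv: "?j (gen (Vertex i)) : carrier ?K" if "i : {1..n}" for i
    using that by (intro j(1) gen_loop) (simp add: loop_gens_eq)
  have sums: "(\<Oplus>\<^bsub>?K\<^esub>i\<in>{1..n}. psi (gen (P i))) = e"
    unfolding e_def by (rule K.M.finsum_cong') (use gens jv in auto)
  have "unit_family n (completion (circle_alg n) p) (%i. to_completion (circle_alg n) p (gen (P i)))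
      (to_completion (circle_alg n) p (gen U)) \<longleftrightarrow>
    unit_family n ?K (%i. psi (gen (P i))) (psi (gen U))"
    by (rule unit_family_completion_iff[OF circle_facts(1) sp F.star_algebra_completion F.cstar_norm_completion hom])
      (auto simp: p_def intro: gen_circle)
  moreover have "unit_family n ?K (%i. psi (gen (P i))) (psi (gen U))"
    using u gens unfolding unit_family_def sums genU e_def by simp
  moreover have "(\<Oplus>\<^bsub>completion (circle_alg n) p\<^esub>i\<in>{1..n}. to_completion (circle_alg n) p (gen (P i))) =
      to_completion (circle_alg n) p (single [])"
  proof -
    have fc: "(\<Oplus>\<^bsub>circle_alg n\<^esub>i\<in>{1..n}. gen (P i)) : carrier (circle_alg n)" by (rule C.finsum_cl) (rule Pc)
    have ec: "single [] : carrier (circle_alg n)" by (rule circle_facts(2)) simp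
    have "psi (\<Oplus>\<^bsub>circle_alg n\<^esub>i\<in>{1..n}. gen (P i)) = e"
      using star_hom_finsum[OF circle_facts(1) F.star_algebra_completion hom, of "{1..n}" "%i. gen (P i)"] Pc sums by simp
    moreover have "psi (single []) = e" using psi[of "[]"] by (simp add: m_def)
    ultimately have "p ((\<Oplus>\<^bsub>circle_alg n\<^esub>i\<in>{1..n}. gen (P i)) \<ominus>\<^bsub>circle_alg n\<^esub> single []) = 0"
      using star_hom_minus[OF circle_facts(1) F.star_algebra_completion hom fc ec] by (simp add: p_def)
    then have "to_completion (circle_alg n) p (\<Oplus>\<^bsub>circle_alg n\<^esub>i\<in>{1..n}. gen (P i)) = to_completion (circle_alg n) p (single [])"
      using C.to_completion_eq_iff[OF fc ec] by simp
    then show ?thesis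
      using star_hom_finsum[OF circle_facts(1) C.star_algebra_completion C.to_completion_hom, of "{1..n}" "%i. gen (P i)"] Pc
      by simp
  qed
  ultimately have "p : circle_adm n" using sp by (simp add: circle_adm_iff)
  moreover have "p (to_circle_alg n f) = q f" if "f : carrier (loop_alg n)" for f
    using that by (simp add: p_def agree F.anorm_to_completion)
  ultimately show ?thesis by blast
qed

lemma circle_adm_nonempty: "circle_adm n ~= {}"
  using loop_adm_nonempty loop_adm_extend by fast

lemma loop_norm_ge: "p : loop_adm n ==> f : carrier (loop_alg n) ==> p f <= loop_norm n f"
  unfolding loop_norm_def by (rule cSUP_upper[OF _ loop_adm_bdd])

text \<open>Among the basis words only the empty one is missed. By the last circle relation it has
  distance 0 from the sum of the projections in every admissible seminorm, so one x serves all p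
  simultaneously.\<close>

lemma to_circle_alg_dense:
  assumes "y : carrier (circle_alg n)"
  shows "\<exists>x\<in>carrier (loop_alg n). \<forall>p\<in>circle_adm n. p (to_circle_alg n x \<ominus>\<^bsub>circle_alg n\<^esub> y) = 0"
proof -
  interpret L: star_algebra "loop_alg n" by (rule loop_facts(1))
  interpret C: star_algebra "circle_alg n" by (rule circle_facts(1))
  note h = star_homD[OF to_circle_alg_hom]
  have sn: "seminormed_star_algebra (circle_alg n) p" if "p : circle_adm n" for p
    using that by (intro seminormed_star_algebraI[OF circle_facts(1)]) (simp add: circle_adm_iff)
  have vg: "gen (Vertex i) : carrier (loop_alg n)" if "i : {1..n}" for i
    using that by (intro gen_loop) (simp add: loop_gens_eq)
  have Pc: "gen (P i) : carrier (circle_alg n)" if "i : {1..n}" for i using that by (intro gen_circle) auto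
  have word: "\<exists>x\<in>carrier (loop_alg n). \<forall>p\<in>circle_adm n. p (to_circle_alg n x \<ominus>\<^bsub>circle_alg n\<^esub> single w) = 0"
    if w: "w : lists (circle_gens n \<times> UNIV)" for w
  proof (cases "w = []")
    case False
    have "to_circle_alg n (single (loop_word w)) = single w"
      using w by (simp add: to_circle_alg_single loop_word_lists circle_loop_word)
    then show ?thesis using w False circle_facts(2)[OF w]
      by (intro bexI[of _ "single (loop_word w)"])
        (simp_all add: loop_facts(2) loop_word_lists seminormed_star_algebra.N_zero[OF sn])
  next
    case True
    define x where "x = (\<Oplus>\<^bsub>loop_alg n\<^esub>i\<in>{1..n}. gen (Vertex i))"
    have x: "x : carrier (loop_alg n)" unfolding x_def by (rule L.finsum_cl) (rule vg)
    have ec: "single [] : carrier (circle_alg n)" by (rule circle_facts(2)) simp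
    have "to_circle_alg n x = (\<Oplus>\<^bsub>circle_alg n\<^esub>i\<in>{1..n}. to_circle_alg n (gen (Vertex i)))"
      unfolding x_def by (rule star_hom_finsum[OF loop_facts(1) circle_facts(1) to_circle_alg_hom]) (auto intro: vg)
    also have "... = (\<Oplus>\<^bsub>circle_alg n\<^esub>i\<in>{1..n}. gen (P i))"
      by (rule C.M.finsum_cong') (auto simp: to_circle_alg_gen loop_gens_eq intro: Pc)
    finally have tx: "to_circle_alg n x = (\<Oplus>\<^bsub>circle_alg n\<^esub>i\<in>{1..n}. gen (P i))" .
    have "p (to_circle_alg n x \<ominus>\<^bsub>circle_alg n\<^esub> single []) = 0" if p: "p : circle_adm n" for p
    proof -
      interpret F: seminormed_star_algebra "circle_alg n" p by (rule sn[OF p])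
      have "to_completion (circle_alg n) p (to_circle_alg n x) = to_completion (circle_alg n) p (single [])"
        using p star_hom_finsum[OF circle_facts(1) F.star_algebra_completion F.to_completion_hom, of "{1..n}" "%i. gen (P i)"] Pc
        by (simp add: circle_adm_iff tx)
      then show ?thesis using F.to_completion_eq_iff[OF h(1)[OF x] ec] by simp
    qed
    then show ?thesis using True x by blast
  qed
  show ?thesis using assms
  proof (induction y rule: free_unital_induct)
    case zero
    show ?case
      using star_hom_zero[OF loop_facts(1) circle_facts(1) to_circle_alg_hom, of n]
      by (intro bexI[of _ "\<zero>\<^bsub>loop_alg n\<^esub>"]) (simp_all add: seminormed_star_algebra.N_zero[OF sn])
  next
    case (add c w g)
    obtain x where x: "x : carrier (loop_alg n)" "\<forall>p\<in>circle_adm n. p (to_circle_alg n x \<ominus>\<^bsub>circle_alg n\<^esub> g) = 0"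
      using add by blast
    obtain v where v: "v : carrier (loop_alg n)" "\<forall>p\<in>circle_adm n. p (to_circle_alg n v \<ominus>\<^bsub>circle_alg n\<^esub> single w) = 0"
      using word add by blast
    have wc: "single w : carrier (circle_alg n)" using add by (intro circle_facts(2))
    note cl = h(1)[OF x(1)] h(1)[OF v(1)] wc add.hyps(1)
    let ?v = "to_circle_alg n v \<ominus>\<^bsub>circle_alg n\<^esub> single w" and ?x = "to_circle_alg n x \<ominus>\<^bsub>circle_alg n\<^esub> g"
    have "p (c \<odot>\<^bsub>circle_alg n\<^esub> ?v \<oplus>\<^bsub>circle_alg n\<^esub> ?x) = 0" if p: "p : circle_adm n" for p
    proof -
      interpret F: seminormed_star_algebra "circle_alg n" p by (rule sn[OF p])
      have "p (c \<odot>\<^bsub>circle_alg n\<^esub> ?v \<oplus>\<^bsub>circle_alg n\<^esub> ?x) <= 0"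
        using F.N_triangle[of "c \<odot>\<^bsub>circle_alg n\<^esub> ?v" ?x] bspec[OF x(2) p] bspec[OF v(2) p] cl by (simp add: F.N_smult)
      then show ?thesis by (rule antisym[OF _ F.N_nonneg]) (use cl in simp)
    qed
    moreover have "to_circle_alg n (c \<odot>\<^bsub>loop_alg n\<^esub> v \<oplus>\<^bsub>loop_alg n\<^esub> x) \<ominus>\<^bsub>circle_alg n\<^esub>
        (c \<odot>\<^bsub>circle_alg n\<^esub> single w \<oplus>\<^bsub>circle_alg n\<^esub> g) = c \<odot>\<^bsub>circle_alg n\<^esub> ?v \<oplus>\<^bsub>circle_alg n\<^esub> ?x"
      using x v cl by (simp add: h(2,3) C.add_minus_add C.s_minus)
    ultimately show ?case using x v by (intro bexI[of _ "c \<odot>\<^bsub>loop_alg n\<^esub> v \<oplus>\<^bsub>loop_alg n\<^esub> x"]) simp_all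
  qed
qed

text \<open>Finiteness is inherited from the loop side: each y agrees, in all admissible seminorms,
  with the image of one loop element.\<close>

lemma circle_adm_bdd:
  assumes y: "y : carrier (circle_alg n)" shows "bdd_above ((%p. p y) ` circle_adm n)"
proof -
  obtain x where x: "x : carrier (loop_alg n)"
      "\<forall>p\<in>circle_adm n. p (to_circle_alg n x \<ominus>\<^bsub>circle_alg n\<^esub> y) = 0"
    using to_circle_alg_dense[OF y] by blast
  have "p y <= loop_norm n x" if p: "p : circle_adm n" for p
  proof -
    interpret F: seminormed_star_algebra "circle_alg n" p
      using p by (intro seminormed_star_algebraI[OF circle_facts(1)]) (simp add: circle_adm_iff)
    show ?thesis
      using F.N_diff_le[OF star_homD(1)[OF to_circle_alg_hom x(1)] y] bspec[OF x(2) p]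
        loop_norm_ge[OF circle_adm_pullback[OF p] x(1)] by auto
  qed
  then show ?thesis by (rule bdd_aboveI2)
qed

lemma cstar_seminorm_loop_norm: "cstar_seminorm (loop_alg n) (loop_norm n)"
  unfolding loop_norm_def[abs_def]
  by (rule cstar_seminorm_SUP[OF loop_facts(1) loop_adm_nonempty]) (auto simp: loop_adm_bdd loop_adm_iff)

lemma cstar_seminorm_circle_norm: "cstar_seminorm (circle_alg n) (circle_norm n)"
  unfolding circle_norm_def[abs_def]
  by (rule cstar_seminorm_SUP[OF circle_facts(1) circle_adm_nonempty]) (auto simp: circle_adm_bdd circle_adm_iff)

text \<open>Pulling seminorms back gives one inequality, extending them gives the other.\<close>

lemma circle_norm_to_circle_alg:
  assumes f: "f : carrier (loop_alg n)"
  shows "circle_norm n (to_circle_alg n f) = loop_norm n f"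
proof (rule antisym)
  show "circle_norm n (to_circle_alg n f) <= loop_norm n f"
    unfolding circle_norm_def
    by (rule cSUP_least[OF circle_adm_nonempty]) (rule loop_norm_ge[OF circle_adm_pullback f])
  show "loop_norm n f <= circle_norm n (to_circle_alg n f)"
    unfolding loop_norm_def
  proof (rule cSUP_least[OF loop_adm_nonempty])
    fix q assume "q : loop_adm n"
    then obtain p where p: "p : circle_adm n" "p (to_circle_alg n f) = q f" using loop_adm_extend f by blast
    show "q f <= circle_norm n (to_circle_alg n f)"
      unfolding circle_norm_def p(2)[symmetric]
      by (rule cSUP_upper[OF p(1) circle_adm_bdd]) (rule star_homD(1)[OF to_circle_alg_hom f])
  qed
qed

lemma circle_norm_dense:
  assumes "y : carrier (circle_alg n)"
  shows "\<exists>x\<in>carrier (loop_alg n). circle_norm n (to_circle_alg n x \<ominus>\<^bsub>circle_alg n\<^esub> y) = 0"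
proof -
  obtain x where x: "x : carrier (loop_alg n)"
      "!!p. p : circle_adm n ==> p (to_circle_alg n x \<ominus>\<^bsub>circle_alg n\<^esub> y) = 0"
    using to_circle_alg_dense[OF assms] by blast
  have "circle_norm n (to_circle_alg n x \<ominus>\<^bsub>circle_alg n\<^esub> y) = (SUP p\<in>circle_adm n. 0)"
    unfolding circle_norm_def by (rule SUP_cong[OF refl x(2)])
  then show ?thesis using x(1) circle_adm_nonempty[of n] by auto
qed

theorem hypergraph_cstar_alg_isomorphic:
  "hypergraph_cstar_alg (full_loop_hypergraph n) \<cong>\<^sup>\<star> circle_free_product n"
  unfolding hypergraph_cstar_alg_loop circle_free_product_eq
  by (rule completion_isomorphic)
    (rule loop_facts(1) cstar_seminorm_loop_norm circle_facts(1) cstar_seminorm_circle_norm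
      to_circle_alg_hom circle_norm_to_circle_alg circle_norm_dense; assumption)+

section \<open>Seminorms from positive functionals\<close>

text \<open>The bound r is a submultiplicative function invariant under the star. Weighted summation
  norms on semigroup algebras and C*-seminorms both occur in this role.\<close>

locale gns = star_algebra D for D (structure) +
  fixes \<omega> :: "'a => complex" and r :: "'a => real" and K :: real
  assumes positive: "positive_functional D \<omega>"
    and bounded: "x : carrier D ==> cmod (\<omega> x) <= K * r x"
    and r_nonneg: "x : carrier D ==> 0 <= r x"
    and r_mult: "x : carrier D ==> y : carrier D ==> r (x \<otimes> y) <= r x * r y"
    and r_star: "x : carrier D ==> r (x\<^sup>\<star>) = r x"
begin

lemma om_add: "x : carrier D ==> y : carrier D ==> \<omega> (x \<oplus> y) = \<omega> x + \<omega> y"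
  and om_smult: "x : carrier D ==> \<omega> (c \<odot> x) = c * \<omega> x"
  and om_pos: "x : carrier D ==> 0 <= Re (\<omega> (x\<^sup>\<star> \<otimes> x))"
  and om_real: "x : carrier D ==> Im (\<omega> (x\<^sup>\<star> \<otimes> x)) = 0"
  using positive by (simp_all add: positive_functional_def)

definition vnorm :: "'a => real" where
  "vnorm x = sqrt (Re (\<omega> (x\<^sup>\<star> \<otimes> x)))"

lemma vnorm_nonneg [simp]: "x : carrier D ==> 0 <= vnorm x"
  by (simp add: vnorm_def om_pos)

lemma vnorm_square: "x : carrier D ==> \<omega> (x\<^sup>\<star> \<otimes> x) = of_real ((vnorm x)^2)"
  by (simp add: vnorm_def om_pos om_real complex_eq_iff)

lemma om_expand:
  assumes "x : carrier D" "y : carrier D"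
  shows "\<omega> ((x \<oplus> z \<odot> y)\<^sup>\<star> \<otimes> (x \<oplus> z \<odot> y)) =
    \<omega> (x\<^sup>\<star> \<otimes> x) + z * \<omega> (x\<^sup>\<star> \<otimes> y) + cnj z * \<omega> (y\<^sup>\<star> \<otimes> x) + cnj z * z * \<omega> (y\<^sup>\<star> \<otimes> y)"
  using assms
  by (simp add: star_add star_smult distrib_left distrib_right smult_mult_left smult_mult_right
      s_assoc om_add om_smult) (simp add: algebra_simps)

text \<open>Polarisation: the functional is real at star-squares of x + z y, and z = 1 and z = \<i>
  suffice.\<close>

lemma hermitian:
  assumes "x : carrier D" "y : carrier D"
  shows "\<omega> (y\<^sup>\<star> \<otimes> x) = cnj (\<omega> (x\<^sup>\<star> \<otimes> y))"
proof -
  have im: "Im (z * \<omega> (x\<^sup>\<star> \<otimes> y) + cnj z * \<omega> (y\<^sup>\<star> \<otimes> x)) = 0" for z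
  proof -
    have "Im (\<omega> ((x \<oplus> z \<odot> y)\<^sup>\<star> \<otimes> (x \<oplus> z \<odot> y))) = 0" using assms by (intro om_real) simp
    then show ?thesis using assms om_real[of x] om_real[of y] by (simp add: om_expand)
  qed
  show ?thesis using im[of 1] im[of \<i>] by (simp add: complex_eq_iff)
qed

lemma cauchy_schwarz:
  assumes x: "x : carrier D" and y: "y : carrier D"
  shows "cmod (\<omega> (x\<^sup>\<star> \<otimes> y)) <= vnorm x * vnorm y"
proof -
  define c where "c = \<omega> (x\<^sup>\<star> \<otimes> y)"
  have "(cmod c)^2 <= (vnorm x)^2 * (vnorm y)^2"
  proof (rule quadratic_nonneg_discrim)
    fix t :: real
    \<comment> \<open>The phase u rotates c to its absolute value; for c = 0 it is set to 0, which
      removes the t-dependence.\<close>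
    define u where "u = (if c = 0 then 0 else cnj c / of_real (cmod c))"
    have uc: "u * c = of_real (cmod c)" "cnj u * u = (if c = 0 then 0 else 1)"
    proof -
      have cc: "cnj c * c = of_real (cmod c) * of_real (cmod c)"
        by (simp add: mult.commute complex_norm_square[symmetric] power2_eq_square flip: of_real_mult)
      then show "u * c = of_real (cmod c)" by (simp add: u_def)
      show "cnj u * u = (if c = 0 then 0 else 1)" using cc by (simp add: u_def field_simps)
    qed
    have uc': "cnj u * cnj c = of_real (cmod c)" using uc(1) by (metis complex_cnj_mult complex_cnj_complex_of_real)
    have "\<omega> ((x \<oplus> (of_real t * u) \<odot> y)\<^sup>\<star> \<otimes> (x \<oplus> (of_real t * u) \<odot> y)) =
        of_real ((vnorm x)^2) + of_real t * (u * c) + of_real t * (cnj u * cnj c) +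
        (of_real t * of_real t) * (cnj u * u) * of_real ((vnorm y)^2)"
      unfolding om_expand[OF x y] vnorm_square[OF x] vnorm_square[OF y] hermitian[OF x y]
        c_def[symmetric]
      by (simp add: algebra_simps)
    also have "... = of_real ((vnorm x)^2 + 2 * cmod c * t + (if c = 0 then 0 else (vnorm y)^2 * t^2))"
      unfolding uc uc' by (simp add: power2_eq_square algebra_simps)
    finally have "0 <= (vnorm x)^2 + 2 * cmod c * t + (if c = 0 then 0 else (vnorm y)^2 * t^2)"
      using om_pos[of "x \<oplus> (of_real t * u) \<odot> y"] x y by simp
    then show "0 <= (vnorm x)^2 + 2 * cmod c * t + (vnorm y)^2 * t^2"
      by (auto split: if_splits)
  qed
  then show ?thesis unfolding c_def[symmetric]
    by (metis power_mult_distrib power2_le_imp_le mult_nonneg_nonneg vnorm_nonneg x y)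
qed

lemma vnorm_triangle:
  assumes x: "x : carrier D" and y: "y : carrier D"
  shows "vnorm (x \<oplus> y) <= vnorm x + vnorm y"
proof -
  have "of_real ((vnorm (x \<oplus> y))^2) = of_real ((vnorm x)^2) + \<omega> (x\<^sup>\<star> \<otimes> y) + cnj (\<omega> (x\<^sup>\<star> \<otimes> y)) + of_real ((vnorm y)^2)"
    using om_expand[OF x y, of 1] x y by (simp add: vnorm_square hermitian[OF x y])
  then have "(vnorm (x \<oplus> y))^2 = (vnorm x)^2 + 2 * Re (\<omega> (x\<^sup>\<star> \<otimes> y)) + (vnorm y)^2"
    by (simp add: complex_eq_iff)
  also have "... <= (vnorm x + vnorm y)^2"
    using complex_Re_le_cmod[of "\<omega> (x\<^sup>\<star> \<otimes> y)"] cauchy_schwarz[OF x y]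
    by (simp add: power2_sum)
  finally show ?thesis by (rule power2_le_imp_le) (simp add: x y)
qed

lemma vnorm_smult: "x : carrier D ==> vnorm (c \<odot> x) = cmod c * vnorm x"
proof -
  assume x: "x : carrier D"
  have "of_real ((vnorm (c \<odot> x))^2) = cnj c * c * of_real ((vnorm x)^2)"
    using x vnorm_square[of "c \<odot> x"]
    by (simp add: star_smult smult_mult_left smult_mult_right s_assoc om_smult vnorm_square
        mult_ac)
  also have "... = of_real ((cmod c * vnorm x)^2)"
    by (simp add: power_mult_distrib mult.commute flip: complex_norm_square)
  finally show ?thesis using x by (simp add: power2_eq_iff_nonneg flip: of_real_power)
qed

text \<open>Iterating the Cauchy--Schwarz inequality for \<open>h = x\<^sup>\<star> x\<close> turns any bound of \<open>\<omega>\<close> by a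
  submultiplicative \<open>r\<close> into boundedness of left multiplication.\<close>

lemma vnorm_mult_le:
  assumes x: "x : carrier D" and v: "v : carrier D"
  shows "(vnorm (x \<otimes> v))^2 <= r (x\<^sup>\<star> \<otimes> x) * (vnorm v)^2"
proof -
  \<comment> \<open>\<open>h k\<close> is the 2^k-th power of x* x, obtained by repeated
    squaring.\<close>
  define h where "h = rec_nat (x\<^sup>\<star> \<otimes> x) (%_ y. y \<otimes> y)"
  have h0: "h 0 = x\<^sup>\<star> \<otimes> x" and hS: "h (Suc k) = h k \<otimes> h k" for k by (simp_all add: h_def)
  have hc: "h k : carrier D \<and> (h k)\<^sup>\<star> = h k \<and> r (h k) <= r (h 0) ^ (2 ^ k)" for k
  proof (induction k)
    case 0
    then show ?case using x by (simp add: h0 star_mult star_star)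
  next
    case (Suc k)
    then have "r (h k) * r (h k) <= r (h 0) ^ (2 ^ k) * r (h 0) ^ (2 ^ k)"
      by (intro mult_mono r_nonneg) (auto intro!: zero_le_power r_nonneg simp: h0 x)
    then have "r (h k \<otimes> h k) <= r (h 0) ^ (2 ^ Suc k)"
      using Suc r_mult[of "h k" "h k"] by (simp add: mult_2 power_add)
    then show ?case using Suc by (simp add: hS star_mult)
  qed
  define a where "a k = vnorm (h k \<otimes> v)" for k
  have a0: "0 <= a k" for k using hc v by (simp add: a_def)
  have step: "(a k)^2 <= vnorm v * a (Suc k)" for k
  proof -
    have "(h k \<otimes> v)\<^sup>\<star> \<otimes> (h k \<otimes> v) = v\<^sup>\<star> \<otimes> (h (Suc k) \<otimes> v)"
      using hc v by (simp add: hS star_mult mult_assoc)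
    then have "of_real ((a k)^2) = \<omega> (v\<^sup>\<star> \<otimes> (h (Suc k) \<otimes> v))"
      using vnorm_square[of "h k \<otimes> v"] hc v by (simp add: a_def)
    then have "(a k)^2 = cmod (\<omega> (v\<^sup>\<star> \<otimes> (h (Suc k) \<otimes> v)))"
      by (metis norm_of_real abs_of_nonneg zero_le_power2)
    then show ?thesis using cauchy_schwarz[of v "h (Suc k) \<otimes> v"] hc v by (simp add: a_def)
  qed
  have first: "(vnorm (x \<otimes> v))^2 <= vnorm v * a 0"
  proof -
    have "(x \<otimes> v)\<^sup>\<star> \<otimes> (x \<otimes> v) = v\<^sup>\<star> \<otimes> (h 0 \<otimes> v)" using x v by (simp add: h0 star_mult mult_assoc)
    then have "of_real ((vnorm (x \<otimes> v))^2) = \<omega> (v\<^sup>\<star> \<otimes> (h 0 \<otimes> v))"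
      using vnorm_square[of "x \<otimes> v"] x v by simp
    then have "(vnorm (x \<otimes> v))^2 = cmod (\<omega> (v\<^sup>\<star> \<otimes> (h 0 \<otimes> v)))"
      by (metis norm_of_real abs_of_nonneg zero_le_power2)
    then show ?thesis using cauchy_schwarz[of v "h 0 \<otimes> v"] hc v by (simp add: a_def)
  qed
  have "a 0 <= r (h 0) * vnorm v"
  proof (cases "vnorm v = 0")
    case True
    then have "(a 0)^2 <= 0" using step[of 0] by simp
    then show ?thesis using True by simp
  next
    case False
    then have vp: "0 < vnorm v" using v by (simp add: less_le)
    define b where "b k = a k / vnorm v" for k
    have bstep: "(b k)^2 <= b (Suc k)" for k
      using step[of k] vp by (simp add: b_def power2_eq_square field_simps)
    have b0: "0 <= b k" for k using a0 vp by (simp add: b_def)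
    have pow: "b 0 ^ (2 ^ k) <= b k" for k
    proof (induction k)
      case (Suc k)
      have "b 0 ^ (2 ^ Suc k) = (b 0 ^ (2 ^ k))^2" by (simp add: power_mult[symmetric] mult.commute)
      also have "... <= (b k)^2" using Suc b0 by (intro power_mono) auto
      finally show ?case using bstep[of k] by simp
    qed simp
    have K0: "0 <= K * r (v\<^sup>\<star> \<otimes> v)" using bounded[of "v\<^sup>\<star> \<otimes> v"] v by (smt (verit) closed norm_ge_zero)
    \<comment> \<open>L collects all factors that do not grow with k; it disappears when roots of
      order 2^k are taken.\<close>
    define L where "L = sqrt (\<bar>K\<bar>) * r v / vnorm v"
    have bL: "b k <= L * r (h 0) ^ (2 ^ k)" for k
    proof -
      have c: "h k \<otimes> v : carrier D" using hc v by simp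
      have rr: "r (h k \<otimes> v) <= r (h 0) ^ (2 ^ k) * r v"
        using r_mult[of "h k" v] hc[of k] v r_nonneg[OF v]
        by (meson mult_right_mono order_trans)
      have rn: "0 <= r (h k \<otimes> v)" by (rule r_nonneg[OF c])
      have "(a k)^2 = cmod (\<omega> ((h k \<otimes> v)\<^sup>\<star> \<otimes> (h k \<otimes> v)))"
        unfolding vnorm_square[OF c] a_def by (simp add: norm_power)
      also have "... <= K * r ((h k \<otimes> v)\<^sup>\<star> \<otimes> (h k \<otimes> v))" by (rule bounded) (use c in simp)
      also have "... <= \<bar>K\<bar> * r ((h k \<otimes> v)\<^sup>\<star> \<otimes> (h k \<otimes> v))"
        by (rule mult_right_mono) (use c r_nonneg in auto)
      also have "... <= \<bar>K\<bar> * (r (h k \<otimes> v) * r (h k \<otimes> v))"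
        using r_mult[of "(h k \<otimes> v)\<^sup>\<star>" "h k \<otimes> v"] c by (intro mult_left_mono) (auto simp: r_star)
      also have "... = (sqrt \<bar>K\<bar> * r (h k \<otimes> v))^2" by (simp add: power_mult_distrib power2_eq_square)
      finally have "a k <= sqrt \<bar>K\<bar> * r (h k \<otimes> v)" by (rule power2_le_imp_le) (simp add: rn)
      also have "... <= sqrt \<bar>K\<bar> * (r (h 0) ^ (2 ^ k) * r v)" using rr by (intro mult_left_mono) auto
      finally show ?thesis using vp by (simp add: b_def L_def field_simps)
    qed
    have "b 0 <= r (h 0)"
      by (rule power_le_imp_base_le[of _ _ L]) (use b0 pow bL hc r_nonneg in "auto intro: order_trans")
    then show ?thesis using vp by (simp add: b_def field_simps)
  qed
  then have "vnorm v * a 0 <= vnorm v * (r (h 0) * vnorm v)" using v by (intro mult_left_mono) auto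
  with first show ?thesis by (simp add: h0 power2_eq_square mult_ac)
qed

text \<open>Norm of the GNS representation, computed on the algebra with the seminorm
  \<open>vnorm\<close> instead of on a quotient or its completion.\<close>

definition gnorm :: "'a => real" where
  "gnorm = opnorm (carrier D) vnorm (\<otimes>)"

lemma mult_bdd: "x : carrier D ==> \<exists>C\<ge>0. \<forall>v\<in>carrier D. vnorm (x \<otimes> v) <= C * vnorm v"
proof (intro exI[of _ "sqrt (r (x\<^sup>\<star> \<otimes> x))"] conjI ballI)
  assume x: "x : carrier D"
  have rn: "0 <= r (x\<^sup>\<star> \<otimes> x)" using x by (intro r_nonneg) simp
  then show "0 <= sqrt (r (x\<^sup>\<star> \<otimes> x))" by simp
  fix v assume v: "v : carrier D"
  have "(vnorm (x \<otimes> v))^2 <= (sqrt (r (x\<^sup>\<star> \<otimes> x)) * vnorm v)^2"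
    using vnorm_mult_le[OF x v] rn by (simp add: power_mult_distrib)
  then show "vnorm (x \<otimes> v) <= sqrt (r (x\<^sup>\<star> \<otimes> x)) * vnorm v"
    by (rule power2_le_imp_le) (use rn v in simp)
qed

lemma gnorm_bound:
  assumes "x : carrier D"
  shows "0 <= gnorm x" and "v : carrier D ==> vnorm (x \<otimes> v) <= gnorm x * vnorm v"
  using opnorm_bound[of "carrier D" vnorm "(\<otimes>)" x, OF mult_bdd[OF assms]] by (auto simp: gnorm_def)

lemma gnorm_least: "0 <= C ==> (!!v. v : carrier D ==> vnorm (x \<otimes> v) <= C * vnorm v) ==> gnorm x <= C"
  unfolding gnorm_def by (rule opnorm_least)

lemma gnorm_le_r: "x : carrier D ==> (gnorm x)^2 <= r (x\<^sup>\<star> \<otimes> x)"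
proof -
  assume x: "x : carrier D"
  have rn: "0 <= r (x\<^sup>\<star> \<otimes> x)" using x by (intro r_nonneg) simp
  have "gnorm x <= sqrt (r (x\<^sup>\<star> \<otimes> x))"
  proof (rule gnorm_least)
    fix v assume v: "v : carrier D"
    have "(vnorm (x \<otimes> v))^2 <= (sqrt (r (x\<^sup>\<star> \<otimes> x)) * vnorm v)^2"
      using vnorm_mult_le[OF x v] rn by (simp add: power_mult_distrib)
    then show "vnorm (x \<otimes> v) <= sqrt (r (x\<^sup>\<star> \<otimes> x)) * vnorm v"
      by (rule power2_le_imp_le) (use rn v in simp)
  qed (simp add: rn)
  then have "(gnorm x)^2 <= (sqrt (r (x\<^sup>\<star> \<otimes> x)))^2" using gnorm_bound(1)[OF x] by (intro power_mono)
  then show ?thesis using rn by simp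
qed

lemma cstar_seminorm_gnorm: "cstar_seminorm D gnorm"
  unfolding gnorm_def
proof (rule opnorm_cstar_seminorm[OF star_algebra_axioms])
  fix x v assume x: "x : carrier D" and v: "v : carrier D"
  show "vnorm (c \<odot> x \<otimes> v) = cmod c * vnorm (x \<otimes> v)" for c
    using x v by (simp add: smult_mult_left vnorm_smult)
  show "(vnorm (x \<otimes> v))^2 <= vnorm v * vnorm (x\<^sup>\<star> \<otimes> x \<otimes> v)"
  proof -
    have "(x \<otimes> v)\<^sup>\<star> \<otimes> (x \<otimes> v) = v\<^sup>\<star> \<otimes> (x\<^sup>\<star> \<otimes> x \<otimes> v)" using x v by (simp add: star_mult mult_assoc)
    then have "of_real ((vnorm (x \<otimes> v))^2) = \<omega> (v\<^sup>\<star> \<otimes> (x\<^sup>\<star> \<otimes> x \<otimes> v))"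
      using vnorm_square[of "x \<otimes> v"] x v by simp
    then have "(vnorm (x \<otimes> v))^2 = cmod (\<omega> (v\<^sup>\<star> \<otimes> (x\<^sup>\<star> \<otimes> x \<otimes> v)))"
      by (metis norm_of_real abs_of_nonneg zero_le_power2)
    then show ?thesis using cauchy_schwarz[of v "x\<^sup>\<star> \<otimes> x \<otimes> v"] x v by simp
  qed
  fix y assume y: "y : carrier D"
  show "vnorm ((x \<oplus> y) \<otimes> v) <= vnorm (x \<otimes> v) + vnorm (y \<otimes> v)"
    using x y v by (simp add: distrib_right vnorm_triangle)
  show "vnorm (x \<otimes> y \<otimes> v) = vnorm (x \<otimes> (y \<otimes> v))" using x y v by (simp add: mult_assoc)
qed (simp_all add: mult_bdd)

end

section \<open>Weighted summation norms and kernels on semigroup algebras\<close>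

definition wnorm :: "('s => real) => ('s => complex) => real" where
  "wnorm wt f = (\<Sum>s | f s ~= 0. cmod (f s) * wt s)"

lemma pairing_le_wnorm:
  assumes "!!s. f s ~= 0 ==> cmod (m s) <= K * wt s"
  shows "cmod (pairing f m) <= K * wnorm wt f"
proof -
  have "cmod (pairing f m) <= (\<Sum>s | f s ~= 0. cmod (f s * m s))" unfolding pairing_def by (rule norm_sum)
  also have "... <= (\<Sum>s | f s ~= 0. K * (cmod (f s) * wt s))"
  proof (rule sum_mono)
    fix s assume "s : {s. f s ~= 0}"
    then have "cmod (f s) * cmod (m s) <= cmod (f s) * (K * wt s)" using assms by (intro mult_left_mono) auto
    then show "cmod (f s * m s) <= K * (cmod (f s) * wt s)" by (simp add: norm_mult algebra_simps)
  qed
  finally show ?thesis by (simp add: wnorm_def sum_distrib_left)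
qed

text \<open>The weighted norm of f is itself a pairing, with the conjugate phases of f as test
  function. Submultiplicativity then follows from \<open>pairing_mult\<close> and two uses of
  \<open>pairing_le_wnorm\<close>.\<close>

lemma wnorm_attained: "of_real (wnorm wt f) = pairing f (%s. cnj (sgn (f s)) * of_real (wt s))"
proof -
  have "of_real (cmod (f s) * wt s) = f s * (cnj (sgn (f s)) * of_real (wt s))" if "f s ~= 0" for s
  proof -
    have "f s * cnj (f s) = of_real (cmod (f s)) * of_real (cmod (f s))"
      by (simp add: complex_norm_square[symmetric] power2_eq_square flip: of_real_mult)
    then have "f s * cnj (sgn (f s)) = of_real (cmod (f s))"
      using that by (simp add: sgn_eq)
    then show ?thesis by (simp add: mult.assoc[symmetric])
  qed
  then show ?thesis unfolding wnorm_def pairing_def of_real_sum by (intro sum.cong) auto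
qed

locale weighted_semigroup = involutive_semigroup S i for S :: "('s, 'm) monoid_scheme" (structure) and i +
  fixes wt :: "'s => real"
  assumes wt_nonneg: "s : carrier S ==> 0 <= wt s"
    and wt_mult: "s : carrier S ==> t : carrier S ==> wt (s \<otimes> t) <= wt s * wt t"
    and wt_inv: "s : carrier S ==> wt (i s) = wt s"
begin

lemma wnorm_nonneg: "f : carrier \<A> ==> 0 <= wnorm wt f"
  unfolding wnorm_def by (rule sum_nonneg) (auto dest: alg_support intro!: mult_nonneg_nonneg wt_nonneg)

lemma sgn_le: "cmod (cnj (sgn z) * of_real a) <= \<bar>a\<bar>"
  by (simp add: norm_mult norm_sgn)

lemma wnorm_mult:
  assumes f: "f : carrier \<A>" and g: "g : carrier \<A>"
  shows "wnorm wt (f \<otimes>\<^bsub>\<A>\<^esub> g) <= wnorm wt f * wnorm wt g"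
proof -
  define m where "m = (%s. cnj (sgn ((f \<otimes>\<^bsub>\<A>\<^esub> g) s)) * of_real (wt s))"
  have "cmod (pairing f (%s. pairing g (%t. m (s \<otimes> t)))) <= wnorm wt g * wnorm wt f"
  proof (rule pairing_le_wnorm)
    fix s assume s: "f s ~= 0"
    have "cmod (pairing g (%t. m (s \<otimes> t))) <= wt s * wnorm wt g"
    proof (rule pairing_le_wnorm)
      fix t assume t: "g t ~= 0"
      have c: "s : carrier S" "t : carrier S" using s t f g by (auto dest: alg_support)
      have "cmod (m (s \<otimes> t)) <= \<bar>wt (s \<otimes> t)\<bar>" unfolding m_def by (rule sgn_le)
      also have "... = wt (s \<otimes> t)" using wt_nonneg[OF sg_closed[OF c]] by simp
      finally show "cmod (m (s \<otimes> t)) <= wt s * wt t" using wt_mult[OF c] by simp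
    qed
    then show "cmod (pairing g (%t. m (s \<otimes> t))) <= wnorm wt g * wt s" by (simp add: mult.commute)
  qed
  moreover have "of_real (wnorm wt (f \<otimes>\<^bsub>\<A>\<^esub> g)) = pairing f (%s. pairing g (%t. m (s \<otimes> t)))"
    unfolding wnorm_attained by (simp add: pairing_mult[OF f g] m_def)
  then have "cmod (pairing f (%s. pairing g (%t. m (s \<otimes> t)))) = wnorm wt (f \<otimes>\<^bsub>\<A>\<^esub> g)"
    using wnorm_nonneg[OF mult_closed'[OF f g]] by (metis norm_of_real abs_of_nonneg)
  ultimately show ?thesis by (simp add: mult.commute)
qed

lemma wnorm_star:
  assumes f: "f : carrier \<A>"
  shows "wnorm wt (f\<^sup>\<star>\<^bsub>\<A>\<^esub>) = wnorm wt f"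
proof -
  have le: "wnorm wt (f\<^sup>\<star>\<^bsub>\<A>\<^esub>) <= wnorm wt f" if f: "f : carrier \<A>" for f
  proof -
    define m where "m = (%s. cnj (sgn ((f\<^sup>\<star>\<^bsub>\<A>\<^esub>) s)) * of_real (wt s))"
    have "cmod (pairing f (%s. cnj (m (i s)))) <= 1 * wnorm wt f"
    proof (rule pairing_le_wnorm)
      fix s assume "f s ~= 0"
      then have s: "s : carrier S" using f by (auto dest: alg_support)
      have "cmod (m (i s)) <= \<bar>wt (i s)\<bar>" unfolding m_def by (rule sgn_le)
      then show "cmod (cnj (m (i s))) <= 1 * wt s" using s wt_nonneg[OF s] by (simp add: wt_inv)
    qed
    moreover have "of_real (wnorm wt (f\<^sup>\<star>\<^bsub>\<A>\<^esub>)) = cnj (pairing f (%s. cnj (m (i s))))"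
      unfolding wnorm_attained by (simp add: pairing_star[OF f] m_def)
    then have "cmod (pairing f (%s. cnj (m (i s)))) = wnorm wt (f\<^sup>\<star>\<^bsub>\<A>\<^esub>)"
      using wnorm_nonneg[OF star_closed'[OF f]] by (metis complex_mod_cnj norm_of_real abs_of_nonneg)
    ultimately show ?thesis by simp
  qed
  interpret A: star_algebra \<A> by (rule star_algebra)
  show ?thesis using le[OF f] le[OF star_closed'[OF f]] f by (simp add: A.star_star)
qed

lemma pairing_star_mult:
  assumes f: "f : carrier \<A>" and g: "g : carrier \<A>"
  shows "pairing (f\<^sup>\<star>\<^bsub>\<A>\<^esub> \<otimes>\<^bsub>\<A>\<^esub> g) \<kappa> = (\<Sum>s | f s ~= 0. \<Sum>t | g t ~= 0. cnj (f s) * g t * \<kappa> (i s \<otimes> t))"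
  by (simp add: pairing_mult star_closed' f g pairing_star)
    (simp add: pairing_def sum_distrib_left mult.assoc)

lemma gns_kernel:
  assumes pos: "!!f. f : carrier \<A> ==>
      Im (pairing (f\<^sup>\<star>\<^bsub>\<A>\<^esub> \<otimes>\<^bsub>\<A>\<^esub> f) \<kappa>) = 0 \<and> 0 <= Re (pairing (f\<^sup>\<star>\<^bsub>\<A>\<^esub> \<otimes>\<^bsub>\<A>\<^esub> f) \<kappa>)"
    and bd: "!!s. s : carrier S ==> cmod (\<kappa> s) <= K * wt s"
  shows "gns \<A> (%f. pairing f \<kappa>) (wnorm wt) K"
proof -
  interpret A: star_algebra \<A> by (rule star_algebra)
  show ?thesis
  proof
    show "positive_functional \<A> (%f. pairing f \<kappa>)"
      unfolding positive_functional_def using pos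
      by (auto simp: alg_simps pairing_add pairing_smult alg_finite)
    show "cmod (pairing x \<kappa>) <= K * wnorm wt x" if "x : carrier \<A>" for x
      using that by (intro pairing_le_wnorm bd) (rule alg_support)
  qed (simp_all add: wnorm_nonneg wnorm_mult wnorm_star)
qed

end

section \<open>Tensor products\<close>

locale star_algebra_pair = A: star_algebra A + B: star_algebra B
  for A :: "('a, 'm) star_alg_scheme" (structure) and B :: "('b, 'k) star_alg_scheme"
begin

abbreviation "\<D> == free_tensor_alg A B"
abbreviation "\<R> == bilinear_relators A B"

sublocale P: involutive_semigroup "A \<times>\<times> B" "map_prod (star A) (star B)"
  by standard (auto simp: A.mult_assoc B.mult_assoc A.star_star B.star_star A.star_mult B.star_mult)

lemma tensor_semigroup: "P.\<A> = \<D>"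
  by (simp add: free_tensor_alg_def)

lemmas tensor_simps = P.alg_simps[unfolded tensor_semigroup]
lemmas tensor_finite = P.alg_finite[unfolded tensor_semigroup]
lemmas tensor_pairing_mult = P.pairing_mult[unfolded tensor_semigroup]
lemmas tensor_pairing_star = P.pairing_star[unfolded tensor_semigroup]
lemmas star_algebra_tensor = P.star_algebra[unfolded tensor_semigroup]

sublocale D: star_algebra \<D> by (rule star_algebra_tensor)

lemma tensor_support: "f : carrier \<D> ==> f (a, b) ~= 0 ==> a : carrier A \<and> b : carrier B"
  using P.alg_support[unfolded tensor_semigroup, of f "(a, b)"] by simp

lemma single_closed [simp]: "a : carrier A ==> b : carrier B ==> single (a, b) : carrier \<D>"
  using P.single_carrier[unfolded tensor_semigroup, of "(a, b)"] by simp

lemma single_mult: "a : carrier A ==> b : carrier B ==> a' : carrier A ==> b' : carrier B ==>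
    single (a, b) \<otimes>\<^bsub>\<D>\<^esub> single (a', b') = single (a \<otimes> a', b \<otimes>\<^bsub>B\<^esub> b')"
  using P.mult_single[unfolded tensor_semigroup, of "(a, b)" "(a', b')"] by simp

lemma single_star: "a : carrier A ==> b : carrier B ==>
    (single (a, b))\<^sup>\<star>\<^bsub>\<D>\<^esub> = single (a\<^sup>\<star>, b\<^sup>\<star>\<^bsub>B\<^esub>)"
  using P.star_single[unfolded tensor_semigroup, of "(a, b)"] by simp

lemma minus_tensor: "f : carrier \<D> ==> g : carrier \<D> ==> f \<ominus>\<^bsub>\<D>\<^esub> g = (%t. f t - g t)"
  by (simp add: D.minus_eq_s) (simp add: tensor_simps)

lemma relators_ops:
  shows relator_zero: "\<zero>\<^bsub>\<D>\<^esub> : \<R>"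
    and relator_add: "f : \<R> ==> g : \<R> ==> f \<oplus>\<^bsub>\<D>\<^esub> g : \<R>"
    and relator_smult: "f : \<R> ==> c \<odot>\<^bsub>\<D>\<^esub> f : \<R>"
    and "a : carrier A ==> a' : carrier A ==> b : carrier B ==>
      single (a \<oplus> a', b) \<ominus>\<^bsub>\<D>\<^esub> (single (a, b) \<oplus>\<^bsub>\<D>\<^esub> single (a', b)) : \<R>"
    and "a : carrier A ==> b : carrier B ==> b' : carrier B ==>
      single (a, b \<oplus>\<^bsub>B\<^esub> b') \<ominus>\<^bsub>\<D>\<^esub> (single (a, b) \<oplus>\<^bsub>\<D>\<^esub> single (a, b')) : \<R>"
    and "a : carrier A ==> b : carrier B ==>
      single (c \<odot> a, b) \<ominus>\<^bsub>\<D>\<^esub> c \<odot>\<^bsub>\<D>\<^esub> single (a, b) : \<R>"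
    and "a : carrier A ==> b : carrier B ==>
      single (a, c \<odot>\<^bsub>B\<^esub> b) \<ominus>\<^bsub>\<D>\<^esub> c \<odot>\<^bsub>\<D>\<^esub> single (a, b) : \<R>"
  using bilinear_relators.intros[where A=A and B=B]
  by (simp_all add: minus_tensor) (simp_all add: tensor_simps)

lemma relators_induct [consumes 1, case_names zero add smult add_left add_right smult_left smult_right]:
  assumes "f : \<R>"
    and "Q \<zero>\<^bsub>\<D>\<^esub>"
    and "!!f g. f : carrier \<D> ==> g : carrier \<D> ==> Q f ==> Q g ==> Q (f \<oplus>\<^bsub>\<D>\<^esub> g)"
    and "!!c f. f : carrier \<D> ==> Q f ==> Q (c \<odot>\<^bsub>\<D>\<^esub> f)"
    and "!!a a' b. a : carrier A ==> a' : carrier A ==> b : carrier B ==>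
      Q (single (a \<oplus> a', b) \<ominus>\<^bsub>\<D>\<^esub> (single (a, b) \<oplus>\<^bsub>\<D>\<^esub> single (a', b)))"
    and "!!a b b'. a : carrier A ==> b : carrier B ==> b' : carrier B ==>
      Q (single (a, b \<oplus>\<^bsub>B\<^esub> b') \<ominus>\<^bsub>\<D>\<^esub> (single (a, b) \<oplus>\<^bsub>\<D>\<^esub> single (a, b')))"
    and "!!c a b. a : carrier A ==> b : carrier B ==>
      Q (single (c \<odot> a, b) \<ominus>\<^bsub>\<D>\<^esub> c \<odot>\<^bsub>\<D>\<^esub> single (a, b))"
    and "!!c a b. a : carrier A ==> b : carrier B ==>
      Q (single (a, c \<odot>\<^bsub>B\<^esub> b) \<ominus>\<^bsub>\<D>\<^esub> c \<odot>\<^bsub>\<D>\<^esub> single (a, b))"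
  shows "f : carrier \<D> \<and> Q f"
  using assms(1)
proof (induction rule: bilinear_relators.induct)
  case zero
  then show ?case using assms(2) D.M.zero_closed by (simp add: tensor_simps)
next
  case (add f g)
  then show ?case using assms(3)[of f g] D.M.a_closed[of f g] by (simp add: tensor_simps)
next
  case (smult f c)
  then show ?case using assms(4)[of f c] D.s_closed[of f c] by (simp add: tensor_simps)
next
  case (add_left a a' b)
  then show ?case using assms(5)[of a a' b]
      D.M.minus_closed[of "single (a \<oplus> a', b)" "single (a, b) \<oplus>\<^bsub>\<D>\<^esub> single (a', b)"]
    by (simp add: minus_tensor) (simp add: tensor_simps)
next
  case (add_right a b b')
  then show ?case using assms(6)[of a b b']
      D.M.minus_closed[of "single (a, b \<oplus>\<^bsub>B\<^esub> b')" "single (a, b) \<oplus>\<^bsub>\<D>\<^esub> single (a, b')"]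
    by (simp add: minus_tensor) (simp add: tensor_simps)
next
  case (smult_left a b c)
  then show ?case using assms(7)[of a b c]
      D.M.minus_closed[of "single (c \<odot> a, b)" "c \<odot>\<^bsub>\<D>\<^esub> single (a, b)"]
    by (simp add: minus_tensor) (simp add: tensor_simps)
next
  case (smult_right a b c)
  then show ?case using assms(8)[of a b c]
      D.M.minus_closed[of "single (a, c \<odot>\<^bsub>B\<^esub> b)" "c \<odot>\<^bsub>\<D>\<^esub> single (a, b)"]
    by (simp add: minus_tensor) (simp add: tensor_simps)
qed

lemma relator_closed: "f : \<R> ==> f : carrier \<D>"
  using relators_induct[of f "%_. True"] by simp

text \<open>Allowing a twist \<open>tau\<close> of the scalars covers the involution as well as multiplications.\<close>

lemma relator_map:
  assumes "f : \<R>" and tau: "tau (- 1) = - 1"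
    and T: "!!f. f : carrier \<D> ==> T f : carrier \<D>"
      "!!f g. f : carrier \<D> ==> g : carrier \<D> ==> T (f \<oplus>\<^bsub>\<D>\<^esub> g) = T f \<oplus>\<^bsub>\<D>\<^esub> T g"
      "!!f c. f : carrier \<D> ==> T (c \<odot>\<^bsub>\<D>\<^esub> f) = tau c \<odot>\<^bsub>\<D>\<^esub> T f" "T \<zero>\<^bsub>\<D>\<^esub> = \<zero>\<^bsub>\<D>\<^esub>"
      "!!a b. a : carrier A ==> b : carrier B ==> T (single (a, b)) = single (phi a, psi b)"
    and phi: "!!a. a : carrier A ==> phi a : carrier A"
      "!!a a'. a : carrier A ==> a' : carrier A ==> phi (a \<oplus> a') = phi a \<oplus> phi a'"
      "!!a c. a : carrier A ==> phi (c \<odot> a) = tau c \<odot> phi a"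
    and psi: "!!b. b : carrier B ==> psi b : carrier B"
      "!!b b'. b : carrier B ==> b' : carrier B ==> psi (b \<oplus>\<^bsub>B\<^esub> b') = psi b \<oplus>\<^bsub>B\<^esub> psi b'"
      "!!b c. b : carrier B ==> psi (c \<odot>\<^bsub>B\<^esub> b) = tau c \<odot>\<^bsub>B\<^esub> psi b"
  shows "T f : \<R>"
proof -
  have m: "T (f \<ominus>\<^bsub>\<D>\<^esub> g) = T f \<ominus>\<^bsub>\<D>\<^esub> T g" if "f : carrier \<D>" "g : carrier \<D>" for f g
    using that by (simp add: D.minus_eq_s T tau)
  have "f : carrier \<D> \<and> T f : \<R>"
    using assms(1)
  proof (induction rule: relators_induct)
    case (add f g)
    then show ?case by (simp add: T relator_add)
  next
    case (smult c f)
    then show ?case by (simp add: T relator_smult)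
  qed (simp_all add: m T phi psi relators_ops)
  then show ?thesis by simp
qed

lemma relator_star: "f : \<R> ==> f\<^sup>\<star>\<^bsub>\<D>\<^esub> : \<R>"
  by (rule relator_map[where tau=cnj and phi="star A" and psi="star B"])
    (simp_all add: single_star D.star_add D.star_smult A.star_add A.star_smult B.star_add B.star_smult)

lemma tensor_induct [consumes 1, case_names zero add]:
  assumes "f : carrier \<D>" and "Q \<zero>\<^bsub>\<D>\<^esub>"
    and "!!c a b g. g : carrier \<D> ==> a : carrier A ==> b : carrier B ==> Q g ==>
      Q (c \<odot>\<^bsub>\<D>\<^esub> single (a, b) \<oplus>\<^bsub>\<D>\<^esub> g)"
  shows "Q f"
  using assms(1)[folded tensor_semigroup]
  by (rule P.alg_induct) (use assms(2,3) in "auto simp: tensor_semigroup")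

lemma relator_mult_left:
  assumes f: "f : \<R>" and g: "g : carrier \<D>"
  shows "f \<otimes>\<^bsub>\<D>\<^esub> g : \<R>"
  using g
proof (induction rule: tensor_induct)
  case zero
  then show ?case using relator_closed[OF f] by (simp add: relator_zero)
next
  case (add c a b g)
  have "f \<otimes>\<^bsub>\<D>\<^esub> single (a, b) : \<R>"
    by (rule relator_map[OF f, where tau="%c. c" and T="%f. f \<otimes>\<^bsub>\<D>\<^esub> single (a, b)" and
        phi="%x. x \<otimes> a" and psi="%x. x \<otimes>\<^bsub>B\<^esub> b"])
      (simp_all add: add.hyps single_mult D.distrib_right D.smult_mult_left A.distrib_right
        A.smult_mult_left B.distrib_right B.smult_mult_left)
  then show ?case using add relator_closed[OF f]
    by (simp add: D.distrib_left D.smult_mult_right relator_add relator_smult)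
qed

lemma relator_mult_right:
  assumes f: "f : \<R>" and g: "g : carrier \<D>"
  shows "g \<otimes>\<^bsub>\<D>\<^esub> f : \<R>"
  using relator_star[OF relator_mult_left[OF relator_star[OF f] D.star_closed[OF g]]]
    relator_closed[OF f] g by (simp add: D.star_mult D.star_star)

section \<open>The algebraic tensor product and its C*-norms\<close>

definition tensor_rel :: "(('a \<times> 'b => complex) \<times> ('a \<times> 'b => complex)) set" where
  "tensor_rel = {(f, g). f : carrier \<D> \<and> g : carrier \<D> \<and> f \<ominus>\<^bsub>\<D>\<^esub> g : \<R>}"

lemma algebraic_tensor_eq: "algebraic_tensor A B = quotient_star_alg \<D> tensor_rel"
proof -
  have "tensor_rel = {(f, g). f : carrier \<D> \<and> g : carrier \<D> \<and> (%t. f t - g t) : \<R>}"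
    unfolding tensor_rel_def by (auto simp: minus_tensor)
  then show ?thesis by (simp add: algebraic_tensor_def)
qed

lemma equiv_tensor_rel: "equiv (carrier \<D>) tensor_rel"
proof (rule equivI)
  show "tensor_rel \<subseteq> carrier \<D> \<times> carrier \<D>" by (auto simp: tensor_rel_def)
  show "refl_on (carrier \<D>) tensor_rel"
    by (rule refl_onI) (auto simp: tensor_rel_def relator_zero)
  show "sym tensor_rel"
  proof (rule symI)
    fix f g assume "(f, g) : tensor_rel"
    then have fg: "f : carrier \<D>" "g : carrier \<D>" "f \<ominus>\<^bsub>\<D>\<^esub> g : \<R>" by (auto simp: tensor_rel_def)
    have "g \<ominus>\<^bsub>\<D>\<^esub> f = (- 1) \<odot>\<^bsub>\<D>\<^esub> (f \<ominus>\<^bsub>\<D>\<^esub> g)"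
      using fg by (simp add: D.minus_eq_s D.s_add_right D.s_assoc D.M.a_comm)
    then show "(g, f) : tensor_rel" using fg by (simp add: tensor_rel_def relator_smult)
  qed
  show "trans tensor_rel"
  proof (rule transI)
    fix f g h assume "(f, g) : tensor_rel" "(g, h) : tensor_rel"
    then have a: "f : carrier \<D>" "g : carrier \<D>" "h : carrier \<D>"
      "f \<ominus>\<^bsub>\<D>\<^esub> g : \<R>" "g \<ominus>\<^bsub>\<D>\<^esub> h : \<R>" by (auto simp: tensor_rel_def)
    have "f \<ominus>\<^bsub>\<D>\<^esub> h = (f \<ominus>\<^bsub>\<D>\<^esub> g) \<oplus>\<^bsub>\<D>\<^esub> (g \<ominus>\<^bsub>\<D>\<^esub> h)"
      by (rule D.minus_minus_trans) fact+
    then show "(f, h) : tensor_rel" using a by (simp add: tensor_rel_def relator_add)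
  qed
qed

lemma tensor_quotient:
  shows tensor_class_hom: "star_hom \<D> (algebraic_tensor A B) (%f. tensor_rel `` {f})"
    and tensor_class_onto: "(%f. tensor_rel `` {f}) ` carrier \<D> = carrier (algebraic_tensor A B)"
    and star_algebra_algebraic_tensor: "star_algebra (algebraic_tensor A B)"
proof -
  have add: "(x \<oplus>\<^bsub>\<D>\<^esub> y, x' \<oplus>\<^bsub>\<D>\<^esub> y') : tensor_rel"
    if "(x, x') : tensor_rel" "(y, y') : tensor_rel" for x x' y y'
    using that by (auto simp: tensor_rel_def D.add_minus_add relator_add)
  have mult: "(x \<otimes>\<^bsub>\<D>\<^esub> y, x' \<otimes>\<^bsub>\<D>\<^esub> y') : tensor_rel"
    if "(x, x') : tensor_rel" "(y, y') : tensor_rel" for x x' y y'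
    using that relator_add[OF relator_mult_left[of "x \<ominus>\<^bsub>\<D>\<^esub> x'" y]
        relator_mult_right[of "y \<ominus>\<^bsub>\<D>\<^esub> y'" x']]
    by (auto simp: tensor_rel_def D.mult_minus_mult)
  have smult: "(c \<odot>\<^bsub>\<D>\<^esub> x, c \<odot>\<^bsub>\<D>\<^esub> x') : tensor_rel" if "(x, x') : tensor_rel" for x x' c
    using that by (auto simp: tensor_rel_def relator_smult simp flip: D.s_minus)
  have star: "(x\<^sup>\<star>\<^bsub>\<D>\<^esub>, x'\<^sup>\<star>\<^bsub>\<D>\<^esub>) : tensor_rel" if "(x, x') : tensor_rel" for x x'
    using that by (auto simp: tensor_rel_def relator_star simp flip: D.star_minus)
  note q = quotient_star_alg_hom[OF star_algebra_tensor equiv_tensor_rel add mult smult star]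
  show "star_hom \<D> (algebraic_tensor A B) (%f. tensor_rel `` {f})"
    "(%f. tensor_rel `` {f}) ` carrier \<D> = carrier (algebraic_tensor A B)"
    "star_algebra (algebraic_tensor A B)"
    unfolding algebraic_tensor_eq by (rule q; assumption)+
qed

lemma tensor_class_zero:
  assumes "f : carrier \<D>"
  shows "tensor_rel `` {f} = \<zero>\<^bsub>algebraic_tensor A B\<^esub> \<longleftrightarrow> f : \<R>"
proof -
  have "\<zero>\<^bsub>algebraic_tensor A B\<^esub> = tensor_rel `` {\<zero>\<^bsub>\<D>\<^esub>}"
    by (simp add: algebraic_tensor_eq quotient_star_alg_def)
  then have "tensor_rel `` {f} = \<zero>\<^bsub>algebraic_tensor A B\<^esub> \<longleftrightarrow> (f, \<zero>\<^bsub>\<D>\<^esub>) : tensor_rel"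
    using eq_equiv_class_iff[OF equiv_tensor_rel assms D.M.zero_closed] by simp
  then show ?thesis using assms by (simp add: tensor_rel_def D.minus_eq_s)
qed

text \<open>C*-norms on the quotient arise from C*-seminorms upstairs whose kernel is exactly the
  set of relators; a difference of representatives is a relator, so the value at a class is
  unambiguous.\<close>

lemma cstar_norm_algebraic_tensor:
  assumes \<gamma>: "cstar_seminorm \<D> \<gamma>" and ker: "!!f. f : carrier \<D> ==> \<gamma> f = 0 \<longleftrightarrow> f : \<R>"
  obtains \<gamma>' where "cstar_norm (algebraic_tensor A B) \<gamma>'"
    and "!!f. f : carrier \<D> ==> \<gamma>' (tensor_rel `` {f}) = \<gamma> f"
proof -
  interpret G: seminormed_star_algebra \<D> \<gamma>
    by (rule seminormed_star_algebraI[OF star_algebra_tensor \<gamma>])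
  let ?q = "%f. tensor_rel `` {f}"
  define \<gamma>' where "\<gamma>' = (%X. \<gamma> (SOME f. f : X))"
  have val: "\<gamma>' (?q f) = \<gamma> f" if f: "f : carrier \<D>" for f
  proof -
    have "f : ?q f" using equiv_class_self[OF equiv_tensor_rel f] .
    then have "(SOME g. g : ?q f) : ?q f" by (rule someI[where P="%g. g : ?q f"])
    then have g: "(SOME g. g : ?q f) : carrier \<D>" "f \<ominus>\<^bsub>\<D>\<^esub> (SOME g. g : ?q f) : \<R>"
      by (auto simp: tensor_rel_def)
    then have "\<gamma> (f \<ominus>\<^bsub>\<D>\<^esub> (SOME g. g : ?q f)) = 0" using ker f by simp
    then show ?thesis using G.N_diff_le[OF f g(1)] by (simp add: \<gamma>'_def)
  qed
  have all: "(\<forall>X\<in>carrier (algebraic_tensor A B). Q X) \<longleftrightarrow> (\<forall>f\<in>carrier \<D>. Q (?q f))" for Q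
    unfolding tensor_class_onto[symmetric] by blast
  note h = star_homD(2-)[OF tensor_class_hom, symmetric]
  have "cstar_seminorm (algebraic_tensor A B) \<gamma>'"
    unfolding cstar_seminorm_def all
    by (simp add: h val G.N_smult G.N_triangle G.N_mult G.N_star_mult)
  then have "cstar_norm (algebraic_tensor A B) \<gamma>'"
    unfolding cstar_norm_def all by (simp add: val ker tensor_class_zero)
  then show thesis using val by (rule that)
qed

lemma cstar_seminorm_max:
  assumes p: "cstar_seminorm \<D> p" and q: "cstar_seminorm \<D> q"
  shows "cstar_seminorm \<D> (%x. max (p x) (q x))"
proof -
  have "cstar_seminorm \<D> (%x. SUP r\<in>{p, q}. r x)"
    by (rule cstar_seminorm_SUP[OF star_algebra_tensor]) (use p q in auto)
  moreover have "(SUP r\<in>{p, q}. r x) = max (p x) (q x)" for x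
    by (subst cSup_eq_Max) auto
  ultimately show ?thesis by simp
qed

lemma relator_functional_zero:
  assumes "f : \<R>"
    and W: "!!a a' b. a : carrier A ==> a' : carrier A ==> b : carrier B ==>
        W (a \<oplus> a', b) = W (a, b) + W (a', b)"
      "!!a b b'. a : carrier A ==> b : carrier B ==> b' : carrier B ==>
        W (a, b \<oplus>\<^bsub>B\<^esub> b') = W (a, b) + W (a, b')"
      "!!c a b. a : carrier A ==> b : carrier B ==> W (c \<odot> a, b) = c * W (a, b)"
      "!!c a b. a : carrier A ==> b : carrier B ==> W (a, c \<odot>\<^bsub>B\<^esub> b) = c * W (a, b)"
  shows "pairing f W = 0"
proof -
  have pa: "pairing (f \<oplus>\<^bsub>\<D>\<^esub> g) W = pairing f W + pairing g W"
    if "f : carrier \<D>" "g : carrier \<D>" for f g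
    using that by (simp add: tensor_simps pairing_add tensor_finite)
  have ps: "pairing (c \<odot>\<^bsub>\<D>\<^esub> f) W = c * pairing f W" for c f
    by (simp add: tensor_simps pairing_smult)
  have "f : carrier \<D> \<and> pairing f W = 0"
    using assms(1)
    by (induction rule: relators_induct)
      (simp_all add: D.minus_eq_s pa ps W, simp add: tensor_simps)
  then show ?thesis by simp
qed

text \<open>Relators form a two-sided ideal on which the functional vanishes; thus f v is a null
  vector for every v.\<close>

lemma gnorm_relator:
  assumes "gns \<D> (%f. pairing f W) r K" and f: "f : \<R>"
    and ker: "!!f. f : \<R> ==> pairing f W = 0"
  shows "gns.gnorm \<D> (%f. pairing f W) f = 0"
proof -
  interpret gns \<D> "%f. pairing f W" r K by fact
  have c: "f : carrier \<D>" using f by (rule relator_closed)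
  have "vnorm (f \<otimes>\<^bsub>\<D>\<^esub> v) <= 0 * vnorm v" if v: "v : carrier \<D>" for v
    using ker[OF relator_mult_right[OF relator_mult_left[OF f v], of "(f \<otimes>\<^bsub>\<D>\<^esub> v)\<^sup>\<star>\<^bsub>\<D>\<^esub>"]] c v
    by (simp add: vnorm_def)
  then have "gnorm f <= 0" by (intro gnorm_least) auto
  then show ?thesis using gnorm_bound(1)[OF c] by simp
qed

end

text \<open>The second seminorm may have a larger kernel than the relators. Its maximum with the
  first is again a C*-norm on the tensor product, and it differs from the first at t.\<close>

lemma not_nuclearI:
  fixes B :: "(nat => complex) normed_star_alg"
  assumes "star_algebra A" and B: "cstar_algebra B"
    and \<gamma>: "cstar_seminorm (free_tensor_alg A B) \<gamma>"
      "!!f. f : carrier (free_tensor_alg A B) ==> \<gamma> f = 0 \<longleftrightarrow> f : bilinear_relators A B"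
    and \<gamma>': "cstar_seminorm (free_tensor_alg A B) \<gamma>'" "!!f. f : bilinear_relators A B ==> \<gamma>' f = 0"
    and t: "t : carrier (free_tensor_alg A B)" "\<gamma> t < \<gamma>' t"
  shows "\<not> nuclear A"
proof
  assume "nuclear A"
  interpret star_algebra_pair A B
    using assms(1) B by (simp add: star_algebra_pair_def cstar_algebra_def)
  obtain \<delta> where \<delta>: "cstar_norm (algebraic_tensor A B) \<delta>"
      "!!f. f : carrier \<D> ==> \<delta> (tensor_rel `` {f}) = \<gamma> f"
    using cstar_norm_algebraic_tensor[OF \<gamma>] by blast
  have "(max (\<gamma> f) (\<gamma>' f) = 0) = (f : \<R>)" if f: "f : carrier \<D>" for f
  proof (cases "f : \<R>")
    case True
    then show ?thesis using \<gamma>(2)[OF f] \<gamma>'(2)[of f] by simp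
  next
    case False
    then have "0 < \<gamma> f" using \<gamma>(2)[OF f] \<gamma>(1) f by (auto simp: cstar_seminorm_def less_le)
    then show ?thesis using False by (simp add: max_def)
  qed
  then obtain \<epsilon> where \<epsilon>: "cstar_norm (algebraic_tensor A B) \<epsilon>"
      "!!f. f : carrier \<D> ==> \<epsilon> (tensor_rel `` {f}) = max (\<gamma> f) (\<gamma>' f)"
    using cstar_norm_algebraic_tensor[OF cstar_seminorm_max[OF \<gamma>(1) \<gamma>'(1)]] by blast
  have "tensor_rel `` {t} : carrier (algebraic_tensor A B)" using t tensor_class_onto by blast
  then have "\<delta> (tensor_rel `` {t}) = \<epsilon> (tensor_rel `` {t})"
    using \<open>nuclear A\<close> B \<delta>(1) \<epsilon>(1) unfolding nuclear_def by blast
  then show False using t by (simp add: \<delta>(2) \<epsilon>(2))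
qed

section \<open>Extending forms to completions\<close>

definition linear_functional :: "('a, 'm) star_alg_scheme => ('a => complex) => bool" where
  "linear_functional A g \<longleftrightarrow> (\<forall>x\<in>carrier A. \<forall>y\<in>carrier A. g (x \<oplus>\<^bsub>A\<^esub> y) = g x + g y) \<and>
     (\<forall>x\<in>carrier A. \<forall>c. g (c \<odot>\<^bsub>A\<^esub> x) = c * g x)"

definition bounded_functional :: "('a, 'm) star_alg_scheme => ('a => real) => real => ('a => complex) => bool" where
  "bounded_functional A N K g \<longleftrightarrow> linear_functional A g \<and> (\<forall>x\<in>carrier A. cmod (g x) <= K * N x)"

lemma linear_functionalD:
  assumes "linear_functional A g"
  shows "x : carrier A ==> y : carrier A ==> g (x \<oplus>\<^bsub>A\<^esub> y) = g x + g y"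
    "x : carrier A ==> g (c \<odot>\<^bsub>A\<^esub> x) = c * g x"
  using assms by (auto simp: linear_functional_def)

lemma bounded_functionalD:
  assumes "bounded_functional A N K g"
  shows "linear_functional A g" "x : carrier A ==> cmod (g x) <= K * N x"
  using assms by (auto simp: bounded_functional_def)

lemma positive_imp_linear_functional: "positive_functional A g ==> linear_functional A g"
  by (simp add: positive_functional_def linear_functional_def)

lemma linear_functional_hom:
  assumes "linear_functional B g" "star_hom A B phi"
  shows "linear_functional A (%x. g (phi x))"
  using linear_functionalD[OF assms(1)] star_homD[OF assms(2)] by (simp add: linear_functional_def)

context star_algebra
begin

lemma functional_finsum:
  assumes g: "linear_functional A g" and "finite T" "!!i. i : T ==> m i : carrier A"
  shows "g (\<Oplus>i\<in>T. m i) = (\<Sum>i\<in>T. g (m i))"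
  using assms(2,3)
proof (induction T rule: finite_induct)
  case empty
  show ?case using linear_functionalD(2)[OF g, of \<zero> 0] by simp
next
  case (insert i T)
  then show ?case by (simp add: finsum_ins finsum_cl linear_functionalD[OF g])
qed

lemma functional_minus:
  assumes g: "linear_functional A g" and "x : carrier A" "y : carrier A"
  shows "g (x \<ominus> y) = g x - g y"
  using assms by (simp add: minus_eq_s linear_functionalD[OF g])

lemma finsum_smult:
  assumes "finite T" "!!i. i : T ==> m i : carrier A"
  shows "(\<Oplus>i\<in>T. c \<odot> m i) = c \<odot> (\<Oplus>i\<in>T. m i)"
  using assms by (induction T rule: finite_induct) (simp_all add: finsum_ins s_add_right finsum_cl)

lemma finsum_add:
  assumes "!!i. i : T ==> m i : carrier A" "!!i. i : T ==> m' i : carrier A"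
  shows "(\<Oplus>i\<in>T. m i \<oplus> m' i) = (\<Oplus>i\<in>T. m i) \<oplus> (\<Oplus>i\<in>T. m' i)"
  by (rule M.finsum_addf) (use assms in auto)

lemma finsum_cong:
  assumes "!!i. i : T ==> m' i : carrier A" "!!i. i : T ==> m i = m' i"
  shows "(\<Oplus>i\<in>T. m i) = (\<Oplus>i\<in>T. m' i)"
  by (rule M.finsum_cong') (use assms in auto)

lemma functional_gram:
  assumes g: "linear_functional A g" and T: "finite T" and a: "!!i. i : T ==> a i : carrier A"
    and x: "x = (\<Oplus>i\<in>T. d i \<odot> a i)"
  shows "g (x\<^sup>\<star> \<otimes> x) = (\<Sum>i\<in>T. \<Sum>j\<in>T. cnj (d i) * d j * g ((a i)\<^sup>\<star> \<otimes> a j))"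
proof -
  have xc: "x : carrier A" unfolding x by (rule finsum_cl) (simp add: a)
  have "x\<^sup>\<star> \<otimes> x = (\<Oplus>i\<in>T. cnj (d i) \<odot> ((a i)\<^sup>\<star> \<otimes> x))"
  proof -
    have "x\<^sup>\<star> \<otimes> x = (\<Oplus>i\<in>T. (d i \<odot> a i)\<^sup>\<star>) \<otimes> x"
      using T a unfolding x by (subst finsum_star) auto
    also have "... = (\<Oplus>i\<in>T. (d i \<odot> a i)\<^sup>\<star> \<otimes> x)" using T a xc by (subst finsum_mult_right) auto
    also have "... = (\<Oplus>i\<in>T. cnj (d i) \<odot> ((a i)\<^sup>\<star> \<otimes> x))"
      by (rule M.finsum_cong') (use a xc in "auto simp: star_smult smult_mult_left")
    finally show ?thesis .
  qed
  then have "g (x\<^sup>\<star> \<otimes> x) = (\<Sum>i\<in>T. cnj (d i) * g ((a i)\<^sup>\<star> \<otimes> x))"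
    using T a xc by (simp add: functional_finsum[OF g] linear_functionalD[OF g])
  also have "... = (\<Sum>i\<in>T. cnj (d i) * (\<Sum>j\<in>T. d j * g ((a i)\<^sup>\<star> \<otimes> a j)))"
  proof (intro sum.cong refl arg_cong[where f="%z. _ * z"])
    fix i assume i: "i : T"
    have "(a i)\<^sup>\<star> \<otimes> x = (\<Oplus>j\<in>T. (a i)\<^sup>\<star> \<otimes> (d j \<odot> a j))"
      using T a i unfolding x by (subst finsum_mult_left) auto
    then show "g ((a i)\<^sup>\<star> \<otimes> x) = (\<Sum>j\<in>T. d j * g ((a i)\<^sup>\<star> \<otimes> a j))"
      using T a i by (simp add: functional_finsum[OF g] smult_mult_right linear_functionalD[OF g])
  qed
  finally show ?thesis by (simp add: sum_distrib_left mult.assoc)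
qed

end

context seminormed_star_algebra
begin

definition extend_functional :: "('a => complex) => (nat => 'a) set => complex" where
  "extend_functional g X = lim (%n. g ((SOME sig. sig : cauchy_seqs A N \<and> cls sig = X) n))"

lemma extend_functional_tendsto:
  assumes g: "bounded_functional A N K g" and t: "tau : cauchy_seqs A N"
  shows "(%n. g (tau n)) \<longlonglongrightarrow> extend_functional g (cls tau)"
proof -
  note gl = bounded_functionalD(1)[OF g]
  have diff: "cmod (g x - g y) <= \<bar>K\<bar> * N (x \<ominus> y)" if "x : carrier A" "y : carrier A" for x y
  proof -
    have "cmod (g x - g y) <= K * N (x \<ominus> y)"
      using that bounded_functionalD(2)[OF g, of "x \<ominus> y"] by (simp add: functional_minus[OF gl])
    also have "... <= \<bar>K\<bar> * N (x \<ominus> y)" using that by (intro mult_right_mono) auto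
    finally show ?thesis .
  qed
  define sig where "sig = (SOME sig. sig : cauchy_seqs A N \<and> cls sig = cls tau)"
  have "sig : cauchy_seqs A N \<and> cls sig = cls tau" unfolding sig_def by (rule someI[of _ tau]) (use t in simp)
  then have s: "sig : cauchy_seqs A N" and eq: "(%n. N (sig n \<ominus> tau n)) \<longlonglongrightarrow> 0"
    using cls_eq_iff[of sig tau] t by auto
  have "Cauchy (%n. g (sig n))"
  proof (rule CauchyI)
    fix e :: real assume e: "0 < e"
    then obtain M where M: "\<forall>m\<ge>M. \<forall>n\<ge>M. N (sig m \<ominus> sig n) < e / (\<bar>K\<bar> + 1)"
      using cauchyD[OF s, of "e / (\<bar>K\<bar> + 1)"] by auto
    have "cmod (g (sig m) - g (sig n)) < e" if "m >= M" "n >= M" for m n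
    proof -
      have "\<bar>K\<bar> * N (sig m \<ominus> sig n) <= \<bar>K\<bar> * (e / (\<bar>K\<bar> + 1))"
        using M that by (intro mult_left_mono) (auto intro: less_imp_le)
      also have "... < e" using e by (simp add: field_simps)
      finally show ?thesis using diff[of "sig m" "sig n"] cauchy_closed[OF s] by (meson le_less_trans)
    qed
    then show "\<exists>M. \<forall>m\<ge>M. \<forall>n\<ge>M. norm (g (sig m) - g (sig n)) < e" by blast
  qed
  then have lim: "(%n. g (sig n)) \<longlonglongrightarrow> extend_functional g (cls tau)"
    unfolding extend_functional_def sig_def[symmetric]
    by (simp add: Cauchy_convergent_iff convergent_LIMSEQ_iff)
  have "(%n. cmod (g (sig n) - g (tau n))) \<longlonglongrightarrow> 0"
  proof (rule tendsto_sandwich[OF _ _ tendsto_const])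
    show "(%n. \<bar>K\<bar> * N (sig n \<ominus> tau n)) \<longlonglongrightarrow> 0" using tendsto_mult_right_zero[OF eq] by simp
  qed (auto intro!: always_eventually diff cauchy_closed s t)
  then have "(%n. g (sig n) - g (tau n)) \<longlonglongrightarrow> 0" by (rule tendsto_norm_zero_cancel)
  from tendsto_diff[OF lim this] show ?thesis by simp
qed

lemma extend_functional_to_completion:
  assumes "bounded_functional A N K g" "x : carrier A"
  shows "extend_functional g (to_completion A N x) = g x"
  using extend_functional_tendsto[OF assms(1) cauchy_const[OF assms(2)]]
  by (simp add: to_completion_cls LIMSEQ_const_iff)

lemma carrier_completion_cases:
  assumes "X : carrier \<K>"
  obtains sig where "sig : cauchy_seqs A N" "X = cls sig"
  using assms cls_onto by blast

lemma bounded_extend_functional: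
  assumes g: "bounded_functional A N K g"
  shows "bounded_functional \<K> (anorm \<K>) K (extend_functional g)"
proof -
  note gl = linear_functionalD[OF bounded_functionalD(1)[OF g]] and lim = extend_functional_tendsto[OF g]
  have "extend_functional g (X \<oplus>\<^bsub>\<K>\<^esub> Y) = extend_functional g X + extend_functional g Y"
    if XY: "X : carrier \<K>" "Y : carrier \<K>" for X Y
  proof -
    obtain sig tau where s: "sig : cauchy_seqs A N" "X = cls sig" and t: "tau : cauchy_seqs A N" "Y = cls tau"
      using XY by (blast elim: carrier_completion_cases)
    show ?thesis unfolding s(2) t(2) cls_ops(1)[OF s(1) t(1)]
      by (rule LIMSEQ_unique[OF lim[OF cauchy_add[OF s(1) t(1)]]])
        (use tendsto_add[OF lim[OF s(1)] lim[OF t(1)]] in "simp add: gl cauchy_closed s t")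
  qed
  moreover have "extend_functional g (c \<odot>\<^bsub>\<K>\<^esub> X) = c * extend_functional g X"
    "cmod (extend_functional g X) <= K * anorm \<K> X" if X: "X : carrier \<K>" for X c
  proof -
    obtain sig where s: "sig : cauchy_seqs A N" "X = cls sig" using X by (rule carrier_completion_cases)
    show "extend_functional g (c \<odot>\<^bsub>\<K>\<^esub> X) = c * extend_functional g X"
      unfolding s(2) cls_unary(1)[OF s(1)]
      by (rule LIMSEQ_unique[OF lim[OF cauchy_smult[OF s(1)]]])
        (use tendsto_mult_left[OF lim[OF s(1)]] in "simp add: gl cauchy_closed s")
    show "cmod (extend_functional g X) <= K * anorm \<K> X" unfolding s(2)
      by (rule LIMSEQ_le[OF tendsto_norm[OF lim[OF s(1)]] tendsto_mult_left[OF anorm_cls[OF s(1)]]])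
        (use bounded_functionalD(2)[OF g] cauchy_closed[OF s(1)] in blast)
  qed
  ultimately show ?thesis by (simp add: bounded_functional_def linear_functional_def)
qed

end

section \<open>Positive forms on pairs of algebras and their extension to completions\<close>

definition gram :: "('a, 'm) star_alg_scheme => ('b, 'k) star_alg_scheme => ('a => 'b => complex) =>
    'j set => ('j => complex) => ('j => 'a) => ('j => 'b) => complex" where
  "gram A B W J c a b = (\<Sum>j\<in>J. \<Sum>k\<in>J. cnj (c j) * c k *
     W ((a j)\<^sup>\<star>\<^bsub>A\<^esub> \<otimes>\<^bsub>A\<^esub> a k) ((b j)\<^sup>\<star>\<^bsub>B\<^esub> \<otimes>\<^bsub>B\<^esub> b k))"

text \<open>W is the restriction to elementary tensors of a positive functional on the tensor
  product; \<open>gram\<close> is that functional at the star-square of a sum of elementary tensors.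
  Boundedness in each variable separately allows extension to completions one variable at a
  time.\<close>

locale tensor_form = star_algebra_pair A B
  for A :: "('a, 'm) star_alg_scheme" (structure) and B :: "('b, 'k) star_alg_scheme" +
  fixes p :: "'a => real" and q :: "'b => real" and W :: "'a => 'b => complex" and K :: real
  assumes p: "cstar_seminorm A p" and q: "cstar_seminorm B q"
    and right: "a : carrier A ==> bounded_functional B q (K * p a) (W a)"
    and left: "b : carrier B ==> bounded_functional A p (K * q b) (%a. W a b)"
    and positive: "!!(m::nat) c a b. (!!j. j < m ==> a j : carrier A) ==> (!!j. j < m ==> b j : carrier B) ==>
      Im (gram A B W {..<m} c a b) = 0 \<and> 0 <= Re (gram A B W {..<m} c a b)"

lemma tensor_form_flip:
  assumes "tensor_form A B p q W K"
  shows "tensor_form B A q p (%b a. W a b) K"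
proof -
  interpret tensor_form A B p q W K by fact
  have g: "gram B A (%b a. W a b) J c b a = gram A B W J c a b" for J :: "nat set" and c b a
    by (simp add: gram_def)
  show ?thesis
    by unfold_locales (simp_all add: p q left right positive g)
qed

context tensor_form
begin

sublocale SA: seminormed_star_algebra A p
  by unfold_locales (rule p)

sublocale SB: seminormed_star_algebra B q
  by unfold_locales (rule q)

abbreviation "\<omega> f == pairing f (%(a, b). W a b)"
abbreviation "rnorm == wnorm (%(a, b). p a * q b)"

sublocale WS: weighted_semigroup "A \<times>\<times> B" "map_prod (star A) (star B)" "%(a, b). p a * q b"
proof (unfold_locales, goal_cases)
  case (1 s)
  then show ?case by (auto simp: mult_nonneg_nonneg)
next
  case (2 s t)
  then have "p (fst s \<otimes> fst t) * q (snd s \<otimes>\<^bsub>B\<^esub> snd t) <= (p (fst s) * p (fst t)) * (q (snd s) * q (snd t))"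
    by (intro mult_mono SA.N_mult SB.N_mult) (auto simp: mult_nonneg_nonneg)
  then show ?case using 2 by (auto simp: mult_ac)
next
  case (3 s)
  then show ?case by (auto simp: SA.N_star SB.N_star)
qed

lemma form_gram: "f : carrier \<D> ==> \<omega> (f\<^sup>\<star>\<^bsub>\<D>\<^esub> \<otimes>\<^bsub>\<D>\<^esub> f) = gram A B W {s. f s ~= 0} f fst snd"
  using WS.pairing_star_mult[unfolded tensor_semigroup, of f f "%(a, b). W a b"]
  by (simp add: gram_def mult_DirProd' map_prod_def split_beta)

lemma gram_nonneg:
  assumes "finite J" "!!j. j : J ==> a j : carrier A" "!!j. j : J ==> b j : carrier B"
  shows "Im (gram A B W J c a b) = 0" "0 <= Re (gram A B W J c a b)"
proof -
  obtain h where h: "bij_betw h {..<card J} J"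
    using ex_bij_betw_nat_finite[OF assms(1)] by (auto simp: atLeast0LessThan)
  have "gram A B W J c a b = gram A B W {..<card J} (c \<circ> h) (a \<circ> h) (b \<circ> h)"
    unfolding gram_def by (simp add: sum.reindex_bij_betw[OF h, symmetric])
  moreover have "h j : J" if "j < card J" for j using h that by (auto simp: bij_betw_def)
  ultimately show "Im (gram A B W J c a b) = 0" "0 <= Re (gram A B W J c a b)"
    using positive[of "card J" "a \<circ> h" "b \<circ> h" "c \<circ> h"] assms by auto
qed

lemma tensor_gns: "gns \<D> \<omega> rnorm K"
  unfolding tensor_semigroup[symmetric]
proof (rule WS.gns_kernel)
  fix f assume "f : carrier P.\<A>"
  then have f: "f : carrier \<D>" by (simp add: tensor_semigroup)
  show "Im (pairing (f\<^sup>\<star>\<^bsub>P.\<A>\<^esub> \<otimes>\<^bsub>P.\<A>\<^esub> f) (%(a, b). W a b)) = 0 \<and>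
      0 <= Re (pairing (f\<^sup>\<star>\<^bsub>P.\<A>\<^esub> \<otimes>\<^bsub>P.\<A>\<^esub> f) (%(a, b). W a b))"
    unfolding tensor_semigroup form_gram[OF f]
    by (intro conjI gram_nonneg tensor_finite[OF f]) (use tensor_support[OF f] in auto)
next
  fix s assume "s : carrier (A \<times>\<times> B)"
  then show "cmod (case s of (a, b) => W a b) <= K * (case s of (a, b) => p a * q b)"
    using bounded_functionalD(2)[OF right] by (auto simp: mult.assoc)
qed

lemma relator_form_zero: "f : \<R> ==> \<omega> f = 0"
  by (erule relator_functional_zero)
    (use linear_functionalD[OF bounded_functionalD(1)[OF right]]
      linear_functionalD[OF bounded_functionalD(1)[OF left]] in simp_all)

abbreviation "\<gamma> == gns.gnorm \<D> \<omega>"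

lemma gamma_relator: "f : \<R> ==> \<gamma> f = 0"
  by (rule gnorm_relator[OF tensor_gns _ relator_form_zero])

lemma cstar_seminorm_gamma: "cstar_seminorm \<D> \<gamma>"
  by (rule gns.cstar_seminorm_gnorm[OF tensor_gns])

lemma gamma_le_rnorm:
  assumes f: "f : carrier \<D>" shows "\<gamma> f <= rnorm f"
proof -
  interpret gns \<D> \<omega> rnorm K by (rule tensor_gns)
  have "(\<gamma> f)^2 <= rnorm (f\<^sup>\<star>\<^bsub>\<D>\<^esub> \<otimes>\<^bsub>\<D>\<^esub> f)" by (rule gnorm_le_r[OF f])
  also have "... <= (rnorm f)^2"
    using r_mult[of "f\<^sup>\<star>\<^bsub>\<D>\<^esub>" f] r_star[of f] f by (simp add: power2_eq_square)
  finally show ?thesis by (rule power2_le_imp_le) (rule r_nonneg[OF f])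
qed

lemma gram_tendsto:
  assumes C: "star_algebra C" "star_hom C SB.\<K> psi"
    and J: "!!j. j : J ==> a j : carrier A" "!!j. j : J ==> tau j : cauchy_seqs B q"
      "!!j. j : J ==> b j : carrier C" "!!j. j : J ==> psi (b j) = SB.cls (tau j)"
  shows "(%n. gram A B W J c a (%j. tau j n)) \<longlonglongrightarrow>
    gram A C (%a b. SB.extend_functional (W a) (psi b)) J c a b"
  unfolding gram_def
proof (intro tendsto_sum tendsto_mult tendsto_const)
  fix j k assume j: "j : J" and k: "k : J"
  interpret C: star_algebra C by fact
  have "psi ((b j)\<^sup>\<star>\<^bsub>C\<^esub> \<otimes>\<^bsub>C\<^esub> b k) = SB.cls (%n. (tau j n)\<^sup>\<star>\<^bsub>B\<^esub> \<otimes>\<^bsub>B\<^esub> tau k n)"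
    using j k J by (simp add: star_homD[OF C(2)] SB.cls_unary(2) SB.cls_ops(2) SB.cauchy_star)
  then show "(%n. W ((a j)\<^sup>\<star> \<otimes> a k) ((tau j n)\<^sup>\<star>\<^bsub>B\<^esub> \<otimes>\<^bsub>B\<^esub> tau k n)) \<longlonglongrightarrow>
      SB.extend_functional (W ((a j)\<^sup>\<star> \<otimes> a k)) (psi ((b j)\<^sup>\<star>\<^bsub>C\<^esub> \<otimes>\<^bsub>C\<^esub> b k))"
    using SB.extend_functional_tendsto[OF right SB.cauchy_mult[OF SB.cauchy_star[OF J(2)[OF j]] J(2)[OF k]],
        of "(a j)\<^sup>\<star> \<otimes> a k"] J(1)[OF j] J(1)[OF k] by simp
qed

text \<open>The algebra C with its map to the completion is kept general: C can be the completion
  itself or a copy of it in another type. Positivity and bounds pass to the limit along representing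
  Cauchy sequences.\<close>

lemma tensor_form_extend:
  assumes C: "star_algebra C" "star_hom C SB.\<K> psi"
  shows "tensor_form A C p (%b. anorm SB.\<K> (psi b)) (%a b. SB.extend_functional (W a) (psi b)) K"
proof -
  interpret C: star_algebra C by fact
  interpret AC: star_algebra_pair A C by unfold_locales
  note psi = star_homD(1)[OF C(2)]
  have lim: "(%n. W a (sig n)) \<longlonglongrightarrow> SB.extend_functional (W a) (SB.cls sig)"
    if "a : carrier A" "sig : cauchy_seqs B q" for a sig
    by (rule SB.extend_functional_tendsto[OF right]) fact+
  have rep: "\<exists>sig. sig : cauchy_seqs B q \<and> psi b = SB.cls sig" if "b : carrier C" for b
    using SB.carrier_completion_cases[OF psi[OF that]] by metis
  show ?thesis
  proof
    show "cstar_seminorm A p" by (rule p)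
    show "cstar_seminorm C (%b. anorm SB.\<K> (psi b))"
      by (rule cstar_seminorm_hom[OF C(1) SB.star_algebra_completion _ C(2)])
        (use SB.cstar_norm_completion in "simp add: cstar_norm_def")
    show "bounded_functional C (%b. anorm SB.\<K> (psi b)) (K * p a) (%b. SB.extend_functional (W a) (psi b))"
      if "a : carrier A" for a
      using SB.bounded_extend_functional[OF right[OF that]] psi
      by (simp add: bounded_functional_def linear_functional_hom[OF _ C(2)])
    show "bounded_functional A p (K * anorm SB.\<K> (psi b)) (%a. SB.extend_functional (W a) (psi b))"
      if b: "b : carrier C" for b
    proof -
      obtain sig where s: "sig : cauchy_seqs B q" "psi b = SB.cls sig" using rep[OF b] by blast
      have l: "linear_functional A (%a. W a (sig n))" for n
        using left[OF SB.cauchy_closed[OF s(1)]] by (rule bounded_functionalD)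
      have "SB.extend_functional (W (x \<oplus> y)) (SB.cls sig) =
          SB.extend_functional (W x) (SB.cls sig) + SB.extend_functional (W y) (SB.cls sig)"
        if "x : carrier A" "y : carrier A" for x y
        by (rule LIMSEQ_unique[OF lim[OF A.M.a_closed[OF that] s(1)]])
          (use tendsto_add[OF lim[OF that(1) s(1)] lim[OF that(2) s(1)]] that in
            \<open>simp add: linear_functionalD(1)[OF l]\<close>)
      moreover have "SB.extend_functional (W (d \<odot> x)) (SB.cls sig) =
          d * SB.extend_functional (W x) (SB.cls sig)" if "x : carrier A" for x d
        by (rule LIMSEQ_unique[OF lim[OF A.s_closed[OF that] s(1)]])
          (use tendsto_mult_left[OF lim[OF that s(1)]] that in "simp add: linear_functionalD(2)[OF l]")
      moreover have "cmod (SB.extend_functional (W x) (SB.cls sig)) <= K * anorm SB.\<K> (SB.cls sig) * p x"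
        if "x : carrier A" for x
        using bounded_functionalD(2)[OF SB.bounded_extend_functional[OF right[OF that]], of "SB.cls sig"]
          SB.cls_unary(3)[OF s(1)] by (simp add: mult_ac)
      ultimately show ?thesis by (simp add: bounded_functional_def linear_functional_def s(2))
    qed
    fix m :: nat and c a b
    assume a: "!!j. j < m ==> a j : carrier A" and b: "!!j. j < m ==> b j : carrier C"
    have "\<forall>j. \<exists>sig. j < m --> sig : cauchy_seqs B q \<and> psi (b j) = SB.cls sig" using rep[OF b] by blast
    then obtain tau where t: "!!j. j < m ==> tau j : cauchy_seqs B q" "!!j. j < m ==> psi (b j) = SB.cls (tau j)"
      by metis
    let ?G = "gram A C (%a b. SB.extend_functional (W a) (psi b)) {..<m} c a b"
    have G: "(%n. gram A B W {..<m} c a (%j. tau j n)) \<longlonglongrightarrow> ?G"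
      by (rule gram_tendsto[OF C]) (use a b t in auto)
    have pos: "Im (gram A B W {..<m} c a (%j. tau j n)) = 0" "0 <= Re (gram A B W {..<m} c a (%j. tau j n))" for n
      by (rule gram_nonneg; use a SB.cauchy_closed[OF t(1)] in auto)+
    have "(%n. 0) \<longlonglongrightarrow> Im ?G" using tendsto_Im[OF G] by (simp add: pos)
    moreover have "0 <= Re ?G" by (rule LIMSEQ_le_const[OF tendsto_Re[OF G]]) (use pos in auto)
    ultimately show "Im ?G = 0 \<and> 0 <= Re ?G" by (simp add: LIMSEQ_const_iff)
  qed
qed

end

section \<open>Elementary tensors and separation by functionals\<close>

context star_algebra_pair
begin

abbreviation "\<Q> == algebraic_tensor A B"
abbreviation "tensor_class f == tensor_rel `` {f}"

definition elem :: "'a => 'b => ('a \<times> 'b => complex) set" where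
  "elem a b = tensor_class (single (a, b))"

sublocale Q: star_algebra \<Q> by (rule star_algebra_algebraic_tensor)

lemma tensor_class_eq: "f : carrier \<D> ==> g : carrier \<D> ==> f \<ominus>\<^bsub>\<D>\<^esub> g : \<R> ==> tensor_class f = tensor_class g"
  using equiv_class_eq[OF equiv_tensor_rel, of f g] by (simp add: tensor_rel_def)

lemma elem_ops:
  assumes a: "a : carrier A" and b: "b : carrier B"
  shows elem_closed: "elem a b : carrier \<Q>"
    and elem_add_left: "a' : carrier A ==> elem (a \<oplus> a') b = elem a b \<oplus>\<^bsub>\<Q>\<^esub> elem a' b"
    and elem_add_right: "b' : carrier B ==> elem a (b \<oplus>\<^bsub>B\<^esub> b') = elem a b \<oplus>\<^bsub>\<Q>\<^esub> elem a b'"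
    and elem_smult_left: "elem (c \<odot> a) b = c \<odot>\<^bsub>\<Q>\<^esub> elem a b"
    and elem_smult_right: "elem a (c \<odot>\<^bsub>B\<^esub> b) = c \<odot>\<^bsub>\<Q>\<^esub> elem a b"
proof -
  note h = star_homD(2,3)[OF tensor_class_hom, symmetric]
  show "elem a b : carrier \<Q>" using a b star_homD(1)[OF tensor_class_hom] by (simp add: elem_def)
  show "elem (a \<oplus> a') b = elem a b \<oplus>\<^bsub>\<Q>\<^esub> elem a' b" if "a' : carrier A"
    using a b that relators_ops(4)[of a a' b] by (simp add: elem_def h) (rule tensor_class_eq, auto)
  show "elem a (b \<oplus>\<^bsub>B\<^esub> b') = elem a b \<oplus>\<^bsub>\<Q>\<^esub> elem a b'" if "b' : carrier B"
    using a b that relators_ops(5)[of a b b'] by (simp add: elem_def h) (rule tensor_class_eq, auto)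
  show "elem (c \<odot> a) b = c \<odot>\<^bsub>\<Q>\<^esub> elem a b"
    using a b relators_ops(6)[of a b c] by (simp add: elem_def h) (rule tensor_class_eq, auto)
  show "elem a (c \<odot>\<^bsub>B\<^esub> b) = c \<odot>\<^bsub>\<Q>\<^esub> elem a b"
    using a b relators_ops(7)[of a b c] by (simp add: elem_def h) (rule tensor_class_eq, auto)
qed

lemma elem_finsum_left:
  assumes "finite T" "!!i. i : T ==> X i : carrier A" "b : carrier B"
  shows "elem (\<Oplus>i\<in>T. X i) b = (\<Oplus>\<^bsub>\<Q>\<^esub>i\<in>T. elem (X i) b)"
  using assms
proof (induction T rule: finite_induct)
  case empty
  then show ?case using elem_smult_left[of "\<zero>" b 0] by (simp add: elem_closed)
next
  case (insert i T)
  then show ?case by (simp add: A.finsum_ins Q.finsum_ins elem_closed elem_add_left A.finsum_cl)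
qed

text \<open>A separating functional \<open>g\<close> with \<open>g b\<^sub>m \<noteq> 0\<close> serves to eliminate \<open>X\<^sub>m\<close>.\<close>

lemma tensor_zero_if_separated:
  assumes lin: "!!g. g : \<G> ==> linear_functional B g"
    and sep: "!!b. b : carrier B ==> (!!g. g : \<G> ==> g b = 0) ==> b = \<zero>\<^bsub>B\<^esub>"
    and "!!i. i < (m::nat) ==> X i : carrier A" "!!i. i < m ==> b i : carrier B"
    and "!!g. g : \<G> ==> (\<Oplus>i\<in>{..<m}. g (b i) \<odot> X i) = \<zero>"
  shows "(\<Oplus>\<^bsub>\<Q>\<^esub>i\<in>{..<m}. elem (X i) (b i)) = \<zero>\<^bsub>\<Q>\<^esub>"
  using assms(3-5)
proof (induction m arbitrary: b)
  case 0
  then show ?case by simp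
next
  case (Suc m)
  have X: "X i : carrier A" if "i <= m" for i using Suc.prems that by simp
  have b: "b i : carrier B" if "i <= m" for i using Suc.prems that by simp
  have split: "(\<Oplus>\<^bsub>\<Q>\<^esub>i\<in>{..<Suc m}. elem (X i) (b i)) =
      elem (X m) (b m) \<oplus>\<^bsub>\<Q>\<^esub> (\<Oplus>\<^bsub>\<Q>\<^esub>i\<in>{..<m}. elem (X i) (b i))"
    unfolding lessThan_Suc by (rule Q.finsum_ins) (auto simp: X b elem_closed)
  have splitA: "g (b m) \<odot> X m \<oplus> (\<Oplus>i\<in>{..<m}. g (b i) \<odot> X i) = \<zero>"
    if "g : \<G>" for g
    using Suc.prems(3)[OF that] unfolding lessThan_Suc by (subst (asm) A.finsum_ins) (auto simp: X)
  show ?case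
  proof (cases "b m = \<zero>\<^bsub>B\<^esub>")
    case True
    have "elem (X m) (b m) = \<zero>\<^bsub>\<Q>\<^esub>"
      using elem_smult_right[of "X m" "\<zero>\<^bsub>B\<^esub>" 0] X by (simp add: True elem_closed)
    moreover have "(\<Oplus>\<^bsub>\<Q>\<^esub>i\<in>{..<m}. elem (X i) (b i)) = \<zero>\<^bsub>\<Q>\<^esub>"
    proof (rule Suc.IH)
      fix g assume g: "g : \<G>"
      have "g (b m) = 0" using linear_functionalD(2)[OF lin[OF g], of "\<zero>\<^bsub>B\<^esub>" 0] True by simp
      then show "(\<Oplus>i\<in>{..<m}. g (b i) \<odot> X i) = \<zero>"
        using splitA[OF g] X by (simp add: A.finsum_cl)
    qed (use X b in auto)
    ultimately show ?thesis unfolding split by simp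
  next
    case False
    then obtain g where g: "g : \<G>" "g (b m) ~= 0" using sep[OF b[of m]] by auto
    \<comment> \<open>The relation for g expresses \<open>X m\<close> as the sum of the
      \<open>d i \<odot> X i\<close>. Moving these scalars across the tensor sign absorbs the last
      term into the elements \<open>b' i\<close>, and m drops by one.\<close>
    define d where "d = (%i. - (g (b i) / g (b m)))"
    define b' where "b' = (%i. b i \<oplus>\<^bsub>B\<^esub> d i \<odot>\<^bsub>B\<^esub> b m)"
    have b': "b' i : carrier B" if "i < m" for i using that b by (simp add: b'_def)
    have Xm: "X m = (\<Oplus>i\<in>{..<m}. d i \<odot> X i)"
    proof -
      let ?S = "\<Oplus>i\<in>{..<m}. g (b i) \<odot> X i"
      have S: "?S : carrier A" by (rule A.finsum_cl) (simp add: X)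
      have "\<ominus> ?S = g (b m) \<odot> X m" using splitA[OF g(1)] S X by (simp add: A.M.minus_equality)
      then have "X m = (1 / g (b m)) \<odot> (\<ominus> ?S)" using X g(2) by (simp add: A.s_assoc)
      also have "... = (- 1 / g (b m)) \<odot> ?S" using S by (simp add: A.a_inv_eq A.s_assoc)
      also have "... = (\<Oplus>i\<in>{..<m}. (- 1 / g (b m)) \<odot> (g (b i) \<odot> X i))"
        by (rule A.finsum_smult[symmetric]) (auto simp: X)
      also have "... = (\<Oplus>i\<in>{..<m}. d i \<odot> X i)"
        by (rule A.finsum_cong) (auto simp: X A.s_assoc d_def)
      finally show ?thesis .
    qed
    have IH: "(\<Oplus>\<^bsub>\<Q>\<^esub>i\<in>{..<m}. elem (X i) (b' i)) = \<zero>\<^bsub>\<Q>\<^esub>"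
    proof (rule Suc.IH)
      fix h assume h: "h : \<G>"
      note hl = linear_functionalD[OF lin[OF h]]
      have S: "(\<Oplus>i\<in>{..<m}. h (b i) \<odot> X i) : carrier A" by (rule A.finsum_cl) (simp add: X)
      have "(\<Oplus>i\<in>{..<m}. h (b' i) \<odot> X i) =
          (\<Oplus>i\<in>{..<m}. h (b i) \<odot> X i \<oplus> h (b m) \<odot> (d i \<odot> X i))"
        by (rule A.finsum_cong) (auto simp: X b b'_def hl A.s_add_left A.s_assoc mult.commute)
      also have "... = (\<Oplus>i\<in>{..<m}. h (b i) \<odot> X i) \<oplus>
          (\<Oplus>i\<in>{..<m}. h (b m) \<odot> (d i \<odot> X i))"
        by (rule A.finsum_add) (auto simp: X)
      also have "(\<Oplus>i\<in>{..<m}. h (b m) \<odot> (d i \<odot> X i)) = h (b m) \<odot> X m"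
        by (subst A.finsum_smult) (auto simp: X Xm)
      finally show "(\<Oplus>i\<in>{..<m}. h (b' i) \<odot> X i) = \<zero>"
        using splitA[OF h] S X by (simp add: A.M.a_comm)
    qed (use X b' in auto)
    have "\<zero>\<^bsub>\<Q>\<^esub> = (\<Oplus>\<^bsub>\<Q>\<^esub>i\<in>{..<m}. elem (X i) (b i) \<oplus>\<^bsub>\<Q>\<^esub> elem (d i \<odot> X i) (b m))"
      unfolding IH[symmetric]
      by (rule Q.finsum_cong) (auto simp: X b b'_def elem_closed elem_add_right elem_smult_left elem_smult_right)
    also have "... = (\<Oplus>\<^bsub>\<Q>\<^esub>i\<in>{..<m}. elem (X i) (b i)) \<oplus>\<^bsub>\<Q>\<^esub> (\<Oplus>\<^bsub>\<Q>\<^esub>i\<in>{..<m}. elem (d i \<odot> X i) (b m))"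
      by (rule Q.finsum_add) (auto simp: X b elem_closed)
    also have "(\<Oplus>\<^bsub>\<Q>\<^esub>i\<in>{..<m}. elem (d i \<odot> X i) (b m)) = elem (X m) (b m)"
      by (subst Xm, rule elem_finsum_left[symmetric]) (simp_all add: X b)
    finally show ?thesis unfolding split
      using X b by (simp add: Q.M.a_comm Q.finsum_cl elem_closed)
  qed
qed

lemma tensor_class_elem_sum:
  assumes "f : carrier \<D>"
  shows "\<exists>(m::nat) X b. (\<forall>i<m. X i : carrier A) \<and> (\<forall>i<m. b i : carrier B) \<and>
    tensor_class f = (\<Oplus>\<^bsub>\<Q>\<^esub>i\<in>{..<m}. elem (X i) (b i))"
  using assms
proof (induction rule: tensor_induct)
  case zero
  have "tensor_class \<zero>\<^bsub>\<D>\<^esub> = \<zero>\<^bsub>\<Q>\<^esub>" by (simp add: tensor_class_zero relator_zero)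
  then show ?case by (intro exI[of _ 0]) simp
next
  case (add c a b' g)
  then obtain m :: nat and X b where X: "\<forall>i<m. X i : carrier A" and b: "\<forall>i<m. b i : carrier B"
    and g: "tensor_class g = (\<Oplus>\<^bsub>\<Q>\<^esub>i\<in>{..<m}. elem (X i) (b i))" by blast
  let ?X = "X(m := c \<odot> a)" and ?b = "b(m := b')"
  have "tensor_class (c \<odot>\<^bsub>\<D>\<^esub> single (a, b') \<oplus>\<^bsub>\<D>\<^esub> g) = elem (c \<odot> a) b' \<oplus>\<^bsub>\<Q>\<^esub> tensor_class g"
    using add.hyps by (simp add: star_homD[OF tensor_class_hom] elem_smult_left) (simp add: elem_def)
  also have "tensor_class g = (\<Oplus>\<^bsub>\<Q>\<^esub>i\<in>{..<m}. elem (?X i) (?b i))"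
    unfolding g by (rule Q.finsum_cong) (use X b in "auto intro: elem_closed")
  also have "elem (c \<odot> a) b' \<oplus>\<^bsub>\<Q>\<^esub> (\<Oplus>\<^bsub>\<Q>\<^esub>i\<in>{..<m}. elem (?X i) (?b i)) =
      (\<Oplus>\<^bsub>\<Q>\<^esub>i\<in>{..<Suc m}. elem (?X i) (?b i))"
    unfolding lessThan_Suc by (subst Q.finsum_ins) (use add.hyps X b in "auto intro!: elem_closed")
  finally show ?case using X b add.hyps by (intro exI[of _ "Suc m"] exI[of _ ?X] exI[of _ ?b]) auto
qed

end

section \<open>The algebra of a group of permutations\<close>

definition perm_monoid :: "('x => 'x) monoid" where
  "perm_monoid = \<lparr>carrier = {g. bij g}, mult = (\<circ>), one = id\<rparr>"

abbreviation pinv :: "('x => 'x) => 'x => 'x" where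
  "pinv == inv_into UNIV"

abbreviation perm_alg :: "(('x => 'x) => complex) star_alg" where
  "perm_alg == semigroup_star_alg perm_monoid pinv"

lemma perm_monoid_simps [simp]:
  "carrier perm_monoid = {g. bij g}" "g \<otimes>\<^bsub>perm_monoid\<^esub> h = g \<circ> h" "\<one>\<^bsub>perm_monoid\<^esub> = id"
  by (simp_all add: perm_monoid_def)

interpretation PM: weighted_semigroup perm_monoid pinv "%_. 1"
  by unfold_locales (auto simp: bij_comp bij_imp_bij_inv inv_inv_eq o_inv_distrib o_assoc)

lemma star_algebra_perm: "star_algebra perm_alg"
  by (rule PM.star_algebra)

text \<open>Equality of two labels is written as a sum over their common value y. This factorises
  the double sum and later exhibits positive kernels as sums of squares.\<close>

lemma sum_over_fibres:
  fixes f :: "'s => complex" and g :: "'t => complex"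
  assumes Y: "finite Y" "\<pi> ` S \<subseteq> Y"
  shows "(\<Sum>s\<in>S. \<Sum>t\<in>T. f s * g t * (if \<pi> s = \<pi>' t then 1 else 0)) =
    (\<Sum>y\<in>Y. (\<Sum>s\<in>S. f s * (if \<pi> s = y then 1 else 0)) * (\<Sum>t\<in>T. g t * (if \<pi>' t = y then 1 else 0)))"
proof -
  have "(\<Sum>y\<in>Y. (\<Sum>s\<in>S. f s * (if \<pi> s = y then 1 else 0)) * (\<Sum>t\<in>T. g t * (if \<pi>' t = y then 1 else 0))) =
      (\<Sum>y\<in>Y. \<Sum>s\<in>S. \<Sum>t\<in>T. f s * g t * ((if \<pi> s = y then 1 else 0) * (if \<pi>' t = y then 1 else 0)))"
    by (simp add: sum_product mult_ac)
  also have "... = (\<Sum>s\<in>S. \<Sum>y\<in>Y. \<Sum>t\<in>T. f s * g t * ((if \<pi> s = y then 1 else 0) * (if \<pi>' t = y then 1 else 0)))"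
    by (rule sum.swap)
  also have "... = (\<Sum>s\<in>S. \<Sum>t\<in>T. \<Sum>y\<in>Y. f s * g t * ((if \<pi> s = y then 1 else 0) * (if \<pi>' t = y then 1 else 0)))"
    by (intro sum.cong refl sum.swap)
  also have "... = (\<Sum>s\<in>S. \<Sum>t\<in>T. f s * g t * (if \<pi> s = \<pi>' t then 1 else 0))"
  proof (intro sum.cong refl)
    fix s t assume "s : S" "t : T"
    then have "\<pi> s : Y" using Y by blast
    then have "(\<Sum>y\<in>Y. (if \<pi> s = y then 1 else 0) * (if \<pi>' t = y then 1 else 0)) = (if \<pi> s = \<pi>' t then 1 else (0::complex))"
      using Y(1) by (simp add: if_distrib[of "%x. x * _"] sum.delta cong: if_cong)
    then show "(\<Sum>y\<in>Y. f s * g t * ((if \<pi> s = y then 1 else 0) * (if \<pi>' t = y then 1 else 0))) =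
        f s * g t * (if \<pi> s = \<pi>' t then 1 else 0)"
      by (simp flip: sum_distrib_left)
  qed
  finally show ?thesis by (rule sym)
qed

lemma sum_support_delta:
  fixes f :: "'s => complex"
  assumes "finite {s. f s ~= 0}"
  shows "(\<Sum>s | f s ~= 0. f s * (if s = y then 1 else 0)) = f y"
    "(\<Sum>s | f s ~= 0. cnj (f s) * (if s = y then 1 else 0)) = cnj (f y)"
  using assms by (simp_all add: if_distrib[of "%x. _ * x"] sum.delta' cong: if_cong)

section \<open>The canonical trace and the reduced norm\<close>

definition trace :: "(('x => 'x) => complex) => complex" where
  "trace f = pairing f (%g. if g = id then 1 else 0)"

lemma trace_star_mult:
  assumes f: "f : carrier perm_alg" and h: "h : carrier perm_alg" and T: "finite T" "!!g. g ~: T ==> f g = 0"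
  shows "trace (f\<^sup>\<star>\<^bsub>perm_alg\<^esub> \<otimes>\<^bsub>perm_alg\<^esub> h) = (\<Sum>g\<in>T. cnj (f g) * h g)"
proof -
  have "trace (f\<^sup>\<star>\<^bsub>perm_alg\<^esub> \<otimes>\<^bsub>perm_alg\<^esub> h) =
      (\<Sum>s | f s ~= 0. \<Sum>t | h t ~= 0. cnj (f s) * h t * (if s = t then 1 else 0))"
    unfolding trace_def PM.pairing_star_mult[OF f h]
  proof (intro sum.cong refl)
    fix s t assume "s : {s. f s ~= 0}" "t : {t. h t ~= 0}"
    then have b: "bij s" "bij t" using PM.alg_support[OF f] PM.alg_support[OF h] by auto
    have "pinv s \<circ> t = id \<longleftrightarrow> s = t"
    proof
      assume "pinv s \<circ> t = id"
      then have "s \<circ> (pinv s \<circ> t) = s" by simp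
      then show "s = t" using b by (simp add: o_assoc surj_iff[THEN iffD1] bij_is_surj)
    qed (use b in "simp add: bij_is_inj")
    then show "cnj (f s) * h t * (if pinv s \<otimes>\<^bsub>perm_monoid\<^esub> t = id then 1 else 0) =
        cnj (f s) * h t * (if s = t then 1 else 0)" by simp
  qed
  also have "... = (\<Sum>y\<in>T. (\<Sum>s | f s ~= 0. cnj (f s) * (if s = y then 1 else 0)) *
      (\<Sum>t | h t ~= 0. h t * (if t = y then 1 else 0)))"
    by (rule sum_over_fibres[where \<pi>="%s. s" and \<pi>'="%t. t"]) (use T in auto)
  finally show ?thesis by (simp add: sum_support_delta PM.alg_finite f h)
qed

text \<open>The GNS construction of the trace is the left regular representation:
  \<open>vnorm\<close> is the square-summation norm of the coefficients, and \<open>gnorm\<close>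
  the reduced norm of the group algebra.\<close>

interpretation PG: gns perm_alg trace "wnorm (%_. 1)" 1
  unfolding trace_def[abs_def]
proof (rule PM.gns_kernel)
  fix f :: "('x => 'x) => complex" assume f: "f : carrier perm_alg"
  have "trace (f\<^sup>\<star>\<^bsub>perm_alg\<^esub> \<otimes>\<^bsub>perm_alg\<^esub> f) = of_real (\<Sum>g | f g ~= 0. (cmod (f g))^2)"
    by (subst trace_star_mult[OF f f PM.alg_finite[OF f]])
      (simp_all add: mult.commute complex_norm_square flip: of_real_power)
  then show "Im (pairing (f\<^sup>\<star>\<^bsub>perm_alg\<^esub> \<otimes>\<^bsub>perm_alg\<^esub> f) (%g. if g = id then 1 else 0)) = 0 \<and>
      0 <= Re (pairing (f\<^sup>\<star>\<^bsub>perm_alg\<^esub> \<otimes>\<^bsub>perm_alg\<^esub> f) (%g. if g = id then 1 else 0))"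
    unfolding trace_def[symmetric] by (simp add: sum_nonneg)
qed simp

lemma single_id: "single id : carrier perm_alg" "f : carrier perm_alg ==> single id \<otimes>\<^bsub>perm_alg\<^esub> f = f"
  "f : carrier perm_alg ==> f \<otimes>\<^bsub>perm_alg\<^esub> single id = f" "(single id)\<^sup>\<star>\<^bsub>perm_alg\<^esub> = single id"
proof -
  show 1: "single id : carrier perm_alg" by (rule PM.single_carrier) simp
  show "(single id)\<^sup>\<star>\<^bsub>perm_alg\<^esub> = single id" by (subst PM.star_single) auto
  assume f: "f : carrier perm_alg"
  show "single id \<otimes>\<^bsub>perm_alg\<^esub> f = f" "f \<otimes>\<^bsub>perm_alg\<^esub> single id = f"
    by (rule pairing_ext; simp add: PM.alg_finite PM.mult_closed' 1 f PM.pairing_mult)+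
qed

lemma vnorm_perm:
  assumes f: "f : carrier perm_alg" and T: "finite T" "!!g. g ~: T ==> f g = 0"
  shows "(PG.vnorm f)^2 = (\<Sum>g\<in>T. (cmod (f g))^2)"
proof -
  have "complex_of_real ((PG.vnorm f)^2) = of_real (\<Sum>g\<in>T. (cmod (f g))^2)"
    using PG.vnorm_square[OF f] trace_star_mult[OF f f T]
    by (simp add: mult.commute complex_norm_square flip: of_real_power)
  then show ?thesis by (simp only: of_real_eq_iff)
qed

lemma vnorm_single:
  assumes "bij g" shows "PG.vnorm (single g) = 1"
proof -
  have c: "single g : carrier perm_alg" using assms by (intro PM.single_carrier) simp
  have "(PG.vnorm (single g))^2 = 1"
    using vnorm_perm[OF c, of "{g}"] by (simp add: single_apply)
  then show ?thesis using power2_eq_1_iff[of "PG.vnorm (single g)"] PG.vnorm_nonneg[OF c] by linarith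
qed

lemma vnorm_le_gnorm: "f : carrier perm_alg ==> PG.vnorm f <= PG.gnorm f"
  using PG.gnorm_bound(2)[of f "single id"] by (simp add: single_id vnorm_single)

lemma cstar_norm_perm: "cstar_norm perm_alg PG.gnorm"
  unfolding cstar_norm_def
proof (intro conjI ballI impI PG.cstar_seminorm_gnorm)
  fix f :: "('x => 'x) => complex" assume f: "f : carrier perm_alg" and "PG.gnorm f = 0"
  then have "(PG.vnorm f)^2 = 0" using vnorm_le_gnorm[OF f] PG.vnorm_nonneg[OF f] by simp
  then have "(\<Sum>g | f g ~= 0. (cmod (f g))^2) = 0" using vnorm_perm[OF f PM.alg_finite[OF f]] by simp
  then have "\<forall>g\<in>{g. f g ~= 0}. (cmod (f g))^2 = 0" by (subst (asm) sum_nonneg_eq_0_iff) (auto simp: PM.alg_finite f)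
  then show "f = \<zero>\<^bsub>perm_alg\<^esub>" by (auto simp: PM.alg_simps)
qed

lemma trace_le_vnorm: "f : carrier perm_alg ==> cmod (trace f) <= PG.vnorm f"
  using PG.cauchy_schwarz[of "single id" f] by (simp add: single_id vnorm_single)

lemma linear_trace: "linear_functional perm_alg trace"
  by (rule positive_imp_linear_functional[OF PG.positive])

lemma cmod_pairing_le_vnorm:
  assumes f: "f : carrier perm_alg" and h: "h : carrier perm_alg"
  shows "cmod (pairing f h) <= PG.vnorm f * PG.vnorm h"
proof -
  define f' where "f' = (%g. cnj (f g))"
  have f': "f' : carrier perm_alg" using f by (simp add: f'_def PM.alg_carrier)
  have "trace (f'\<^sup>\<star>\<^bsub>perm_alg\<^esub> \<otimes>\<^bsub>perm_alg\<^esub> h) = pairing f h"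
    by (subst trace_star_mult[OF f' h PM.alg_finite[OF f]]) (auto simp: f'_def pairing_def)
  moreover have "(PG.vnorm f')^2 = (PG.vnorm f)^2"
    by (subst (1 2) vnorm_perm[OF _ PM.alg_finite[OF f]]) (auto simp: f f', auto simp: f'_def)
  then have "PG.vnorm f' = PG.vnorm f" using f f' by (simp add: power2_eq_iff_nonneg)
  ultimately show ?thesis using PG.cauchy_schwarz[OF f' h] by simp
qed

text \<open>The left and the right regular representation commute; at the point mass at the identity
  their product has the matrix coefficient \<open>\<Sum> f g \<cdot> h g\<close>.\<close>

lemma tensor_form_regular:
  assumes A: "star_algebra A" "cstar_seminorm A p" "star_hom A perm_alg phi"
      "!!a. a : carrier A ==> PG.vnorm (phi a) <= p a"
    and B: "star_algebra B" "cstar_seminorm B q" "star_hom B perm_alg psi"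
      "!!b. b : carrier B ==> PG.vnorm (psi b) <= q b"
  shows "tensor_form A B p q (%a b. pairing (phi a) (psi b)) 1"
proof -
  interpret A: star_algebra A by fact
  interpret B: star_algebra B by fact
  interpret star_algebra_pair A B by unfold_locales
  note phi = star_homD[OF A(3)] and psi = star_homD[OF B(3)]
  have bd: "cmod (pairing (phi a) (psi b)) <= p a * q b" if "a : carrier A" "b : carrier B" for a b
    using cmod_pairing_le_vnorm[OF phi(1)[OF that(1)] psi(1)[OF that(2)]]
      mult_mono[OF A(4)[OF that(1)] B(4)[OF that(2)]] order_trans[OF PG.vnorm_nonneg A(4)] phi(1) psi(1) that
    by (meson PG.vnorm_nonneg order_trans)
  show ?thesis
  proof
    show "cstar_seminorm A p" "cstar_seminorm B q" by fact+
    show "bounded_functional B q (1 * p a) (%b. pairing (phi a) (psi b))" if "a : carrier A" for a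
      using that bd by (simp add: bounded_functional_def linear_functional_def psi PM.alg_simps
          pairing_add_right pairing_smult_right)
    show "bounded_functional A p (1 * q b) (%a. pairing (phi a) (psi b))" if "b : carrier B" for b
      using that bd by (simp add: bounded_functional_def linear_functional_def phi PM.alg_simps
          pairing_add pairing_smult PM.alg_finite mult.commute)
    fix m :: nat and c a b
    assume a: "!!j. j < m ==> a j : carrier A" and b: "!!j. j < m ==> b j : carrier B"
    define Z where "Z = (%j. {s. phi (a j) s ~= 0} \<times> {s. psi (b j) s ~= 0})"
    define e where "e = (%j z. phi (a j) (fst z) * psi (b j) (snd z))"
    \<comment> \<open>The permutation s' from the left and s from the right together move the
      identity to s' composed with the inverse of s. So \<open>y j\<close> is the vector to which
      the j-th elementary tensor sends the point mass at the identity.\<close>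
    define \<pi> :: "('c => 'c) \<times> ('c => 'c) => 'c => 'c" where "\<pi> = (%z. snd z \<circ> pinv (fst z))"
    have Zfin: "finite (Z j)" if "j < m" for j
      unfolding Z_def by (intro finite_cartesian_product PM.alg_finite phi(1) psi(1) a b that)
    define Y where "Y = (\<Union>j<m. \<pi> ` Z j)"
    have Y: "finite Y" "j < m ==> \<pi> ` Z j \<subseteq> Y" for j using Zfin by (auto simp: Y_def)
    define y where "y = (%j g. \<Sum>z\<in>Z j. e j z * (if \<pi> z = g then 1 else 0))"
    have W: "pairing (phi ((a j)\<^sup>\<star>\<^bsub>A\<^esub> \<otimes>\<^bsub>A\<^esub> a k)) (psi ((b j)\<^sup>\<star>\<^bsub>B\<^esub> \<otimes>\<^bsub>B\<^esub> b k)) = (\<Sum>g\<in>Y. cnj (y j g) * y k g)"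
      if j: "j < m" and k: "k < m" for j k
    proof -
      have cl: "phi (a j) : carrier perm_alg" "phi (a k) : carrier perm_alg" "psi (b j) : carrier perm_alg"
        "psi (b k) : carrier perm_alg" using a b j k phi(1) psi(1) by blast+
      have val: "((psi (b j))\<^sup>\<star>\<^bsub>perm_alg\<^esub> \<otimes>\<^bsub>perm_alg\<^esub> psi (b k)) z = (\<Sum>s' | psi (b j) s' ~= 0. \<Sum>t' | psi (b k) t' ~= 0.
          cnj (psi (b j) s') * psi (b k) t' * (if pinv s' \<circ> t' = z then 1 else 0))" for z
        using pairing_indicator[OF PM.alg_finite[OF PM.mult_closed'[OF PM.star_closed'[OF cl(3)] cl(4)]], of z]
          PM.pairing_star_mult[OF cl(3,4), of "%s. if s = z then 1 else 0"] by simp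
      have eq: "pinv s' \<circ> t' = pinv s \<circ> t \<longleftrightarrow> s' \<circ> pinv s = t' \<circ> pinv t" if "bij s" "bij t" "bij s'" for s t s' t' :: "'c => 'c"
      proof
        assume "pinv s' \<circ> t' = pinv s \<circ> t"
        then have "s' \<circ> (pinv s' \<circ> t') \<circ> pinv t = s' \<circ> (pinv s \<circ> t) \<circ> pinv t" by simp
        then show "s' \<circ> pinv s = t' \<circ> pinv t" using that
          by (simp add: o_assoc surj_iff[THEN iffD1] bij_is_surj) (simp add: comp_assoc surj_iff[THEN iffD1] bij_is_surj)
      next
        assume "s' \<circ> pinv s = t' \<circ> pinv t"
        then have "pinv s' \<circ> (s' \<circ> pinv s) \<circ> t = pinv s' \<circ> (t' \<circ> pinv t) \<circ> t" by simp
        then show "pinv s' \<circ> t' = pinv s \<circ> t" using that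
          by (simp add: o_assoc bij_is_inj)
      qed
      have "pairing (phi ((a j)\<^sup>\<star>\<^bsub>A\<^esub> \<otimes>\<^bsub>A\<^esub> a k)) (psi ((b j)\<^sup>\<star>\<^bsub>B\<^esub> \<otimes>\<^bsub>B\<^esub> b k)) =
          (\<Sum>s | phi (a j) s ~= 0. \<Sum>t | phi (a k) t ~= 0. \<Sum>s' | psi (b j) s' ~= 0. \<Sum>t' | psi (b k) t' ~= 0.
            cnj (phi (a j) s) * phi (a k) t * (cnj (psi (b j) s') * psi (b k) t' * (if pinv s' \<circ> t' = pinv s \<circ> t then 1 else 0)))"
        using a b j k by (simp add: phi psi PM.pairing_star_mult[OF cl(1,2)] val sum_distrib_left)
      also have "... = (\<Sum>s | phi (a j) s ~= 0. \<Sum>t | phi (a k) t ~= 0. \<Sum>s' | psi (b j) s' ~= 0. \<Sum>t' | psi (b k) t' ~= 0.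
            cnj (e j (s, s')) * e k (t, t') * (if \<pi> (s, s') = \<pi> (t, t') then 1 else 0))"
      proof (intro sum.cong refl)
        fix s t s' t' assume "s : {s. phi (a j) s ~= 0}" "t : {t. phi (a k) t ~= 0}" "s' : {s'. psi (b j) s' ~= 0}"
        then have "bij s" "bij t" "bij s'" using cl[THEN PM.alg_support] by auto
        then show "cnj (phi (a j) s) * phi (a k) t * (cnj (psi (b j) s') * psi (b k) t' * (if pinv s' \<circ> t' = pinv s \<circ> t then 1 else 0)) =
            cnj (e j (s, s')) * e k (t, t') * (if \<pi> (s, s') = \<pi> (t, t') then 1 else 0)"
          by (simp add: eq e_def \<pi>_def)
      qed
      also have "... = (\<Sum>z\<in>Z j. \<Sum>z'\<in>Z k. cnj (e j z) * e k z' * (if \<pi> z = \<pi> z' then 1 else 0))"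
        unfolding Z_def by (simp add: sum.cartesian_product' sum.swap[of _ "{t. phi (a k) t ~= 0}" "{s'. psi (b j) s' ~= 0}"])
      also have "... = (\<Sum>g\<in>Y. cnj (y j g) * y k g)"
        by (subst sum_over_fibres[OF Y(1) Y(2)[OF j]]) (simp add: y_def if_distrib[of cnj] cong: if_cong)
      finally show ?thesis .
    qed
    have "gram A B (%a b. pairing (phi a) (psi b)) {..<m} c a b =
        (\<Sum>j<m. \<Sum>k<m. \<Sum>g\<in>Y. cnj (c j * y j g) * (c k * y k g))"
      unfolding gram_def by (intro sum.cong refl) (simp add: W sum_distrib_left mult_ac)
    also have "... = (\<Sum>j<m. \<Sum>g\<in>Y. \<Sum>k<m. cnj (c j * y j g) * (c k * y k g))"
      by (intro sum.cong refl sum.swap)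
    also have "... = (\<Sum>g\<in>Y. \<Sum>j<m. \<Sum>k<m. cnj (c j * y j g) * (c k * y k g))"
      by (rule sum.swap)
    also have "... = (\<Sum>g\<in>Y. cnj (\<Sum>j<m. c j * y j g) * (\<Sum>k<m. c k * y k g))"
      unfolding cnj_sum sum_product ..
    also have "... = of_real (\<Sum>g\<in>Y. (cmod (\<Sum>j<m. c j * y j g))^2)"
      by (simp add: mult.commute complex_norm_square flip: of_real_power)
    finally show "Im (gram A B (%a b. pairing (phi a) (psi b)) {..<m} c a b) = 0 \<and>
        0 <= Re (gram A B (%a b. pairing (phi a) (psi b)) {..<m} c a b)" by (simp add: sum_nonneg)
  qed
qed

text \<open>The sum of the c_j a_j \<otimes> b_j is viewed as an A-valued function D on the group.
  Under the trace distinct group elements are orthogonal, so only the terms F at star-squares of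
  \<open>D g\<close> remain.\<close>

lemma gram_trace:
  assumes "star_algebra A" and F: "linear_functional A F" and psi: "star_hom B perm_alg psi" "star_algebra B"
    and J: "finite J" "!!j. j : J ==> a j : carrier A" "!!j. j : J ==> b j : carrier B"
    and T: "finite T" "!!j g. j : J ==> g ~: T ==> psi (b j) g = 0"
    and D: "D = (%g. \<Oplus>\<^bsub>A\<^esub>j\<in>J. (c j * psi (b j) g) \<odot>\<^bsub>A\<^esub> a j)"
  shows "gram A B (%a b. F a * trace (psi b)) J c a b = (\<Sum>g\<in>T. F ((D g)\<^sup>\<star>\<^bsub>A\<^esub> \<otimes>\<^bsub>A\<^esub> D g))"
proof -
  interpret A: star_algebra A by fact
  interpret B: star_algebra B by fact
  have "gram A B (%a b. F a * trace (psi b)) J c a b = (\<Sum>j\<in>J. \<Sum>k\<in>J. \<Sum>g\<in>T.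
      cnj (c j * psi (b j) g) * (c k * psi (b k) g) * F ((a j)\<^sup>\<star>\<^bsub>A\<^esub> \<otimes>\<^bsub>A\<^esub> a k))"
    unfolding gram_def
  proof (intro sum.cong refl)
    fix j k assume j: "j : J" and k: "k : J"
    have "trace (psi ((b j)\<^sup>\<star>\<^bsub>B\<^esub> \<otimes>\<^bsub>B\<^esub> b k)) = (\<Sum>g\<in>T. cnj (psi (b j) g) * psi (b k) g)"
      using trace_star_mult[OF star_homD(1)[OF psi(1) J(3)[OF j]] star_homD(1)[OF psi(1) J(3)[OF k]] T(1) T(2)[OF j]]
        J(3)[OF j] J(3)[OF k] by (simp add: star_homD[OF psi(1)])
    then show "cnj (c j) * c k * (F ((a j)\<^sup>\<star>\<^bsub>A\<^esub> \<otimes>\<^bsub>A\<^esub> a k) * trace (psi ((b j)\<^sup>\<star>\<^bsub>B\<^esub> \<otimes>\<^bsub>B\<^esub> b k))) =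
        (\<Sum>g\<in>T. cnj (c j * psi (b j) g) * (c k * psi (b k) g) * F ((a j)\<^sup>\<star>\<^bsub>A\<^esub> \<otimes>\<^bsub>A\<^esub> a k))"
      by (simp add: sum_distrib_left mult_ac)
  qed
  also have "... = (\<Sum>j\<in>J. \<Sum>g\<in>T. \<Sum>k\<in>J. cnj (c j * psi (b j) g) * (c k * psi (b k) g) * F ((a j)\<^sup>\<star>\<^bsub>A\<^esub> \<otimes>\<^bsub>A\<^esub> a k))"
    by (intro sum.cong refl sum.swap)
  also have "... = (\<Sum>g\<in>T. \<Sum>j\<in>J. \<Sum>k\<in>J. cnj (c j * psi (b j) g) * (c k * psi (b k) g) * F ((a j)\<^sup>\<star>\<^bsub>A\<^esub> \<otimes>\<^bsub>A\<^esub> a k))"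
    by (rule sum.swap)
  also have "... = (\<Sum>g\<in>T. F ((D g)\<^sup>\<star>\<^bsub>A\<^esub> \<otimes>\<^bsub>A\<^esub> D g))"
    by (intro sum.cong refl A.functional_gram[OF F J(1,2), symmetric]) (simp_all add: D)
  finally show ?thesis .
qed

text \<open>Positivity comes from \<open>gram_trace\<close>, which writes the Gram sum as a sum of
  values of F at star-squares.\<close>

lemma tensor_form_trace:
  assumes A: "star_algebra A" "cstar_seminorm A p" and F: "positive_functional A F" "!!a. a : carrier A ==> cmod (F a) <= K * p a"
    and B: "star_algebra B" "cstar_seminorm B q" "star_hom B perm_alg psi" "!!b. b : carrier B ==> PG.vnorm (psi b) <= q b"
  shows "tensor_form A B p q (%a b. F a * trace (psi b)) K"
proof -
  interpret A: star_algebra A by fact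
  interpret B: star_algebra B by fact
  interpret star_algebra_pair A B by unfold_locales
  note psi = star_homD[OF B(3)] and Fl = positive_imp_linear_functional[OF F(1)]
  note tl = linear_functional_hom[OF linear_trace B(3)]
  have bd: "cmod (F a * trace (psi b)) <= K * p a * q b" if "a : carrier A" "b : carrier B" for a b
  proof -
    have "cmod (trace (psi b)) <= q b"
      using trace_le_vnorm[OF psi(1)[OF that(2)]] B(4)[OF that(2)] by simp
    then have "cmod (F a) * cmod (trace (psi b)) <= K * p a * q b"
      by (rule mult_mono[OF F(2)[OF that(1)]]) (use F(2)[OF that(1)] in "auto intro: order_trans[OF norm_ge_zero]")
    then show ?thesis by (simp add: norm_mult)
  qed
  show ?thesis
  proof
    show "cstar_seminorm A p" "cstar_seminorm B q" by fact+
    show "bounded_functional B q (K * p a) (%b. F a * trace (psi b))" if "a : carrier A" for a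
      using that bd by (simp add: bounded_functional_def linear_functional_def linear_functionalD[OF tl] ring_distribs)
    show "bounded_functional A p (K * q b) (%a. F a * trace (psi b))" if "b : carrier B" for b
      using that bd by (simp add: bounded_functional_def linear_functional_def linear_functionalD[OF Fl] ring_distribs mult_ac)
    fix m :: nat and c a b
    assume a: "!!j. j < m ==> a j : carrier A" and b: "!!j. j < m ==> b j : carrier B"
    define T where "T = (\<Union>j<m. {g. psi (b j) g ~= 0})"
    define D where "D = (%g. \<Oplus>\<^bsub>A\<^esub>j\<in>{..<m}. (c j * psi (b j) g) \<odot>\<^bsub>A\<^esub> a j)"
    have "finite T" using PM.alg_finite[OF psi(1)[OF b]] by (simp add: T_def)
    then have "gram A B (%a b. F a * trace (psi b)) {..<m} c a b = (\<Sum>g\<in>T. F ((D g)\<^sup>\<star>\<^bsub>A\<^esub> \<otimes>\<^bsub>A\<^esub> D g))"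
      by (intro gram_trace[OF A(1) Fl B(3) B(1) _ _ _ _ _ D_def]) (auto simp: a b T_def)
    moreover have "Im (F ((D g)\<^sup>\<star>\<^bsub>A\<^esub> \<otimes>\<^bsub>A\<^esub> D g)) = 0 \<and> 0 <= Re (F ((D g)\<^sup>\<star>\<^bsub>A\<^esub> \<otimes>\<^bsub>A\<^esub> D g))" for g
    proof -
      have "D g : carrier A" unfolding D_def by (rule A.finsum_cl) (simp add: a)
      then show ?thesis using F(1) by (simp add: positive_functional_def)
    qed
    ultimately show "Im (gram A B (%a b. F a * trace (psi b)) {..<m} c a b) = 0 \<and>
        0 <= Re (gram A B (%a b. F a * trace (psi b)) {..<m} c a b)" by (simp add: sum_nonneg)
  qed
qed

section \<open>Homomorphisms from free algebras into the group algebra\<close>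

definition perm_word :: "('g => ('x => 'x) => complex) => 'g word => ('x => 'x) => complex" where
  "perm_word e w = foldr (%(g, s) x. (if s then (e g)\<^sup>\<star>\<^bsub>perm_alg\<^esub> else e g) \<otimes>\<^bsub>perm_alg\<^esub> x) w (single id)"

definition perm_hom :: "('g => ('x => 'x) => complex) => ('g word => complex) => ('x => 'x) => complex" where
  "perm_hom e f = star_algebra.lin perm_alg f (perm_word e)"

lemma perm_word_closed: "range e \<subseteq> carrier perm_alg ==> perm_word e w : carrier perm_alg"
  by (induction w) (auto simp: perm_word_def single_id intro!: PM.mult_closed' PM.star_closed' dest: range_subsetD)

lemma perm_word_Cons: "perm_word e (x # w) =
    (if snd x then (e (fst x))\<^sup>\<star>\<^bsub>perm_alg\<^esub> else e (fst x)) \<otimes>\<^bsub>perm_alg\<^esub> perm_word e w"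
  by (simp add: perm_word_def split_beta)

lemma perm_word_append:
  assumes e: "range e \<subseteq> carrier perm_alg"
  shows "perm_word e (v @ w) = perm_word e v \<otimes>\<^bsub>perm_alg\<^esub> perm_word e w"
proof (induction v)
  case Nil
  show ?case using perm_word_closed[OF e, of w] by (simp add: perm_word_def[of e "[]"] single_id)
next
  case (Cons x v)
  then show ?case by (simp add: perm_word_Cons PG.mult_assoc perm_word_closed[OF e] range_subsetD[OF e] PM.star_closed')
qed

lemma perm_word_star:
  assumes e: "range e \<subseteq> carrier perm_alg"
  shows "perm_word e (word_star w) = (perm_word e w)\<^sup>\<star>\<^bsub>perm_alg\<^esub>"
proof (induction w)
  case Nil
  show ?case by (simp add: perm_word_def word_star_def single_id)
next
  case (Cons x w)
  have nil: "perm_word e [] = single id" by (simp add: perm_word_def)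
  have "perm_word e (word_star (x # w)) = perm_word e (word_star w @ [(fst x, \<not> snd x)])"
    by (simp add: word_star_def split_beta)
  also have "... = (perm_word e w)\<^sup>\<star>\<^bsub>perm_alg\<^esub> \<otimes>\<^bsub>perm_alg\<^esub> (if snd x then e (fst x) else (e (fst x))\<^sup>\<star>\<^bsub>perm_alg\<^esub>)"
    unfolding perm_word_append[OF e] Cons.IH by (simp add: perm_word_Cons nil single_id range_subsetD[OF e] PM.star_closed')
  finally show ?case
    by (simp add: perm_word_Cons PG.star_mult PG.star_star range_subsetD[OF e] perm_word_closed[OF e] PM.star_closed')
qed

lemma perm_hom:
  assumes e: "range e \<subseteq> carrier perm_alg"
  shows "star_hom (free_star_alg G) perm_alg (perm_hom e)"
    and "star_hom (free_unital_star_alg G) perm_alg (perm_hom e)"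
    and "perm_hom e (single w) = perm_word e w"
    and "perm_hom e (gen g) = e g"
proof -
  show "star_hom (free_star_alg G) perm_alg (perm_hom e)" "star_hom (free_unital_star_alg G) perm_alg (perm_hom e)"
    unfolding perm_hom_def[abs_def]
    by (rule star_hom_free star_hom_free_unital;
        use perm_word_closed[OF e] perm_word_append[OF e] perm_word_star[OF e] in "simp add: star_algebra_perm")+
  show s: "perm_hom e (single w) = perm_word e w" for w
    unfolding perm_hom_def by (rule PG.lin_single) (rule perm_word_closed[OF e])
  show "perm_hom e (gen g) = e g" unfolding gen_def s using range_subsetD[OF e] by (simp add: perm_word_def single_id)
qed

section \<open>Permutations of integer lists\<close>

text \<open>\<open>flip_head i\<close> is an involution that exchanges the lists with head \<open>i\<close> with all other lists; the
  entry following a head \<open>i\<close> encodes a list whose head differs from \<open>i\<close>.\<close>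

fun flip_head :: "int => int list => int list" where
  "flip_head i [] = [i]"
| "flip_head i (j # w) =
    (if j = i then (case w of [] => [] | k # v => (if k < i then k else k + 1) # v)
     else i # (if j < i then j else j - 1) # w)"

definition has_head :: "int => int list => bool" where
  "has_head i w \<longleftrightarrow> w ~= [] \<and> hd w = i"

abbreviation shift :: "int list => int list" where
  "shift == map (%j. j + 1)"

lemma flip_head_flip_head [simp]: "flip_head i (flip_head i w) = w"
  by (cases w) (auto split: list.splits)

lemma flip_head_o [simp]: "flip_head i \<circ> flip_head i = id"
  by auto

lemma flip_head_o_o [simp]: "flip_head i \<circ> (flip_head i \<circ> g) = g"
  by auto

lemma has_head_flip_head: "has_head i (flip_head i w) \<longleftrightarrow> \<not> has_head i w"
  by (cases w) (auto simp: has_head_def split: list.splits)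

text \<open>The encoding depends only on the order of entries and on steps by one, so it commutes
  with translation. Over the integers this translation is a bijection.\<close>

lemma shift_flip_head: "shift \<circ> flip_head i = flip_head (i + 1) \<circ> shift"
proof
  show "(shift \<circ> flip_head i) w = (flip_head (i + 1) \<circ> shift) w" for w
    by (cases w) (auto split: list.splits)
qed

lemma bij_flip_head: "bij (flip_head i)"
  by (rule involuntory_imp_bij) simp

lemma pinv_flip_head [simp]: "pinv (flip_head i) = flip_head i"
  by (rule inv_unique_comp) auto

lemma bij_shift: "bij shift"
  by (rule o_bij[of "map (%j. j - 1)"]) (auto simp: o_def)

text \<open>At each \<open>g\<close> at most one \<open>i\<close> is the head of \<open>g []\<close>; the other terms are moved by \<open>flip_head i\<close> to
  places where \<open>i\<close> is the head.\<close>

lemma flip_head_sum_square: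
  fixes u :: "(int list => int list) => real"
  assumes u: "!!g. 0 <= u g" and T: "finite T" "!!g. g ~: T ==> u g = 0" and T': "finite T'"
  shows "(\<Sum>g\<in>T'. (\<Sum>i<5. u (flip_head (int i) \<circ> g))^2) <= 20 * (\<Sum>g\<in>T. (u g)^2)"
proof -
  define h where "h = (%i (g :: int list => int list). has_head (int i) (g []))"
  have uniq: "i = j" if "h i g" "h j g" for i j g using that by (auto simp: h_def has_head_def)
  have flip: "h i (flip_head (int i) \<circ> g) \<longleftrightarrow> \<not> h i g" for i g by (simp add: h_def has_head_flip_head)
  let ?f = "%i g. flip_head (int i) \<circ> g"
  have moved: "(\<Sum>g\<in>T'. if Q (?f i g) then (u (?f i g))^2 else 0) <= (\<Sum>g\<in>T. if Q g then (u g)^2 else 0)" for i Q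
  proof -
    have inj: "inj_on (?f i) T'"
      by (rule inj_on_inverseI[of _ "?f i"]) simp
    have "(\<Sum>g\<in>T'. if Q (?f i g) then (u (?f i g))^2 else 0) = (\<Sum>g\<in>?f i ` T'. if Q g then (u g)^2 else 0)"
      by (simp add: sum.reindex[OF inj])
    also have "... = (\<Sum>g\<in>?f i ` T' \<inter> T. if Q g then (u g)^2 else 0)"
      by (rule sum.mono_neutral_right) (use T T' in auto)
    also have "... <= (\<Sum>g\<in>T. if Q g then (u g)^2 else 0)"
      by (rule sum_mono2) (use T in auto)
    finally show ?thesis .
  qed
  \<comment> \<open>The factor 2 is from (x + y)^2 <= 2 x^2 + 2 y^2, and 10 is this 2 times the 5
    from Cauchy--Schwarz for five terms.\<close>
  have pt: "(\<Sum>i<5. u (?f i g))^2 <= 2 * (\<Sum>i<5. if \<not> h i (?f i g) then (u (?f i g))^2 else 0) +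
      10 * (\<Sum>i<5. if h i (?f i g) then (u (?f i g))^2 else 0)" for g
  proof -
    \<comment> \<open>\<open>a\<close> keeps the at most one index that is the head of
      \<open>g []\<close>, so its sum squares without cross terms; \<open>b\<close> keeps the
      indices whose moved point has head i.\<close>
    define a where "a = (%i. if h i g then u (?f i g) else 0)"
    define b where "b = (%i. if h i g then 0 else u (?f i g))"
    have split: "(\<Sum>i<5. u (?f i g)) = (\<Sum>i<5. a i) + (\<Sum>i<5. b i)"
      unfolding sum.distrib[symmetric] by (rule sum.cong) (auto simp: a_def b_def)
    have "(\<Sum>i<5. a i)^2 = (\<Sum>i<5. (a i)^2)"
    proof (cases "\<exists>j<5. h j g")
      case True
      then obtain j where j: "j < 5" "h j g" by blast
      have z: "a i = 0" if "i ~= j" for i using uniq[of i g j] j that by (auto simp: a_def)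
      have "(\<Sum>i<5. a i) = (\<Sum>i\<in>{j}. a i)" "(\<Sum>i<5. (a i)^2) = (\<Sum>i\<in>{j}. (a i)^2)"
        by (rule sum.mono_neutral_right; use j z in auto)+
      then show ?thesis by simp
    next
      case False
      then show ?thesis by (simp add: a_def)
    qed
    moreover have "(\<Sum>i<5. b i)^2 <= 5 * (\<Sum>i<5. (b i)^2)"
    proof -
      have e: "{..<5::nat} = {0, 1, 2, 3, 4}" by auto
      \<comment> \<open>Lagrange's identity: this sum equals five times the sum of the squares minus
        the square of the sum.\<close>
      have "0 <= (b 0 - b 1)^2 + (b 0 - b 2)^2 + (b 0 - b 3)^2 + (b 0 - b 4)^2 + (b 1 - b 2)^2 +
          (b 1 - b 3)^2 + (b 1 - b 4)^2 + (b 2 - b 3)^2 + (b 2 - b 4)^2 + (b 3 - b 4)^2"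
        by (intro add_nonneg_nonneg zero_le_power2)
      then show ?thesis unfolding e by (simp add: power2_eq_square algebra_simps)
    qed
    moreover have "(x + y)^2 <= 2 * x^2 + 2 * y^2" for x y :: real
      using zero_le_power2[of "x - y"] by (simp add: power2_eq_square algebra_simps)
    ultimately have "(\<Sum>i<5. u (?f i g))^2 <= 2 * (\<Sum>i<5. (a i)^2) + 10 * (\<Sum>i<5. (b i)^2)"
      unfolding split by (smt (verit))
    also have "(\<Sum>i<5. (a i)^2) = (\<Sum>i<5. if \<not> h i (?f i g) then (u (?f i g))^2 else 0)"
      by (rule sum.cong) (auto simp: a_def flip)
    also have "(\<Sum>i<5. (b i)^2) = (\<Sum>i<5. if h i (?f i g) then (u (?f i g))^2 else 0)"
      by (rule sum.cong) (auto simp: b_def flip)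
    finally show ?thesis .
  qed
  let ?S = "\<Sum>g\<in>T. (u g)^2"
  have "(\<Sum>g\<in>T'. (\<Sum>i<5. u (?f i g))^2) \<le>
      (\<Sum>g\<in>T'. 2 * (\<Sum>i<5. if \<not> h i (?f i g) then (u (?f i g))^2 else 0) +
        10 * (\<Sum>i<5. if h i (?f i g) then (u (?f i g))^2 else 0))" by (rule sum_mono) (rule pt)
  also have "... = 2 * (\<Sum>i<5. \<Sum>g\<in>T'. if \<not> h i (?f i g) then (u (?f i g))^2 else 0) +
      10 * (\<Sum>i<5. \<Sum>g\<in>T'. if h i (?f i g) then (u (?f i g))^2 else 0)"
    by (simp only: sum.distrib sum_distrib_left[symmetric] sum.swap[of _ T'])
  \<comment> \<open>The first group is bounded by the full sum once for each of five indices. In the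
    second the head conditions exclude each other, so the full sum is counted once. Altogether this
    gives 2 * 5 + 10 = 20.\<close>
  also have "... <= 2 * (\<Sum>i<(5::nat). ?S) + 10 * ?S"
  proof (intro add_mono mult_left_mono)
    show "(\<Sum>i<5. \<Sum>g\<in>T'. if \<not> h i (?f i g) then (u (?f i g))^2 else 0) <= (\<Sum>i<(5::nat). ?S)"
    proof (rule sum_mono)
      fix i
      have "(\<Sum>g\<in>T. if \<not> h i g then (u g)^2 else 0) <= ?S" by (rule sum_mono) auto
      then show "(\<Sum>g\<in>T'. if \<not> h i (?f i g) then (u (?f i g))^2 else 0) <= ?S"
        using moved[of "%g. \<not> h i g" i] by simp
    qed
    have "(\<Sum>i<5. \<Sum>g\<in>T'. if h i (?f i g) then (u (?f i g))^2 else 0) \<le>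
        (\<Sum>i<(5::nat). \<Sum>g\<in>T. if h i g then (u g)^2 else 0)" by (rule sum_mono) (rule moved)
    also have "... = (\<Sum>g\<in>T. \<Sum>i<5. if h i g then (u g)^2 else 0)" by (rule sum.swap)
    also have "... <= ?S"
    proof (rule sum_mono)
      fix g
      show "(\<Sum>i<5. if h i g then (u g)^2 else 0) <= (u g)^2"
      proof (cases "\<exists>j<5. h j g")
        case True
        then obtain j where j: "j < 5" "h j g" by blast
        have "(\<Sum>i<5. if h i g then (u g)^2 else 0) = (\<Sum>i\<in>{j}. if h i g then (u g)^2 else 0)"
          by (rule sum.mono_neutral_right) (use j uniq in auto)
        then show ?thesis by simp
      next
        case False
        then have "(\<Sum>i<5. if h i g then (u g)^2 else 0) = 0" by (intro sum.neutral) auto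
        then show ?thesis by simp
      qed
    qed
    finally show "(\<Sum>i<5. \<Sum>g\<in>T'. if h i (?f i g) then (u (?f i g))^2 else 0) <= ?S" .
  qed simp_all
  finally show ?thesis by simp
qed

section \<open>A representation of the relations by permutations\<close>

text \<open>The first two projections are (1 + t) / 2 and (1 - t) / 2 for the involution t =
  \<open>flip_head 0\<close>, so that 2 p_1 - 1 becomes t itself. The edge becomes the translation
  that conjugates each involution to the next.\<close>

definition loop_rep :: "(nat, nat) hypergraph_gen => (int list => int list) => complex" where
  "loop_rep x = (case x of
     Vertex k => if k = 1 then (%g. (1/2) * single id g + (1/2) * single (flip_head 0) g)
       else if k = 2 then (%g. (1/2) * single id g + (- 1/2) * single (flip_head 0) g) else (%g. 0)
   | Edge k => single shift)"

text \<open>Elements of the commutative subalgebra spanned by 1 and the involution; the relations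
  between projections are then checked on pairs of coefficients.\<close>

definition flip_comb :: "complex => complex => (int list => int list) => complex" where
  "flip_comb a b = a \<odot>\<^bsub>perm_alg\<^esub> single id \<oplus>\<^bsub>perm_alg\<^esub> b \<odot>\<^bsub>perm_alg\<^esub> single (flip_head 0)"

lemma single_perm_closed: "single id : carrier perm_alg" "single (flip_head i) : carrier perm_alg"
    "single shift : carrier perm_alg"
  by (simp_all add: PM.single_carrier bij_flip_head bij_shift)

lemma flip_comb_simps:
  "flip_comb a b : carrier perm_alg"
  "flip_comb a b \<otimes>\<^bsub>perm_alg\<^esub> flip_comb c d = flip_comb (a * c + b * d) (a * d + b * c)"
  "(flip_comb a b)\<^sup>\<star>\<^bsub>perm_alg\<^esub> = flip_comb (cnj a) (cnj b)"
  "flip_comb a b \<oplus>\<^bsub>perm_alg\<^esub> flip_comb c d = flip_comb (a + c) (b + d)"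
  "flip_comb 0 0 = \<zero>\<^bsub>perm_alg\<^esub>" "flip_comb 1 0 = single id"
proof -
  note cl = single_perm_closed
  have v: "single (flip_head 0) \<otimes>\<^bsub>perm_alg\<^esub> single (flip_head 0) = single id"
    "(single (flip_head 0))\<^sup>\<star>\<^bsub>perm_alg\<^esub> = single (flip_head 0)"
    by (simp_all add: PM.mult_single PM.star_single bij_flip_head)
  show "flip_comb a b : carrier perm_alg" by (simp add: flip_comb_def cl)
  show "flip_comb a b \<otimes>\<^bsub>perm_alg\<^esub> flip_comb c d = flip_comb (a * c + b * d) (a * d + b * c)"
    using cl by (simp add: flip_comb_def PG.distrib_left PG.distrib_right PG.smult_mult_left
        PG.smult_mult_right PG.s_assoc v single_id) (simp add: PM.alg_simps fun_eq_iff algebra_simps)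
  show "(flip_comb a b)\<^sup>\<star>\<^bsub>perm_alg\<^esub> = flip_comb (cnj a) (cnj b)"
    using cl by (simp add: flip_comb_def PG.star_add PG.star_smult v single_id)
  show "flip_comb a b \<oplus>\<^bsub>perm_alg\<^esub> flip_comb c d = flip_comb (a + c) (b + d)"
    "flip_comb 0 0 = \<zero>\<^bsub>perm_alg\<^esub>" "flip_comb 1 0 = single id"
    by (simp_all add: flip_comb_def PM.alg_simps fun_eq_iff algebra_simps)
qed

lemma loop_rep_simps:
  "loop_rep (Vertex 1) = flip_comb (1/2) (1/2)" "loop_rep (Vertex 2) = flip_comb (1/2) (- 1/2)"
  "k ~= 1 ==> k ~= 2 ==> loop_rep (Vertex k) = flip_comb 0 0" "loop_rep (Edge k) = single shift"
  by (simp_all add: loop_rep_def flip_comb_def PM.alg_simps)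

lemma loop_rep_closed: "loop_rep x : carrier perm_alg"
proof (cases x)
  case (Vertex k)
  then show ?thesis
    by (cases "k = 1"; cases "k = 2") (simp_all add: loop_rep_simps flip_comb_simps(1) single_perm_closed del: flip_comb_simps(5))
qed (simp add: loop_rep_simps single_perm_closed)

lemma range_loop_rep: "range loop_rep \<subseteq> carrier perm_alg"
  using loop_rep_closed by blast

lemma unit_family_loop_rep:
  assumes n: "2 <= n"
  shows "unit_family n perm_alg (%i. loop_rep (Vertex i)) (loop_rep (Edge 1))"
proof -
  have vals: "loop_rep (Vertex i) = flip_comb (if i = 1 \<or> i = 2 then 1/2 else 0)
      (if i = 1 then 1/2 else if i = 2 then - 1/2 else 0)" for i by (simp add: loop_rep_simps)
  have sum: "(\<Oplus>\<^bsub>perm_alg\<^esub>i\<in>{1..n}. loop_rep (Vertex i)) = single id"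
  proof -
    have "(\<Oplus>\<^bsub>perm_alg\<^esub>i\<in>T. loop_rep (Vertex i)) =
        flip_comb (\<Sum>i\<in>T. if i = 1 \<or> i = 2 then 1/2 else 0) (\<Sum>i\<in>T. if i = 1 then 1/2 else if i = 2 then - 1/2 else 0)"
      if "finite T" for T
      using that
      by (induction T rule: finite_induct)
        (simp_all add: flip_comb_simps(5) PG.finsum_ins loop_rep_closed, simp add: vals flip_comb_simps)
    moreover have "(\<Sum>i\<in>{1..n}. if i = 1 \<or> i = 2 then 1/2 else 0) = (\<Sum>i\<in>{1,2::nat}. (1/2::complex))"
      by (rule sum.mono_neutral_cong_right) (use n in auto)
    moreover have "(\<Sum>i\<in>{1..n}. if i = 1 then 1/2 else if i = 2 then - 1/2 else 0) =
        (\<Sum>i\<in>{1,2::nat}. if i = 1 then 1/2 else (- 1/2::complex))"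
      by (rule sum.mono_neutral_cong_right) (use n in auto)
    ultimately show ?thesis by (simp add: flip_comb_simps)
  qed
  have sh: "pinv shift \<circ> shift = id" "shift \<circ> pinv shift = id"
    using bij_shift by (simp_all add: bij_is_inj surj_iff[THEN iffD1] bij_is_surj)
  show ?thesis
    unfolding unit_family_def sum
    by (auto simp: projection_def vals flip_comb_simps loop_rep_simps(4) single_perm_closed PM.star_single PM.mult_single
        bij_shift bij_imp_bij_inv sh)
qed

text \<open>Through this admissible seminorm the universal norm dominates the reduced norm of the
  represented element, which bounds the regular form.\<close>

lemma loop_rep_adm:
  assumes "2 <= n" shows "(%f. PG.gnorm (perm_hom loop_rep f)) : loop_adm n"
proof -
  note hom = perm_hom(1)[OF range_loop_rep]
  have sn: "cstar_seminorm (loop_alg n) (%f. PG.gnorm (perm_hom loop_rep f))"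
    by (rule cstar_seminorm_hom[OF loop_facts(1) star_algebra_perm PG.cstar_seminorm_gnorm hom])
  have "unit_family n perm_alg (%i. perm_hom loop_rep (gen (Vertex i))) (perm_hom loop_rep (gen (Edge 1)))"
    using unit_family_loop_rep[OF assms] by (simp add: perm_hom(4)[OF range_loop_rep])
  moreover have gens: "i : {1..n} ==> gen (Vertex i) : carrier (loop_alg n)" "gen (Edge 1) : carrier (loop_alg n)" for i
    by (rule gen_loop, simp add: loop_gens_eq)+
  moreover have "unit_family n (completion (loop_alg n) (%f. PG.gnorm (perm_hom loop_rep f)))
      (%i. to_completion (loop_alg n) (%f. PG.gnorm (perm_hom loop_rep f)) (gen (Vertex i)))
      (to_completion (loop_alg n) (%f. PG.gnorm (perm_hom loop_rep f)) (gen (Edge 1))) \<longleftrightarrow>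
      unit_family n perm_alg (%i. perm_hom loop_rep (gen (Vertex i))) (perm_hom loop_rep (gen (Edge 1)))"
    by (rule unit_family_completion_iff[OF loop_facts(1) sn star_algebra_perm cstar_norm_perm hom])
      (simp_all only: gens)
  ultimately show ?thesis using sn by (simp only: loop_adm_iff simp_thms)
qed

lemma vnorm_loop_rep_le:
  assumes "2 <= n" and f: "f : carrier (loop_alg n)"
  shows "PG.vnorm (perm_hom loop_rep f) <= loop_norm n f"
  using vnorm_le_gnorm[OF star_homD(1)[OF perm_hom(1)[OF range_loop_rep] f]]
    loop_norm_ge[OF loop_rep_adm[OF assms(1)] f] by simp

text \<open>The unitaries \<open>u\<^sup>i v u\<^sup>-\<^sup>i\<close> for the self-adjoint unitary \<open>v = 2 p\<^sub>1 - 1\<close>.\<close>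

primrec conj_flip :: "nat => nat => (nat, nat) hypergraph_gen word => complex" where
  "conj_flip n 0 = 2 \<odot>\<^bsub>loop_alg n\<^esub> gen (Vertex 1) \<ominus>\<^bsub>loop_alg n\<^esub>
     (gen (Edge 1))\<^sup>\<star>\<^bsub>loop_alg n\<^esub> \<otimes>\<^bsub>loop_alg n\<^esub> gen (Edge 1)"
| "conj_flip n (Suc i) = gen (Edge 1) \<otimes>\<^bsub>loop_alg n\<^esub> (conj_flip n i \<otimes>\<^bsub>loop_alg n\<^esub> (gen (Edge 1))\<^sup>\<star>\<^bsub>loop_alg n\<^esub>)"

text \<open>In the definition s* s stands in for the unit q. The star-square of 2 p_1 - q is q,
  which gives norm at most 1; conjugation by the contraction s preserves this bound.\<close>

lemma conj_flip:
  assumes n: "2 <= n"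
  shows conj_flip_closed: "conj_flip n i : carrier (loop_alg n)"
    and perm_hom_conj_flip: "perm_hom loop_rep (conj_flip n i) = single (flip_head (int i))"
    and conj_flip_norm_le: "loop_norm n (conj_flip n i) <= 1"
proof -
  interpret L: star_algebra "loop_alg n" by (rule loop_facts(1))
  have g: "gen (Vertex 1) : carrier (loop_alg n)" "gen (Edge 1) : carrier (loop_alg n)"
    by (rule gen_loop, use n in "simp add: loop_gens_eq")+
  show cl: "conj_flip n i : carrier (loop_alg n)" for i by (induction i) (simp_all add: g)
  note hom = perm_hom(1)[OF range_loop_rep, where G="loop_gens n"] and h = star_homD(2-)[OF hom]
  have sh: "pinv shift \<circ> shift = id" "shift \<circ> pinv shift = id"
    using bij_shift by (simp_all add: bij_is_inj surj_iff[THEN iffD1] bij_is_surj)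
  show "perm_hom loop_rep (conj_flip n i) = single (flip_head (int i))"
  proof (induction i)
    case 0
    have "perm_hom loop_rep (conj_flip n 0) = 2 \<odot>\<^bsub>perm_alg\<^esub> loop_rep (Vertex 1) \<oplus>\<^bsub>perm_alg\<^esub>
        (- 1) \<odot>\<^bsub>perm_alg\<^esub> ((single shift)\<^sup>\<star>\<^bsub>perm_alg\<^esub> \<otimes>\<^bsub>perm_alg\<^esub> single shift)"
      using g by (simp add: L.minus_eq_s h perm_hom(4)[OF range_loop_rep] loop_rep_simps(4))
    also have "(single shift)\<^sup>\<star>\<^bsub>perm_alg\<^esub> \<otimes>\<^bsub>perm_alg\<^esub> single shift = single id"
      by (simp add: PM.star_single PM.mult_single bij_shift bij_imp_bij_inv sh)
    finally show ?case by (simp add: loop_rep_simps(1) flip_comb_def PM.alg_simps fun_eq_iff)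
  next
    case (Suc i)
    have "perm_hom loop_rep (conj_flip n (Suc i)) =
        single shift \<otimes>\<^bsub>perm_alg\<^esub> (single (flip_head (int i)) \<otimes>\<^bsub>perm_alg\<^esub> (single shift)\<^sup>\<star>\<^bsub>perm_alg\<^esub>)"
      using g cl by (simp add: h perm_hom(4)[OF range_loop_rep] loop_rep_simps(4) Suc)
    also have "... = single (shift \<circ> flip_head (int i) \<circ> pinv shift)"
      by (simp add: PM.star_single PM.mult_single bij_shift bij_imp_bij_inv bij_flip_head bij_comp o_assoc)
    also have "shift \<circ> flip_head (int i) \<circ> pinv shift = flip_head (int (Suc i))"
      unfolding shift_flip_head comp_assoc sh(2) by (simp add: add.commute)
    finally show ?case .
  qed
  have "p (conj_flip n i) <= 1" if p: "p : loop_adm n" for p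
  proof -
    have sn: "cstar_seminorm (loop_alg n) p" using p by (simp add: loop_adm_iff)
    interpret F: seminormed_star_algebra "loop_alg n" p by (rule seminormed_star_algebraI[OF loop_facts(1) sn])
    let ?K = "completion (loop_alg n) p" and ?j = "to_completion (loop_alg n) p"
    interpret K: normed_star_algebra ?K "anorm ?K" by (rule completion_normed) (rule F.seminormed_star_algebra_axioms)
    define P where "P = (%i. ?j (gen (Vertex i)))"
    define s where "s = ?j (gen (Edge 1))"
    have u: "unit_family n ?K P s" using p by (simp add: loop_adm_iff P_def s_def)
    define q where "q = s\<^sup>\<star>\<^bsub>?K\<^esub> \<otimes>\<^bsub>?K\<^esub> s"
    have q: "q = (\<Oplus>\<^bsub>?K\<^esub>i\<in>{1..n}. P i)" using u by (simp add: unit_family_def q_def)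
    have n1: "1 : {1..n}" using n by simp
    have pq: "q \<otimes>\<^bsub>?K\<^esub> P 1 = P 1" "P 1 \<otimes>\<^bsub>?K\<^esub> q = P 1" "projection ?K q" "projection ?K (P 1)"
      using K.unit_family_facts(1-3)[OF u] n1 u unfolding q by (auto simp: unit_family_def)
    then have [simp]: "P 1 : carrier ?K" "q : carrier ?K" and st: "(P 1)\<^sup>\<star>\<^bsub>?K\<^esub> = P 1" "q\<^sup>\<star>\<^bsub>?K\<^esub> = q"
      and pp: "P 1 \<otimes>\<^bsub>?K\<^esub> P 1 = P 1" "q \<otimes>\<^bsub>?K\<^esub> q = q" by (auto simp: projection_def)
    have [simp]: "s : carrier ?K" using u by (simp add: unit_family_def)
    note j = star_homD[OF F.to_completion_hom]
    have norm: "p f = anorm ?K (?j f)" if "f : carrier (loop_alg n)" for f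
      using F.anorm_to_completion[OF that] by simp
    have "anorm ?K (?j (conj_flip n i)) <= 1"
    proof (induction i)
      case 0
      have x: "?j (conj_flip n 0) = 2 \<odot>\<^bsub>?K\<^esub> P 1 \<oplus>\<^bsub>?K\<^esub> (- 1) \<odot>\<^bsub>?K\<^esub> q"
        using g by (simp add: L.minus_eq_s j P_def q_def s_def)
      have "(?j (conj_flip n 0))\<^sup>\<star>\<^bsub>?K\<^esub> \<otimes>\<^bsub>?K\<^esub> ?j (conj_flip n 0) =
          (4 \<odot>\<^bsub>?K\<^esub> P 1 \<oplus>\<^bsub>?K\<^esub> (- 2) \<odot>\<^bsub>?K\<^esub> P 1) \<oplus>\<^bsub>?K\<^esub> ((- 2) \<odot>\<^bsub>?K\<^esub> P 1 \<oplus>\<^bsub>?K\<^esub> q)"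
        unfolding x by (simp add: K.star_add K.star_smult K.distrib_left K.distrib_right K.smult_mult_left
            K.smult_mult_right K.s_assoc K.s_add_right st pp pq K.M.a_ac)
      also have "... = q" by (simp flip: K.M.a_assoc K.s_add_left)
      finally have "(anorm ?K (?j (conj_flip n 0)))^2 = anorm ?K q"
        using K.N_star_mult[of "?j (conj_flip n 0)"] j(1)[OF cl[of 0]] by (simp del: conj_flip.simps)
      also have "anorm ?K q = (anorm ?K s)^2" unfolding q_def by (rule K.N_star_mult) simp
      also have "... <= 1^2" using K.unit_family_norm_le(2)[OF u] by (intro power_mono) auto
      finally show ?case by (rule power2_le_imp_le) simp
    next
      case (Suc i)
      let ?x = "?j (conj_flip n i)"
      have x [simp]: "?x : carrier ?K" by (rule j(1)[OF cl])
      have s1: "anorm ?K s <= 1" by (rule K.unit_family_norm_le(2)[OF u])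
      have "?j (conj_flip n (Suc i)) = s \<otimes>\<^bsub>?K\<^esub> (?x \<otimes>\<^bsub>?K\<^esub> s\<^sup>\<star>\<^bsub>?K\<^esub>)"
        using g cl by (simp add: j s_def)
      then have "anorm ?K (?j (conj_flip n (Suc i))) <= anorm ?K s * anorm ?K (?x \<otimes>\<^bsub>?K\<^esub> s\<^sup>\<star>\<^bsub>?K\<^esub>)"
        by (simp add: K.N_mult)
      also have "... <= 1 * (anorm ?K ?x * anorm ?K (s\<^sup>\<star>\<^bsub>?K\<^esub>))"
        using s1 by (intro mult_mono K.N_mult) auto
      also have "... <= 1 * (1 * 1)" using s1 Suc by (intro mult_mono) (auto simp: K.N_star)
      finally show ?case by simp
    qed
    then show ?thesis by (simp add: norm cl)
  qed
  then show "loop_norm n (conj_flip n i) <= 1"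
    unfolding loop_norm_def by (intro cSUP_least loop_adm_nonempty)
qed

section \<open>Transport of structure\<close>

definition transport :: "('a => 'b) => 'a normed_star_alg => 'b normed_star_alg" where
  "transport \<iota> A = (let psi = inv_into (carrier A) \<iota> in
     \<lparr>carrier = \<iota> ` carrier A, mult = (%x y. \<iota> (psi x \<otimes>\<^bsub>A\<^esub> psi y)), one = \<iota> \<one>\<^bsub>A\<^esub>, zero = \<iota> \<zero>\<^bsub>A\<^esub>,
      add = (%x y. \<iota> (psi x \<oplus>\<^bsub>A\<^esub> psi y)), smult = (%c x. \<iota> (c \<odot>\<^bsub>A\<^esub> psi x)), star = (%x. \<iota> ((psi x)\<^sup>\<star>\<^bsub>A\<^esub>)),
      anorm = (%x. anorm A (psi x))\<rparr>)"

lemma transport: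
  assumes A: "cstar_algebra A" and inj: "inj_on \<iota> (carrier A)"
  shows "cstar_algebra (transport \<iota> A)" "star_hom A (transport \<iota> A) \<iota>"
    "star_hom (transport \<iota> A) A (inv_into (carrier A) \<iota>)"
    "carrier (transport \<iota> A) = \<iota> ` carrier A"
proof -
  let ?T = "transport \<iota> A" and ?psi = "inv_into (carrier A) \<iota>"
  have sA: "star_algebra A" and nA: "cstar_norm A (anorm A)" using A by (auto simp: cstar_algebra_def)
  interpret A: normed_star_algebra A "anorm A" by (rule normed_star_algebraI[OF sA nA])
  show car: "carrier ?T = \<iota> ` carrier A" by (simp add: transport_def Let_def)
  have inv: "?psi (\<iota> x) = x" if "x : carrier A" for x using inj that by simp
  show hom: "star_hom A ?T \<iota>"
    unfolding star_hom_def by (simp add: transport_def Let_def inv)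
  have sT: "star_algebra ?T"
    by (rule star_algebra_image[OF sA _ hom]) (simp_all add: transport_def Let_def)
  interpret T: star_algebra ?T by (rule sT)
  have all: "(\<forall>x\<in>carrier ?T. Q x) \<longleftrightarrow> (\<forall>x\<in>carrier A. Q (\<iota> x))" for Q unfolding car by blast
  note h = star_homD(2-)[OF hom, symmetric]
  show hom': "star_hom ?T A ?psi"
    unfolding star_hom_def all by (simp add: h inv)
  have an: "anorm ?T x = anorm A (?psi x)" for x by (simp add: transport_def Let_def)
  have zero: "\<zero>\<^bsub>?T\<^esub> = \<iota> \<zero>\<^bsub>A\<^esub>" by (simp add: transport_def Let_def)
  have "cstar_norm ?T (anorm ?T)"
    unfolding cstar_norm_def cstar_seminorm_def all
    by (simp add: h an inv A.N_smult A.N_triangle A.N_mult A.N_star_mult zero) (use A.N_definite in blast)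
  moreover have "\<exists>x\<in>carrier ?T. (%n. anorm ?T (sig n \<ominus>\<^bsub>?T\<^esub> x)) \<longlonglongrightarrow> 0"
    if s: "sig : cauchy_seqs ?T (anorm ?T)" for sig
  proof -
    have cl: "sig n : carrier ?T" for n using s by (simp add: cauchy_seqs_def)
    have m: "anorm ?T (x \<ominus>\<^bsub>?T\<^esub> y) = anorm A (?psi x \<ominus>\<^bsub>A\<^esub> ?psi y)" if "x : carrier ?T" "y : carrier ?T" for x y
      using star_hom_minus[OF sT sA hom' that] by (simp add: an)
    have "(%n. ?psi (sig n)) : cauchy_seqs A (anorm A)"
      using s star_homD(1)[OF hom' cl] by (simp add: cauchy_seqs_def m[OF cl cl])
    then obtain x where x: "x : carrier A" "(%n. anorm A (?psi (sig n) \<ominus>\<^bsub>A\<^esub> x)) \<longlonglongrightarrow> 0"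
      using A by (auto simp: cstar_algebra_def)
    then show ?thesis using cl by (intro bexI[of _ "\<iota> x"]) (simp_all add: m car inv)
  qed
  ultimately show "cstar_algebra ?T" using sT by (simp add: cstar_algebra_def)
qed

context gns
begin

text \<open>The GNS representation is faithful on the completion in its own norm. Let
  \<open>sig\<close> represent X. For v fixed and y = sig n v, the coefficients of sig m between y
  and v tend to 0 as m grows, while they stay close to the squared norm of y once n and m are large.
  So y is small relative to v, uniformly in v.\<close>

lemma coefficients_separate:
  assumes bd: "bounded_functional D gnorm C \<omega>" and X: "X : carrier (completion D gnorm)"
    and zero: "!!z w. z : carrier D ==> w : carrier D ==>
      seminormed_star_algebra.extend_functional D gnorm \<omega> ((to_completion D gnorm z)\<^sup>\<star>\<^bsub>completion D gnorm\<^esub>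
        \<otimes>\<^bsub>completion D gnorm\<^esub> (X \<otimes>\<^bsub>completion D gnorm\<^esub> to_completion D gnorm w)) = 0"
  shows "X = \<zero>\<^bsub>completion D gnorm\<^esub>"
proof -
  interpret N: seminormed_star_algebra D gnorm
    by (rule seminormed_star_algebraI[OF star_algebra_axioms cstar_seminorm_gnorm])
  obtain sig where s: "sig : cauchy_seqs D gnorm" "X = N.cls sig" using X by (rule N.carrier_completion_cases)
  note cl = N.cauchy_closed[OF s(1)]
  have lim: "(%m. \<omega> (z\<^sup>\<star> \<otimes> (sig m \<otimes> w))) \<longlonglongrightarrow> 0" if "z : carrier D" "w : carrier D" for z w
  proof -
    have zc: "z\<^sup>\<star> : carrier D" using that by simp
    note c1 = N.cauchy_mult[OF s(1) N.cauchy_const[OF that(2)]] and c2 = N.cauchy_const[OF zc]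
    show ?thesis
      using N.extend_functional_tendsto[OF bd N.cauchy_mult[OF c2 c1]] zero[OF that]
      by (simp add: s(2) N.to_completion_cls N.cls_unary(2)[OF N.cauchy_const[OF that(1)]]
          N.cls_ops(2)[OF s(1) N.cauchy_const[OF that(2)]] N.cls_ops(2)[OF c2 c1])
  qed
  have "(%n. gnorm (sig n)) \<longlonglongrightarrow> 0"
  proof (rule LIMSEQ_I)
    fix e :: real assume e: "0 < e"
    then obtain M where M: "\<forall>m\<ge>M. \<forall>n\<ge>M. gnorm (sig m \<ominus> sig n) < e/2" using N.cauchyD[OF s(1), of "e/2"] by auto
    have "gnorm (sig n) <= e/2" if n: "n >= M" for n
    proof (rule gnorm_least)
      fix v assume v: "v : carrier D"
      let ?y = "sig n \<otimes> v"
      have y: "?y : carrier D" using v cl by simp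
      have b: "cmod (\<omega> (?y\<^sup>\<star> \<otimes> ?y) - \<omega> (?y\<^sup>\<star> \<otimes> (sig m \<otimes> v))) <= vnorm ?y * (e/2 * vnorm v)" if m: "m >= M" for m
      proof -
        have d: "sig n \<ominus> sig m : carrier D" using cl by simp
        have "\<omega> (?y\<^sup>\<star> \<otimes> ?y) - \<omega> (?y\<^sup>\<star> \<otimes> (sig m \<otimes> v)) = \<omega> (?y\<^sup>\<star> \<otimes> ((sig n \<ominus> sig m) \<otimes> v))"
          using cl v y by (simp add: minus_mult_left minus_mult_right
              functional_minus[OF positive_imp_linear_functional[OF positive]])
        also have "cmod ... <= vnorm ?y * vnorm ((sig n \<ominus> sig m) \<otimes> v)"
          by (rule cauchy_schwarz) (use d v y in auto)
        also have "... <= vnorm ?y * (gnorm (sig n \<ominus> sig m) * vnorm v)"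
          by (intro mult_left_mono gnorm_bound) (use d v y in auto)
        also have "... <= vnorm ?y * (e/2 * vnorm v)"
          using M m n v y by (intro mult_left_mono mult_right_mono) (auto intro: less_imp_le)
        finally show ?thesis .
      qed
      have "cmod (\<omega> (?y\<^sup>\<star> \<otimes> ?y) - 0) <= vnorm ?y * (e/2 * vnorm v)"
        by (rule LIMSEQ_le_const2[OF tendsto_norm[OF tendsto_diff[OF tendsto_const lim[OF y v]]]]) (use b in blast)
      then have "vnorm ?y * vnorm ?y <= vnorm ?y * (e/2 * vnorm v)"
        unfolding vnorm_square[OF y] by (simp add: norm_power) (simp add: power2_eq_square)
      then show "vnorm ?y <= e/2 * vnorm v"
        using vnorm_nonneg[OF y] vnorm_nonneg[OF v] e by (cases "vnorm ?y = 0") (auto simp: less_le)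
    qed (use e in simp)
    then show "\<exists>M. \<forall>n\<ge>M. norm (gnorm (sig n) - 0) < e"
      using e gnorm_bound(1)[OF cl] by (intro exI[of _ M]) fastforce
  qed
  then have "N.cls sig = N.cls (%n. \<zero>)"
    using s(1) cl by (simp add: N.cls_eq_iff N.cauchy_const minus_eq_s)
  then show ?thesis by (simp add: s(2) N.cls_zero)
qed

end

section \<open>Two tensor norms\<close>

lemma (in star_algebra) finsum_product:
  assumes "finite I" "finite J" "!!i j. i : I ==> j : J ==> m (i, j) : carrier A"
  shows "(\<Oplus>k\<in>I \<times> J. m k) = (\<Oplus>i\<in>I. \<Oplus>j\<in>J. m (i, j))"
  using assms(1,3)
proof (induction I rule: finite_induct)
  case empty
  show ?case by simp
next
  case (insert i I)
  have U: "insert i I \<times> J = Pair i ` J \<union> I \<times> J" by auto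
  have "(\<Oplus>k\<in>insert i I \<times> J. m k) = (\<Oplus>k\<in>Pair i ` J. m k) \<oplus> (\<Oplus>k\<in>I \<times> J. m k)"
    unfolding U by (rule M.finsum_Un_disjoint) (use insert assms(2) in auto)
  also have "(\<Oplus>k\<in>Pair i ` J. m k) = (\<Oplus>j\<in>J. m (i, j))"
    by (rule M.finsum_reindex) (use insert.prems in "auto simp: inj_on_def")
  finally show ?case using insert by (simp add: finsum_ins finsum_cl)
qed

lemma (in gns) vnorm_finsum_le:
  assumes "finite T" "!!i. i : T ==> m i : carrier D"
  shows "vnorm (\<Oplus>i\<in>T. m i) <= (\<Sum>i\<in>T. vnorm (m i))"
  using assms
proof (induction T rule: finite_induct)
  case empty
  show ?case using vnorm_smult[of \<zero> 0] by simp
next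
  case (insert i T)
  then show ?case using vnorm_triangle[of "m i" "\<Oplus>i\<in>T. m i"] by (simp add: finsum_ins finsum_cl)
qed

context star_algebra_pair
begin

text \<open>The representation of f by c, a, b may have repetitions, as happens for the product of
  two combinations.\<close>

lemma pairing_star_mult_gram:
  assumes f: "f : carrier \<D>" and rep: "!!m. pairing f m = (\<Sum>j\<in>J. c j * m (a j, b j))"
  shows "pairing (f\<^sup>\<star>\<^bsub>\<D>\<^esub> \<otimes>\<^bsub>\<D>\<^esub> f) (%(a, b). W a b) = gram A B W J c a b"
  by (simp add: tensor_pairing_mult tensor_pairing_star f D.star_closed rep gram_def sum_distrib_left mult_ac)

lemma linear_pairing: "linear_functional \<D> (%f. pairing f m)"
  by (simp add: linear_functional_def tensor_simps pairing_add pairing_smult tensor_finite)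

end

section \<open>The second tensor factor\<close>

definition flip_rep :: "nat => (int list => int list) => complex" where
  "flip_rep i = single (flip_head (int i))"

abbreviation "flip_alg == free_unital_star_alg (UNIV :: nat set)"
abbreviation "flip_hom == perm_hom flip_rep"

lemma range_flip_rep: "range flip_rep \<subseteq> carrier perm_alg"
  by (auto simp: flip_rep_def single_perm_closed)

lemmas flip_facts = free_unital_star_alg_facts[where G="UNIV :: nat set", simplified]
lemmas star_hom_flip = perm_hom(2)[OF range_flip_rep, where G=UNIV]

lemma flip_hom_gen: "flip_hom (gen i) = single (flip_head (int i))"
  by (simp add: perm_hom(4)[OF range_flip_rep] flip_rep_def)

lemma flip_hom_one: "flip_hom (single []) = single id"
  by (simp add: perm_hom(3)[OF range_flip_rep] perm_word_def)

lemma gen_flip: "gen i : carrier flip_alg"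
  unfolding gen_def by (rule flip_facts(2))

interpretation PS: seminormed_star_algebra perm_alg PG.gnorm
  by (rule seminormed_star_algebraI[OF star_algebra_perm PG.cstar_seminorm_gnorm])

text \<open>The free algebra is used as dense algebra because its words are countable. The seminorm
  obtained is the operator norm of \<open>flip_hom b\<close> on the span of the words in the
  flips.\<close>

interpretation FG: gns flip_alg "%b. trace (flip_hom b)" "%b. PG.gnorm (flip_hom b)" 1
proof -
  interpret star_algebra flip_alg by (rule flip_facts(1))
  note h = star_homD[OF star_hom_flip]
  show "gns flip_alg (%b. trace (flip_hom b)) (%b. PG.gnorm (flip_hom b)) 1"
  proof
    show "positive_functional flip_alg (%b. trace (flip_hom b))"
      by (simp add: positive_functional_def h PG.om_add PG.om_smult PG.om_pos PG.om_real)
    fix x assume x: "x : carrier flip_alg"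
    show "cmod (trace (flip_hom x)) <= 1 * PG.gnorm (flip_hom x)"
      using trace_le_vnorm[OF h(1)[OF x]] vnorm_le_gnorm[OF h(1)[OF x]] by simp
  qed (simp_all add: h PS.N_mult PS.N_star)
qed

interpretation FS: seminormed_star_algebra flip_alg FG.gnorm
  by (rule seminormed_star_algebraI[OF flip_facts(1) FG.cstar_seminorm_gnorm])

lemma vnorm_flip_hom_le:
  assumes b: "b : carrier flip_alg" shows "PG.vnorm (flip_hom b) <= FG.gnorm b"
proof -
  have v: "FG.vnorm x = PG.vnorm (flip_hom x)" if "x : carrier flip_alg" for x
    using that by (simp add: FG.vnorm_def PG.vnorm_def star_homD[OF star_hom_flip])
  have "single [] : carrier flip_alg" by (rule flip_facts(2))
  with FG.gnorm_bound(2)[OF b this] b show ?thesis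
    by (simp add: v star_homD[OF star_hom_flip] flip_hom_one single_id vnorm_single)
qed

lemma bounded_flip_trace: "bounded_functional flip_alg FG.gnorm 1 (%b. trace (flip_hom b))"
  unfolding bounded_functional_def
proof (intro conjI ballI linear_functional_hom[OF linear_trace star_hom_flip])
  fix x assume x: "x : carrier flip_alg"
  show "cmod (trace (flip_hom x)) <= 1 * FG.gnorm x"
    using trace_le_vnorm[OF star_homD(1)[OF star_hom_flip x]] vnorm_flip_hom_le[OF x] by simp
qed

abbreviation "flip_cstar == completion flip_alg FG.gnorm"
abbreviation "flip_incl == to_completion flip_alg FG.gnorm"
abbreviation "flip_state == FS.extend_functional (%b. trace (flip_hom b))"

interpretation FK: star_algebra flip_cstar by (rule FS.star_algebra_completion)

lemmas flip_state_linear = linear_functionalD[OF bounded_functionalD(1)[OF FS.bounded_extend_functional[OF bounded_flip_trace]]]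
lemmas flip_incl_closed = star_homD(1)[OF FS.to_completion_hom]

definition flip_coeff :: "nat word => nat word => (nat => nat word => complex) set => complex" where
  "flip_coeff z w X = flip_state ((flip_incl (single z))\<^sup>\<star>\<^bsub>flip_cstar\<^esub> \<otimes>\<^bsub>flip_cstar\<^esub>
     (X \<otimes>\<^bsub>flip_cstar\<^esub> flip_incl (single w)))"

lemma linear_flip_coeff: "linear_functional flip_cstar (flip_coeff z w)"
  using flip_incl_closed[OF flip_facts(2)]
  by (simp add: linear_functional_def flip_coeff_def FK.distrib_right FK.distrib_left FK.smult_mult_left
      FK.smult_mult_right flip_state_linear)

text \<open>Coefficients at words determine those at all elements of the dense algebra, by linearity
  in each argument.\<close>

lemma flip_coeff_separates:
  assumes X: "X : carrier flip_cstar" and zero: "!!z w. flip_coeff z w X = 0"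
  shows "X = \<zero>\<^bsub>flip_cstar\<^esub>"
proof (rule FG.coefficients_separate[OF bounded_flip_trace X])
  note c = flip_incl_closed[OF flip_facts(2)] and h = star_homD(2-)[OF FS.to_completion_hom]
  have state0: "flip_state \<zero>\<^bsub>flip_cstar\<^esub> = 0" using flip_state_linear(2)[OF FK.M.zero_closed, of 0] by simp
  have incl0: "flip_incl \<zero>\<^bsub>flip_alg\<^esub> = \<zero>\<^bsub>flip_cstar\<^esub>"
    by (rule star_hom_zero[OF flip_facts(1) FK.star_algebra_axioms FS.to_completion_hom])
  let ?f = "%z w. flip_state ((flip_incl z)\<^sup>\<star>\<^bsub>flip_cstar\<^esub> \<otimes>\<^bsub>flip_cstar\<^esub> (X \<otimes>\<^bsub>flip_cstar\<^esub> flip_incl w))"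
  have one: "?f z (single w) = 0" if "z : carrier flip_alg" for z w
    using that
  proof (induction rule: free_unital_induct)
    case zero
    then show ?case using X c by (simp add: incl0 state0)
  next
    case (add d v g)
    then show ?case using X c[of v] c[of w] flip_incl_closed[OF add.hyps(1)] zero[of v w] flip_facts(2)[of v]
      by (simp add: h FK.star_add FK.star_smult FK.distrib_right FK.smult_mult_left flip_state_linear flip_coeff_def)
  qed
  show "?f z w = 0" if z: "z : carrier flip_alg" and w: "w : carrier flip_alg" for z w
    using w
  proof (induction rule: free_unital_induct)
    case zero
    then show ?case using X flip_incl_closed[OF z] by (simp add: incl0 state0)
  next
    case (add d v g)
    then show ?case using X c[of v] flip_incl_closed[OF z] flip_incl_closed[OF add.hyps(1)] one[OF z] flip_facts(2)[of v]
      by (simp add: h FK.distrib_left FK.smult_mult_right flip_state_linear)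
  qed
qed

text \<open>The countably many matrix coefficients at words embed the completion into \<open>nat \<Rightarrow> complex\<close>,
  the type to which nuclearity restricts the second tensor factor.\<close>

definition flip_embed :: "(nat => nat word => complex) set => nat => complex" where
  "flip_embed X k = (case from_nat k of (z, w) => flip_coeff z w X)"

lemma inj_flip_embed: "inj_on flip_embed (carrier flip_cstar)"
proof (rule inj_onI)
  fix X Y assume X: "X : carrier flip_cstar" and Y: "Y : carrier flip_cstar" and eq: "flip_embed X = flip_embed Y"
  have "flip_coeff z w X = flip_coeff z w Y" for z w
    using fun_cong[OF eq, of "to_nat (z, w)"] by (simp add: flip_embed_def)
  then have "X \<ominus>\<^bsub>flip_cstar\<^esub> Y = \<zero>\<^bsub>flip_cstar\<^esub>"
    using X Y by (intro flip_coeff_separates) (auto simp: FK.functional_minus[OF linear_flip_coeff])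
  then show "X = Y" using X Y by (simp add: FK.minus_zero_iff)
qed

definition "flip_target = transport flip_embed flip_cstar"

abbreviation "flip_inv == inv_into (carrier flip_cstar) flip_embed"
abbreviation "flip_elt b == flip_embed (flip_incl b)"

lemmas flip_target = transport[OF FS.cstar_algebra_completion inj_flip_embed, folded flip_target_def]

lemma star_algebra_flip_target: "star_algebra flip_target"
  using flip_target(1) by (simp add: cstar_algebra_def)

interpretation FT: star_algebra flip_target by (rule star_algebra_flip_target)

lemmas flip_inv_hom = star_homD[OF flip_target(3)]

lemma flip_elt: "b : carrier flip_alg ==> flip_elt b : carrier flip_target"
  "b : carrier flip_alg ==> flip_inv (flip_elt b) = flip_incl b"
  using flip_incl_closed inj_flip_embed by (auto simp: flip_target(4))

lemma flip_elt_mult: "b : carrier flip_alg ==> b' : carrier flip_alg ==>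
    flip_elt (b \<otimes>\<^bsub>flip_alg\<^esub> b') = flip_elt b \<otimes>\<^bsub>flip_target\<^esub> flip_elt b'"
  "b : carrier flip_alg ==> flip_elt (b\<^sup>\<star>\<^bsub>flip_alg\<^esub>) = (flip_elt b)\<^sup>\<star>\<^bsub>flip_target\<^esub>"
  using flip_incl_closed by (simp_all add: star_homD[OF FS.to_completion_hom] star_homD[OF flip_target(2)])

text \<open>The flip is its own inverse, so left multiplication translates the argument by the flip
  itself.\<close>

lemma flip_hom_mult_gen:
  assumes b: "b : carrier flip_alg"
  shows "flip_hom (gen i \<otimes>\<^bsub>flip_alg\<^esub> b) g = flip_hom b (flip_head (int i) \<circ> g)"
proof -
  note c = star_homD(1)[OF star_hom_flip b]
  have eq: "flip_head j \<circ> t = g \<longleftrightarrow> t = flip_head j \<circ> g" for j and t :: "int list => int list" by auto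
  have "flip_hom (gen i \<otimes>\<^bsub>flip_alg\<^esub> b) g = pairing (flip_hom b) (%t. if t = flip_head (int i) \<circ> g then 1 else 0)"
    using b gen_flip by (simp add: star_homD[OF star_hom_flip] flip_hom_gen PM.alg_finite c
        PM.alg_finite[OF single_perm_closed(2)] PM.mult_pairing eq)
  then show ?thesis by (simp add: pairing_indicator PM.alg_finite c)
qed

section \<open>The two seminorms on the tensor product with the hypergraph algebra\<close>

context
  fixes n :: nat
  assumes n: "2 <= n"
begin

abbreviation "LA == completion (loop_alg n) (loop_norm n)"
abbreviation "incl == to_completion (loop_alg n) (loop_norm n)"
abbreviation "target_norm b == anorm flip_cstar (flip_inv b)"
abbreviation "\<TT> == free_tensor_alg LA flip_target"

interpretation LS: seminormed_star_algebra "loop_alg n" "loop_norm n"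
  by (rule seminormed_star_algebraI[OF loop_facts(1) cstar_seminorm_loop_norm])

interpretation LA: normed_star_algebra LA "anorm LA"
  by (rule completion_normed) (rule LS.seminormed_star_algebra_axioms)

interpretation LT: star_algebra_pair LA flip_target
  by unfold_locales

lemmas incl_hom = star_homD[OF LS.to_completion_hom]

definition conj_elt :: "nat => (nat => (nat, nat) hypergraph_gen word => complex) set" where
  "conj_elt i = incl (conj_flip n i)"

lemma conj_elt: "conj_elt i : carrier LA" "anorm LA (conj_elt i) <= 1"
  unfolding conj_elt_def using conj_flip[OF n, of i] by (simp_all add: incl_hom(1) LS.anorm_to_completion)

definition tensor_elt :: "(nat => (nat, nat) hypergraph_gen word => complex) set \<times> (nat => complex) => complex" where
  "tensor_elt = (\<Oplus>\<^bsub>\<TT>\<^esub>i\<in>{..<5}. single (conj_elt i, flip_elt (gen i)))"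

lemma tensor_elt_closed: "tensor_elt : carrier \<TT>"
  unfolding tensor_elt_def by (rule LT.D.finsum_cl) (simp add: conj_elt flip_elt gen_flip)

lemma pairing_tensor_elt: "pairing tensor_elt m = (\<Sum>i<5. m (conj_elt i, flip_elt (gen i)))"
  unfolding tensor_elt_def
  by (subst LT.D.functional_finsum[OF LT.linear_pairing]) (simp_all add: conj_elt flip_elt gen_flip)

lemma pairing_tensor_elt_mult:
  assumes y: "y : carrier \<TT>" and rep: "!!m. pairing y m = (\<Sum>j\<in>J. c j * m (a j, b j))"
  shows "pairing (tensor_elt \<otimes>\<^bsub>\<TT>\<^esub> y) m = (\<Sum>k\<in>{..<5} \<times> J. c (snd k) *
    m (conj_elt (fst k) \<otimes>\<^bsub>LA\<^esub> a (snd k), flip_elt (gen (fst k)) \<otimes>\<^bsub>flip_target\<^esub> b (snd k)))"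
  by (simp add: LT.tensor_pairing_mult tensor_elt_closed y pairing_tensor_elt rep sum.cartesian_product')

text \<open>The constant 2 is the one delivered by \<open>positive_functional_exists\<close>; a
  common bound makes the supremum over all these functionals finite.\<close>

definition functionals :: "((nat => (nat, nat) hypergraph_gen word => complex) set => complex) set" where
  "functionals = {F. positive_functional LA F \<and> (\<forall>x\<in>carrier LA. cmod (F x) <= 2 * anorm LA x)}"

text \<open>Written as an extension from the dense algebra so that it is a
  \<open>tensor_form\<close> by construction; \<open>product_form_eq\<close> recovers the product of
  F with the extended trace.\<close>

definition product_form :: "((nat => (nat, nat) hypergraph_gen word => complex) set => complex) =>
    (nat => (nat, nat) hypergraph_gen word => complex) set => (nat => complex) => complex" where
  "product_form F = (%a b. FS.extend_functional (%b. F a * trace (flip_hom b)) (flip_inv b))"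

lemma tensor_form_product_trace:
  "F : functionals ==> tensor_form LA flip_alg (anorm LA) FG.gnorm (%a b. F a * trace (flip_hom b)) 2"
  by (rule tensor_form_trace[OF LA.star_algebra_axioms LA.cstar_seminorm _ _ flip_facts(1)
        FG.cstar_seminorm_gnorm star_hom_flip vnorm_flip_hom_le]) (auto simp: functionals_def)

lemma tensor_form_product:
  "F : functionals ==> tensor_form LA flip_target (anorm LA) target_norm (product_form F) 2"
  unfolding product_form_def
  by (rule tensor_form.tensor_form_extend[OF tensor_form_product_trace star_algebra_flip_target flip_target(3)])

lemma product_form_eq:
  assumes b: "b : carrier flip_target"
  shows "product_form F a b = F a * flip_state (flip_inv b)"
proof -
  obtain tau where t: "tau : cauchy_seqs flip_alg FG.gnorm" "flip_inv b = FS.cls tau"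
    using flip_inv_hom(1)[OF b] by (rule FS.carrier_completion_cases)
  have "bounded_functional flip_alg FG.gnorm (cmod (F a)) (%b. F a * trace (flip_hom b))"
    using bounded_flip_trace
    by (auto simp: bounded_functional_def linear_functional_def ring_distribs norm_mult intro!: mult_left_mono)
  from FS.extend_functional_tendsto[OF this t(1)]
    tendsto_mult_left[OF FS.extend_functional_tendsto[OF bounded_flip_trace t(1)], of "F a"]
  show ?thesis unfolding product_form_def t(2) by (rule LIMSEQ_unique)
qed

text \<open>Multiplication by the test element turns the function D into D', where D' g is the sum
  over i of \<open>conj_elt i\<close> times D at \<open>flip_head (int i) \<circ> g\<close>. The
  factors \<open>conj_elt i\<close> are contractions for the seminorm of F, so the scalar inequality
  \<open>flip_head_sum_square\<close> applies to the seminorms of the values of D.\<close>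

lemma product_gram_bound:
  assumes F: "F : functionals" and J: "finite J" "!!j. j : J ==> a j : carrier LA" "!!j. j : J ==> b j : carrier flip_alg"
  shows "Re (gram LA flip_alg (%a b. F a * trace (flip_hom b)) ({..<5} \<times> J) (%k. c (snd k))
      (%k. conj_elt (fst k) \<otimes>\<^bsub>LA\<^esub> a (snd k)) (%k. gen (fst k) \<otimes>\<^bsub>flip_alg\<^esub> b (snd k))) \<le>
    20 * Re (gram LA flip_alg (%a b. F a * trace (flip_hom b)) J c a b)"
proof -
  interpret GF: gns LA F "anorm LA" 2
    by unfold_locales (use F in "auto simp: functionals_def LA.N_mult LA.N_star")
  note Fl = positive_imp_linear_functional[OF GF.positive]
  define T where "T = (\<Union>j\<in>J. {g. flip_hom (b j) g ~= 0})"
  define T' where "T' = (\<Union>i<(5::nat). (%g. flip_head (int i) \<circ> g) ` T)"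
  define D where "D = (%g. \<Oplus>\<^bsub>LA\<^esub>j\<in>J. (c j * flip_hom (b j) g) \<odot>\<^bsub>LA\<^esub> a j)"
  define D' where "D' = (%g. \<Oplus>\<^bsub>LA\<^esub>k\<in>{..<5} \<times> J. (c (snd k) * flip_hom (gen (fst k) \<otimes>\<^bsub>flip_alg\<^esub> b (snd k)) g) \<odot>\<^bsub>LA\<^esub>
      (conj_elt (fst k) \<otimes>\<^bsub>LA\<^esub> a (snd k)))"
  have T: "finite T" "finite T'"
    using J PM.alg_finite[OF star_homD(1)[OF star_hom_flip J(3)]] by (simp_all add: T_def T'_def)
  have Dc: "D g : carrier LA" for g unfolding D_def by (rule LA.finsum_cl) (simp add: J)
  have zero': "flip_hom (gen i \<otimes>\<^bsub>flip_alg\<^esub> b j) g = 0" if "i < 5" "j : J" "g ~: T'" for i j g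
  proof (rule ccontr)
    assume "flip_hom (gen i \<otimes>\<^bsub>flip_alg\<^esub> b j) g ~= 0"
    then have "flip_head (int i) \<circ> g : T" using that J by (auto simp: flip_hom_mult_gen T_def)
    then have "flip_head (int i) \<circ> (flip_head (int i) \<circ> g) : T'" using that(1) unfolding T'_def by blast
    then show False using that(3) by simp
  qed
  have g1: "gram LA flip_alg (%a b. F a * trace (flip_hom b)) J c a b = (\<Sum>g\<in>T. F ((D g)\<^sup>\<star>\<^bsub>LA\<^esub> \<otimes>\<^bsub>LA\<^esub> D g))"
    by (rule gram_trace[where psi=flip_hom and a=a and b=b and c=c,
          OF LA.star_algebra_axioms Fl star_hom_flip flip_facts(1) _ _ _ T(1) _ D_def])
      (use J in "auto simp: T_def")
  have g2: "gram LA flip_alg (%a b. F a * trace (flip_hom b)) ({..<5} \<times> J) (%k. c (snd k))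
      (%k. conj_elt (fst k) \<otimes>\<^bsub>LA\<^esub> a (snd k)) (%k. gen (fst k) \<otimes>\<^bsub>flip_alg\<^esub> b (snd k)) =
      (\<Sum>g\<in>T'. F ((D' g)\<^sup>\<star>\<^bsub>LA\<^esub> \<otimes>\<^bsub>LA\<^esub> D' g))"
    by (rule gram_trace[where psi=flip_hom and a="%k. conj_elt (fst k) \<otimes>\<^bsub>LA\<^esub> a (snd k)" and
          b="%k. gen (fst k) \<otimes>\<^bsub>flip_alg\<^esub> b (snd k)" and c="%k. c (snd k)",
          OF LA.star_algebra_axioms Fl star_hom_flip flip_facts(1) _ _ _ T(2) _ D'_def])
      (use J zero' in "auto simp: conj_elt gen_flip")
  have D'_eq: "D' g = (\<Oplus>\<^bsub>LA\<^esub>i\<in>{..<5}. conj_elt i \<otimes>\<^bsub>LA\<^esub> D (flip_head (int i) \<circ> g))" for g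
  proof -
    have "D' g = (\<Oplus>\<^bsub>LA\<^esub>i\<in>{..<5}. \<Oplus>\<^bsub>LA\<^esub>j\<in>J. (c j * flip_hom (gen i \<otimes>\<^bsub>flip_alg\<^esub> b j) g) \<odot>\<^bsub>LA\<^esub> (conj_elt i \<otimes>\<^bsub>LA\<^esub> a j))"
      unfolding D'_def by (subst LA.finsum_product) (simp_all add: J conj_elt)
    also have "... = (\<Oplus>\<^bsub>LA\<^esub>i\<in>{..<5}. conj_elt i \<otimes>\<^bsub>LA\<^esub> D (flip_head (int i) \<circ> g))"
    proof (rule LA.finsum_cong)
      fix i
      show "conj_elt i \<otimes>\<^bsub>LA\<^esub> D (flip_head (int i) \<circ> g) : carrier LA" by (simp add: conj_elt Dc)
      show "(\<Oplus>\<^bsub>LA\<^esub>j\<in>J. (c j * flip_hom (gen i \<otimes>\<^bsub>flip_alg\<^esub> b j) g) \<odot>\<^bsub>LA\<^esub> (conj_elt i \<otimes>\<^bsub>LA\<^esub> a j)) =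
          conj_elt i \<otimes>\<^bsub>LA\<^esub> D (flip_head (int i) \<circ> g)"
        unfolding D_def
        by (subst LA.finsum_mult_left)
          (auto simp: J conj_elt LA.smult_mult_right flip_hom_mult_gen intro!: LA.finsum_cong)
    qed
    finally show ?thesis .
  qed
  have D'c: "D' g : carrier LA" for g unfolding D'_eq by (rule LA.finsum_cl) (simp add: conj_elt Dc)
  have contr: "GF.vnorm (conj_elt i \<otimes>\<^bsub>LA\<^esub> x) <= GF.vnorm x" if x: "x : carrier LA" for i x
  proof (rule power2_le_imp_le)
    have "(anorm LA (conj_elt i))^2 <= 1" using conj_elt[of i] by (simp add: power_le_one)
    then have "anorm LA ((conj_elt i)\<^sup>\<star>\<^bsub>LA\<^esub> \<otimes>\<^bsub>LA\<^esub> conj_elt i) * (GF.vnorm x)^2 <= 1 * (GF.vnorm x)^2"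
      by (intro mult_right_mono) (simp_all add: LA.N_star_mult conj_elt)
    then show "(GF.vnorm (conj_elt i \<otimes>\<^bsub>LA\<^esub> x))^2 <= (GF.vnorm x)^2"
      using GF.vnorm_mult_le[OF conj_elt(1) x, of i] by simp
  qed (use x in simp)
  have outside: "GF.vnorm (D g) = 0" if "g ~: T" for g
  proof -
    have "D g = (\<Oplus>\<^bsub>LA\<^esub>j\<in>J. \<zero>\<^bsub>LA\<^esub>)" unfolding D_def
      by (rule LA.finsum_cong) (use that J in "auto simp: T_def")
    then show ?thesis using GF.vnorm_smult[of "\<zero>\<^bsub>LA\<^esub>" 0] by simp
  qed
  have "(\<Sum>g\<in>T'. (GF.vnorm (D' g))^2) <= (\<Sum>g\<in>T'. (\<Sum>i<5. GF.vnorm (D (flip_head (int i) \<circ> g)))^2)"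
  proof (rule sum_mono, rule power_mono)
    fix g
    have "GF.vnorm (D' g) <= (\<Sum>i<5. GF.vnorm (conj_elt i \<otimes>\<^bsub>LA\<^esub> D (flip_head (int i) \<circ> g)))"
      unfolding D'_eq by (rule GF.vnorm_finsum_le) (simp_all add: conj_elt Dc)
    also have "... <= (\<Sum>i<5. GF.vnorm (D (flip_head (int i) \<circ> g)))"
      by (rule sum_mono) (rule contr[OF Dc])
    finally show "GF.vnorm (D' g) <= (\<Sum>i<5. GF.vnorm (D (flip_head (int i) \<circ> g)))" .
  qed (rule GF.vnorm_nonneg[OF D'c])
  also have "... <= 20 * (\<Sum>g\<in>T. (GF.vnorm (D g))^2)"
    by (rule flip_head_sum_square) (simp_all add: Dc T outside)
  finally show ?thesis
    unfolding g1 g2 GF.vnorm_square[OF Dc] GF.vnorm_square[OF D'c] by simp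
qed

text \<open>The second components of y are approximated from the dense algebra, where the Gram
  inequality is available; both sides converge to the quantities for y.\<close>

lemma product_gamma_bound:
  assumes F: "F : functionals"
  shows "gns.gnorm \<TT> (%f. pairing f (%(a, b). product_form F a b)) tensor_elt <= sqrt 20"
proof -
  interpret P: tensor_form LA flip_target "anorm LA" target_norm "product_form F" 2
    by (rule tensor_form_product[OF F])
  interpret G: gns \<TT> P.\<omega> P.rnorm 2 by (rule P.tensor_gns)
  interpret P0: tensor_form LA flip_alg "anorm LA" FG.gnorm "%a b. F a * trace (flip_hom b)" 2
    by (rule tensor_form_product_trace[OF F])
  show ?thesis
  proof (rule G.gnorm_least)
    fix y assume y: "y : carrier \<TT>"
    let ?J = "{s. y s ~= 0}"
    let ?W = "%a b. F a * trace (flip_hom b)"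
    have rep: "pairing y m = (\<Sum>s\<in>?J. y s * m (fst s, snd s))" for m by (simp add: pairing_def)
    have J: "finite ?J" "!!s. s : ?J ==> fst s : carrier LA" "!!s. s : ?J ==> snd s : carrier flip_target"
      using LT.tensor_finite[OF y] LT.tensor_support[OF y] by auto
    have "\<forall>s. \<exists>sig. s : ?J --> sig : cauchy_seqs flip_alg FG.gnorm \<and> flip_inv (snd s) = FS.cls sig"
      using FS.carrier_completion_cases[OF flip_inv_hom(1)[OF J(3)]] by metis
    then obtain tau where t: "!!s. s : ?J ==> tau s : cauchy_seqs flip_alg FG.gnorm"
        "!!s. s : ?J ==> flip_inv (snd s) = FS.cls (tau s)" by metis
    have ty: "tensor_elt \<otimes>\<^bsub>\<TT>\<^esub> y : carrier \<TT>" using y tensor_elt_closed by simp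
    have l1: "(%k. gram LA flip_alg ?W ?J y fst (%s. tau s k)) \<longlonglongrightarrow> P.\<omega> (y\<^sup>\<star>\<^bsub>\<TT>\<^esub> \<otimes>\<^bsub>\<TT>\<^esub> y)"
      unfolding LT.pairing_star_mult_gram[OF y rep] unfolding product_form_def
      by (rule P0.gram_tendsto[OF star_algebra_flip_target flip_target(3)]) (use J t in auto)
    have l2: "(%k. gram LA flip_alg ?W ({..<5} \<times> ?J) (%k. y (snd k)) (%k. conj_elt (fst k) \<otimes>\<^bsub>LA\<^esub> fst (snd k))
        (%p. gen (fst p) \<otimes>\<^bsub>flip_alg\<^esub> tau (snd p) k)) \<longlonglongrightarrow>
        P.\<omega> ((tensor_elt \<otimes>\<^bsub>\<TT>\<^esub> y)\<^sup>\<star>\<^bsub>\<TT>\<^esub> \<otimes>\<^bsub>\<TT>\<^esub> (tensor_elt \<otimes>\<^bsub>\<TT>\<^esub> y))"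
      unfolding LT.pairing_star_mult_gram[OF ty pairing_tensor_elt_mult[OF y rep]] unfolding product_form_def
    proof (rule P0.gram_tendsto[OF star_algebra_flip_target flip_target(3),
          where tau="%p k. gen (fst p) \<otimes>\<^bsub>flip_alg\<^esub> tau (snd p) k"])
      fix p :: "nat \<times> (nat => (nat, nat) hypergraph_gen word => complex) set \<times> (nat => complex)"
      assume "p : {..<5} \<times> ?J"
      then have p: "snd p : ?J" by auto
      note c = FS.cauchy_const[OF gen_flip[of "fst p"]]
      show "conj_elt (fst p) \<otimes>\<^bsub>LA\<^esub> fst (snd p) : carrier LA" using J(2)[OF p] conj_elt by simp
      show "flip_elt (gen (fst p)) \<otimes>\<^bsub>flip_target\<^esub> snd (snd p) : carrier flip_target"
        using J(3)[OF p] flip_elt(1)[OF gen_flip] by simp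
      show "(%k. gen (fst p) \<otimes>\<^bsub>flip_alg\<^esub> tau (snd p) k) : cauchy_seqs flip_alg FG.gnorm"
        by (rule FS.cauchy_mult[OF c t(1)[OF p]])
      show "flip_inv (flip_elt (gen (fst p)) \<otimes>\<^bsub>flip_target\<^esub> snd (snd p)) =
          FS.cls (%k. gen (fst p) \<otimes>\<^bsub>flip_alg\<^esub> tau (snd p) k)"
        using J(3)[OF p] flip_elt[OF gen_flip, of "fst p"] flip_inv_hom(4)[OF flip_elt(1)[OF gen_flip[of "fst p"]] J(3)[OF p]]
        by (simp add: t(2)[OF p] FS.to_completion_cls FS.cls_ops(2)[OF c t(1)[OF p]])
    qed
    have "Re (P.\<omega> ((tensor_elt \<otimes>\<^bsub>\<TT>\<^esub> y)\<^sup>\<star>\<^bsub>\<TT>\<^esub> \<otimes>\<^bsub>\<TT>\<^esub> (tensor_elt \<otimes>\<^bsub>\<TT>\<^esub> y))) <= 20 * Re (P.\<omega> (y\<^sup>\<star>\<^bsub>\<TT>\<^esub> \<otimes>\<^bsub>\<TT>\<^esub> y))"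
    proof (rule LIMSEQ_le[OF tendsto_Re[OF l2] tendsto_mult_left[OF tendsto_Re[OF l1]]], intro exI allI impI)
      fix k
      show "Re (gram LA flip_alg ?W ({..<5} \<times> ?J) (%k. y (snd k)) (%k. conj_elt (fst k) \<otimes>\<^bsub>LA\<^esub> fst (snd k))
        (%p. gen (fst p) \<otimes>\<^bsub>flip_alg\<^esub> tau (snd p) k)) <= 20 * Re (gram LA flip_alg ?W ?J y fst (%s. tau s k))"
        by (rule product_gram_bound[OF F J(1,2)]) (use FS.cauchy_closed[OF t(1)] in auto)
    qed
    then have "(G.vnorm (tensor_elt \<otimes>\<^bsub>\<TT>\<^esub> y))^2 <= (sqrt 20 * G.vnorm y)^2"
      unfolding G.vnorm_square[OF y] G.vnorm_square[OF ty] by (simp add: power_mult_distrib)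
    then show "G.vnorm (tensor_elt \<otimes>\<^bsub>\<TT>\<^esub> y) <= sqrt 20 * G.vnorm y"
      by (rule power2_le_imp_le) (use y in simp)
  qed simp
qed

text \<open>The form lives first on the two free algebras. Extending the second variable, exchanging
  the factors, extending again and exchanging back carries it to both C*-algebras.\<close>

lemma regular_form_exists:
  "\<exists>W. tensor_form LA flip_target (anorm LA) target_norm W 1 \<and>
    (\<forall>a\<in>carrier (loop_alg n). \<forall>b\<in>carrier flip_alg. W (incl a) (flip_elt b) = pairing (perm_hom loop_rep a) (flip_hom b))"
proof -
  let ?W = "%a b. pairing (perm_hom loop_rep a) (flip_hom b)"
  have R1: "tensor_form (loop_alg n) flip_alg (loop_norm n) FG.gnorm ?W 1"
    by (rule tensor_form_regular[OF loop_facts(1) cstar_seminorm_loop_norm perm_hom(1)[OF range_loop_rep]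
        vnorm_loop_rep_le[OF n] flip_facts(1) FG.cstar_seminorm_gnorm star_hom_flip vnorm_flip_hom_le])
  let ?W2 = "%a b. FS.extend_functional (?W a) (flip_inv b)"
  have R2: "tensor_form (loop_alg n) flip_target (loop_norm n) target_norm ?W2 1"
    by (rule tensor_form.tensor_form_extend[OF R1 star_algebra_flip_target flip_target(3)])
  have R3: "tensor_form flip_target (loop_alg n) target_norm (loop_norm n) (%b a. ?W2 a b) 1"
    by (rule tensor_form_flip[OF R2])
  let ?W3 = "%b a. LS.extend_functional (%a. ?W2 a b) a"
  have id: "star_hom LA LA (%x. x)" by (simp add: star_hom_def)
  have R4: "tensor_form flip_target LA target_norm (anorm LA) ?W3 1"
    using tensor_form.tensor_form_extend[OF R3 LA.star_algebra_axioms id] by simp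
  have "?W3 (flip_elt b) (incl a) = ?W a b" if a: "a : carrier (loop_alg n)" and b: "b : carrier flip_alg" for a b
    using LS.extend_functional_to_completion[OF tensor_form.right[OF R3 flip_elt(1)[OF b]] a]
      FS.extend_functional_to_completion[OF tensor_form.right[OF R1 a] b] by (simp add: flip_elt b)
  then show ?thesis using tensor_form_flip[OF R4] by blast
qed

text \<open>The vector y is an elementary tensor whose two components go to the same permutation. It
  has norm 1 in the regular form and takes the place of a unit vector; the test element sends it to
  a vector of norm 5.\<close>

lemma regular_gamma_bound:
  assumes W: "tensor_form LA flip_target (anorm LA) target_norm W 1"
    and val: "!!a b. a : carrier (loop_alg n) ==> b : carrier flip_alg ==>
      W (incl a) (flip_elt b) = pairing (perm_hom loop_rep a) (flip_hom b)"
  shows "5 <= gns.gnorm \<TT> (%f. pairing f (%(a, b). W a b)) tensor_elt"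
proof -
  interpret P: tensor_form LA flip_target "anorm LA" target_norm W 1 by (rule W)
  interpret G: gns \<TT> P.\<omega> P.rnorm 1 by (rule P.tensor_gns)
  define y where "y = single (conj_elt 0, flip_elt (gen 0))"
  have y: "y : carrier \<TT>" by (simp add: y_def conj_elt flip_elt gen_flip)
  have ty: "tensor_elt \<otimes>\<^bsub>\<TT>\<^esub> y : carrier \<TT>" using y tensor_elt_closed by simp
  note lh = star_homD[OF perm_hom(1)[OF range_loop_rep, where G="loop_gens n"]] and fh = star_homD[OF star_hom_flip]
    and cc = conj_flip_closed[OF n]
  have one: "W ((incl a)\<^sup>\<star>\<^bsub>LA\<^esub> \<otimes>\<^bsub>LA\<^esub> incl a') ((flip_elt b)\<^sup>\<star>\<^bsub>flip_target\<^esub> \<otimes>\<^bsub>flip_target\<^esub> flip_elt b') = 1"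
    if a: "a : carrier (loop_alg n)" "a' : carrier (loop_alg n)" and b: "b : carrier flip_alg" "b' : carrier flip_alg"
      and g: "bij g" "bij g'" and eq: "perm_hom loop_rep a = single g" "perm_hom loop_rep a' = single g'"
        "flip_hom b = single g" "flip_hom b' = single g'" for a a' b b' g g'
  proof -
    have "(incl a)\<^sup>\<star>\<^bsub>LA\<^esub> \<otimes>\<^bsub>LA\<^esub> incl a' = incl (a\<^sup>\<star>\<^bsub>loop_alg n\<^esub> \<otimes>\<^bsub>loop_alg n\<^esub> a')"
      using a by (simp add: incl_hom)
    moreover have "(flip_elt b)\<^sup>\<star>\<^bsub>flip_target\<^esub> \<otimes>\<^bsub>flip_target\<^esub> flip_elt b' = flip_elt (b\<^sup>\<star>\<^bsub>flip_alg\<^esub> \<otimes>\<^bsub>flip_alg\<^esub> b')"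
      using b by (simp add: flip_elt_mult)
    ultimately show ?thesis
      using a b g by (simp add: val lh fh eq PM.star_single PM.mult_single bij_imp_bij_inv single_apply)
  qed
  have "P.\<omega> (y\<^sup>\<star>\<^bsub>\<TT>\<^esub> \<otimes>\<^bsub>\<TT>\<^esub> y) = gram LA flip_target W {0::nat} (%_. 1) (%_. conj_elt 0) (%_. flip_elt (gen 0))"
    by (rule LT.pairing_star_mult_gram[OF y]) (simp add: y_def)
  also have "... = 1"
    unfolding gram_def conj_elt_def
    by (simp add: one[OF cc cc gen_flip gen_flip bij_flip_head bij_flip_head perm_hom_conj_flip[OF n]
          perm_hom_conj_flip[OF n] flip_hom_gen flip_hom_gen] del: conj_flip.simps)
  finally have vy: "G.vnorm y = 1" by (simp add: G.vnorm_def)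
  have mono: "conj_elt i \<otimes>\<^bsub>LA\<^esub> conj_elt 0 = incl (conj_flip n i \<otimes>\<^bsub>loop_alg n\<^esub> conj_flip n 0)"
    "flip_elt (gen i) \<otimes>\<^bsub>flip_target\<^esub> flip_elt (gen 0) = flip_elt (gen i \<otimes>\<^bsub>flip_alg\<^esub> gen 0)" for i
    using cc gen_flip by (simp_all add: conj_elt_def incl_hom flip_elt_mult del: conj_flip.simps)
  have "P.\<omega> ((tensor_elt \<otimes>\<^bsub>\<TT>\<^esub> y)\<^sup>\<star>\<^bsub>\<TT>\<^esub> \<otimes>\<^bsub>\<TT>\<^esub> (tensor_elt \<otimes>\<^bsub>\<TT>\<^esub> y)) =
      gram LA flip_target W {..<5::nat} (%_. 1) (%i. conj_elt i \<otimes>\<^bsub>LA\<^esub> conj_elt 0)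
        (%i. flip_elt (gen i) \<otimes>\<^bsub>flip_target\<^esub> flip_elt (gen 0))"
    by (rule LT.pairing_star_mult_gram[OF ty])
      (simp add: y_def LT.tensor_pairing_mult tensor_elt_closed y[unfolded y_def] pairing_tensor_elt)
  \<comment> \<open>Both components of each of the five tensors are represented by the same
    permutation, so each of the 25 Gram entries is 1.\<close>
  also have "... = (\<Sum>i<(5::nat). \<Sum>k<(5::nat). 1)"
    unfolding gram_def mono
  proof (intro sum.cong refl)
    fix i k :: nat
    have b: "bij (flip_head (int i) \<circ> flip_head (int 0))" for i by (intro bij_comp bij_flip_head)
    have "perm_hom loop_rep (conj_flip n i \<otimes>\<^bsub>loop_alg n\<^esub> conj_flip n 0) = single (flip_head (int i) \<circ> flip_head (int 0))"
      "flip_hom (gen i \<otimes>\<^bsub>flip_alg\<^esub> gen 0) = single (flip_head (int i) \<circ> flip_head (int 0))" for i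
      using cc gen_flip by (simp_all add: lh fh perm_hom_conj_flip[OF n] flip_hom_gen PM.mult_single bij_flip_head
          del: conj_flip.simps)
    then have "W ((incl (conj_flip n i \<otimes>\<^bsub>loop_alg n\<^esub> conj_flip n 0))\<^sup>\<star>\<^bsub>LA\<^esub> \<otimes>\<^bsub>LA\<^esub> incl (conj_flip n k \<otimes>\<^bsub>loop_alg n\<^esub> conj_flip n 0))
        ((flip_elt (gen i \<otimes>\<^bsub>flip_alg\<^esub> gen 0))\<^sup>\<star>\<^bsub>flip_target\<^esub> \<otimes>\<^bsub>flip_target\<^esub> flip_elt (gen k \<otimes>\<^bsub>flip_alg\<^esub> gen 0)) = 1"
      using cc gen_flip b by (intro one) (simp_all del: conj_flip.simps)
    then show "cnj 1 * 1 * W ((incl (conj_flip n i \<otimes>\<^bsub>loop_alg n\<^esub> conj_flip n 0))\<^sup>\<star>\<^bsub>LA\<^esub> \<otimes>\<^bsub>LA\<^esub> incl (conj_flip n k \<otimes>\<^bsub>loop_alg n\<^esub> conj_flip n 0))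
        ((flip_elt (gen i \<otimes>\<^bsub>flip_alg\<^esub> gen 0))\<^sup>\<star>\<^bsub>flip_target\<^esub> \<otimes>\<^bsub>flip_target\<^esub> flip_elt (gen k \<otimes>\<^bsub>flip_alg\<^esub> gen 0)) = 1"
      by (simp del: conj_flip.simps)
  qed
  finally have "P.\<omega> ((tensor_elt \<otimes>\<^bsub>\<TT>\<^esub> y)\<^sup>\<star>\<^bsub>\<TT>\<^esub> \<otimes>\<^bsub>\<TT>\<^esub> (tensor_elt \<otimes>\<^bsub>\<TT>\<^esub> y)) = 25" by simp
  then have "G.vnorm (tensor_elt \<otimes>\<^bsub>\<TT>\<^esub> y) = 5" by (simp add: G.vnorm_def real_sqrt_eq_iff[of 25 "5^2", simplified])
  then show ?thesis using G.gnorm_bound(2)[OF tensor_elt_closed y] by (simp add: vy)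
qed

text \<open>This takes the role of the minimal norm: a single faithful functional on the second
  factor, and enough functionals on the first to separate its elements.\<close>

definition gamma :: "((nat => (nat, nat) hypergraph_gen word => complex) set \<times> (nat => complex) => complex) => real" where
  "gamma f = (SUP F\<in>functionals. gns.gnorm \<TT> (%f. pairing f (%(a, b). product_form F a b)) f)"

lemma functionals_nonempty: "functionals ~= {}"
proof -
  have "(%x. 0) : functionals" by (simp add: functionals_def positive_functional_def)
  then show ?thesis by blast
qed

lemma gamma_bdd:
  assumes "f : carrier \<TT>"
  shows "bdd_above ((%F. gns.gnorm \<TT> (%f. pairing f (%(a, b). product_form F a b)) f) ` functionals)"
  using tensor_form.gamma_le_rnorm[OF tensor_form_product assms] by (intro bdd_aboveI2)

lemma cstar_seminorm_gamma: "cstar_seminorm \<TT> gamma"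
proof -
  have "cstar_seminorm \<TT> (%f. SUP p\<in>(%F. gns.gnorm \<TT> (%f. pairing f (%(a, b). product_form F a b))) ` functionals. p f)"
    by (rule cstar_seminorm_SUP[OF LT.star_algebra_tensor])
      (auto simp: functionals_nonempty image_image gamma_bdd intro: tensor_form.cstar_seminorm_gamma[OF tensor_form_product])
  then show ?thesis by (simp add: gamma_def[abs_def] image_image)
qed

text \<open>If the seminorm of f vanishes, then slicing f by a matrix coefficient of the second
  factor gives an element C of the first. For each Y, a functional positive at the star-square of C
  Y would contradict vanishing, so C Y = 0 and C = 0. As the coefficients separate the second
  factor, the tensor is zero.\<close>

lemma gamma_kernel:
  assumes f: "f : carrier \<TT>"
  shows "gamma f = 0 \<longleftrightarrow> f : LT.\<R>"
proof
  assume "f : LT.\<R>"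
  then have "gns.gnorm \<TT> (%f. pairing f (%(a, b). product_form F a b)) f = 0" if "F : functionals" for F
    using that tensor_form.gamma_relator[OF tensor_form_product] by blast
  then show "gamma f = 0" using functionals_nonempty by (simp add: gamma_def)
next
  assume z: "gamma f = 0"
  obtain m :: nat and X b where X: "!!i. i < m ==> X i : carrier LA" and b: "!!i. i < m ==> b i : carrier flip_target"
    and cf: "LT.tensor_class f = (\<Oplus>\<^bsub>LT.\<Q>\<^esub>i\<in>{..<m}. LT.elem (X i) (b i))"
    using LT.tensor_class_elem_sum[OF f] by blast
  \<comment> \<open>A representative of the class of f with explicitly listed terms, on which
    coefficients can be computed.\<close>
  define h where "h = (\<Oplus>\<^bsub>\<TT>\<^esub>i\<in>{..<m}. single (X i, b i))"
  have h: "h : carrier \<TT>" unfolding h_def by (rule LT.D.finsum_cl) (simp add: X b)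
  have "LT.tensor_class h = LT.tensor_class f"
    unfolding cf h_def LT.elem_def
    by (rule star_hom_finsum[OF LT.star_algebra_tensor LT.star_algebra_algebraic_tensor LT.tensor_class_hom]) (simp_all add: X b)
  then have rel: "h \<ominus>\<^bsub>\<TT>\<^esub> f : LT.\<R>"
    using eq_equiv_class[OF _ LT.equiv_tensor_rel f] by (simp add: LT.tensor_rel_def)
  have gh: "gns.gnorm \<TT> (%f. pairing f (%(a, b). product_form F a b)) h = 0" if F: "F : functionals" for F
  proof -
    interpret P: tensor_form LA flip_target "anorm LA" target_norm "product_form F" 2
      by (rule tensor_form_product[OF F])
    interpret G: seminormed_star_algebra \<TT> P.\<gamma> by (rule seminormed_star_algebraI[OF LT.star_algebra_tensor P.cstar_seminorm_gamma])
    have "P.\<gamma> f <= 0" unfolding z[symmetric] gamma_def by (rule cSUP_upper[OF F gamma_bdd[OF f]])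
    then show ?thesis using G.N_diff_le[OF h f] P.gamma_relator[OF rel] G.N_nonneg[OF f] by simp
  qed
  define coeff where "coeff = (%z w b. flip_coeff z w (flip_inv b))"
  have coeff_linear: "linear_functional flip_target (coeff z w)" for z w
    unfolding coeff_def by (rule linear_functional_hom[OF linear_flip_coeff flip_target(3)])
  define C where "C = (%z w. \<Oplus>\<^bsub>LA\<^esub>i\<in>{..<m}. coeff z w (b i) \<odot>\<^bsub>LA\<^esub> X i)"
  have Cc: "C z w : carrier LA" for z w unfolding C_def by (rule LA.finsum_cl) (simp add: X)
  have "C z w \<otimes>\<^bsub>LA\<^esub> Y = \<zero>\<^bsub>LA\<^esub>" if Y: "Y : carrier LA" for z w Y
  proof (rule ccontr)
    let ?CY = "C z w \<otimes>\<^bsub>LA\<^esub> Y"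
    have CY: "?CY : carrier LA" using Cc Y by simp
    assume "?CY ~= \<zero>\<^bsub>LA\<^esub>"
    then have "0 < anorm LA ?CY" using LA.N_definite[OF CY] LA.N_nonneg[OF CY] by fastforce
    then obtain F where F: "F : functionals" and pos: "0 < Re (F (?CY\<^sup>\<star>\<^bsub>LA\<^esub> \<otimes>\<^bsub>LA\<^esub> ?CY))"
      using LA.positive_functional_exists[OF CY] by (auto simp: functionals_def)
    interpret P: tensor_form LA flip_target "anorm LA" target_norm "product_form F" 2
      by (rule tensor_form_product[OF F])
    interpret G: gns \<TT> P.\<omega> P.rnorm 2 by (rule P.tensor_gns)
    note Fl = positive_imp_linear_functional[of LA F]
    have Fl: "linear_functional LA F" using F by (intro Fl) (simp add: functionals_def)
    note wc = flip_facts(2)[of w] and zc = flip_facts(2)[of z]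
    note wt = flip_elt(1)[OF wc] and zt = flip_elt(1)[OF zc]
    \<comment> \<open>Between these two vectors h has the coefficient F at the star-square of C Y,
      while Cauchy--Schwarz bounds it by 0 because h acts as zero.\<close>
    define v where "v = single (Y, flip_elt (single w))"
    define v' where "v' = single (?CY, flip_elt (single z))"
    have v: "v : carrier \<TT>" "v' : carrier \<TT>" using Y CY wt zt by (simp_all add: v_def v'_def)
    have "P.\<omega> (v'\<^sup>\<star>\<^bsub>\<TT>\<^esub> \<otimes>\<^bsub>\<TT>\<^esub> (h \<otimes>\<^bsub>\<TT>\<^esub> v)) =
        pairing h (%(x, b). product_form F (?CY\<^sup>\<star>\<^bsub>LA\<^esub> \<otimes>\<^bsub>LA\<^esub> (x \<otimes>\<^bsub>LA\<^esub> Y))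
          ((flip_elt (single z))\<^sup>\<star>\<^bsub>flip_target\<^esub> \<otimes>\<^bsub>flip_target\<^esub> (b \<otimes>\<^bsub>flip_target\<^esub> flip_elt (single w))))"
      using v h zt CY unfolding v_def v'_def
      by (simp add: LT.tensor_pairing_mult LT.single_star case_prod_beta' mult_DirProd')
    also have "... = (\<Sum>i<m. product_form F (?CY\<^sup>\<star>\<^bsub>LA\<^esub> \<otimes>\<^bsub>LA\<^esub> (X i \<otimes>\<^bsub>LA\<^esub> Y))
          ((flip_elt (single z))\<^sup>\<star>\<^bsub>flip_target\<^esub> \<otimes>\<^bsub>flip_target\<^esub> (b i \<otimes>\<^bsub>flip_target\<^esub> flip_elt (single w))))"
      unfolding h_def by (subst LT.D.functional_finsum[OF LT.linear_pairing]) (simp_all add: X b)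
    also have "... = (\<Sum>i<m. coeff z w (b i) * F (?CY\<^sup>\<star>\<^bsub>LA\<^esub> \<otimes>\<^bsub>LA\<^esub> (X i \<otimes>\<^bsub>LA\<^esub> Y)))"
    proof (rule sum.cong[OF refl])
      fix i assume "i : {..<m}"
      then have bi: "b i : carrier flip_target" using b by simp
      have "flip_inv ((flip_elt (single z))\<^sup>\<star>\<^bsub>flip_target\<^esub> \<otimes>\<^bsub>flip_target\<^esub> (b i \<otimes>\<^bsub>flip_target\<^esub> flip_elt (single w))) =
          (flip_incl (single z))\<^sup>\<star>\<^bsub>flip_cstar\<^esub> \<otimes>\<^bsub>flip_cstar\<^esub> (flip_inv (b i) \<otimes>\<^bsub>flip_cstar\<^esub> flip_incl (single w))"
        using bi zt wt by (simp add: flip_inv_hom flip_elt(2)[OF zc] flip_elt(2)[OF wc])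
      then show "product_form F (?CY\<^sup>\<star>\<^bsub>LA\<^esub> \<otimes>\<^bsub>LA\<^esub> (X i \<otimes>\<^bsub>LA\<^esub> Y))
          ((flip_elt (single z))\<^sup>\<star>\<^bsub>flip_target\<^esub> \<otimes>\<^bsub>flip_target\<^esub> (b i \<otimes>\<^bsub>flip_target\<^esub> flip_elt (single w))) =
          coeff z w (b i) * F (?CY\<^sup>\<star>\<^bsub>LA\<^esub> \<otimes>\<^bsub>LA\<^esub> (X i \<otimes>\<^bsub>LA\<^esub> Y))"
        using bi zt wt by (simp add: product_form_eq coeff_def flip_coeff_def mult.commute)
    qed
    also have "... = F (?CY\<^sup>\<star>\<^bsub>LA\<^esub> \<otimes>\<^bsub>LA\<^esub> ?CY)"
    proof -
      have "linear_functional LA (%x. F (?CY\<^sup>\<star>\<^bsub>LA\<^esub> \<otimes>\<^bsub>LA\<^esub> (x \<otimes>\<^bsub>LA\<^esub> Y)))"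
        using CY Y by (simp add: linear_functional_def LA.distrib_left LA.distrib_right LA.smult_mult_left
            LA.smult_mult_right linear_functionalD[OF Fl])
      note l = this
      have Ceq: "(\<Oplus>\<^bsub>LA\<^esub>i\<in>{..<m}. coeff z w (b i) \<odot>\<^bsub>LA\<^esub> X i) = C z w" by (simp add: C_def)
      have "F (?CY\<^sup>\<star>\<^bsub>LA\<^esub> \<otimes>\<^bsub>LA\<^esub> ((\<Oplus>\<^bsub>LA\<^esub>i\<in>{..<m}. coeff z w (b i) \<odot>\<^bsub>LA\<^esub> X i) \<otimes>\<^bsub>LA\<^esub> Y)) =
          (\<Sum>i<m. F (?CY\<^sup>\<star>\<^bsub>LA\<^esub> \<otimes>\<^bsub>LA\<^esub> ((coeff z w (b i) \<odot>\<^bsub>LA\<^esub> X i) \<otimes>\<^bsub>LA\<^esub> Y)))"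
        by (rule LA.functional_finsum[OF l]) (simp_all add: X)
      then show ?thesis unfolding Ceq using linear_functionalD(2)[OF l] X by simp
    qed
    finally have "cmod (F (?CY\<^sup>\<star>\<^bsub>LA\<^esub> \<otimes>\<^bsub>LA\<^esub> ?CY)) <= G.vnorm v' * G.vnorm (h \<otimes>\<^bsub>\<TT>\<^esub> v)"
      using G.cauchy_schwarz[OF v(2), of "h \<otimes>\<^bsub>\<TT>\<^esub> v"] h v by simp
    also have "G.vnorm (h \<otimes>\<^bsub>\<TT>\<^esub> v) = 0"
      using G.gnorm_bound(2)[OF h v(1)] gh[OF F] G.vnorm_nonneg[OF LT.D.mult_closed[OF h v(1)]] by simp
    finally show False using pos by simp
  qed
  \<comment> \<open>Y is taken to be the star of C, which turns the vanishing product into a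
    star-square.\<close>
  then have "C z w \<otimes>\<^bsub>LA\<^esub> (C z w)\<^sup>\<star>\<^bsub>LA\<^esub> = \<zero>\<^bsub>LA\<^esub>" for z w using Cc by simp
  then have "(C z w)\<^sup>\<star>\<^bsub>LA\<^esub> = \<zero>\<^bsub>LA\<^esub>" for z w
    using LA.star_mult_zero[of "(C z w)\<^sup>\<star>\<^bsub>LA\<^esub>"] Cc by (simp add: LA.star_star)
  then have C0: "C z w = \<zero>\<^bsub>LA\<^esub>" for z w using LA.star_star[OF Cc] LA.star_zero by metis
  have "LT.tensor_class f = \<zero>\<^bsub>LT.\<Q>\<^esub>"
    unfolding cf
  proof (rule LT.tensor_zero_if_separated[where \<G>="{coeff z w | z w. True}"])
    show "linear_functional flip_target g" if "g : {coeff z w | z w. True}" for g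
      using that coeff_linear by blast
    show "x = \<zero>\<^bsub>flip_target\<^esub>" if x: "x : carrier flip_target" and g: "!!g. g : {coeff z w | z w. True} ==> g x = 0" for x
    proof -
      have "coeff z w x = 0" for z w by (rule g) blast
      then have "flip_inv x = \<zero>\<^bsub>flip_cstar\<^esub>"
        by (intro flip_coeff_separates flip_inv_hom(1)[OF x]) (simp add: coeff_def)
      then have "x = flip_embed \<zero>\<^bsub>flip_cstar\<^esub>" using x f_inv_into_f[of x flip_embed "carrier flip_cstar"] by (simp add: flip_target(4))
      then show ?thesis
        using star_hom_zero[OF FK.star_algebra_axioms star_algebra_flip_target flip_target(2)] by simp
    qed
    show "(\<Oplus>\<^bsub>LA\<^esub>i\<in>{..<m}. g (b i) \<odot>\<^bsub>LA\<^esub> X i) = \<zero>\<^bsub>LA\<^esub>" if "g : {coeff z w | z w. True}" for g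
      using that C0 by (auto simp: C_def)
  qed (simp_all add: X b)
  then show "f : LT.\<R>" using LT.tensor_class_zero[OF f] by simp
qed

lemma not_nuclear_loop: "\<not> nuclear LA"
proof -
  obtain W where W: "tensor_form LA flip_target (anorm LA) target_norm W 1"
    and val: "!!a b. a : carrier (loop_alg n) ==> b : carrier flip_alg ==>
      W (incl a) (flip_elt b) = pairing (perm_hom loop_rep a) (flip_hom b)"
    using regular_form_exists by blast
  have "gamma tensor_elt <= sqrt 20"
    unfolding gamma_def by (rule cSUP_least[OF functionals_nonempty product_gamma_bound])
  also have "... < 5" by (rule real_less_lsqrt) simp_all
  also have "... <= gns.gnorm \<TT> (%f. pairing f (%(a, b). W a b)) tensor_elt"
    by (rule regular_gamma_bound[OF W val])
  finally have lt: "gamma tensor_elt < gns.gnorm \<TT> (%f. pairing f (%(a, b). W a b)) tensor_elt" .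
  show ?thesis
    by (rule not_nuclearI[OF LA.star_algebra_axioms flip_target(1) cstar_seminorm_gamma gamma_kernel
          tensor_form.cstar_seminorm_gamma[OF W] tensor_form.gamma_relator[OF W] tensor_elt_closed lt])
qed

end

theorem proposition4p2:
  fixes n :: nat
  assumes "1 \<le> n"
  shows "hypergraph_cstar_alg (full_loop_hypergraph n) \<cong>\<^sup>\<star> circle_free_product n \<and>
    (2 \<le> n \<longrightarrow> \<not> nuclear (hypergraph_cstar_alg (full_loop_hypergraph n)) \<and>
                 \<not> amenable_hypergraph (full_loop_hypergraph n))"
  using hypergraph_cstar_alg_isomorphic not_nuclear_loop
  by (simp add: amenable_hypergraph_def hypergraph_cstar_alg_loop)

end
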